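(* Let $E$ be a complex Banach space and let $T\in N_k(E)$ be a current of bidimension $(0,k)$ with $\overline\partial T=0$, such that $\mathrm{supp}\,T$ is bounded and at positive distance from $0$. Then there exists a quasi-local metric current $U$ of bidimension $(0,k+1)$ such that $\overline\partial U=T$.
   Context: Metric currents (Ambrosio–Kirchheim) on $E$: with $\mathscr E^k(E)=\mathrm{Lip}_b(E)\times[\mathrm{Lip}(E)]^k$ (complex-valued), a $k$-dimensional metric current is a multilinear $T:\mathscr E^k(E)\to\mathbb C$, continuous under pointwise convergence with uniformly bounded Lipschitz constants, local ($T(f,\pi)=0$ if some $\pi_j$ is constant near $\mathrm{supp} f$), of finite mass (finite Radon $\mu$ with $|T(f,\pi)|\le\prod_j\mathrm{Lip}(\pi_j)\int|f|d\mu$). Boundary $dT(f,\pi)=T(1,f,\pi)$; $N_k(E)$: currents with boundary of finite mass. Quasi-local currents: $\mathscr E_{\mathrm{q\text{-}loc}}(E)$ = Lipschitz functions with bounded support; $\mathrm{Lip}_{\mathrm{q\text{-}loc}}(E)$ = continuous functions Lipschitz on every ball $B(0,R)$; $\mathscr E^k_{\mathrm{q\text{-}loc}}(E)=\mathscr E_{\mathrm{q\text{-}loc}}(E)\times[\mathrm{Lip}_{\mathrm{q\text{-}loc}}(E)]^k$. Convergence in $\mathscr E^k_{\mathrm{q\text{-}loc}}$: pointwise convergence, first entries supported in a common ball with uniformly bounded Lipschitz constants, other entries with Lipschitz constants on each fixed ball uniformly bounded. A quasi-local $k$-dimensional metric current is a multilinear $T:\mathscr E^k_{\mathrm{q\text{-}loc}}(E)\to\mathbb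 C$, continuous for this convergence, local, and such that for each $R>0$ there is a finite Radon measure $\mu_R$ with $|T(f,\pi)|\le\prod_j\mathrm{Lip}(\pi_j|_{B(0,R)})\int_{B(0,R)}|f|d\mu_R$ whenever $\mathrm{supp} f\subset B(0,R)$; its boundary is $dT(f,\pi)=T(\sigma,f,\pi)$ with $\sigma\in\mathscr E_{\mathrm{q\text{-}loc}}(E)$ equal to $1$ near $\mathrm{supp} f$. For (quasi-local or Ambrosio–Kirchheim) currents, bidimension $(p,q)$, $p+q=k$, means vanishing on $(f,\pi)$ whenever $p+1$ of the $\pi_j$, or $q+1$ of the $\overline{\pi_j}$, are holomorphic on an open set containing $\mathrm{supp} f$. For $T$ of bidimension $(p,q)$ whose boundary admits a (unique) decomposition into currents of fixed bidimension, that decomposition is $(dT)_{p,q-1}+(dT)_{p-1,q}$, and $\overline\partial T:=(dT)_{p,q-1}$, $\partial T:=(dT)_{p-1,q}$; in particular for bidimension $(0,k)$ one has $\overline\partial T=dT$. *)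

theory Defs
  imports "HOL-Analysis.Analysis"
begin

class complex_normed_vector = real_normed_vector +
  fixes scaleC :: "complex \<Rightarrow> 'a \<Rightarrow> 'a"
  assumes scaleC_add_right: "scaleC a (x + y) = scaleC a x + scaleC a y"
    and scaleC_add_left: "scaleC (a + b) x = scaleC a x + scaleC b x"
    and scaleC_scaleC: "scaleC a (scaleC b x) = scaleC (a * b) x"
    and scaleC_one: "scaleC 1 x = x"
    and scaleR_scaleC: "scaleR r x = scaleC (complex_of_real r) x"
    and norm_scaleC: "norm (scaleC a x) = cmod a * norm x"

class complex_banach = complex_normed_vector + banach

instantiation complex :: complex_normed_vector
begin
definition scaleC_complex :: "complex \<Rightarrow> complex \<Rightarrow> complex" where
  "scaleC_complex a x = a * x"
instance
  by standard (auto simp: scaleC_complex_def algebra_simps norm_mult scaleR_conv_of_real)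
end

instance complex :: complex_banach ..

definition holo_on :: "'a::complex_normed_vector set \<Rightarrow> ('a \<Rightarrow> complex) \<Rightarrow> bool" where
  "holo_on V f \<longleftrightarrow> (\<forall>x\<in>V. \<exists>L. (f has_derivative L) (at x) \<and>
       (\<forall>c v. L (scaleC c v) = c * L v))"

definition fsupp :: "('a::topological_space \<Rightarrow> complex) \<Rightarrow> 'a set" where
  "fsupp f = closure {x. f x \<noteq> 0}"

definition lipc :: "'a::metric_space set \<Rightarrow> ('a \<Rightarrow> complex) \<Rightarrow> real" where
  "lipc S f = Inf {C. C-lipschitz_on S f}"

definition Lip :: "('a::metric_space \<Rightarrow> complex) set" where
  "Lip = {f. \<exists>C. C-lipschitz_on UNIV f}"

definition Lipb :: "('a::metric_space \<Rightarrow> complex) set" where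
  "Lipb = {f. (\<exists>C. C-lipschitz_on UNIV f) \<and> bounded (range f)}"

definition Eqloc :: "('a::real_normed_vector \<Rightarrow> complex) set" where
  "Eqloc = {f. (\<exists>C. C-lipschitz_on UNIV f) \<and> bounded (fsupp f)}"

definition Lipqloc :: "('a::real_normed_vector \<Rightarrow> complex) set" where
  "Lipqloc = {f. continuous_on UNIV f \<and> (\<forall>R>0. \<exists>C. C-lipschitz_on (ball 0 R) f)}"

definition finite_radon :: "'a::metric_space measure \<Rightarrow> bool" where
  "finite_radon \<mu> \<longleftrightarrow> sets \<mu> = sets borel \<and> emeasure \<mu> (space \<mu>) < \<infinity> \<and>
     (\<forall>A\<in>sets borel. emeasure \<mu> A = (SUP K\<in>{K. compact K \<and> K \<subseteq> A}. emeasure \<mu> K))"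

text \<open>A functional \<open>T f [\<pi>\<^sub>1,...,\<pi>\<^sub>k]\<close>; \<open>D0\<close> is the domain of the first entry,
  \<open>D1\<close> that of the other \<open>k\<close> entries.  Only lists of length \<open>k\<close> matter.\<close>

definition args :: "('a \<Rightarrow> complex) set \<Rightarrow> nat \<Rightarrow> ('a \<Rightarrow> complex) list set" where
  "args D1 k = {\<pi>. length \<pi> = k \<and> set \<pi> \<subseteq> D1}"

definition multilin ::
  "('a \<Rightarrow> complex) set \<Rightarrow> ('a \<Rightarrow> complex) set \<Rightarrow> nat
    \<Rightarrow> (('a \<Rightarrow> complex) \<Rightarrow> ('a \<Rightarrow> complex) list \<Rightarrow> complex) \<Rightarrow> bool" where
  "multilin D0 D1 k T \<longleftrightarrow>
     (\<forall>f g \<pi> c. f \<in> D0 \<longrightarrow> g \<in> D0 \<longrightarrow> \<pi> \<in> args D1 k \<longrightarrow>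
        T (\<lambda>x. c * f x + g x) \<pi> = c * T f \<pi> + T g \<pi>) \<and>
     (\<forall>f \<pi> g h c i. f \<in> D0 \<longrightarrow> \<pi> \<in> args D1 k \<longrightarrow> g \<in> D1 \<longrightarrow> h \<in> D1 \<longrightarrow> i < k \<longrightarrow>
        T f (\<pi>[i := (\<lambda>x. c * g x + h x)]) = c * T f (\<pi>[i := g]) + T f (\<pi>[i := h]))"

definition locality ::
  "('a::topological_space \<Rightarrow> complex) set \<Rightarrow> ('a \<Rightarrow> complex) set \<Rightarrow> nat
    \<Rightarrow> (('a \<Rightarrow> complex) \<Rightarrow> ('a \<Rightarrow> complex) list \<Rightarrow> complex) \<Rightarrow> bool" where
  "locality D0 D1 k T \<longleftrightarrow>
     (\<forall>f \<pi> j. f \<in> D0 \<longrightarrow> \<pi> \<in> args D1 k \<longrightarrow> j < k \<longrightarrow>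
        (\<exists>V c. open V \<and> fsupp f \<subseteq> V \<and> (\<forall>x\<in>V. (\<pi> ! j) x = c)) \<longrightarrow> T f \<pi> = 0)"

definition bidim ::
  "nat \<Rightarrow> nat \<Rightarrow> ('a::complex_normed_vector \<Rightarrow> complex) set \<Rightarrow> ('a \<Rightarrow> complex) set \<Rightarrow> nat
    \<Rightarrow> (('a \<Rightarrow> complex) \<Rightarrow> ('a \<Rightarrow> complex) list \<Rightarrow> complex) \<Rightarrow> bool" where
  "bidim p q D0 D1 k T \<longleftrightarrow>
     (\<forall>f \<pi>. f \<in> D0 \<longrightarrow> \<pi> \<in> args D1 k \<longrightarrow>
        ((\<exists>J V. J \<subseteq> {..<k} \<and> card J = p + 1 \<and> open V \<and> fsupp f \<subseteq> V \<and>
              (\<forall>j\<in>J. holo_on V (\<pi> ! j))) \<or>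
         (\<exists>J V. J \<subseteq> {..<k} \<and> card J = q + 1 \<and> open V \<and> fsupp f \<subseteq> V \<and>
              (\<forall>j\<in>J. holo_on V (\<lambda>x. cnj ((\<pi> ! j) x))))) \<longrightarrow> T f \<pi> = 0)"

definition ak_continuous ::
  "nat \<Rightarrow> (('a::metric_space \<Rightarrow> complex) \<Rightarrow> ('a \<Rightarrow> complex) list \<Rightarrow> complex) \<Rightarrow> bool" where
  "ak_continuous k T \<longleftrightarrow>
     (\<forall>f \<pi> ps. f \<in> Lipb \<longrightarrow> \<pi> \<in> args Lip k \<longrightarrow> (\<forall>n. ps n \<in> args Lip k) \<longrightarrow>
        (\<forall>j<k. \<forall>x. (\<lambda>n. (ps n ! j) x) \<longlonglongrightarrow> (\<pi> ! j) x) \<longrightarrow>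
        (\<exists>C. \<forall>n. \<forall>j<k. C-lipschitz_on UNIV (ps n ! j)) \<longrightarrow>
        (\<lambda>n. T f (ps n)) \<longlonglongrightarrow> T f \<pi>)"

definition ak_mass_bound ::
  "nat \<Rightarrow> (('a::metric_space \<Rightarrow> complex) \<Rightarrow> ('a \<Rightarrow> complex) list \<Rightarrow> complex) \<Rightarrow> 'a measure \<Rightarrow> bool" where
  "ak_mass_bound k T \<mu> \<longleftrightarrow> finite_radon \<mu> \<and>
     (\<forall>f \<pi>. f \<in> Lipb \<longrightarrow> \<pi> \<in> args Lip k \<longrightarrow>
        cmod (T f \<pi>) \<le> prod_list (map (lipc UNIV) \<pi>) * (\<integral>x. cmod (f x) \<partial>\<mu>))"

definition ak_current ::
  "nat \<Rightarrow> (('a::metric_space \<Rightarrow> complex) \<Rightarrow> ('a \<Rightarrow> complex) list \<Rightarrow> complex) \<Rightarrow> bool" where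
  "ak_current k T \<longleftrightarrow> multilin Lipb Lip k T \<and> ak_continuous k T \<and>
     locality Lipb Lip k T \<and> (\<exists>\<mu>. ak_mass_bound k T \<mu>)"

definition ak_bd ::
  "(('a \<Rightarrow> complex) \<Rightarrow> ('a \<Rightarrow> complex) list \<Rightarrow> complex)
    \<Rightarrow> ('a \<Rightarrow> complex) \<Rightarrow> ('a \<Rightarrow> complex) list \<Rightarrow> complex" where
  "ak_bd T f \<pi> = T (\<lambda>_. 1) (f # \<pi>)"

text \<open>Normal currents \<open>N\<^sub>k(E)\<close> (for \<open>k = 0\<close> the boundary is \<open>0\<close> by convention).\<close>
definition normal_current ::
  "nat \<Rightarrow> (('a::metric_space \<Rightarrow> complex) \<Rightarrow> ('a \<Rightarrow> complex) list \<Rightarrow> complex) \<Rightarrow> bool" where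
  "normal_current k T \<longleftrightarrow> ak_current k T \<and>
     (0 < k \<longrightarrow> (\<exists>\<nu>. ak_mass_bound (k - 1) (ak_bd T) \<nu>))"

definition ak_bd_zero ::
  "nat \<Rightarrow> (('a::metric_space \<Rightarrow> complex) \<Rightarrow> ('a \<Rightarrow> complex) list \<Rightarrow> complex) \<Rightarrow> bool" where
  "ak_bd_zero k T \<longleftrightarrow>
     (\<forall>f \<pi>. 0 < k \<longrightarrow> f \<in> Lipb \<longrightarrow> \<pi> \<in> args Lip (k - 1) \<longrightarrow> ak_bd T f \<pi> = 0)"

definition mass_measure ::
  "nat \<Rightarrow> (('a::metric_space \<Rightarrow> complex) \<Rightarrow> ('a \<Rightarrow> complex) list \<Rightarrow> complex) \<Rightarrow> 'a measure" where
  "mass_measure k T = (THE \<mu>. ak_mass_bound k T \<mu> \<and>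
     (\<forall>\<nu>. ak_mass_bound k T \<nu> \<longrightarrow> (\<forall>A\<in>sets borel. emeasure \<mu> A \<le> emeasure \<nu> A)))"

definition current_supp ::
  "nat \<Rightarrow> (('a::metric_space \<Rightarrow> complex) \<Rightarrow> ('a \<Rightarrow> complex) list \<Rightarrow> complex) \<Rightarrow> 'a set" where
  "current_supp k T = {x. \<forall>e>0. emeasure (mass_measure k T) (ball x e) > 0}"

definition qloc_continuous ::
  "nat \<Rightarrow> (('a::real_normed_vector \<Rightarrow> complex) \<Rightarrow> ('a \<Rightarrow> complex) list \<Rightarrow> complex) \<Rightarrow> bool" where
  "qloc_continuous k T \<longleftrightarrow>
     (\<forall>f \<pi> fs ps. f \<in> Eqloc \<longrightarrow> \<pi> \<in> args Lipqloc k \<longrightarrow>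
        (\<forall>n. fs n \<in> Eqloc) \<longrightarrow> (\<forall>n. ps n \<in> args Lipqloc k) \<longrightarrow>
        (\<forall>x. (\<lambda>n. fs n x) \<longlonglongrightarrow> f x) \<longrightarrow>
        (\<forall>j<k. \<forall>x. (\<lambda>n. (ps n ! j) x) \<longlonglongrightarrow> (\<pi> ! j) x) \<longrightarrow>
        (\<exists>R. \<forall>n. fsupp (fs n) \<subseteq> ball 0 R) \<longrightarrow>
        (\<exists>C. \<forall>n. C-lipschitz_on UNIV (fs n)) \<longrightarrow>
        (\<forall>R>0. \<exists>C. \<forall>n. \<forall>j<k. C-lipschitz_on (ball 0 R) (ps n ! j)) \<longrightarrow>
        (\<lambda>n. T (fs n) (ps n)) \<longlonglongrightarrow> T f \<pi>)"

definition qloc_mass ::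
  "nat \<Rightarrow> (('a::real_normed_vector \<Rightarrow> complex) \<Rightarrow> ('a \<Rightarrow> complex) list \<Rightarrow> complex) \<Rightarrow> bool" where
  "qloc_mass k T \<longleftrightarrow>
     (\<forall>R>0. \<exists>\<mu>. finite_radon \<mu> \<and>
        (\<forall>f \<pi>. f \<in> Eqloc \<longrightarrow> \<pi> \<in> args Lipqloc k \<longrightarrow> fsupp f \<subseteq> ball 0 R \<longrightarrow>
          cmod (T f \<pi>) \<le> prod_list (map (lipc (ball 0 R)) \<pi>) *
                           (LINT x:ball 0 R|\<mu>. cmod (f x))))"

definition qloc_current ::
  "nat \<Rightarrow> (('a::real_normed_vector \<Rightarrow> complex) \<Rightarrow> ('a \<Rightarrow> complex) list \<Rightarrow> complex) \<Rightarrow> bool" where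
  "qloc_current k T \<longleftrightarrow> multilin Eqloc Lipqloc k T \<and> qloc_continuous k T \<and>
     locality Eqloc Lipqloc k T \<and> qloc_mass k T"

text \<open>Boundary of a quasi-local current: \<open>dT(f,\<pi>) = T(\<sigma>,f,\<pi>)\<close> with \<open>\<sigma> \<in> \<E>\<^sub>q\<^sub>-\<^sub>l\<^sub>o\<^sub>c\<close>
  equal to \<open>1\<close> near \<open>supp f\<close> (independent of the choice of \<open>\<sigma>\<close>).\<close>
definition qloc_bd ::
  "(('a::real_normed_vector \<Rightarrow> complex) \<Rightarrow> ('a \<Rightarrow> complex) list \<Rightarrow> complex)
    \<Rightarrow> ('a \<Rightarrow> complex) \<Rightarrow> ('a \<Rightarrow> complex) list \<Rightarrow> complex" where
  "qloc_bd T f \<pi> = T (SOME \<sigma>. \<sigma> \<in> Eqloc \<and> (\<exists>V. open V \<and> fsupp f \<subseteq> V \<and> (\<forall>x\<in>V. \<sigma> x = 1)))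
                      (f # \<pi>)"

end

theory Submission
  imports Defs "HOL-Complex_Analysis.Cauchy_Integral_Theorem"
begin

text \<open>
  Let \<open>T\<close> be concentrated on the annulus \<open>r \<le> |x| \<le> R\<^sub>0\<close> and put \<open>H(z, x) = z x\<close> on the product of the complex
  plane with \<open>E\<close>. The product of the Cauchy kernel \<open>1 / (z - 1)\<close> with \<open>T\<close>, pushed forward by \<open>H\<close>, is the
  primitive:
  up to a constant, \<open>U(f, \<pi>)\<close> is the integral over \<open>z\<close> of \<open>1 / (z - 1)\<close> times the contraction of \<open>T\<close> with
  the antiholomorphic \<open>z\<close>-derivative of \<open>(f \<circ> H, \<pi> \<circ> H)\<close>. If \<open>f\<close> is supported in the ball of radius \<open>R\<close>, then
  only \<open>|z| \<le> R / r\<close> matters, which is why \<open>U\<close> is quasi-local. Since the boundary of \<open>T\<close> vanishes,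
  \<open>U(f, g, \<pi>) + U(g, f, \<pi>)\<close> is the Cauchy--Pompeiu integral of the antiholomorphic derivative of
  \<open>z \<mapsto> T((f g)(z x), \<pi>(z x))\<close>, that is, its value \<open>T(f g, \<pi>)\<close> at \<open>z = 1\<close>; for \<open>g = 1\<close> near the support of
  \<open>f\<close> one of the two terms disappears by locality. If \<open>\<pi>\<^sub>i\<close> is holomorphic, its antiholomorphic
  \<open>z\<close>-derivative vanishes, and the remaining terms vanish because \<open>T\<close> has bidimension \<open>(0, k)\<close>.

  Lipschitz functions need not be differentiable along \<open>z\<close>, so the families \<open>z \<mapsto> p(z x)\<close> are first averaged
  over small squares in \<open>z\<close>; the mass bound for \<open>T\<close>, together with antisymmetry and an integration by parts,
  makes the resulting functionals converge.

  That \<open>T\<close> is concentrated on the annulus uses that the least mass measure exists: two mass measures can be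
  glued along a Hahn decomposition, and a minimising sequence of densities yields the least one.
\<close>

section \<open>Lipschitz functions and Radon measures\<close>

text \<open>The averages converge uniformly as the squares shrink, but their z-derivatives need not,
  so the integrand of U has no evident limit. What rescues the convergence is that the mass bound
  estimates U through the values of its first argument alone. An error G in a later entry is moved
  to the front by antisymmetry and then, by U(F, G, \<pi>) = T(F G, \<pi>) - U(G, F, \<pi>) with F,
  G and \<pi> taken at z = 1 inside T, into the first argument. Hence U is stable under uniformly
  small errors in every entry as long as the Lipschitz constants stay bounded; the continuity of the
  limit has the same source.

  The vanishing boundary enters as T(1, \<pi>) = 0. With a Leibniz rule it makes T alternating in
  its first argument and its entries together, as long as they are bounded: the boundary accepts
  only bounded first arguments. In infinite dimensions the closed support of f need not be compact,
  so holomorphy near it gives no uniform neighbourhood; vanishing on holomorphic entries is first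
  proved with a uniform margin and then extended by cutoffs and the mass bound.\<close>

lemma lipc_le: "C-lipschitz_on S f \<Longrightarrow> lipc S f \<le> C"
  unfolding lipc_def by (rule cInf_lower) (auto intro!: bdd_belowI[of _ 0] dest: lipschitz_on_nonneg)

text \<open>For a fixed pair of points the Lipschitz inequality passes to the infimum, so the
  infimum is attained. Some constant has to exist beforehand, since otherwise \<open>lipc\<close> is
  an infimum over the empty set.\<close>

lemma lipschitz_on_lipc:
  assumes "C-lipschitz_on S f"
  shows "(lipc S f)-lipschitz_on S f"
proof (rule lipschitz_onI)
  have ne: "{C. C-lipschitz_on S f} \<noteq> {}"
    using assms by auto
  show "0 \<le> lipc S f"
    unfolding lipc_def by (rule cInf_greatest[OF ne]) (auto dest: lipschitz_on_nonneg)
  fix x y assume xy: "x \<in> S" "y \<in> S"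
  show "dist (f x) (f y) \<le> lipc S f * dist x y"
  proof (cases "x = y")
    case False
    then have "dist (f x) (f y) / dist x y \<le> lipc S f"
      unfolding lipc_def using xy
      by (intro cInf_greatest[OF ne]) (auto simp: divide_le_eq dest: lipschitz_onD)
    then show ?thesis
      using False by (simp add: divide_le_eq)
  qed simp
qed

lemma prod_list_nth: "prod_list (map h xs) = (\<Prod>j<length xs. h (xs ! j))"
  for h :: "'b \<Rightarrow> real"
  by (simp add: prod.list_conv_set_nth atLeast0LessThan)

lemma lipc_nonneg: "C-lipschitz_on S f \<Longrightarrow> 0 \<le> lipc S f"
  using lipschitz_on_lipc lipschitz_on_nonneg by blast

lemma prod_list_lipc_le:
  assumes "\<And>j. j < length \<pi> \<Longrightarrow> (L j)-lipschitz_on S (\<pi> ! j)"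
  shows "prod_list (map (lipc S) \<pi>) \<le> (\<Prod>j<length \<pi>. L j)"
  unfolding prod_list_nth using assms
  by (intro prod_mono) (auto intro: lipc_le lipc_nonneg)

lemma prod_list_lipc_nonneg:
  assumes "\<And>j. j < length \<pi> \<Longrightarrow> \<exists>C. C-lipschitz_on S (\<pi> ! j)"
  shows "0 \<le> prod_list (map (lipc S) \<pi>)"
  unfolding prod_list_nth using assms
  by (intro prod_nonneg) (auto intro: lipc_nonneg)

lemma args_nth: "\<pi> \<in> args D k \<Longrightarrow> j < k \<Longrightarrow> \<pi> ! j \<in> D"
  by (auto simp: args_def)

lemma args_length: "\<pi> \<in> args D k \<Longrightarrow> length \<pi> = k"
  by (auto simp: args_def)

lemma args_update: "\<pi> \<in> args D k \<Longrightarrow> p \<in> D \<Longrightarrow> \<pi>[j := p] \<in> args D k"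
  by (auto simp: args_def dest: set_update_subset_insert[THEN subsetD])

lemma args_mono: "D \<subseteq> D' \<Longrightarrow> args D k \<subseteq> args D' k"
  by (auto simp: args_def)

lemma args_map: "(\<And>p. p \<in> D \<Longrightarrow> g p \<in> D') \<Longrightarrow> \<pi> \<in> args D k \<Longrightarrow> map g \<pi> \<in> args D' k"
  by (auto simp: args_def)

lemma lipschitz_on_mult_bounded:
  fixes f g :: "'a::metric_space \<Rightarrow> complex"
  assumes f: "C-lipschitz_on UNIV f" and g: "D-lipschitz_on UNIV g"
    and bf: "\<And>x. cmod (f x) \<le> A" and bg: "\<And>x. cmod (g x) \<le> B"
  shows "(C * B + A * D)-lipschitz_on UNIV (\<lambda>x. f x * g x)"
proof (rule lipschitz_onI)
  have A: "0 \<le> A" "0 \<le> B"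
    using order_trans[OF norm_ge_zero bf[of undefined]] order_trans[OF norm_ge_zero bg[of undefined]] by auto
  then show "0 \<le> C * B + A * D"
    using f g by (auto dest!: lipschitz_on_nonneg)
  fix x y
  have "f x * g x - f y * g y = (f x - f y) * g x + f y * (g x - g y)"
    by (simp add: algebra_simps)
  then have "dist (f x * g x) (f y * g y) \<le> dist (f x) (f y) * cmod (g x) + cmod (f y) * dist (g x) (g y)"
    by (metis dist_norm norm_mult norm_triangle_ineq)
  also have "\<dots> \<le> (C * dist x y) * B + A * (D * dist x y)"
    using lipschitz_onD[OF f, of x y] lipschitz_onD[OF g, of x y] A bf bg
    lipschitz_on_nonneg[OF f] lipschitz_on_nonneg[OF g]
    by (intro add_mono mult_mono) (auto simp: dist_commute)
  finally show "dist (f x * g x) (f y * g y) \<le> (C * B + A * D) * dist x y"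
    by (simp add: algebra_simps)
qed

lemma LipI: "C-lipschitz_on UNIV f \<Longrightarrow> f \<in> Lip"
  by (auto simp: Lip_def)

lemma LipE: "f \<in> Lip \<Longrightarrow> (\<And>C. 0 \<le> C \<Longrightarrow> C-lipschitz_on UNIV f \<Longrightarrow> P) \<Longrightarrow> P"
  by (auto simp: Lip_def dest: lipschitz_on_nonneg)

lemma LipbI: "C-lipschitz_on UNIV f \<Longrightarrow> (\<And>x. cmod (f x) \<le> B) \<Longrightarrow> f \<in> Lipb"
  by (auto simp: Lipb_def bounded_iff)

lemma LipbE:
  "f \<in> Lipb \<Longrightarrow> (\<And>C B. 0 \<le> C \<Longrightarrow> 0 \<le> B \<Longrightarrow> C-lipschitz_on UNIV f \<Longrightarrow> (\<And>x. cmod (f x) \<le> B) \<Longrightarrow> P) \<Longrightarrow> P"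
proof (simp add: Lipb_def bounded_iff, elim conjE exE)
  fix B C assume P: "\<And>C B. \<lbrakk>0 \<le> C; 0 \<le> B; C-lipschitz_on UNIV f; \<And>x. cmod (f x) \<le> B\<rbrakk> \<Longrightarrow> P"
    and a: "\<forall>x. cmod (f x) \<le> B" "C-lipschitz_on UNIV f"
  show P
    using a order_trans[OF norm_ge_zero a(1)[rule_format, of undefined]] lipschitz_on_nonneg[OF a(2)]
    by (intro P[of C B]) auto
qed

lemma Lipb_subset_Lip: "Lipb \<subseteq> Lip"
  by (auto simp: Lipb_def Lip_def)

lemma Lipb_Lip: "f \<in> Lipb \<Longrightarrow> f \<in> Lip"
  using Lipb_subset_Lip by blast

lemma Lip_const [simp]: "(\<lambda>x. c) \<in> Lip"
  by (rule LipI[OF lipschitz_on_constant])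

lemma Lipb_const [simp]: "(\<lambda>x. c) \<in> Lipb"
  by (rule LipbI[of 0 _ "cmod c"]) (auto intro: lipschitz_on_constant)

lemma Lip_add: "f \<in> Lip \<Longrightarrow> g \<in> Lip \<Longrightarrow> (\<lambda>x. f x + g x) \<in> Lip"
  by (elim LipE) (auto intro: LipI lipschitz_on_add)

lemma Lip_cmult: "f \<in> Lip \<Longrightarrow> (\<lambda>x. c * f x) \<in> Lip"
proof (elim LipE)
  fix C assume "0 \<le> C" "C-lipschitz_on UNIV f"
  then have "(cmod c * C)-lipschitz_on UNIV (\<lambda>x. c * f x)"
    by (auto simp: lipschitz_on_def dist_norm norm_mult mult.assoc
        simp flip: right_diff_distrib intro: mult_left_mono)
  then show ?thesis by (rule LipI)
qed

lemma Lip_diff: "f \<in> Lip \<Longrightarrow> g \<in> Lip \<Longrightarrow> (\<lambda>x. f x - g x) \<in> Lip"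
  by (elim LipE) (auto intro: LipI lipschitz_on_diff)

lemma Lipb_iff: "f \<in> Lipb \<longleftrightarrow> f \<in> Lip \<and> (\<exists>B. \<forall>x. cmod (f x) \<le> B)"
  by (auto simp: Lipb_def Lip_def bounded_iff)

lemma Lipb_mult: "f \<in> Lipb \<Longrightarrow> g \<in> Lipb \<Longrightarrow> (\<lambda>x. f x * g x) \<in> Lipb"
proof (elim LipbE)
  fix C B C' B' assume *: "0 \<le> B" "C-lipschitz_on UNIV f" "\<And>x. cmod (f x) \<le> B" "0 \<le> B'"
    "C'-lipschitz_on UNIV g" "\<And>x. cmod (g x) \<le> B'"
  have "cmod (f x * g x) \<le> B * B'" for x
    using * by (auto simp: norm_mult intro!: mult_mono)
  then show "(\<lambda>x. f x * g x) \<in> Lipb"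
    using lipschitz_on_mult_bounded[OF *(2,5,3,6)] LipbI by blast
qed

lemma Lipb_add: "f \<in> Lipb \<Longrightarrow> g \<in> Lipb \<Longrightarrow> (\<lambda>x. f x + g x) \<in> Lipb"
  unfolding Lipb_iff by (auto intro: Lip_add) (meson norm_triangle_mono)

lemma Lipb_cmult: "f \<in> Lipb \<Longrightarrow> (\<lambda>x. c * f x) \<in> Lipb"
  by (rule Lipb_mult) simp

lemma Lipb_diff: "f \<in> Lipb \<Longrightarrow> g \<in> Lipb \<Longrightarrow> (\<lambda>x. f x - g x) \<in> Lipb"
  using Lipb_add[of f "\<lambda>x. -1 * g x"] Lipb_cmult[of g "-1"] by simp

lemma Lip_continuous: "f \<in> Lip \<Longrightarrow> continuous_on S f"
  by (elim LipE) (meson lipschitz_on_continuous_on continuous_on_subset subset_UNIV)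

lemma Lip_measurable: "f \<in> Lip \<Longrightarrow> f \<in> borel_measurable borel"
  by (intro borel_measurable_continuous_onI Lip_continuous)

lemma Lipb_of_real:
  fixes u :: "'a::metric_space \<Rightarrow> real"
  assumes "C-lipschitz_on UNIV u" "\<And>x. \<bar>u x\<bar> \<le> B"
  shows "(\<lambda>x. complex_of_real (u x)) \<in> Lipb"
  using assms by (intro LipbI[of C _ B]) (auto simp: lipschitz_on_def dist_norm simp flip: of_real_diff)

section \<open>Inner regularity of finite Radon measures\<close>

lemma finite_radonD:
  assumes "finite_radon \<mu>"
  shows "sets \<mu> = sets borel" "space \<mu> = UNIV" "finite_measure \<mu>"
proof -
  show s: "sets \<mu> = sets borel"
    using assms by (auto simp: finite_radon_def)
  then show "space \<mu> = UNIV"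
    using sets_eq_imp_space_eq by fastforce
  show "finite_measure \<mu>"
    using assms by (auto simp: finite_radon_def intro!: finite_measureI)
qed

text \<open>Finiteness turns the supremum in \<open>finite_radon\<close> into a number, so some
  compact set comes within e of it; the difference form is the one in which errors add up.\<close>

lemma finite_radon_compact:
  assumes \<mu>: "finite_radon \<mu>" and A: "A \<in> sets borel" and e: "0 < e"
  obtains K where "compact K" "K \<subseteq> A" "measure \<mu> (A - K) \<le> e"
proof -
  interpret finite_measure \<mu> by (rule finite_radonD[OF \<mu>])
  note s = finite_radonD(1)[OF \<mu>]
  have "\<exists>K. compact K \<and> K \<subseteq> A \<and> measure \<mu> A < measure \<mu> K + e"
  proof (rule ccontr)
    assume neg: "\<not> ?thesis"
    have le: "emeasure \<mu> K \<le> ennreal (measure \<mu> A - e)" if "compact K" "K \<subseteq> A" for K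
    proof -
      have "measure \<mu> K \<le> measure \<mu> A - e"
        using neg[unfolded not_ex, rule_format, of K] that by simp
      then show ?thesis
        by (simp add: emeasure_eq_measure ennreal_leI)
    qed
    have "emeasure \<mu> A = (SUP K\<in>{K. compact K \<and> K \<subseteq> A}. emeasure \<mu> K)"
      using \<mu> A by (auto simp: finite_radon_def)
    also have "\<dots> \<le> ennreal (measure \<mu> A - e)"
      using le by (intro SUP_least) auto
    finally have "ennreal (measure \<mu> A) \<le> ennreal (measure \<mu> A - e)"
      by (simp add: emeasure_eq_measure)
    \<comment> \<open>Testing with the empty compact set gives e \<le> measure A; otherwise
      \<open>ennreal\<close> would truncate a negative difference to 0.\<close>
    moreover have "measure \<mu> A - e \<ge> 0"
      using neg[unfolded not_ex, rule_format, of "{}"] by simp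
    ultimately show False
      using e by (simp add: ennreal_le_iff)
  qed
  then obtain K where K: "compact K" "K \<subseteq> A" "measure \<mu> A < measure \<mu> K + e"
    by auto
  moreover have "measure \<mu> (A - K) = measure \<mu> A - measure \<mu> K"
    using K A s by (intro finite_measure_Diff) (auto intro: borel_closed compact_imp_closed)
  ultimately show ?thesis
    using that[OF K(1,2)] by simp
qed

lemma finite_radonI:
  assumes s: "sets \<mu> = sets borel" and "finite_measure \<mu>"
    and K: "\<And>A e. A \<in> sets borel \<Longrightarrow> 0 < e \<Longrightarrow> \<exists>K. compact K \<and> K \<subseteq> A \<and> measure \<mu> (A - K) \<le> e"
  shows "finite_radon \<mu>"
proof -
  interpret finite_measure \<mu> by fact
  have "emeasure \<mu> A = (SUP K\<in>{K. compact K \<and> K \<subseteq> A}. emeasure \<mu> K)" if A: "A \<in> sets borel" for A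
  proof (rule antisym)
    show "(SUP K\<in>{K. compact K \<and> K \<subseteq> A}. emeasure \<mu> K) \<le> emeasure \<mu> A"
      using A s by (auto intro!: SUP_least emeasure_mono)
    show "emeasure \<mu> A \<le> (SUP K\<in>{K. compact K \<and> K \<subseteq> A}. emeasure \<mu> K)"
    proof (rule ennreal_le_epsilon)
      fix e :: real assume "0 < e"
      then obtain K where "compact K" "K \<subseteq> A" "measure \<mu> (A - K) \<le> e"
        using K A by blast
      moreover have "measure \<mu> (A - K) = measure \<mu> A - measure \<mu> K"
        using A s \<open>K \<subseteq> A\<close> \<open>compact K\<close>
        by (intro finite_measure_Diff) (auto intro: borel_closed compact_imp_closed)
      ultimately have "emeasure \<mu> A \<le> emeasure \<mu> K + ennreal e"
        using \<open>0 < e\<close>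
        by (simp add: emeasure_eq_measure flip: ennreal_plus)
      also have "\<dots> \<le> (SUP K\<in>{K. compact K \<and> K \<subseteq> A}. emeasure \<mu> K) + ennreal e"
        using \<open>compact K\<close> \<open>K \<subseteq> A\<close> by (intro add_right_mono SUP_upper) auto
      finally show "emeasure \<mu> A \<le> (SUP K\<in>{K. compact K \<and> K \<subseteq> A}. emeasure \<mu> K) + ennreal e" .
    qed
  qed
  then show ?thesis
    using s emeasure_finite[of "space \<mu>"] by (auto simp: finite_radon_def less_top[symmetric])
qed

text \<open>Compact sets that nearly exhaust a set for \<mu> do so for anything below \<mu>. This
  makes glued measures and densities bounded by 1 Radon.\<close>

lemma finite_radon_mono:
  fixes \<mu> \<nu> :: "'a::metric_space measure"
  assumes \<mu>: "finite_radon \<mu>" and s: "sets \<nu> = sets borel"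
    and le: "\<And>A. A \<in> sets borel \<Longrightarrow> emeasure \<nu> A \<le> emeasure \<mu> A"
  shows "finite_radon \<nu>"
proof (rule finite_radonI[OF s])
  interpret \<mu>: finite_measure \<mu> by (rule finite_radonD[OF \<mu>])
  have sp: "space \<nu> = UNIV"
    using s sets_eq_imp_space_eq by fastforce
  show fin: "finite_measure \<nu>"
    using le[of UNIV] \<mu>.emeasure_finite[of UNIV] sp
    by (intro finite_measureI) (auto simp: top_unique)
  interpret \<nu>: finite_measure \<nu> by fact
  fix A :: "'a set" and e :: real assume "A \<in> sets borel" "0 < e"
  then obtain K where "compact K" "K \<subseteq> A" "measure \<mu> (A - K) \<le> e"
    using finite_radon_compact[OF \<mu>] by blast
  moreover have "measure \<nu> (A - K) \<le> measure \<mu> (A - K)"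
    using le[of "A - K"] \<open>A \<in> sets borel\<close> \<open>compact K\<close>
    by (auto simp: \<mu>.emeasure_eq_measure \<nu>.emeasure_eq_measure intro: borel_closed compact_imp_closed)
  ultimately show "\<exists>K. compact K \<and> K \<subseteq> A \<and> measure \<nu> (A - K) \<le> e"
    by force
qed

lemma Lipb_integrable:
  assumes "f \<in> Lipb" "sets \<mu> = sets borel" "finite_measure \<mu>"
  shows "integrable \<mu> f"
proof -
  interpret finite_measure \<mu> by fact
  obtain B where "\<And>x. cmod (f x) \<le> B"
    using LipbE[OF assms(1)] by metis
  then show ?thesis
    using Lip_measurable[OF Lipb_Lip[OF assms(1)]] assms(2)
    by (intro integrable_const_bound[of _ B]) (auto cong: measurable_cong_sets)
qed

lemma ak_mass_boundD:
  assumes "ak_mass_bound k T \<mu>" "f \<in> Lipb" "\<pi> \<in> args Lip k"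
    and "\<And>j. j < k \<Longrightarrow> (L j)-lipschitz_on UNIV (\<pi> ! j)"
  shows "cmod (T f \<pi>) \<le> (\<Prod>j<k. L j) * (\<integral>x. cmod (f x) \<partial>\<mu>)"
proof -
  have "cmod (T f \<pi>) \<le> prod_list (map (lipc UNIV) \<pi>) * (\<integral>x. cmod (f x) \<partial>\<mu>)"
    using assms by (auto simp: ak_mass_bound_def)
  also have "\<dots> \<le> (\<Prod>j<k. L j) * (\<integral>x. cmod (f x) \<partial>\<mu>)"
    using prod_list_lipc_le[of \<pi> L UNIV] assms args_length[OF assms(3)]
    by (intro mult_right_mono) auto
  finally show ?thesis .
qed

lemma multilin_lin:
  "multilin D0 D1 k T \<Longrightarrow> f \<in> D0 \<Longrightarrow> g \<in> D0 \<Longrightarrow> \<pi> \<in> args D1 k \<Longrightarrow>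
    T (\<lambda>x. c * f x + g x) \<pi> = c * T f \<pi> + T g \<pi>"
  unfolding multilin_def by blast

lemma multilin_add:
  "multilin D0 D1 k T \<Longrightarrow> f \<in> D0 \<Longrightarrow> g \<in> D0 \<Longrightarrow> \<pi> \<in> args D1 k \<Longrightarrow> T (\<lambda>x. f x + g x) \<pi> = T f \<pi> + T g \<pi>"
  using multilin_lin[of D0 D1 k T f g \<pi> 1] by simp

lemma multilin_lin_arg:
  "multilin D0 D1 k T \<Longrightarrow> f \<in> D0 \<Longrightarrow> \<pi> \<in> args D1 k \<Longrightarrow> g \<in> D1 \<Longrightarrow> h \<in> D1 \<Longrightarrow> i < k \<Longrightarrow>
    T f (\<pi>[i := (\<lambda>x. c * g x + h x)]) = c * T f (\<pi>[i := g]) + T f (\<pi>[i := h])"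
  unfolding multilin_def by blast

section \<open>The least mass measure\<close>

text \<open>Compactness makes the distance d between the two sets positive, and the tent of slope 1
  / d over K1 has died out on K2.\<close>

lemma compact_lipschitz_separation:
  fixes K1 K2 :: "'a::metric_space set"
  assumes "compact K1" "compact K2" "K1 \<inter> K2 = {}"
  obtains \<phi> :: "'a \<Rightarrow> real" and C where "C-lipschitz_on UNIV \<phi>" "\<And>x. 0 \<le> \<phi> x" "\<And>x. \<phi> x \<le> 1"
    "\<And>x. x \<in> K1 \<Longrightarrow> \<phi> x = 1" "\<And>x. x \<in> K2 \<Longrightarrow> \<phi> x = 0"
proof -
  \<comment> \<open>\<open>infdist\<close> to the empty set is 0, and a minimum over K2 needs a
    point, so empty sets are treated apart.\<close>
  consider "K1 = {}" | "K1 \<noteq> {}" "K2 = {}" | "K1 \<noteq> {}" "K2 \<noteq> {}" by blast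
  then show ?thesis
  proof cases
    case 1
    then show ?thesis
      by (intro that[of 0 "\<lambda>_. 0"]) (auto intro: lipschitz_on_constant)
  next
    case 2
    then show ?thesis
      by (intro that[of 0 "\<lambda>_. 1"]) (auto intro: lipschitz_on_constant)
  next
    case 3
    obtain y where y: "y \<in> K2" "\<And>x. x \<in> K2 \<Longrightarrow> infdist y K1 \<le> infdist x K1"
      using continuous_attains_inf[OF assms(2) 3(2) continuous_on_infdist[OF continuous_on_id], of K1] by blast
    define d where "d = infdist y K1"
    have "y \<notin> closure K1"
      using y assms by (auto simp: compact_imp_closed)
    then have d: "0 < d"
      unfolding d_def using 3 by (simp add: in_closure_iff_infdist_zero infdist_nonneg less_le)
    show ?thesis
    proof (rule that[of "1/d" "\<lambda>x. max 0 (1 - infdist x K1 / d)"])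
      show "(1/d)-lipschitz_on UNIV (\<lambda>x. max 0 (1 - infdist x K1 / d))"
      proof (rule lipschitz_onI)
        fix x y :: 'a
        have "dist (max 0 (1 - infdist x K1 / d)) (max 0 (1 - infdist y K1 / d)) \<le> \<bar>infdist x K1 / d - infdist y K1 / d\<bar>"
          by (auto simp: dist_real_def)
        also have "\<dots> = \<bar>infdist x K1 - infdist y K1\<bar> / d"
          using d by (simp flip: diff_divide_distrib)
        also have "\<dots> \<le> dist x y / d"
          using d by (intro divide_right_mono infdist_triangle_abs) auto
        finally show "dist (max 0 (1 - infdist x K1 / d)) (max 0 (1 - infdist y K1 / d)) \<le> 1 / d * dist x y"
          by simp
      qed (use d in auto)
    qed (use d y in \<open>auto simp: d_def infdist_nonneg\<close>)
  qed
qed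

text \<open>Approximate \<open>A\<close> and its complement from inside by disjoint compact sets and split \<open>f\<close> with a Lipschitz cutoff.\<close>
lemma mass_glue:
  assumes T: "multilin Lipb Lip k T" and b1: "ak_mass_bound k T \<nu>1" and b2: "ak_mass_bound k T \<nu>2"
    and A: "A \<in> sets borel" and f: "f \<in> Lipb" and \<pi>: "\<pi> \<in> args Lip k"
  shows "cmod (T f \<pi>) \<le> prod_list (map (lipc UNIV) \<pi>) *
     ((\<integral>x. indicator A x * cmod (f x) \<partial>\<nu>1) + (\<integral>x. indicator (-A) x * cmod (f x) \<partial>\<nu>2))"
    (is "_ \<le> ?P * (?I1 + ?I2)")
proof -
  have r1: "finite_radon \<nu>1" and r2: "finite_radon \<nu>2"
    using b1 b2 by (auto simp: ak_mass_bound_def)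
  interpret n1: finite_measure \<nu>1 by (rule finite_radonD[OF r1])
  interpret n2: finite_measure \<nu>2 by (rule finite_radonD[OF r2])
  have [measurable_cong, simp]: "sets \<nu>1 = sets borel" "sets \<nu>2 = sets borel"
    using finite_radonD r1 r2 by auto
  have [measurable]: "A \<in> sets borel" "f \<in> borel_measurable borel"
    using A f by (auto intro: Lip_measurable Lipb_Lip)
  obtain C B where B: "0 \<le> B" "\<And>x. cmod (f x) \<le> B"
    using LipbE[OF f] by metis
  have P: "0 \<le> ?P"
    using args_nth[OF \<pi>] args_length[OF \<pi>] by (intro prod_list_lipc_nonneg) (auto simp: Lip_def)
  have if1: "integrable \<nu>1 (\<lambda>x. indicator X x * cmod (f x))" if [measurable]: "X \<in> sets borel" for X
    using B by (intro n1.integrable_const_bound[of _ B]) (auto split: split_indicator)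
  have if2: "integrable \<nu>2 (\<lambda>x. indicator X x * cmod (f x))" if [measurable]: "X \<in> sets borel" for X
    using B by (intro n2.integrable_const_bound[of _ B]) (auto split: split_indicator)
  have main: "cmod (T f \<pi>) \<le> ?P * (?I1 + ?I2) + (2 * ?P * B) * e" if e: "0 < e" for e
  proof -
    \<comment> \<open>The choice is crosswise. The part of f that is cut to 0 on K2 is charged to
      \<nu>1 and spills out of A only into -A - K2, which is small for \<nu>1; the other part spills
      only into A - K1, which is small for \<nu>2.\<close>
    obtain K1 where K1: "compact K1" "K1 \<subseteq> A" "measure \<nu>2 (A - K1) \<le> e"
      using finite_radon_compact[OF r2 A e] by blast
    obtain K2 where K2: "compact K2" "K2 \<subseteq> -A" "measure \<nu>1 (-A - K2) \<le> e"
      by (rule finite_radon_compact[OF r1 _ e, of "-A"]) (use A in auto)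
    have [measurable]: "K1 \<in> sets borel" "K2 \<in> sets borel"
      using K1 K2 by (auto intro: borel_closed compact_imp_closed)
    obtain \<phi> :: "'a \<Rightarrow> real" and C where \<phi>: "C-lipschitz_on UNIV \<phi>" "\<And>x. 0 \<le> \<phi> x" "\<And>x. \<phi> x \<le> 1"
      "\<And>x. x \<in> K1 \<Longrightarrow> \<phi> x = 1" "\<And>x. x \<in> K2 \<Longrightarrow> \<phi> x = 0"
      by (rule compact_lipschitz_separation[OF K1(1) K2(1)]) (use K1(2) K2(2) in auto)
    have \<phi>1: "(\<lambda>x. complex_of_real (\<phi> x)) \<in> Lipb"
      using \<phi> by (intro Lipb_of_real[of C _ 1]) auto
    have [measurable]: "\<phi> \<in> borel_measurable borel"
      using \<phi>(1) by (intro borel_measurable_continuous_onI lipschitz_on_continuous_on)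
    let ?g = "\<lambda>x. complex_of_real (\<phi> x) * f x" and ?h = "\<lambda>x. (1 - complex_of_real (\<phi> x)) * f x"
    have g: "?g \<in> Lipb" and h: "?h \<in> Lipb"
      using \<phi>1 f by (auto intro!: Lipb_mult Lipb_diff)
    have "T f \<pi> = T (\<lambda>x. ?g x + ?h x) \<pi>"
      by (simp add: algebra_simps)
    also have "\<dots> = T ?g \<pi> + T ?h \<pi>"
      using multilin_add[OF T g h \<pi>] .
    finally have eq: "T f \<pi> = T ?g \<pi> + T ?h \<pi>" .
    have i1: "(\<integral>x. cmod (?g x) \<partial>\<nu>1) \<le> ?I1 + B * e"
    proof -
      have "(\<integral>x. cmod (?g x) \<partial>\<nu>1) \<le> (\<integral>x. indicator A x * cmod (f x) + B * indicator (-A - K2) x \<partial>\<nu>1)"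
        using \<phi> B mult_mono[OF \<phi>(3) B(2)]
        by (intro integral_mono integrable_norm Lipb_integrable[OF g] Bochner_Integration.integrable_add if1)
           (auto simp: norm_mult abs_of_nonneg mult_left_le_one_le n1.finite_measure_axioms n1.emeasure_eq_measure
             split: split_indicator)
      also have "\<dots> = ?I1 + B * measure \<nu>1 (-A - K2)"
        by (subst Bochner_Integration.integral_add) (auto intro!: if1 simp: n1.emeasure_eq_measure)
      finally show ?thesis
        using mult_left_mono[OF K2(3) B(1)] by simp
    qed
    have i2: "(\<integral>x. cmod (?h x) \<partial>\<nu>2) \<le> ?I2 + B * e"
    proof -
      have le1: "cmod (1 - complex_of_real (\<phi> x)) \<le> 1" for x
        using \<phi>(2,3)[of x] norm_of_real[of "1 - \<phi> x", where ?'a = complex] by simp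
      have "(\<integral>x. cmod (?h x) \<partial>\<nu>2) \<le> (\<integral>x. indicator (-A) x * cmod (f x) + B * indicator (A - K1) x \<partial>\<nu>2)"
        using \<phi> B mult_mono[OF le1 B(2)] le1
        by (intro integral_mono integrable_norm Lipb_integrable[OF h] Bochner_Integration.integrable_add if2)
           (auto simp: norm_mult mult_left_le_one_le n2.finite_measure_axioms n2.emeasure_eq_measure
             split: split_indicator)
      also have "\<dots> = ?I2 + B * measure \<nu>2 (A - K1)"
        by (subst Bochner_Integration.integral_add) (auto intro!: if2 simp: n2.emeasure_eq_measure)
      finally show ?thesis
        using mult_left_mono[OF K1(3) B(1)] by simp
    qed
    have "cmod (T f \<pi>) \<le> cmod (T ?g \<pi>) + cmod (T ?h \<pi>)"
      unfolding eq by (rule norm_triangle_ineq)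
    also have "\<dots> \<le> ?P * (\<integral>x. cmod (?g x) \<partial>\<nu>1) + ?P * (\<integral>x. cmod (?h x) \<partial>\<nu>2)"
      using b1 b2 g h \<pi> unfolding ak_mass_bound_def by (intro add_mono) blast+
    also have "\<dots> \<le> ?P * (?I1 + B * e) + ?P * (?I2 + B * e)"
      using P i1 i2 by (intro add_mono mult_left_mono) auto
    finally show ?thesis
      by (simp add: algebra_simps)
  qed
  have "((\<lambda>e. ?P * (?I1 + ?I2) + (2 * ?P * B) * e) \<longlongrightarrow> ?P * (?I1 + ?I2) + (2 * ?P * B) * 0) (at_right 0)"
    by (intro tendsto_intros)
  then show ?thesis
    using main
    by (intro tendsto_lowerbound[where F = "at_right (0::real)" and f = "\<lambda>e. ?P * (?I1 + ?I2) + (2 * ?P * B) * e"])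
       (auto simp: eventually_at_filter)
qed

text \<open>On the set where h exceeds 1, the density has the measure of that set plus the integral
  of the excess. Finiteness allows cancelling the former, so the excess integrates to 0.\<close>

lemma density_le_AE:
  fixes h :: "'a \<Rightarrow> ennreal"
  assumes "finite_measure \<nu>" and [measurable]: "h \<in> borel_measurable \<nu>"
    and le: "\<And>A. A \<in> sets \<nu> \<Longrightarrow> emeasure (density \<nu> h) A \<le> emeasure \<nu> A"
  shows "AE x in \<nu>. h x \<le> 1"
proof -
  interpret finite_measure \<nu> by fact
  define A where "A = {x\<in>space \<nu>. 1 < h x}"
  have A [measurable]: "A \<in> sets \<nu>"
    unfolding A_def by measurable
  have "(\<integral>\<^sup>+x. (h x - 1) * indicator A x \<partial>\<nu>) + emeasure \<nu> A
      = (\<integral>\<^sup>+x. (h x - 1) * indicator A x + indicator A x \<partial>\<nu>)"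
    by (subst nn_integral_add) auto
  also have "\<dots> = (\<integral>\<^sup>+x. h x * indicator A x \<partial>\<nu>)"
    by (intro nn_integral_cong) (auto simp: A_def diff_add_cancel_ennreal split: split_indicator)
  also have "\<dots> \<le> emeasure \<nu> A"
    using le[OF A] by (simp add: emeasure_density)
  finally have "(\<integral>\<^sup>+x. (h x - 1) * indicator A x \<partial>\<nu>) + emeasure \<nu> A \<le> 0 + emeasure \<nu> A"
    by simp
  then have "(\<integral>\<^sup>+x. (h x - 1) * indicator A x \<partial>\<nu>) = 0"
    using emeasure_finite[of A] ennreal_add_left_cancel_le[of "emeasure \<nu> A" _ 0] by (simp add: add.commute)
  then have "AE x in \<nu>. (h x - 1) * indicator A x = 0"
    by (subst (asm) nn_integral_0_iff_AE) auto
  then show ?thesis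
    using AE_space
  proof eventually_elim
    case (elim x)
    show ?case
    proof (rule ccontr)
      assume "\<not> h x \<le> 1"
      then have "x \<in> A" "1 < h x"
        using elim by (auto simp: A_def)
      then have "h x - 1 = 0"
        using elim by simp
      with \<open>1 < h x\<close> show False
        by (metis diff_gr0_ennreal less_irrefl)
    qed
  qed
qed

text \<open>A Hahn decomposition tells where \<nu>' is the smaller of the two; taking \<nu>' there
  and \<nu> elsewhere gives a measure below both, and \<open>mass_glue\<close> shows that it still
  bounds T. Writing it as a density at most 1 against \<nu> is what later lets a decreasing sequence
  of such measures converge pointwise.\<close>

lemma mass_inf:
  fixes T :: "('a::metric_space \<Rightarrow> complex) \<Rightarrow> ('a \<Rightarrow> complex) list \<Rightarrow> complex"
  assumes T: "multilin Lipb Lip k T" and b1: "ak_mass_bound k T \<nu>" and b2: "ak_mass_bound k T \<nu>'"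
  obtains g :: "'a \<Rightarrow> real" where "g \<in> borel_measurable borel" "\<And>x. 0 \<le> g x" "\<And>x. g x \<le> 1"
    "ak_mass_bound k T (density \<nu> g)" "\<And>B. B \<in> sets borel \<Longrightarrow> emeasure (density \<nu> g) B \<le> emeasure \<nu>' B"
proof -
  have r1: "finite_radon \<nu>" and r2: "finite_radon \<nu>'"
    using b1 b2 by (auto simp: ak_mass_bound_def)
  interpret n1: finite_measure \<nu> by (rule finite_radonD[OF r1])
  interpret n2: finite_measure \<nu>' by (rule finite_radonD[OF r2])
  have [measurable_cong, simp]: "sets \<nu> = sets borel" "sets \<nu>' = sets borel"
    using finite_radonD r1 r2 by auto
  obtain Y where Y [measurable]: "Y \<in> sets borel" and Y1: "\<And>X. X \<in> sets borel \<Longrightarrow> X \<subseteq> Y \<Longrightarrow> emeasure \<nu>' X \<le> emeasure \<nu> X"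
    and Y2: "\<And>X. X \<in> sets borel \<Longrightarrow> X \<inter> Y = {} \<Longrightarrow> emeasure \<nu> X \<le> emeasure \<nu>' X"
    using finite_unsigned_Hahn_decomposition[OF n1.finite_measure_axioms n2.finite_measure_axioms] by auto
  \<comment> \<open>The restriction of \<nu>' to Y. It lies below \<nu>, so Radon--Nikodym gives it
    a density against \<nu>.\<close>
  define N where "N = density \<nu>' (indicator Y)"
  have N: "emeasure N X = emeasure \<nu>' (X \<inter> Y)" if [measurable]: "X \<in> sets borel" for X
    unfolding N_def by (subst emeasure_density) (auto simp: nn_integral_indicator[symmetric] mult.commute
        indicator_inter_arith[symmetric] simp del: nn_integral_indicator)
  have le: "emeasure N X \<le> emeasure \<nu> X" if [measurable]: "X \<in> sets borel" for X
    using N[OF that] Y1[of "X \<inter> Y"] emeasure_mono[of "X \<inter> Y" X \<nu>] by (auto intro: order_trans)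
  have "absolutely_continuous \<nu> N"
    unfolding absolutely_continuous_def null_sets_def
    using le by (auto simp: N_def) (metis le_zero_eq)
  then obtain h where h0: "h \<in> borel_measurable \<nu>" and dh: "density \<nu> h = N"
    using n1.Radon_Nikodym[of N] unfolding N_def by (metis \<open>sets \<nu> = sets borel\<close> \<open>sets \<nu>' = sets borel\<close> sets_density)
  have h [measurable]: "h \<in> borel_measurable borel"
    using h0 measurable_cong_sets[of \<nu> borel borel borel] by simp
  have h1: "AE x in \<nu>. h x \<le> 1"
    by (rule density_le_AE[OF n1.finite_measure_axioms]) (use le in \<open>auto simp: dh\<close>)
  \<comment> \<open>A real-valued version of the density: \<open>density_le_AE\<close> bounds h by 1
    almost everywhere, so the truncation changes it only on a null set.\<close>
  define g0 where "g0 x = enn2real (min 1 (h x))" for x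
  define g where "g x = (if x \<in> Y then g0 x else 1)" for x
  have g0 [measurable]: "g0 \<in> borel_measurable borel"
    unfolding g0_def by measurable
  have g [measurable]: "g \<in> borel_measurable borel"
    unfolding g_def by measurable
  have g01: "0 \<le> g0 x" "g0 x \<le> 1" for x
    unfolding g0_def by (auto intro!: enn2real_leI)
  have g1: "0 \<le> g x" "g x \<le> 1" for x
    using g01 by (auto simp: g_def)
  have dg0: "density \<nu> (\<lambda>x. ennreal (g0 x)) = N"
    unfolding dh[symmetric]
  proof (rule density_cong)
    show "AE x in \<nu>. ennreal (g0 x) = h x"
      using h1 by eventually_elim (auto simp: g0_def min_absorb2 ennreal_enn2real_if top_unique)
  qed auto
  have em: "emeasure (density \<nu> g) B = emeasure \<nu>' (B \<inter> Y) + emeasure \<nu> (B - Y)" if [measurable]: "B \<in> sets borel" for B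
  proof -
    have "emeasure (density \<nu> g) B = (\<integral>\<^sup>+x. ennreal (g0 x) * indicator (B \<inter> Y) x + indicator (B - Y) x \<partial>\<nu>)"
      by (subst emeasure_density) (auto intro!: nn_integral_cong simp: g_def split: split_indicator)
    also have "\<dots> = emeasure N (B \<inter> Y) + emeasure \<nu> (B - Y)"
      unfolding dg0[symmetric] by (subst nn_integral_add) (auto simp: emeasure_density)
    finally show ?thesis
      by (simp add: N Int_assoc)
  qed
  have em': "emeasure (density \<nu> g) B \<le> emeasure \<nu>' B" if [measurable]: "B \<in> sets borel" for B
  proof -
    have "emeasure (density \<nu> g) B \<le> emeasure \<nu>' (B \<inter> Y) + emeasure \<nu>' (B - Y)"
      unfolding em[OF that] by (intro add_left_mono Y2) auto
    also have "\<dots> = emeasure \<nu>' B"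
      by (subst plus_emeasure) (auto intro!: arg_cong[where f = "emeasure \<nu>'"])
    finally show ?thesis .
  qed
  have int: "(\<integral>x. cmod (f x) \<partial>density \<nu> g) = (\<integral>x. indicator Y x * cmod (f x) \<partial>\<nu>') + (\<integral>x. indicator (-Y) x * cmod (f x) \<partial>\<nu>)"
    if f: "f \<in> Lipb" for f
  proof -
    have [measurable]: "f \<in> borel_measurable borel"
      using f by (auto intro: Lip_measurable Lipb_Lip)
    obtain B where B: "0 \<le> B" "\<And>x. cmod (f x) \<le> B"
      using LipbE[OF f] by metis
    have if1: "integrable \<nu> (\<lambda>x. u x * cmod (f x))" if [measurable]: "u \<in> borel_measurable borel" and "\<And>x. 0 \<le> u x" "\<And>x. u x \<le> 1" for u
      using B that mult_mono[of "u _" 1 "cmod (f _)" B] by (intro n1.integrable_const_bound[of _ B]) (auto simp: abs_mult)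
    have "(\<integral>x. cmod (f x) \<partial>density \<nu> g) = (\<integral>x. g x * cmod (f x) \<partial>\<nu>)"
      using g1 by (subst integral_density) auto
    also have "\<dots> = (\<integral>x. g0 x * (indicator Y x * cmod (f x)) + indicator (-Y) x * cmod (f x) \<partial>\<nu>)"
      by (intro Bochner_Integration.integral_cong) (auto simp: g_def)
    also have "\<dots> = (\<integral>x. (g0 x * indicator Y x) * cmod (f x) \<partial>\<nu>) + (\<integral>x. indicator (-Y) x * cmod (f x) \<partial>\<nu>)"
      unfolding mult.assoc[symmetric] using g01
      by (subst Bochner_Integration.integral_add) (auto intro!: if1 mult_le_one split: split_indicator)
    also have "(\<integral>x. (g0 x * indicator Y x) * cmod (f x) \<partial>\<nu>) = (\<integral>x. indicator Y x * cmod (f x) \<partial>N)"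
      unfolding dg0[symmetric] using g01 by (subst integral_density) (auto simp: mult.assoc)
    also have "\<dots> = (\<integral>x. indicator Y x * cmod (f x) \<partial>\<nu>')"
    proof -
      have "(\<integral>x. indicator Y x * cmod (f x) \<partial>density \<nu>' (\<lambda>x. ennreal (indicator Y x)))
          = (\<integral>x. indicator Y x *\<^sub>R (indicator Y x * cmod (f x)) \<partial>\<nu>')"
        by (subst integral_density) auto
      also have "\<dots> = (\<integral>x. indicator Y x * cmod (f x) \<partial>\<nu>')"
        by (intro Bochner_Integration.integral_cong) (auto split: split_indicator)
      finally show ?thesis
        unfolding N_def by (simp add: ennreal_indicator)
    qed
    finally show ?thesis .
  qed
  have "ak_mass_bound k T (density \<nu> g)"
    unfolding ak_mass_bound_def
  proof (intro conjI allI impI)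
    show "finite_radon (density \<nu> g)"
      by (rule finite_radon_mono[OF r2]) (use em' in auto)
    fix f :: "'a \<Rightarrow> complex" and \<pi> :: "('a \<Rightarrow> complex) list" assume "f \<in> Lipb" "\<pi> \<in> args Lip k"
    then show "cmod (T f \<pi>) \<le> prod_list (map (lipc UNIV) \<pi>) * (\<integral>x. cmod (f x) \<partial>density \<nu> g)"
      using mass_glue[OF T b2 b1 Y] int by simp
  qed
  then show ?thesis
    using that g g1 em' by blast
qed

text \<open>Take mass measures whose total masses approach the infimum and lower step by step with
  \<open>mass_inf\<close>: the densities against the fixed \<mu>0 decrease, and the mass bound
  survives dominated convergence. A mass measure of minimal total mass is least, because its infimum
  with any rival has the same total mass and hence agrees with it on every Borel set.\<close>

lemma exists_least_mass_measure:
  fixes T :: "('a::metric_space \<Rightarrow> complex) \<Rightarrow> ('a \<Rightarrow> complex) list \<Rightarrow> complex"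
  assumes T: "multilin Lipb Lip k T" and b0: "ak_mass_bound k T \<mu>0"
  obtains \<nu> where "ak_mass_bound k T \<nu>"
    "\<And>\<nu>' A. ak_mass_bound k T \<nu>' \<Longrightarrow> A \<in> sets borel \<Longrightarrow> emeasure \<nu> A \<le> emeasure \<nu>' A"
proof -
  have r0: "finite_radon \<mu>0"
    using b0 by (auto simp: ak_mass_bound_def)
  interpret m0: finite_measure \<mu>0 by (rule finite_radonD[OF r0])
  have [measurable_cong, simp]: "sets \<mu>0 = sets borel" "space \<mu>0 = UNIV"
    using finite_radonD r0 by auto
  define \<M> where "\<M> = {\<nu>. ak_mass_bound k T \<nu>}"
  define m where "m = (INF \<nu>\<in>\<M>. measure \<nu> UNIV)"
  have ne: "\<M> \<noteq> {}"
    using b0 by (auto simp: \<M>_def)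
  have bdd: "bdd_below ((\<lambda>\<nu>. measure \<nu> UNIV) ` \<M>)"
    by (intro bdd_belowI[of _ 0]) auto
  have m_le: "m \<le> measure \<nu> UNIV" if "ak_mass_bound k T \<nu>" for \<nu>
    unfolding m_def using that bdd by (intro cINF_lower) (auto simp: \<M>_def)
  have "\<exists>\<nu>. ak_mass_bound k T \<nu> \<and> measure \<nu> UNIV < m + 1 / real (Suc n)" for n
  proof -
    have "\<exists>\<nu>\<in>\<M>. measure \<nu> UNIV < m + 1 / real (Suc n)"
      unfolding m_def using cINF_less_iff[OF ne bdd, of "m + 1 / real (Suc n)"] by (simp add: m_def)
    then show ?thesis by (auto simp: \<M>_def)
  qed
  then obtain ns where ns: "\<And>n. ak_mass_bound k T (ns n)" "\<And>n. measure (ns n) UNIV < m + 1 / real (Suc n)"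
    by metis
  define ok where "ok g \<longleftrightarrow> g \<in> borel_measurable borel \<and> (\<forall>x. 0 \<le> g x \<and> g x \<le> 1) \<and>
     ak_mass_bound k T (density \<mu>0 (\<lambda>x. ennreal (g x)))" for g :: "'a \<Rightarrow> real"
  \<comment> \<open>Each density is lowered against the next member of the minimising sequence; the
    initial density 1 stands for \<mu>0 itself.\<close>
  have "\<exists>G. \<forall>n. ok (G n) \<and> ((\<forall>x. G (Suc n) x \<le> G n x) \<and>
        emeasure (density \<mu>0 (\<lambda>x. ennreal (G (Suc n) x))) UNIV \<le> emeasure (ns n) UNIV)"
  proof (rule dependent_nat_choice)
    have "density \<mu>0 (\<lambda>x. ennreal 1) = \<mu>0"
      by (simp add: density_1)
    then show "\<exists>g. ok g"
      using b0 by (intro exI[of _ "\<lambda>_. 1"]) (auto simp: ok_def)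
  next
    fix g n assume ok: "ok g"
    then have [measurable]: "g \<in> borel_measurable borel" and g: "\<And>x. 0 \<le> g x" "\<And>x. g x \<le> 1"
      and bd: "ak_mass_bound k T (density \<mu>0 (\<lambda>x. ennreal (g x)))"
      by (auto simp: ok_def)
    obtain h :: "'a \<Rightarrow> real" where [measurable]: "h \<in> borel_measurable borel" and h: "\<And>x. 0 \<le> h x" "\<And>x. h x \<le> 1"
      "ak_mass_bound k T (density (density \<mu>0 (\<lambda>x. ennreal (g x))) h)"
      "\<And>B. B \<in> sets borel \<Longrightarrow> emeasure (density (density \<mu>0 (\<lambda>x. ennreal (g x))) h) B \<le> emeasure (ns n) B"
      by (rule mass_inf[OF T bd ns(1)[of n]]) (rule that)
    have eq: "density (density \<mu>0 (\<lambda>x. ennreal (g x))) h = density \<mu>0 (\<lambda>x. ennreal (g x * h x))"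
      using g h by (subst density_density_eq) (auto simp: ennreal_mult)
    show "\<exists>g'. ok g' \<and> (\<forall>x. g' x \<le> g x) \<and> emeasure (density \<mu>0 (\<lambda>x. ennreal (g' x))) UNIV \<le> emeasure (ns n) UNIV"
      using g h(1,2) h(3,4)[unfolded eq]
      by (intro exI[of _ "\<lambda>x. g x * h x"]) (auto simp: ok_def mult_left_le intro!: mult_le_one)
  qed
  then obtain G where ok: "\<And>n. ok (G n)" and dec: "\<And>n x. G (Suc n) x \<le> G n x"
    and Gm: "\<And>n. emeasure (density \<mu>0 (\<lambda>x. ennreal (G (Suc n) x))) UNIV \<le> emeasure (ns n) UNIV"
    by auto
  have [measurable]: "G n \<in> borel_measurable borel" for n
    using ok by (auto simp: ok_def)
  have G01: "0 \<le> G n x" "G n x \<le> 1" for n x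
    using ok[of n] by (auto simp: ok_def)
  define g where "g x = lim (\<lambda>n. G n x)" for x
  have lim: "(\<lambda>n. G n x) \<longlonglongrightarrow> g x" for x
  proof -
    have "convergent (\<lambda>n. G n x)"
      using dec G01 by (intro Bseq_monoseq_convergent) (auto intro!: BseqI[of 1] decseq_imp_monoseq decseq_SucI)
    then show ?thesis
      unfolding g_def by (simp add: convergent_LIMSEQ_iff)
  qed
  have [measurable]: "g \<in> borel_measurable borel"
    by (rule borel_measurable_LIMSEQ_metric[OF _ lim]) simp
  have g01: "0 \<le> g x" "g x \<le> 1" for x
    using LIMSEQ_le_const[OF lim, of 0] LIMSEQ_le_const2[OF lim, of _ 1] G01 by blast+
  have g_le: "g x \<le> G n x" for n x
    using decseq_ge[OF _ lim, of x n] dec by (auto intro: decseq_SucI)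
  define \<nu> where "\<nu> = density \<mu>0 (\<lambda>x. ennreal (g x))"
  have b: "ak_mass_bound k T \<nu>"
    unfolding ak_mass_bound_def
  proof (intro conjI allI impI)
    show "finite_radon \<nu>"
    proof (rule finite_radon_mono[OF r0])
      fix A :: "'a set" assume [measurable]: "A \<in> sets borel"
      have "emeasure \<nu> A = (\<integral>\<^sup>+x. ennreal (g x) * indicator A x \<partial>\<mu>0)"
        unfolding \<nu>_def by (subst emeasure_density) auto
      also have "\<dots> \<le> (\<integral>\<^sup>+x. indicator A x \<partial>\<mu>0)"
        using g01 by (intro nn_integral_mono) (auto split: split_indicator)
      finally show "emeasure \<nu> A \<le> emeasure \<mu>0 A" by simp
    qed (simp add: \<nu>_def)
    fix f :: "'a \<Rightarrow> complex" and \<pi> :: "('a \<Rightarrow> complex) list" assume f: "f \<in> Lipb" and \<pi>: "\<pi> \<in> args Lip k"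
    have [measurable]: "f \<in> borel_measurable borel"
      using f by (auto intro: Lip_measurable Lipb_Lip)
    obtain B where B: "0 \<le> B" "\<And>x. cmod (f x) \<le> B"
      using LipbE[OF f] by metis
    have "cmod (T f \<pi>) \<le> prod_list (map (lipc UNIV) \<pi>) * (\<integral>x. G n x * cmod (f x) \<partial>\<mu>0)" for n
    proof -
      have "cmod (T f \<pi>) \<le> prod_list (map (lipc UNIV) \<pi>) * (\<integral>x. cmod (f x) \<partial>density \<mu>0 (\<lambda>x. ennreal (G n x)))"
        using ok[of n] f \<pi> by (auto simp: ok_def ak_mass_bound_def)
      then show ?thesis
        using G01 by (subst (asm) integral_density) auto
    qed
    moreover have "(\<lambda>n. \<integral>x. G n x * cmod (f x) \<partial>\<mu>0) \<longlonglongrightarrow> (\<integral>x. g x * cmod (f x) \<partial>\<mu>0)"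
    proof (rule integral_dominated_convergence[where w = "\<lambda>_. B"])
      show "AE x in \<mu>0. (\<lambda>n. G n x * cmod (f x)) \<longlonglongrightarrow> g x * cmod (f x)"
        by (intro AE_I2 tendsto_mult lim tendsto_const)
      show "AE x in \<mu>0. norm (G n x * cmod (f x)) \<le> B" for n
        using G01[of n] B mult_mono[OF G01(2)[of n] B(2)] by (auto simp: abs_mult)
    qed auto
    ultimately have "cmod (T f \<pi>) \<le> prod_list (map (lipc UNIV) \<pi>) * (\<integral>x. g x * cmod (f x) \<partial>\<mu>0)"
      by (intro LIMSEQ_le_const[OF tendsto_mult_left]) auto
    then show "cmod (T f \<pi>) \<le> prod_list (map (lipc UNIV) \<pi>) * (\<integral>x. cmod (f x) \<partial>\<nu>)"
      unfolding \<nu>_def using g01 by (subst integral_density) auto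
  qed
  have fin: "finite_measure \<nu>'" "sets \<nu>' = sets borel" "space \<nu>' = UNIV" if "ak_mass_bound k T \<nu>'" for \<nu>'
    using that finite_radonD[of \<nu>'] by (auto simp: ak_mass_bound_def)
  have "measure \<nu> UNIV \<le> m + 1 / real (Suc n)" for n
  proof -
    have "emeasure \<nu> UNIV \<le> emeasure (density \<mu>0 (\<lambda>x. ennreal (G (Suc n) x))) UNIV"
      unfolding \<nu>_def using g_le by (subst (1 2) emeasure_density) (auto intro!: nn_integral_mono ennreal_leI)
    then have "emeasure \<nu> UNIV \<le> emeasure (ns n) UNIV"
      using Gm order_trans by blast
    then have "measure \<nu> UNIV \<le> measure (ns n) UNIV"
      using fin(1)[OF b] fin(1)[OF ns(1)[of n]] by (simp add: finite_measure.emeasure_eq_measure)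
    then show ?thesis using ns(2)[of n] by simp
  qed
  moreover have "(\<lambda>n. m + 1 / real (Suc n)) \<longlonglongrightarrow> m + 0"
    by (intro tendsto_intros LIMSEQ_Suc lim_1_over_n)
  ultimately have \<nu>m: "measure \<nu> UNIV \<le> m"
    using LIMSEQ_le_const[of "\<lambda>n. m + 1 / real (Suc n)" "m + 0" "measure \<nu> UNIV"] by auto
  interpret n: finite_measure \<nu> by (rule fin[OF b])
  have [simp]: "sets \<nu> = sets borel" "space \<nu> = UNIV"
    using fin[OF b] by auto
  have "emeasure \<nu> A \<le> emeasure \<nu>' A" if b': "ak_mass_bound k T \<nu>'" and A: "A \<in> sets borel" for \<nu>' A
  proof -
    obtain h :: "'a \<Rightarrow> real" where h0: "h \<in> borel_measurable borel" and h: "\<And>x. 0 \<le> h x" "\<And>x. h x \<le> 1"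
      "ak_mass_bound k T (density \<nu> h)"
      "\<And>B. B \<in> sets borel \<Longrightarrow> emeasure (density \<nu> h) B \<le> emeasure \<nu>' B"
      by (rule mass_inf[OF T b b']) (rule that)
    let ?N = "density \<nu> (\<lambda>x. ennreal (h x))"
    interpret N: finite_measure ?N by (rule fin[OF h(3)])
    have [measurable]: "h \<in> borel_measurable \<nu>"
      using h0 measurable_cong_sets[of \<nu> borel "borel :: real measure" borel] by simp
    have le: "measure ?N B \<le> measure \<nu> B" if [measurable]: "B \<in> sets borel" for B
    proof -
      have "emeasure ?N B \<le> (\<integral>\<^sup>+x. indicator B x \<partial>\<nu>)"
        using h that by (subst emeasure_density) (auto intro!: nn_integral_mono simp del: nn_integral_indicator split: split_indicator)
      then show ?thesis
        using that by (simp add: N.emeasure_eq_measure n.emeasure_eq_measure)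
    qed
    have "measure ?N UNIV = measure ?N A + measure ?N (UNIV - A)"
      using A N.finite_measure_Diff[of UNIV A] by simp
    moreover have "measure \<nu> UNIV = measure \<nu> A + measure \<nu> (UNIV - A)"
      using A n.finite_measure_Diff[of UNIV A] by simp
    \<comment> \<open>Minimality of the total mass. Since ?N is also at most \<nu> on the complement
      of A, it cannot be smaller than \<nu> on A.\<close>
    moreover have "measure \<nu> UNIV \<le> measure ?N UNIV"
      using \<nu>m m_le[OF h(3)] by simp
    ultimately have "measure \<nu> A \<le> measure ?N A"
      using le[of "UNIV - A"] A by simp
    then have "emeasure \<nu> A \<le> emeasure ?N A"
      by (simp add: N.emeasure_eq_measure n.emeasure_eq_measure)
    then show ?thesis
      using h(4)[OF A] by (rule order_trans)
  qed
  then show ?thesis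
    using that b by blast
qed

text \<open>Two least mass measures bound each other on Borel sets and therefore coincide, so the
  description operator in \<open>mass_measure\<close> denotes one.\<close>

lemma mass_measure_least:
  assumes "ak_current k T"
  shows "ak_mass_bound k T (mass_measure k T)"
proof -
  let ?P = "\<lambda>\<mu>. ak_mass_bound k T \<mu> \<and>
     (\<forall>\<nu>. ak_mass_bound k T \<nu> \<longrightarrow> (\<forall>A\<in>sets borel. emeasure \<mu> A \<le> emeasure \<nu> A))"
  obtain \<mu>0 where "multilin Lipb Lip k T" "ak_mass_bound k T \<mu>0"
    using assms by (auto simp: ak_current_def)
  then obtain \<nu> where \<nu>: "?P \<nu>"
    using exists_least_mass_measure by metis
  have "?P (THE \<mu>. ?P \<mu>)"
  proof (rule theI[where P = ?P, OF \<nu>])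
    fix \<mu> assume \<mu>: "?P \<mu>"
    have s: "sets \<mu> = sets borel" "sets \<nu> = sets borel"
      using \<mu> \<nu> finite_radonD by (auto simp: ak_mass_bound_def)
    show "\<mu> = \<nu>"
      by (rule measure_eqI) (use \<mu> \<nu> s in \<open>auto intro!: antisym\<close>)
  qed
  then show ?thesis
    unfolding mass_measure_def by blast
qed

text \<open>Without separability an open set need not be a countable union of null balls. Inner
  regularity reduces the claim to compact subsets, which finitely many null balls cover.\<close>

lemma mass_measure_null_outside_supp:
  assumes T: "ak_current k T" and W: "open W" "W \<inter> current_supp k T = {}"
  shows "emeasure (mass_measure k T) W = 0"
proof -
  let ?\<nu> = "mass_measure k T"
  have r: "finite_radon ?\<nu>"
    using mass_measure_least[OF T] by (auto simp: ak_mass_bound_def)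
  have [simp]: "sets ?\<nu> = sets borel"
    using finite_radonD[OF r] by simp
  have "emeasure ?\<nu> K = 0" if K: "compact K" "K \<subseteq> W" for K
  proof -
    have "\<forall>x\<in>K. \<exists>e>0. emeasure ?\<nu> (ball x e) = 0"
      using W K by (force simp: current_supp_def)
    then obtain e where e: "\<And>x. x \<in> K \<Longrightarrow> e x > 0" "\<And>x. x \<in> K \<Longrightarrow> emeasure ?\<nu> (ball x (e x)) = 0"
      by metis
    obtain D where D: "D \<subseteq> K" "finite D" "K \<subseteq> (\<Union>x\<in>D. ball x (e x))"
      by (rule compactE_image[OF K(1), of K "\<lambda>x. ball x (e x)"]) (use e in force)+
    have "(\<Union>x\<in>D. ball x (e x)) \<in> null_sets ?\<nu>"
      using D e by (intro null_sets.finite_UN) (auto intro!: null_setsI)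
    moreover have "K \<in> sets ?\<nu>"
      using K by (auto intro: borel_closed compact_imp_closed)
    ultimately show ?thesis
      using D(3) by (meson null_setsD1 null_sets_subset)
  qed
  then have "(SUP K\<in>{K. compact K \<and> K \<subseteq> W}. emeasure ?\<nu> K) = 0"
    by (auto simp: SUP_eq_iff intro!: antisym SUP_least)
  then show ?thesis
    using r W by (simp add: finite_radon_def)
qed

section \<open>Calculus of metric currents\<close>

text \<open>Raising the index by 1 replaces a single entry, so the difference of a functional at two
  lists telescopes into one-slot differences, to which multilinearity applies.\<close>

definition hybrid :: "nat \<Rightarrow> 'b list \<Rightarrow> 'b list \<Rightarrow> 'b list" where
  "hybrid i xs ys = take i ys @ drop i xs"

lemma length_hybrid [simp]: "length xs = length ys \<Longrightarrow> length (hybrid i xs ys) = length ys"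
  by (auto simp: hybrid_def)

lemma nth_hybrid: "length xs = length ys \<Longrightarrow> j < length ys \<Longrightarrow> hybrid i xs ys ! j = (if j < i then ys ! j else xs ! j)"
  by (auto simp: hybrid_def nth_append)

lemma hybrid_args: "xs \<in> args D n \<Longrightarrow> ys \<in> args D n \<Longrightarrow> hybrid i xs ys \<in> args D n"
  by (auto simp: args_def hybrid_def dest!: in_set_takeD in_set_dropD)

lemma sum_hybrid:
  fixes H :: "'b list \<Rightarrow> 'c::ab_group_add"
  assumes "length xs = n" "length ys = n"
  shows "H xs - H ys = (\<Sum>i<n. H ((hybrid i xs ys)[i := xs ! i]) - H ((hybrid i xs ys)[i := ys ! i]))"
proof -
  have "(hybrid i xs ys)[i := xs ! i] = hybrid i xs ys" "(hybrid i xs ys)[i := ys ! i] = hybrid (Suc i) xs ys" if "i < n" for i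
    using assms that by (auto intro!: nth_equalityI simp: nth_hybrid nth_list_update)
  then have "(\<Sum>i<n. H ((hybrid i xs ys)[i := xs ! i]) - H ((hybrid i xs ys)[i := ys ! i]))
      = (\<Sum>i<n. H (hybrid i xs ys) - H (hybrid (Suc i) xs ys))"
    by (intro sum.cong) auto
  also have "\<dots> = H (hybrid 0 xs ys) - H (hybrid n xs ys)"
    by (rule sum_lessThan_telescope')
  finally show ?thesis
    using assms by (simp add: hybrid_def)
qed

section \<open>Radial retraction, supports and cutoffs\<close>

definition ball_retract :: "real \<Rightarrow> 'a::real_normed_vector \<Rightarrow> 'a" where
  "ball_retract R x = (if norm x \<le> R then x else (R / norm x) *\<^sub>R x)"

lemma norm_ball_retract_le: "0 \<le> R \<Longrightarrow> norm (ball_retract R x) \<le> R"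
  by (auto simp: ball_retract_def)

lemma ball_retract_id: "norm x \<le> R \<Longrightarrow> ball_retract R x = x"
  by (auto simp: ball_retract_def)

text \<open>In a general normed space the radial retraction is not 1-Lipschitz; the difference of
  the radial factors costs a second copy of the distance, whence 2.\<close>

lemma ball_retract_lipschitz:
  assumes "0 \<le> R"
  shows "2-lipschitz_on UNIV (ball_retract R :: 'a::real_normed_vector \<Rightarrow> 'a)"
proof -
  have in_out: "norm (x - (R / norm y) *\<^sub>R y) \<le> 2 * norm (x - y)" if "norm x \<le> R" "R < norm y" for x y :: 'a
  proof -
    have y: "0 < norm y"
      using that norm_ge_zero[of x] assms by linarith
    have "x - (R / norm y) *\<^sub>R y = (x - y) + (1 - R / norm y) *\<^sub>R y"
      by (simp add: algebra_simps)
    then have "norm (x - (R / norm y) *\<^sub>R y) \<le> norm (x - y) + norm ((1 - R / norm y) *\<^sub>R y)"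
      by (metis norm_triangle_ineq)
    also have "norm ((1 - R / norm y) *\<^sub>R y) = norm y - R"
      using that y assms by (simp add: field_simps)
    also have "\<dots> \<le> norm (x - y)"
      using that norm_triangle_ineq2[of y x] by (simp add: norm_minus_commute)
    finally show ?thesis by simp
  qed
  have out_out: "norm ((R / norm x) *\<^sub>R x - (R / norm y) *\<^sub>R y) \<le> 2 * norm (x - y)"
    if "R < norm x" "R < norm y" for x y :: 'a
  proof -
    have p: "0 < norm x" "0 < norm y"
      using that assms by linarith+
    have "(R / norm x) *\<^sub>R x - (R / norm y) *\<^sub>R y = (R / norm x) *\<^sub>R (x - y) + (R / norm x - R / norm y) *\<^sub>R y"
      by (simp add: algebra_simps)
    then have "norm ((R / norm x) *\<^sub>R x - (R / norm y) *\<^sub>R y)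
        \<le> norm ((R / norm x) *\<^sub>R (x - y)) + norm ((R / norm x - R / norm y) *\<^sub>R y)"
      by (metis norm_triangle_ineq)
    also have "norm ((R / norm x) *\<^sub>R (x - y)) = (R / norm x) * norm (x - y)"
      using assms p by simp
    also have "norm ((R / norm x - R / norm y) *\<^sub>R y) = (R / norm x) * \<bar>norm y - norm x\<bar>"
    proof -
      have "(R / norm x - R / norm y) * norm y = (R / norm x) * (norm y - norm x)"
        using p by (simp add: field_simps)
      then have "\<bar>R / norm x - R / norm y\<bar> * norm y = (R / norm x) * \<bar>norm y - norm x\<bar>"
        using assms p abs_mult[of "R / norm x - R / norm y" "norm y"] abs_mult[of "R / norm x" "norm y - norm x"] by simp
      then show ?thesis by simp
    qed
    also have "(R / norm x) * norm (x - y) + (R / norm x) * \<bar>norm y - norm x\<bar> \<le> 1 * norm (x - y) + 1 * norm (x - y)"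
      using that assms p norm_triangle_ineq3[of x y]
      by (intro add_mono mult_mono) (auto simp: divide_le_eq abs_minus_commute)
    finally show ?thesis by simp
  qed
  show ?thesis
  proof (rule lipschitz_onI)
    fix x y :: 'a
    show "dist (ball_retract R x) (ball_retract R y) \<le> 2 * dist x y"
      using in_out[of x y] in_out[of y x] out_out[of x y]
      by (auto simp: ball_retract_def dist_norm norm_minus_commute)
  qed simp
qed

lemma fsupp_mult_subset: "fsupp (\<lambda>x. f x * g x) \<subseteq> fsupp f"
  unfolding fsupp_def by (intro closure_mono) auto

lemma fsupp_subset_closed: "closed S \<Longrightarrow> (\<And>x. f x \<noteq> 0 \<Longrightarrow> x \<in> S) \<Longrightarrow> fsupp f \<subseteq> S"
  unfolding fsupp_def by (intro closure_minimal) auto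

lemma Lipb_inverse:
  assumes u: "u \<in> Lipb" and e: "0 < e" "\<And>x. e \<le> cmod (u x)"
  shows "(\<lambda>x. inverse (u x)) \<in> Lipb"
proof -
  obtain C where C: "0 \<le> C" "C-lipschitz_on UNIV u"
    using LipbE[OF u] by metis
  have nz: "u x \<noteq> 0" for x
    using e(1) e(2)[of x] by auto
  show ?thesis
  proof (rule LipbI)
    show "cmod (inverse (u x)) \<le> inverse e" for x
      using e by (simp add: norm_inverse le_imp_inverse_le)
    show "(C * (inverse e * inverse e))-lipschitz_on UNIV (\<lambda>x. inverse (u x))"
    proof (rule lipschitz_onI)
      fix x y
      have "inverse (u x) - inverse (u y) = (u y - u x) * (inverse (u x) * inverse (u y))"
        using nz by (simp add: field_simps)
      then have "dist (inverse (u x)) (inverse (u y)) = dist (u x) (u y) * (inverse (cmod (u x)) * inverse (cmod (u y)))"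
        by (simp add: dist_norm norm_mult norm_inverse norm_minus_commute)
      also have "\<dots> \<le> (C * dist x y) * (inverse e * inverse e)"
        using e C lipschitz_onD[OF C(2), of x y] nz by (intro mult_mono) auto
      finally show "dist (inverse (u x)) (inverse (u y)) \<le> C * (inverse e * inverse e) * dist x y"
        by (simp add: algebra_simps)
    qed (use C e in auto)
  qed
qed

text \<open>The width 1/2 keeps the closed support strictly inside the open ball of radius R + 1.
  For R = \<open>R0\<close> this is the region where \<open>ball_retract (R0 + 1)\<close> is the
  identity.\<close>

lemma norm_cutoff:
  fixes R :: real
  obtains \<theta> :: "'a::real_normed_vector \<Rightarrow> complex" where "\<theta> \<in> Lipb" "\<And>x. norm x \<le> R \<Longrightarrow> \<theta> x = 1" "\<And>x. \<theta> x \<noteq> 0 \<Longrightarrow> norm x \<le> R + 1/2"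
    "fsupp \<theta> \<subseteq> cball 0 (R + 1/2)"
proof
  let ?u = "\<lambda>x::'a. max 0 (min 1 (2 * R + 1 - 2 * norm x))"
  show "(\<lambda>x. complex_of_real (?u x)) \<in> Lipb"
  proof (rule Lipb_of_real[of 2 _ 1])
    show "2-lipschitz_on UNIV ?u"
    proof (rule lipschitz_onI)
      fix x y :: 'a
      show "dist (?u x) (?u y) \<le> 2 * dist x y"
        using norm_triangle_ineq3[of x y] unfolding dist_norm real_norm_def by linarith
    qed simp
  qed auto
  show "complex_of_real (?u x) = 1" if "norm x \<le> R" for x :: 'a
    using that by (simp add: max_def min_def)
  show "norm x \<le> R + 1/2" if "complex_of_real (?u x) \<noteq> 0" for x :: 'a
    using that by (auto simp: max_def min_def split: if_splits)
  then show "fsupp (\<lambda>x. complex_of_real (?u x)) \<subseteq> cball 0 (R + 1/2)"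
    by (intro fsupp_subset_closed) auto
qed

lemma finite_net_of_bounded:
  assumes "\<And>x. cmod (f x) \<le> B" "0 < e"
  obtains N where "finite N" "\<And>x. \<exists>c\<in>N. cmod (f x - c) < e"
proof -
  obtain N where N: "finite N" "cball (0::complex) B \<subseteq> (\<Union>c\<in>N. ball c e)"
    by (rule compactE_image[of "cball (0::complex) B" "cball 0 B" "\<lambda>c. ball c e"]) (use assms in auto)
  show ?thesis
  proof (rule that[OF N(1)])
    fix x
    have "f x \<in> cball 0 B"
      using assms(1) by simp
    then show "\<exists>c\<in>N. cmod (f x - c) < e"
      using N(2) by (fastforce simp: dist_norm norm_minus_commute)
  qed
qed

text \<open>Concentration on the annulus is stated almost everywhere for a mass measure, so that
  first arguments agreeing on the annulus are interchangeable; later entries have to agree on an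
  open set around the support of the first argument. Bidimension (0, k) means that a single entry
  holomorphic near that support makes T vanish.\<close>

locale annulus_current =
  fixes T :: "('a::complex_normed_vector \<Rightarrow> complex) \<Rightarrow> ('a \<Rightarrow> complex) list \<Rightarrow> complex"
    and k :: nat and \<nu> :: "'a measure" and r R0 :: real
  assumes multi: "multilin Lipb Lip k T"
    and cont: "ak_continuous k T"
    and loc: "locality Lipb Lip k T"
    and mass: "ak_mass_bound k T \<nu>"
    and bidim: "bidim 0 k Lipb Lip k T"
    and bd_zero: "ak_bd_zero k T"
    and r_pos: "0 < r" and R0_nonneg: "0 \<le> R0"
    and concentrated: "AE x in \<nu>. r \<le> norm x \<and> norm x \<le> R0"
begin

section \<open>Linearity, locality and mass of the current\<close>

lemma radon: "finite_radon \<nu>"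
  using mass by (simp add: ak_mass_bound_def)

lemma sets_nu [simp, measurable_cong]: "sets \<nu> = sets borel"
  using finite_radonD[OF radon] by simp

lemma space_nu [simp]: "space \<nu> = UNIV"
  using finite_radonD[OF radon] by simp

sublocale nu: finite_measure \<nu>
  by (rule finite_radonD[OF radon])

lemma int_nu: "f \<in> Lipb \<Longrightarrow> integrable \<nu> (\<lambda>x. cmod (f x))"
  by (intro integrable_norm Lipb_integrable) (auto intro: nu.finite_measure_axioms)

lemmas T_bound = ak_mass_boundD[OF mass]

lemma T_lin: "f \<in> Lipb \<Longrightarrow> g \<in> Lipb \<Longrightarrow> \<pi> \<in> args Lip k \<Longrightarrow> T (\<lambda>x. c * f x + g x) \<pi> = c * T f \<pi> + T g \<pi>"
  by (rule multilin_lin[OF multi])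

lemma T_add: "f \<in> Lipb \<Longrightarrow> g \<in> Lipb \<Longrightarrow> \<pi> \<in> args Lip k \<Longrightarrow> T (\<lambda>x. f x + g x) \<pi> = T f \<pi> + T g \<pi>"
  by (rule multilin_add[OF multi])

lemma T_zero: "\<pi> \<in> args Lip k \<Longrightarrow> T (\<lambda>x. 0) \<pi> = 0"
  using T_lin[of "\<lambda>x. 0" "\<lambda>x. 0" \<pi> 1] by simp

lemma T_scale: "f \<in> Lipb \<Longrightarrow> \<pi> \<in> args Lip k \<Longrightarrow> T (\<lambda>x. c * f x) \<pi> = c * T f \<pi>"
  using T_lin[of f "\<lambda>x. 0" \<pi> c] T_zero by simp

lemma T_diff: "f \<in> Lipb \<Longrightarrow> g \<in> Lipb \<Longrightarrow> \<pi> \<in> args Lip k \<Longrightarrow> T (\<lambda>x. f x - g x) \<pi> = T f \<pi> - T g \<pi>"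
  using T_lin[of g f \<pi> "-1"] by simp

lemma T_sum: "finite N \<Longrightarrow> (\<And>c. c \<in> N \<Longrightarrow> h c \<in> Lipb) \<Longrightarrow> \<pi> \<in> args Lip k \<Longrightarrow>
    T (\<lambda>x. \<Sum>c\<in>N. h c x) \<pi> = (\<Sum>c\<in>N. T (h c) \<pi>) \<and> (\<lambda>x. \<Sum>c\<in>N. h c x) \<in> Lipb"
  by (induction N rule: finite_induct) (auto simp: T_zero T_add Lipb_add)

lemma T_lin_arg: "f \<in> Lipb \<Longrightarrow> \<pi> \<in> args Lip k \<Longrightarrow> g \<in> Lip \<Longrightarrow> h \<in> Lip \<Longrightarrow> i < k \<Longrightarrow>
    T f (\<pi>[i := (\<lambda>x. c * g x + h x)]) = c * T f (\<pi>[i := g]) + T f (\<pi>[i := h])"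
  by (rule multilin_lin_arg[OF multi])

lemma T_diff_arg: "f \<in> Lipb \<Longrightarrow> \<pi> \<in> args Lip k \<Longrightarrow> g \<in> Lip \<Longrightarrow> h \<in> Lip \<Longrightarrow> i < k \<Longrightarrow>
    T f (\<pi>[i := (\<lambda>x. g x - h x)]) = T f (\<pi>[i := g]) - T f (\<pi>[i := h])"
  using T_lin_arg[of f \<pi> h g i "-1"] by simp

lemma T_add_arg: "f \<in> Lipb \<Longrightarrow> \<pi> \<in> args Lip k \<Longrightarrow> g \<in> Lip \<Longrightarrow> h \<in> Lip \<Longrightarrow> i < k \<Longrightarrow>
    T f (\<pi>[i := (\<lambda>x. g x + h x)]) = T f (\<pi>[i := g]) + T f (\<pi>[i := h])"
  using T_lin_arg[of f \<pi> g h i 1] by simp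

lemma T_const_arg:
  assumes "f \<in> Lipb" "\<pi> \<in> args Lip k" "i < k" "p \<in> Lip" "open V" "fsupp f \<subseteq> V" "\<And>x. x \<in> V \<Longrightarrow> p x = c"
  shows "T f (\<pi>[i := p]) = 0"
proof -
  have "\<pi>[i := p] ! i = p"
    using assms args_length by fastforce
  then show ?thesis
    using loc assms args_update[OF assms(2,4), of i] unfolding locality_def by metis
qed

lemma T_cong_arg:
  assumes f: "f \<in> Lipb" and \<pi>: "\<pi> \<in> args Lip k" and i: "i < k" and pq: "p \<in> Lip" "q \<in> Lip"
    and V: "open V" "fsupp f \<subseteq> V" "\<And>x. x \<in> V \<Longrightarrow> p x = q x"
  shows "T f (\<pi>[i := p]) = T f (\<pi>[i := q])"
  using T_diff_arg[OF f \<pi> pq i] T_const_arg[OF f \<pi> i Lip_diff[OF pq] V(1,2), of 0] V(3) by simp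

lemma T_cong_args:
  assumes f: "f \<in> Lipb" and \<pi>: "\<pi> \<in> args Lip k" and \<pi>': "\<pi>' \<in> args Lip k"
    and V: "open V" "fsupp f \<subseteq> V" "\<And>x i. x \<in> V \<Longrightarrow> i < k \<Longrightarrow> (\<pi> ! i) x = (\<pi>' ! i) x"
  shows "T f \<pi> = T f \<pi>'"
proof -
  have "T f \<pi> - T f \<pi>' = (\<Sum>i<k. T f ((hybrid i \<pi> \<pi>')[i := \<pi> ! i]) - T f ((hybrid i \<pi> \<pi>')[i := \<pi>' ! i]))"
    using \<pi> \<pi>' by (intro sum_hybrid) (auto simp: args_def)
  also have "\<dots> = 0"
    using args_nth[OF \<pi>] args_nth[OF \<pi>'] V
    by (intro sum.neutral ballI) (simp add: T_cong_arg[OF f hybrid_args[OF \<pi> \<pi>'] _ _ _ V(1,2)])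
  finally show ?thesis by simp
qed

text \<open>The difference of the two first arguments vanishes \<nu>-almost everywhere, and the mass
  bound sees only \<nu>.\<close>

lemma T_cong_first:
  assumes "f \<in> Lipb" "g \<in> Lipb" and \<pi>: "\<pi> \<in> args Lip k"
    and eq: "\<And>x. r \<le> norm x \<Longrightarrow> norm x \<le> R0 \<Longrightarrow> f x = g x"
  shows "T f \<pi> = T g \<pi>"
proof -
  have "\<exists>C. C-lipschitz_on UNIV (\<pi> ! j)" if "j < k" for j
    using args_nth[OF \<pi> that] by (auto simp: Lip_def)
  then obtain L where "\<And>j. j < k \<Longrightarrow> (L j)-lipschitz_on UNIV (\<pi> ! j)"
    by metis
  then have "cmod (T (\<lambda>x. f x - g x) \<pi>) \<le> (\<Prod>j<k. L j) * (\<integral>x. cmod (f x - g x) \<partial>\<nu>)"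
    using assms by (intro T_bound) (auto intro: Lipb_diff)
  also have "(\<integral>x. cmod (f x - g x) \<partial>\<nu>) = (\<integral>x. 0 \<partial>\<nu>)"
  proof (rule integral_cong_AE)
    show "AE x in \<nu>. cmod (f x - g x) = 0"
      using concentrated by eventually_elim (simp add: eq)
  qed (use Lip_measurable[OF Lipb_Lip[OF assms(1)]] Lip_measurable[OF Lipb_Lip[OF assms(2)]] in auto)
  finally show ?thesis
    using T_diff[OF assms(1,2) \<pi>] by simp
qed

section \<open>The Leibniz rule in one entry\<close>

lemma T_bound_slot:
  assumes \<pi>: "\<pi> \<in> args Lip k" and j: "j < k"
  obtains P where "0 \<le> P" "\<And>h p c. h \<in> Lipb \<Longrightarrow> c-lipschitz_on UNIV p \<Longrightarrow>
      cmod (T h (\<pi>[j := p])) \<le> P * c * (\<integral>x. cmod (h x) \<partial>\<nu>)"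
proof -
  have "\<exists>C. C-lipschitz_on UNIV (\<pi> ! j)" if "j < k" for j
    using args_nth[OF \<pi> that] by (auto simp: Lip_def)
  then obtain L where L: "\<And>j. j < k \<Longrightarrow> (L j)-lipschitz_on UNIV (\<pi> ! j)"
    by metis
  show ?thesis
  proof (rule that[of "\<Prod>i\<in>{..<k} - {j}. L i"])
    show "0 \<le> (\<Prod>i\<in>{..<k} - {j}. L i)"
      using L by (intro prod_nonneg) (auto dest: lipschitz_on_nonneg)
    fix h p :: "'a \<Rightarrow> complex" and c assume h: "h \<in> Lipb" and p: "c-lipschitz_on UNIV p"
    have "cmod (T h (\<pi>[j := p])) \<le> (\<Prod>i<k. (L(j := c)) i) * (\<integral>x. cmod (h x) \<partial>\<nu>)"
      using h args_update[OF \<pi> LipI[OF p]] L p args_length[OF \<pi>]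
      by (intro T_bound) (auto simp: nth_list_update)
    also have "(\<Prod>i<k. (L(j := c)) i) = (\<Prod>i\<in>{..<k} - {j}. L i) * c"
      using j by (subst prod.remove[of _ j]) auto
    finally show "cmod (T h (\<pi>[j := p])) \<le> (\<Prod>i\<in>{..<k} - {j}. L i) * c * (\<integral>x. cmod (h x) \<partial>\<nu>)" .
  qed
qed

text \<open>Retracting \<open>f - c\<close> and \<open>g - d\<close> to a small disc changes nothing near the support of \<open>h\<close>, by locality,
  and makes every term small by the mass bound; no chain rule is needed.\<close>
lemma T_product_local:
  assumes P: "0 \<le> P" "\<And>h p c. h \<in> Lipb \<Longrightarrow> c-lipschitz_on UNIV p \<Longrightarrow>
      cmod (T h (\<pi>[j := p])) \<le> P * c * (\<integral>x. cmod (h x) \<partial>\<nu>)"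
    and \<pi>: "\<pi> \<in> args Lip k" and j: "j < k"
    and f: "f \<in> Lipb" "Cf-lipschitz_on UNIV f" and g: "g \<in> Lipb" "Cg-lipschitz_on UNIV g" and h: "h \<in> Lipb"
    and \<eta>: "0 < \<eta>" and small: "\<And>x. h x \<noteq> 0 \<Longrightarrow> cmod (f x - c) \<le> \<eta> \<and> cmod (g x - d) \<le> \<eta>"
  shows "cmod (T h (\<pi>[j := \<lambda>x. f x * g x]) - T (\<lambda>x. h x * f x) (\<pi>[j := g]) - T (\<lambda>x. h x * g x) (\<pi>[j := f]))
     \<le> 5 * P * \<eta> * (Cf + Cg) * (\<integral>x. cmod (h x) \<partial>\<nu>)"
proof -
  define f1 where "f1 x = ball_retract (2*\<eta>) (f x - c)" for x
  define g1 where "g1 x = ball_retract (2*\<eta>) (g x - d)" for x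
  let ?I = "\<integral>x. cmod (h x) \<partial>\<nu>"
  note [simp] = Lipb_Lip[OF f(1)] Lipb_Lip[OF g(1)] f(1) g(1) h \<pi> j
  have fcL [simp]: "(\<lambda>x. f x - c) \<in> Lipb" and gdL [simp]: "(\<lambda>x. g x - d) \<in> Lipb"
    using f g by (auto intro: Lipb_diff[OF _ Lipb_const])
  have [simp]: "(\<lambda>x. h x * (f x - c)) \<in> Lipb" "(\<lambda>x. h x * (g x - d)) \<in> Lipb"
    by (rule Lipb_mult[OF h fcL] Lipb_mult[OF h gdL])+
  have [simp]: "(\<lambda>x. d * f x - c * d) \<in> Lip"
    by (rule Lip_diff[OF Lip_cmult Lip_const]) simp
  have [simp]: "\<pi>[j := g] \<in> args Lip k" "\<pi>[j := f] \<in> args Lip k"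
    by (auto intro!: args_update)
  have C: "0 \<le> Cf" "0 \<le> Cg"
    using f(2) g(2) lipschitz_on_nonneg by auto
  have fc: "Cf-lipschitz_on UNIV (\<lambda>x. f x - c)" and gd: "Cg-lipschitz_on UNIV (\<lambda>x. g x - d)"
    using f(2) g(2) by (auto simp: lipschitz_on_def dist_norm)
  have f1: "(2*Cf)-lipschitz_on UNIV f1" "\<And>x. cmod (f1 x) \<le> 2*\<eta>"
    unfolding f1_def using \<eta> lipschitz_on_compose2[OF fc lipschitz_on_subset[OF ball_retract_lipschitz, of "2*\<eta>"]] norm_ball_retract_le[of "2*\<eta>"]
    by (auto simp: mult.commute)
  have g1: "(2*Cg)-lipschitz_on UNIV g1" "\<And>x. cmod (g1 x) \<le> 2*\<eta>"
    unfolding g1_def using \<eta> lipschitz_on_compose2[OF gd lipschitz_on_subset[OF ball_retract_lipschitz, of "2*\<eta>"]] norm_ball_retract_le[of "2*\<eta>"]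
    by (auto simp: mult.commute)
  have fg1: "(2*Cf * (2*\<eta>) + 2*\<eta> * (2*Cg))-lipschitz_on UNIV (\<lambda>x. f1 x * g1 x)"
    by (rule lipschitz_on_mult_bounded[OF f1(1) g1(1) f1(2) g1(2)])
  note [simp] = LipI[OF fg1] Lipb_Lip[OF Lipb_mult[OF f(1) g(1)]]
  \<comment> \<open>The closeness up to \<eta> extends to the closed support of h. Retracting at
    radius 2 \<eta> leaves room for an open neighbourhood V of it on which both retractions are the
    identity.\<close>
  define V where "V = {x. cmod (f x - c) < 2*\<eta>} \<inter> {x. cmod (g x - d) < 2*\<eta>}"
  have V: "open V"
    unfolding V_def by (intro open_Int open_Collect_less continuous_intros Lip_continuous) auto
  have "fsupp h \<subseteq> {x. cmod (f x - c) \<le> \<eta>} \<inter> {x. cmod (g x - d) \<le> \<eta>}"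
    by (intro fsupp_subset_closed closed_Int closed_Collect_le continuous_intros Lip_continuous) (use small in auto)
  then have hV: "fsupp h \<subseteq> V"
    using \<eta> by (force simp: V_def)
  \<comment> \<open>Expansion of f g about the constants c and d: the affine terms reproduce the
    Leibniz terms up to errors weighted by f - c and g - d, and only the product of the retracted
    differences is new.\<close>
  have "T h (\<pi>[j := \<lambda>x. f x * g x]) = T h (\<pi>[j := \<lambda>x. 1 * (f1 x * g1 x) + (c * g x + (d * f x + (- (c * d))))])"
  proof (rule T_cong_arg[OF _ _ _ _ _ V hV])
    show "(\<lambda>x. 1 * (f1 x * g1 x) + (c * g x + (d * f x + (- (c * d))))) \<in> Lip"
      by (intro Lip_add Lip_cmult) auto
    fix x assume "x \<in> V"
    then have *: "f1 x = f x - c" "g1 x = g x - d"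
      by (auto simp: V_def f1_def g1_def intro!: ball_retract_id)
    show "f x * g x = 1 * (f1 x * g1 x) + (c * g x + (d * f x + (- (c * d))))"
      unfolding * by (simp add: algebra_simps)
  qed auto
  also have "\<dots> = T h (\<pi>[j := \<lambda>x. f1 x * g1 x]) + (c * T h (\<pi>[j := g]) + (d * T h (\<pi>[j := f]) + T h (\<pi>[j := \<lambda>x. - (c * d)])))"
    by (subst T_lin_arg; (subst T_lin_arg)?; (subst T_lin_arg)?) (auto intro!: Lip_add Lip_cmult)
  also have "T h (\<pi>[j := \<lambda>x. - (c * d)]) = 0"
    by (rule T_const_arg[of _ _ _ _ UNIV]) auto
  finally have e1: "T h (\<pi>[j := \<lambda>x. f x * g x]) = T h (\<pi>[j := \<lambda>x. f1 x * g1 x]) + (c * T h (\<pi>[j := g]) + d * T h (\<pi>[j := f]))"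
    by simp
  have e2: "T (\<lambda>x. h x * f x) (\<pi>[j := g]) = T (\<lambda>x. h x * (f x - c)) (\<pi>[j := g]) + c * T h (\<pi>[j := g])"
  proof -
    have "(\<lambda>x. h x * f x) = (\<lambda>x. c * h x + h x * (f x - c))"
      by (auto simp: algebra_simps)
    then show ?thesis
      using T_lin[of h "\<lambda>x. h x * (f x - c)" "\<pi>[j := g]" c] by (auto intro!: args_update)
  qed
  have e3: "T (\<lambda>x. h x * g x) (\<pi>[j := f]) = T (\<lambda>x. h x * (g x - d)) (\<pi>[j := f]) + d * T h (\<pi>[j := f])"
  proof -
    have "(\<lambda>x. h x * g x) = (\<lambda>x. d * h x + h x * (g x - d))"
      by (auto simp: algebra_simps)
    then show ?thesis
      using T_lin[of h "\<lambda>x. h x * (g x - d)" "\<pi>[j := f]" d] by (auto intro!: args_update)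
  qed
  have i: "(\<integral>x. cmod (h x * u x) \<partial>\<nu>) \<le> \<eta> * ?I" if "u \<in> Lipb" "\<And>x. h x \<noteq> 0 \<Longrightarrow> cmod (u x) \<le> \<eta>" for u
  proof -
    have "(\<integral>x. cmod (h x * u x) \<partial>\<nu>) \<le> (\<integral>x. \<eta> * cmod (h x) \<partial>\<nu>)"
    proof (intro integral_mono int_nu integrable_mult_right)
      show "cmod (h x * u x) \<le> \<eta> * cmod (h x)" for x
        using that(2)[of x] by (cases "h x = 0") (auto simp: norm_mult mult.commute)
    qed (use that in \<open>auto intro: Lipb_mult\<close>)
    then show ?thesis by simp
  qed
  have "cmod (T h (\<pi>[j := \<lambda>x. f x * g x]) - T (\<lambda>x. h x * f x) (\<pi>[j := g]) - T (\<lambda>x. h x * g x) (\<pi>[j := f]))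
    = cmod (T h (\<pi>[j := \<lambda>x. f1 x * g1 x]) - T (\<lambda>x. h x * (f x - c)) (\<pi>[j := g]) - T (\<lambda>x. h x * (g x - d)) (\<pi>[j := f]))"
    unfolding e1 e2 e3 by (simp add: algebra_simps)
  also have "\<dots> \<le> cmod (T h (\<pi>[j := \<lambda>x. f1 x * g1 x])) + cmod (T (\<lambda>x. h x * (f x - c)) (\<pi>[j := g]))
      + cmod (T (\<lambda>x. h x * (g x - d)) (\<pi>[j := f]))"
    by (smt (verit) norm_triangle_ineq4)
  \<comment> \<open>The product of the two retractions has Lipschitz constant 4 \<eta> (Cf + Cg);
    the other two terms contribute \<eta> Cg and \<eta> Cf. Together this is the factor 5.\<close>
  also have "\<dots> \<le> P * (2*Cf * (2*\<eta>) + 2*\<eta> * (2*Cg)) * ?I + P * Cg * (\<eta> * ?I) + P * Cf * (\<eta> * ?I)"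
  proof (intro add_mono)
    show "cmod (T (\<lambda>x. h x * (f x - c)) (\<pi>[j := g])) \<le> P * Cg * (\<eta> * ?I)"
      using i[of "\<lambda>x. f x - c"] small C P(1)
      by (intro order_trans[OF P(2)[OF _ g(2)]] mult_left_mono) auto
    show "cmod (T (\<lambda>x. h x * (g x - d)) (\<pi>[j := f])) \<le> P * Cf * (\<eta> * ?I)"
      using i[of "\<lambda>x. g x - d"] small C P(1)
      by (intro order_trans[OF P(2)[OF _ f(2)]] mult_left_mono) auto
  qed (use P(2)[OF h fg1] in simp)
  also have "\<dots> = 5 * P * \<eta> * (Cf + Cg) * ?I"
    by (simp add: algebra_simps)
  finally show ?thesis .
qed

text \<open>A partition of unity splits h into pieces on which f and g each stay within \<eta> of a
  constant, and the local estimate applies to each piece. The absolute values of the pieces add up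
  to that of h, so the total error is proportional to \<eta> whatever the number of pieces, and
  \<eta> tends to 0.\<close>

lemma T_product:
  assumes h: "h \<in> Lipb" and f: "f \<in> Lipb" and g: "g \<in> Lipb" and \<pi>: "\<pi> \<in> args Lip k" and j: "j < k"
  shows "T h (\<pi>[j := \<lambda>x. f x * g x]) = T (\<lambda>x. h x * f x) (\<pi>[j := g]) + T (\<lambda>x. h x * g x) (\<pi>[j := f])"
proof -
  obtain P where P: "0 \<le> P" "\<And>h p c. h \<in> Lipb \<Longrightarrow> c-lipschitz_on UNIV p \<Longrightarrow>
      cmod (T h (\<pi>[j := p])) \<le> P * c * (\<integral>x. cmod (h x) \<partial>\<nu>)"
    by (rule T_bound_slot[OF \<pi> j]) (rule that)
  obtain Cf slot_primitive where Cf: "0 \<le> Cf" "Cf-lipschitz_on UNIV f" "\<And>x. cmod (f x) \<le> slot_primitive"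
    using LipbE[OF f] by metis
  obtain Cg Bg where Cg: "0 \<le> Cg" "Cg-lipschitz_on UNIV g" "\<And>x. cmod (g x) \<le> Bg"
    using LipbE[OF g] by metis
  define E where "E h = T h (\<pi>[j := \<lambda>x. f x * g x]) - T (\<lambda>x. h x * f x) (\<pi>[j := g]) - T (\<lambda>x. h x * g x) (\<pi>[j := f])" for h
  have args: "\<pi>[j := \<lambda>x. f x * g x] \<in> args Lip k" "\<pi>[j := g] \<in> args Lip k" "\<pi>[j := f] \<in> args Lip k"
    using f g \<pi> by (auto intro!: args_update Lipb_Lip Lipb_mult)
  have E_sum: "E (\<lambda>x. \<Sum>c\<in>N. u c x) = (\<Sum>c\<in>N. E (u c))" if "finite N" "\<And>c. c \<in> N \<Longrightarrow> u c \<in> Lipb" for N :: "(complex \<times> complex) set" and u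
  proof -
    have "u c \<in> Lipb \<and> (\<lambda>x. u c x * f x) \<in> Lipb \<and> (\<lambda>x. u c x * g x) \<in> Lipb" if "c \<in> N" for c
      using \<open>\<And>c. c \<in> N \<Longrightarrow> u c \<in> Lipb\<close>[OF that] f g by (auto intro: Lipb_mult)
    then show ?thesis
      unfolding E_def sum_distrib_right using that args by (simp add: T_sum sum_subtractf)
  qed
  have main: "cmod (E h) \<le> (5 * P * (Cf + Cg) * (\<integral>x. cmod (h x) \<partial>\<nu>)) * \<eta>" if \<eta>: "0 < \<eta>" for \<eta>
  proof -
    \<comment> \<open>Mesh \<eta>/4 in each factor leaves some bump of height at least \<eta>/2 at
      every point, which keeps the normalising sum away from 0.\<close>
    obtain Nf where Nf: "finite Nf" "\<And>x. \<exists>c\<in>Nf. cmod (f x - c) < \<eta>/4"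
      by (rule finite_net_of_bounded[of f slot_primitive "\<eta>/4", OF Cf(3)]) (use \<eta> in simp, rule that)
    obtain Ng where Ng: "finite Ng" "\<And>x. \<exists>c\<in>Ng. cmod (g x - c) < \<eta>/4"
      by (rule finite_net_of_bounded[of g Bg "\<eta>/4", OF Cg(3)]) (use \<eta> in simp, rule that)
    define N where "N = Nf \<times> Ng"
    have N: "finite N"
      using Nf Ng by (simp add: N_def)
    define \<psi> where "\<psi> c x = max 0 (\<eta> - (cmod (f x - fst c) + cmod (g x - snd c)))" for c :: "complex \<times> complex" and x
    have \<psi>: "0 \<le> \<psi> c x" "\<psi> c x \<le> \<eta>" for c x
      using \<eta> norm_ge_zero[of "f x - fst c"] norm_ge_zero[of "g x - snd c"] unfolding \<psi>_def by linarith+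
    have \<psi>L: "(\<lambda>x. complex_of_real (\<psi> c x)) \<in> Lipb" for c
    proof (rule Lipb_of_real)
      show "(Cf + Cg)-lipschitz_on UNIV (\<psi> c)"
      proof (rule lipschitz_onI)
        fix x y
        have "dist (\<psi> c x) (\<psi> c y) \<le> \<bar>cmod (f x - fst c) - cmod (f y - fst c)\<bar> + \<bar>cmod (g x - snd c) - cmod (g y - snd c)\<bar>"
          by (auto simp: \<psi>_def dist_real_def)
        also have "\<dots> \<le> cmod (f x - f y) + cmod (g x - g y)"
          using norm_triangle_ineq3[of "f x - fst c" "f y - fst c"] norm_triangle_ineq3[of "g x - snd c" "g y - snd c"]
          by simp
        also have "\<dots> \<le> Cf * dist x y + Cg * dist x y"
          using lipschitz_onD[OF Cf(2), of x y] lipschitz_onD[OF Cg(2), of x y] by (simp add: dist_norm)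
        finally show "dist (\<psi> c x) (\<psi> c y) \<le> (Cf + Cg) * dist x y"
          by (simp add: algebra_simps)
      qed (use Cf Cg in auto)
      show "\<bar>\<psi> c x\<bar> \<le> \<eta>" for x
        using \<psi>[of c x] by simp
    qed
    define s where "s x = (\<Sum>c\<in>N. complex_of_real (\<psi> c x))" for x
    have s_real: "s x = complex_of_real (\<Sum>c\<in>N. \<psi> c x)" for x
      by (simp add: s_def)
    have s_norm: "cmod (s x) = (\<Sum>c\<in>N. \<psi> c x)" for x
      unfolding s_real norm_of_real using \<psi> by (simp add: sum_nonneg)
    have s: "\<eta>/2 \<le> cmod (s x)" for x
    proof -
      obtain c d where cd: "c \<in> Nf" "d \<in> Ng" "cmod (f x - c) < \<eta>/4" "cmod (g x - d) < \<eta>/4"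
        using Nf(2) Ng(2) by meson
      then have "\<eta>/2 \<le> \<psi> (c, d) x"
        unfolding \<psi>_def fst_conv snd_conv by linarith
      also have "\<dots> \<le> (\<Sum>c\<in>N. \<psi> c x)"
        using N cd \<psi> by (intro member_le_sum) (auto simp: N_def)
      finally show ?thesis
        by (simp add: s_norm)
    qed
    have sL: "s \<in> Lipb"
      unfolding s_def using T_sum[of N "\<lambda>c x. complex_of_real (\<psi> c x)" \<pi>] N \<psi>L \<pi> by blast
    have s0: "s x \<noteq> 0" for x
      using s[of x] \<eta> by auto
    define u where "u c x = h x * inverse (s x) * complex_of_real (\<psi> c x)" for c x
    have uL: "u c \<in> Lipb" for c
      unfolding u_def using h \<psi>L Lipb_inverse[OF sL _ s] \<eta> by (intro Lipb_mult) auto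
    have h_eq: "h = (\<lambda>x. \<Sum>c\<in>N. u c x)"
      unfolding u_def by (rule ext) (simp add: s0 flip: sum_distrib_left s_def)
    have norm_u: "(\<Sum>c\<in>N. cmod (u c x)) = cmod (h x)" for x
    proof -
      have "(\<Sum>c\<in>N. cmod (u c x)) = cmod (h x) * inverse (cmod (s x)) * (\<Sum>c\<in>N. \<psi> c x)"
        using \<psi> by (simp add: u_def norm_mult norm_inverse sum_distrib_left)
      also have "(\<Sum>c\<in>N. \<psi> c x) = cmod (s x)"
        by (simp add: s_norm)
      finally show ?thesis
        using s0 by simp
    qed
    have "cmod (E h) \<le> (\<Sum>c\<in>N. cmod (E (u c)))"
      by (subst h_eq, subst E_sum[OF N uL]) (rule norm_sum)
    also have "\<dots> \<le> (\<Sum>c\<in>N. 5 * P * \<eta> * (Cf + Cg) * (\<integral>x. cmod (u c x) \<partial>\<nu>))"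
    proof (rule sum_mono)
      fix c
      show "cmod (E (u c)) \<le> 5 * P * \<eta> * (Cf + Cg) * (\<integral>x. cmod (u c x) \<partial>\<nu>)"
        unfolding E_def
      proof (rule T_product_local[OF P \<pi> j f Cf(2) g Cg(2) uL \<eta>, of _ "fst c" "snd c"])
        fix x assume "u c x \<noteq> 0"
        then have "\<psi> c x \<noteq> 0"
          by (auto simp: u_def)
        then have "cmod (f x - fst c) + cmod (g x - snd c) < \<eta>"
          by (auto simp: \<psi>_def)
        then show "cmod (f x - fst c) \<le> \<eta> \<and> cmod (g x - snd c) \<le> \<eta>"
          using norm_ge_zero[of "f x - fst c"] norm_ge_zero[of "g x - snd c"] by linarith
      qed
    qed
    also have "\<dots> = 5 * P * \<eta> * (Cf + Cg) * (\<integral>x. (\<Sum>c\<in>N. cmod (u c x)) \<partial>\<nu>)"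
      using int_nu[OF uL] by (subst Bochner_Integration.integral_sum) (auto simp: sum_distrib_left)
    finally show ?thesis
      by (simp add: norm_u algebra_simps)
  qed
  have "cmod (E h) \<le> 0"
  proof (rule tendsto_lowerbound[where F = "at_right (0::real)"])
    show "((\<lambda>\<eta>. (5 * P * (Cf + Cg) * (\<integral>x. cmod (h x) \<partial>\<nu>)) * \<eta>) \<longlongrightarrow> 0) (at_right 0)"
      by (rule tendsto_eq_intros refl)+ simp
    show "\<forall>\<^sub>F \<eta> in at_right 0. cmod (E h) \<le> 5 * P * (Cf + Cg) * (\<integral>x. cmod (h x) \<partial>\<nu>) * \<eta>"
      using main by (auto simp: eventually_at_filter)
  qed simp
  then show ?thesis
    by (simp add: E_def algebra_simps)
qed

text \<open>In \<open>ak_bd\<close> the first entry becomes the first argument of the boundary and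
  must be bounded. This is why everything below that rests on alternation takes its entries from
  \<open>Lipb\<close>.\<close>

lemma T_one: "0 < k \<Longrightarrow> \<pi> \<in> args Lipb k \<Longrightarrow> T (\<lambda>_. 1) \<pi> = 0"
proof -
  assume "0 < k" and \<pi>: "\<pi> \<in> args Lipb k"
  then obtain f \<pi>' where *: "\<pi> = f # \<pi>'" "f \<in> Lipb" "\<pi>' \<in> args Lipb (k - 1)"
    by (cases \<pi>) (auto simp: args_def)
  then have "\<pi>' \<in> args Lip (k - 1)"
    using args_mono[OF Lipb_subset_Lip] by blast
  with * show ?thesis
    using bd_zero \<open>0 < k\<close> by (auto simp: ak_bd_zero_def ak_bd_def)
qed

lemma args_Lip: "\<pi> \<in> args Lipb k \<Longrightarrow> \<pi> \<in> args Lip k"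
  using args_mono[OF Lipb_subset_Lip] by blast

text \<open>The Leibniz rule with weight 1 expands the entry h g, and its left side is a value of
  the boundary, hence 0.\<close>

lemma T_swap_first:
  assumes "h \<in> Lipb" "g \<in> Lipb" "\<pi> \<in> args Lipb k" "j < k"
  shows "T h (\<pi>[j := g]) = - T g (\<pi>[j := h])"
  using T_product[of "\<lambda>_. 1" h g \<pi> j] T_one[of "\<pi>[j := \<lambda>x. h x * g x]"] assms
  by (simp add: args_Lip args_update Lipb_mult eq_neg_iff_add_eq_0)

text \<open>Swapping h into slot i leaves f both as first argument and in slot j. Twice such a value
  is, by the Leibniz rule, T(1, ..., f^2, ...), which vanishes with the boundary.\<close>

lemma T_alternating:
  assumes "h \<in> Lipb" "f \<in> Lipb" "\<pi> \<in> args Lipb k" "i < k" "j < k" "i \<noteq> j"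
  shows "T h (\<pi>[i := f, j := f]) = 0"
proof -
  have "T h (\<pi>[i := f, j := f]) = T h (\<pi>[j := f, i := f])"
    using assms by (simp add: list_update_swap)
  also have "\<dots> = - T f (\<pi>[j := f, i := h])"
    using assms by (intro T_swap_first) (auto intro: args_update)
  also have "\<dots> = - T f (\<pi>[i := h, j := f])"
    using assms by (simp add: list_update_swap)
  also have "T f (\<pi>[i := h, j := f]) = 0"
    using T_product[of "\<lambda>_. 1" f f "\<pi>[i := h]" j] T_one[of "\<pi>[i := h, j := \<lambda>x. f x * f x]"] assms
    by (simp add: args_Lip args_update Lipb_mult)
  finally show ?thesis by simp
qed

text \<open>Polarisation of \<open>T_alternating\<close> at a + b.\<close>

lemma T_antisym:
  assumes h: "h \<in> Lipb" and ab: "a \<in> Lipb" "b \<in> Lipb" and \<pi>: "\<pi> \<in> args Lipb k" and ij: "i < k" "j < k" "i \<noteq> j"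
  shows "T h (\<pi>[i := a, j := b]) = - T h (\<pi>[i := b, j := a])"
proof -
  let ?s = "\<lambda>x. a x + b x"
  have s: "?s \<in> Lipb"
    using ab by (rule Lipb_add)
  have *: "T h (\<pi>[i := ?s, j := p]) = T h (\<pi>[i := a, j := p]) + T h (\<pi>[i := b, j := p])" if "p \<in> Lipb" for p
    using T_add_arg[of h "\<pi>[j := p]" a b i] h ab \<pi> ij that
    by (simp add: list_update_swap[of i j] args_Lip args_update Lipb_Lip)
  have "0 = T h (\<pi>[i := ?s, j := ?s])"
    using T_alternating[OF h s \<pi> ij] by simp
  also have "\<dots> = T h (\<pi>[i := ?s, j := a]) + T h (\<pi>[i := ?s, j := b])"
    using h ab s \<pi> ij by (intro T_add_arg) (auto intro!: args_Lip args_update Lipb_Lip)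
  also have "\<dots> = T h (\<pi>[i := b, j := a]) + T h (\<pi>[i := a, j := b])"
    using * ab T_alternating[OF h _ \<pi> ij] by simp
  finally show ?thesis
    by (simp add: eq_neg_iff_add_eq_0 add.commute)
qed

text \<open>\<open>ak_continuous\<close> keeps the first argument fixed. Its variation is absorbed
  by the mass bound, using the common Lipschitz constant of the other entries and dominated
  convergence in \<nu>.\<close>

lemma T_tendsto:
  assumes f: "f \<in> Lipb" "\<And>n. fs n \<in> Lipb" and \<pi>: "\<pi> \<in> args Lip k" "\<And>n. ps n \<in> args Lip k"
    and fl: "\<And>x. (\<lambda>n. fs n x) \<longlonglongrightarrow> f x" and B: "\<And>n x. cmod (fs n x) \<le> B"
    and pl: "\<And>j x. j < k \<Longrightarrow> (\<lambda>n. (ps n ! j) x) \<longlonglongrightarrow> (\<pi> ! j) x"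
    and C: "\<And>n j. j < k \<Longrightarrow> C-lipschitz_on UNIV (ps n ! j)"
  shows "(\<lambda>n. T (fs n) (ps n)) \<longlonglongrightarrow> T f \<pi>"
proof -
  have 1: "(\<lambda>n. T f (ps n)) \<longlonglongrightarrow> T f \<pi>"
    using cont f \<pi> pl C unfolding ak_continuous_def by blast
  have 2: "(\<lambda>n. T (\<lambda>x. fs n x - f x) (ps n)) \<longlonglongrightarrow> 0"
  proof (rule Lim_null_comparison)
    show "\<forall>\<^sub>F n in sequentially. norm (T (\<lambda>x. fs n x - f x) (ps n)) \<le> (\<Prod>j<k. C) * (\<integral>x. cmod (fs n x - f x) \<partial>\<nu>)"
      using f \<pi> C by (intro always_eventually allI T_bound) (auto intro: Lipb_diff)
    have [measurable]: "f \<in> borel_measurable borel" "fs n \<in> borel_measurable borel" for n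
      using f by (auto intro: Lip_measurable Lipb_Lip)
    have slot_primitive: "cmod (f x) \<le> B" for x
      using B by (intro LIMSEQ_le_const2[OF tendsto_norm[OF fl]]) auto
    have "(\<lambda>n. \<integral>x. cmod (fs n x - f x) \<partial>\<nu>) \<longlonglongrightarrow> (\<integral>x. 0 \<partial>\<nu>)"
    proof (rule integral_dominated_convergence[where w = "\<lambda>_. 2 * B"])
      show "AE x in \<nu>. (\<lambda>n. cmod (fs n x - f x)) \<longlonglongrightarrow> 0"
        using fl by (intro AE_I2 tendsto_norm_zero) (auto simp: LIM_zero_iff)
      show "AE x in \<nu>. norm (cmod (fs n x - f x)) \<le> 2 * B" for n
      proof (rule AE_I2)
        fix x
        show "norm (cmod (fs n x - f x)) \<le> 2 * B"
          using B[of n x] slot_primitive[of x] norm_triangle_ineq4[of "fs n x" "f x"] by simp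
      qed
    qed auto
    then show "(\<lambda>n. (\<Prod>j<k. C) * (\<integral>x. cmod (fs n x - f x) \<partial>\<nu>)) \<longlonglongrightarrow> 0"
      by (intro tendsto_mult_right_zero) simp
  qed
  have "(\<lambda>n. T (\<lambda>x. fs n x - f x) (ps n) + T f (ps n)) \<longlonglongrightarrow> 0 + T f \<pi>"
    by (intro tendsto_add 1 2)
  then show ?thesis
    using f \<pi> by (simp add: T_diff)
qed

end

section \<open>The Cauchy--Pompeiu formula\<close>

definition has_dir_deriv :: "complex \<Rightarrow> (complex \<Rightarrow> complex) \<Rightarrow> (complex \<Rightarrow> complex) \<Rightarrow> bool" where
  "has_dir_deriv e g g' \<longleftrightarrow> (\<forall>z. ((\<lambda>t. g (z + of_real t * e)) has_vector_derivative g' z) (at 0))"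

lemma has_dir_deriv_at:
  assumes "has_dir_deriv e g g'"
  shows "((\<lambda>t. g (z + of_real t * e)) has_vector_derivative g' (z + of_real s * e)) (at s)"
proof -
  have "((\<lambda>t. g (z + of_real s * e + of_real t * e)) has_vector_derivative g' (z + of_real s * e)) (at ((\<lambda>t. t - s) s))"
    using assms by (simp add: has_dir_deriv_def)
  moreover have "((\<lambda>t. t - s) has_vector_derivative 1) (at s)"
    by (auto intro!: derivative_eq_intros)
  ultimately have "((\<lambda>t. g (z + of_real s * e + of_real t * e)) \<circ> (\<lambda>t. t - s) has_vector_derivative 1 *\<^sub>R g' (z + of_real s * e)) (at s)"
    by (intro vector_diff_chain_at)
  then show ?thesis
    by (simp add: o_def algebra_simps)
qed

lemma has_dir_deriv_bound:
  assumes d: "has_dir_deriv e g g'" and B: "\<And>s. 0 \<le> s \<Longrightarrow> s \<le> h \<Longrightarrow> cmod (g' (z + of_real s * e)) \<le> B" and h: "0 \<le> h"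
  shows "cmod (g (z + of_real h * e) - g z) \<le> B * h"
proof -
  have "norm ((\<lambda>t. g (z + of_real t * e)) h - (\<lambda>t. g (z + of_real t * e)) 0) \<le> B * norm (h - 0)"
  proof (rule differentiable_bound[of "{0..h}"])
    show "((\<lambda>t. g (z + of_real t * e)) has_derivative (\<lambda>u. u *\<^sub>R g' (z + of_real s * e))) (at s within {0..h})" for s
      using has_dir_deriv_at[OF d, of z s] by (auto simp: has_vector_derivative_def intro: has_derivative_at_withinI)
    show "onorm (\<lambda>u. u *\<^sub>R g' (z + of_real s * e)) \<le> B" if "s \<in> {0..h}" for s
      by (intro onorm_le) (use B[of s] that in \<open>auto simp: mult.commute[of B] intro!: mult_left_mono\<close>)
  qed (use h in auto)
  then show ?thesis
    using h by simp
qed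

lemma has_dir_deriv_quot:
  assumes "has_dir_deriv e g g'" and h: "h \<longlonglongrightarrow> 0" "\<And>n. h n \<noteq> (0::real)"
  shows "(\<lambda>n. (g (z + of_real (h n) * e) - g z) / of_real (h n)) \<longlonglongrightarrow> g' z"
proof -
  have "((\<lambda>t. norm (g (z + of_real t * e) - g z - t *\<^sub>R g' z) / norm t) \<longlongrightarrow> 0) (at 0)"
    using assms(1)[unfolded has_dir_deriv_def, rule_format, of z]
    unfolding has_vector_derivative_def has_derivative_at by simp
  moreover have "filterlim h (at 0) sequentially"
    using h by (auto simp: filterlim_at)
  ultimately have lim: "(\<lambda>n. norm (g (z + of_real (h n) * e) - g z - h n *\<^sub>R g' z) / norm (h n)) \<longlonglongrightarrow> 0"
    by (rule filterlim_compose)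
  have "norm (g (z + of_real (h n) * e) - g z - h n *\<^sub>R g' z) / norm (h n)
      = norm ((g (z + of_real (h n) * e) - g z) / of_real (h n) - g' z)" for n
  proof -
    have "(g (z + of_real (h n) * e) - g z) / of_real (h n) - g' z
        = (g (z + of_real (h n) * e) - g z - h n *\<^sub>R g' z) / of_real (h n)"
      using h(2)[of n] by (simp add: diff_divide_distrib scaleR_conv_of_real)
    then show ?thesis
      by (simp add: norm_divide)
  qed
  with lim have "(\<lambda>n. norm ((g (z + of_real (h n) * e) - g z) / of_real (h n) - g' z)) \<longlonglongrightarrow> 0"
    by simp
  then show ?thesis
    by (simp only: tendsto_norm_zero_iff LIM_zero_iff)
qed

section \<open>Integration over the complex plane\<close>

lemma integrable_compact_support:
  fixes f :: "complex \<Rightarrow> complex"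
  assumes "continuous_on UNIV f" "\<And>z. M < cmod z \<Longrightarrow> f z = 0"
  shows "integrable lborel f"
proof -
  have "integrable lborel (\<lambda>z. indicator (cball 0 M) z *\<^sub>R f z)"
    using assms(1) by (intro borel_integrable_compact) (auto intro: continuous_on_subset)
  also have "(\<lambda>z. indicator (cball 0 M) z *\<^sub>R f z) = f"
    using assms(2) by (auto simp: indicator_def fun_eq_iff not_le)
  finally show ?thesis .
qed

lemma continuous_compact_support_bounded:
  fixes f :: "complex \<Rightarrow> complex"
  assumes "continuous_on UNIV f" "\<And>z. M < cmod z \<Longrightarrow> f z = 0"
  obtains B where "0 \<le> B" "\<And>z. cmod (f z) \<le> B"
proof -
  have "compact (f ` cball 0 M)"
    using assms(1) by (intro compact_continuous_image) (auto intro: continuous_on_subset)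
  then obtain B where B: "\<forall>z\<in>cball 0 M. cmod (f z) \<le> B"
    by (auto dest!: compact_imp_bounded simp: bounded_iff)
  show ?thesis
  proof (rule that[of "max 0 B"])
    show "cmod (f z) \<le> max 0 B" for z
      using B[rule_format, of z] assms(2)[of z] by (cases "M < cmod z") auto
  qed simp
qed

lemma lborel_integral_affine:
  fixes f :: "complex \<Rightarrow> complex"
  assumes c: "c \<noteq> (0::real)" and [measurable]: "f \<in> borel_measurable borel"
  shows "(\<integral>z. f z \<partial>lborel) = (\<integral>u. c\<^sup>2 *\<^sub>R f (t + c *\<^sub>R u) \<partial>lborel)"
proof -
  have "(\<integral>z. f z \<partial>lborel) = (\<integral>z. f z \<partial>density (distr lborel borel (\<lambda>x. t + c *\<^sub>R x)) (\<lambda>_. ennreal (\<bar>c\<bar> ^ DIM(complex))))"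
    using lborel_affine[OF c, of t] by simp
  also have "\<dots> = (\<integral>z. (c\<^sup>2) *\<^sub>R f z \<partial>distr lborel borel (\<lambda>x. t + c *\<^sub>R x))"
    by (subst integral_density) auto
  also have "\<dots> = (\<integral>u. c\<^sup>2 *\<^sub>R f (t + c *\<^sub>R u) \<partial>lborel)"
    by (subst integral_distr) auto
  finally show ?thesis .
qed

lemma cball_borel [measurable]: "cball (z::complex) M \<in> sets borel"
  by simp

lemma integrable_cball: "integrable lborel (indicat_real (cball (z::complex) M))"
  using emeasure_lborel_cball_finite[of z M] by (intro integrable_real_indicator) (auto simp: less_top)

text \<open>By translation invariance every difference quotient integrates to 0, and dominated
  convergence passes to the derivative.\<close>

lemma integral_dir_deriv_zero:
  assumes d: "has_dir_deriv e g g'" and c: "continuous_on UNIV g" "continuous_on UNIV g'"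
    and M: "\<And>z. M < cmod z \<Longrightarrow> g z = 0" "\<And>z. M < cmod z \<Longrightarrow> g' z = 0"
  shows "(\<integral>z. g' z \<partial>lborel) = 0"
proof -
  obtain B where B: "0 \<le> B" "\<And>z. cmod (g' z) \<le> B"
    using continuous_compact_support_bounded[OF c(2) M(2)] by metis
  define h where "h n = 1 / real (Suc n)" for n
  have h: "h \<longlonglongrightarrow> 0" "\<And>n. h n \<noteq> 0" "\<And>n. 0 \<le> h n" "\<And>n. h n \<le> 1"
    unfolding h_def using LIMSEQ_Suc[OF lim_1_over_n] by auto
  have [measurable]: "g \<in> borel_measurable borel" "g' \<in> borel_measurable borel"
    using c by (auto intro: borel_measurable_continuous_onI)
  let ?q = "\<lambda>n z. (g (z + of_real (h n) * e) - g z) / of_real (h n)"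
  have int: "integrable lborel g" "integrable lborel (\<lambda>z. g (z + of_real (h n) * e))" for n
  proof -
    show "integrable lborel g"
      by (rule integrable_compact_support[OF c(1) M(1)])
    show "integrable lborel (\<lambda>z. g (z + of_real (h n) * e))"
    proof (rule integrable_compact_support[where M = "M + cmod e"])
      show "continuous_on UNIV (\<lambda>z. g (z + of_real (h n) * e))"
        by (rule continuous_on_compose2[OF c(1)]) (auto intro!: continuous_intros)
      fix z assume z: "M + cmod e < cmod z"
      have "cmod (of_real (h n) * e) \<le> cmod e"
        using h(3,4)[of n] by (simp add: norm_mult mult_left_le_one_le)
      then have "M < cmod (z + of_real (h n) * e)"
        using z norm_diff_ineq[of z "of_real (h n) * e"] by linarith
      then show "g (z + of_real (h n) * e) = 0"
        by (rule M)
    qed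
  qed
  have zero: "(\<integral>z. ?q n z \<partial>lborel) = 0" for n
  proof -
    have "(\<integral>z. g (z + of_real (h n) * e) \<partial>lborel) = (\<integral>z. g z \<partial>lborel)"
      using lborel_integral_affine[of 1 g "of_real (h n) * e"] by (simp add: add.commute)
    then show ?thesis
      using int by simp
  qed
  have conv: "(\<lambda>n. \<integral>z. ?q n z \<partial>lborel) \<longlonglongrightarrow> (\<integral>z. g' z \<partial>lborel)"
  \<comment> \<open>The steps are at most 1, so the translated functions live in the disc enlarged
    by |e|.\<close>
  proof (rule integral_dominated_convergence[where w = "\<lambda>z. indicator (cball 0 (M + cmod e)) z * B"])
    show "AE z in lborel. (\<lambda>n. ?q n z) \<longlonglongrightarrow> g' z"
      by (intro AE_I2 has_dir_deriv_quot[OF d] h)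
    show "AE z in lborel. norm (?q n z) \<le> indicator (cball 0 (M + cmod e)) z * B" for n
    proof (rule AE_I2)
      fix z
      have 1: "cmod (g (z + of_real (h n) * e) - g z) \<le> B * h n"
        using B h by (intro has_dir_deriv_bound[OF d]) auto
      have "cmod (?q n z) = cmod (g (z + of_real (h n) * e) - g z) / h n"
        using h(3)[of n] by (simp add: norm_divide)
      also have "\<dots> \<le> B"
        using 1 h(2,3)[of n] by (simp add: divide_le_eq less_le)
      finally have 2: "cmod (?q n z) \<le> B" .
      show "norm (?q n z) \<le> indicator (cball 0 (M + cmod e)) z * B"
      proof (cases "cmod z \<le> M + cmod e")
        case False
        have "cmod (of_real (h n) * e) \<le> cmod e"
          using h(3,4)[of n] by (simp add: norm_mult mult_left_le_one_le)
        then have "M < cmod (z + of_real (h n) * e)" "M < cmod z"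
          using False norm_diff_ineq[of z "of_real (h n) * e"] norm_ge_zero[of e] by linarith+
        then show ?thesis
          using False by (simp add: M)
      qed (use 2 in simp)
    qed
    show "integrable lborel (\<lambda>z. indicator (cball (0::complex) (M + cmod e)) z * B)"
      by (intro integrable_mult_left integrable_cball)
  qed auto
  from LIMSEQ_unique[OF conv[unfolded zero] tendsto_const] show ?thesis .
qed

text \<open>A substitute for polar coordinates: the function is dominated by a sum of multiples of
  indicators of discs, whose areas are proportional to the squared radii.\<close>

lemma integrable_by_balls:
  fixes g :: "complex \<Rightarrow> real"
  assumes [measurable]: "g \<in> borel_measurable borel" and g: "\<And>u. 0 \<le> g u"
    and c: "\<And>n. 0 \<le> c n" "\<And>n. 0 \<le> \<rho> n" "summable (\<lambda>n. c n * (\<rho> n)\<^sup>2)"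
    and le: "\<And>u. g u \<noteq> 0 \<Longrightarrow> \<exists>n. g u \<le> c n \<and> cmod u \<le> \<rho> n"
  shows "integrable lborel g"
proof (rule integrableI_nonneg)
  have "(\<integral>\<^sup>+u. ennreal (g u) \<partial>lborel) \<le> (\<integral>\<^sup>+u. (\<Sum>n. ennreal (c n) * indicator (cball (0::complex) (\<rho> n)) u) \<partial>lborel)"
  proof (rule nn_integral_mono)
    fix u :: complex
    show "ennreal (g u) \<le> (\<Sum>n. ennreal (c n) * indicator (cball 0 (\<rho> n)) u)"
    proof (cases "g u = 0")
      case False
      then obtain n where n: "g u \<le> c n" "cmod u \<le> \<rho> n"
        using le by blast
      then have "ennreal (g u) \<le> ennreal (c n) * indicator (cball 0 (\<rho> n)) u"
        by (simp add: ennreal_leI)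
      also have "\<dots> \<le> (\<Sum>n. ennreal (c n) * indicator (cball 0 (\<rho> n)) u)"
        using sum_le_suminf[of "\<lambda>n. ennreal (c n) * indicator (cball 0 (\<rho> n)) u" "{n}"]
        by (simp del: sum_mult_indicator)
      finally show ?thesis .
    qed simp
  qed
  also have "\<dots> = (\<Sum>n. ennreal (c n) * emeasure lborel (cball (0::complex) (\<rho> n)))"
    by (subst nn_integral_suminf) (auto simp: nn_integral_cmult)
  also have "\<dots> = (\<Sum>n. ennreal (c n * (\<rho> n)\<^sup>2 * unit_ball_vol 2))"
    using c by (intro arg_cong[where f = suminf] ext) (simp add: emeasure_cball ennreal_mult' mult_ac)
  also have "\<dots> < \<infinity>"
    using c summable_mult2[OF c(3), of "unit_ball_vol 2"]
    by (subst suminf_ennreal2) (auto simp: unit_ball_vol_nonneg intro!: mult_nonneg_nonneg)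
  finally show "(\<integral>\<^sup>+u. ennreal (g u) \<partial>lborel) < \<infinity>" .
qed (use g in auto)

lemma integrable_inverse_norm:
  "integrable lborel (\<lambda>w::complex. indicator (cball 0 1) w * inverse (cmod w))"
\<comment> \<open>Dyadic shells: for 2^-(n+1) < |w| \<le> 2^-n the value is below 2^(n+1) and the
  area of order 4^-n, which gives a convergent geometric series.\<close>
proof (rule integrable_by_balls[where c = "\<lambda>n. 2 ^ Suc n" and \<rho> = "\<lambda>n. (1/2) ^ n"])
  have "(\<lambda>n. 2 ^ Suc n * ((1/2::real) ^ n)\<^sup>2) = (\<lambda>n. 2 * (1/2) ^ n)"
    by (auto simp: fun_eq_iff power2_eq_square simp flip: power_mult_distrib mult.assoc)
  then show "summable (\<lambda>n. 2 ^ Suc n * ((1/2::real) ^ n)\<^sup>2)"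
    by (auto intro!: summable_mult summable_geometric)
  fix u :: complex assume u: "indicator (cball 0 1) u * inverse (cmod u) \<noteq> 0"
  then have u': "0 < cmod u" "cmod u \<le> 1"
    by (auto simp: indicator_def split: if_splits)
  obtain n where n: "(1/2) ^ n < cmod u"
    using real_arch_pow_inv[of "cmod u" "1/2"] u' by auto
  define m where "m = (LEAST n. (1/2) ^ n < cmod u)"
  have m: "(1/2) ^ m < cmod u"
    unfolding m_def by (rule LeastI[of _ n]) (rule n)
  then have "m \<noteq> 0"
    using u' by (intro notI) simp
  then obtain l where l: "m = Suc l"
    using not0_implies_Suc by blast
  then have "cmod u \<le> (1/2) ^ l"
    using not_less_Least[of l "\<lambda>n. (1/2) ^ n < cmod u"] by (simp add: m_def not_less)
  moreover have "inverse (cmod u) \<le> 2 ^ Suc l"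
    using m u' unfolding l by (simp add: field_simps power_one_over)
  ultimately show "\<exists>n. indicator (cball 0 1) u * inverse (cmod u) \<le> 2 ^ Suc n \<and> cmod u \<le> (1/2) ^ n"
    using u' by (intro exI[of _ l]) (auto simp: indicator_def)
qed auto

text \<open>The singularity at 1 is that of \<open>integrable_inverse_norm\<close> translated; at
  distance more than 1 from it the kernel is at most 1.\<close>

lemma integrable_cauchy_kernel:
  "integrable lborel (\<lambda>z::complex. indicator (cball 0 M) z * inverse (cmod (z - 1)))"
proof (rule Bochner_Integration.integrable_bound)
  let ?f = "\<lambda>w::complex. indicator (cball 0 1) w * inverse (cmod w)"
  have "lborel = distr lborel borel ((+) (1::complex))"
    by (rule lborel_distr_plus[symmetric])
  then have "integrable (distr lborel borel ((+) (1::complex))) (\<lambda>z. ?f (z - 1))"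
    by (subst integrable_distr_eq) (auto simp: integrable_inverse_norm)
  then have "integrable lborel (\<lambda>z. ?f (z - 1))"
    by (simp add: lborel_distr_plus)
  then show "integrable lborel (\<lambda>z. ?f (z - 1) + indicator (cball 0 M) z)"
    by (intro Bochner_Integration.integrable_add integrable_cball)
  show "AE z in lborel. norm (indicator (cball 0 M) z * inverse (cmod (z - 1))) \<le> norm (?f (z - 1) + indicator (cball 0 M) z)"
  proof (rule AE_I2)
    fix z :: complex
    have "inverse (cmod (z - 1)) \<le> 1" if "\<not> cmod (z - 1) \<le> 1"
      using that by (simp add: inverse_le_1_iff)
    then show "norm (indicator (cball 0 M) z * inverse (cmod (z - 1))) \<le> norm (?f (z - 1) + indicator (cball 0 M) z)"
      by (auto simp: indicator_def)
  qed
qed auto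

text \<open>Up to scaling, the Wirtinger derivative of the regularised kernel
  \<open>cnj w / (|w|\<^sup>2 + \<eta>\<^sup>2)\<close> replacing \<open>1 / w\<close>. The value \<open>2\<pi>\<close> of its integral is never needed.\<close>
definition cp_kernel :: "complex \<Rightarrow> real" where
  "cp_kernel u = 2 / (1 + (cmod u)\<^sup>2)\<^sup>2"

definition cp_const :: real where
  "cp_const = (\<integral>u. cp_kernel u \<partial>lborel)"

lemma cp_kernel_measurable [measurable]: "cp_kernel \<in> borel_measurable borel"
  unfolding cp_kernel_def by measurable

lemma cp_kernel_nonneg: "0 \<le> cp_kernel u"
  by (simp add: cp_kernel_def)

lemma cp_kernel_integrable: "integrable lborel cp_kernel"
\<comment> \<open>On the shell 2^l < |u| \<le> 2^(l+1) the kernel is at most 2 / 16^l, which is 32 /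
  16^(l+1), while areas grow like 4^(l+1).\<close>
proof (rule integrable_by_balls[where c = "\<lambda>n. 32 * (1/16) ^ n" and \<rho> = "\<lambda>n. 2 ^ n"])
  have "(\<lambda>n. 32 * (1/16) ^ n * ((2::real) ^ n)\<^sup>2) = (\<lambda>n. 32 * (1/4) ^ n)"
    by (auto simp: fun_eq_iff power2_eq_square simp flip: power_mult_distrib mult.assoc)
  then show "summable (\<lambda>n. 32 * (1/16) ^ n * ((2::real) ^ n)\<^sup>2)"
    by (auto intro!: summable_mult summable_geometric)
  fix u :: complex
  obtain n where n: "cmod u \<le> 2 ^ n"
    using real_arch_pow[of 2 "cmod u"] by (auto intro: less_imp_le)
  define m where "m = (LEAST n. cmod u \<le> 2 ^ n)"
  have m: "cmod u \<le> 2 ^ m"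
    unfolding m_def by (rule LeastI[of _ n]) (rule n)
  have "cp_kernel u \<le> 32 * (1/16) ^ m"
  proof (cases m)
    case 0
    have "1 \<le> (1 + (cmod u)\<^sup>2)\<^sup>2"
      by simp
    then have "cp_kernel u \<le> 2"
      unfolding cp_kernel_def by (simp add: divide_le_eq)
    then show ?thesis
      by (simp add: 0)
  next
    case (Suc l)
    then have "2 ^ l < cmod u"
      using not_less_Least[of l "\<lambda>n. cmod u \<le> 2 ^ n"] by (simp add: m_def not_le)
    then have "(2 ^ l) ^ 4 \<le> cmod u ^ 4"
      by (intro power_mono) auto
    also have "\<dots> = ((cmod u)\<^sup>2)\<^sup>2"
      by (simp flip: power_mult)
    also have "\<dots> \<le> (1 + (cmod u)\<^sup>2)\<^sup>2"
      by (intro power_mono) auto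
    finally have "(2 ^ l) ^ 4 \<le> (1 + (cmod u)\<^sup>2)\<^sup>2" .
    then have "cp_kernel u \<le> 2 / (2 ^ l) ^ 4"
      unfolding cp_kernel_def by (intro frac_le) auto
    also have "(2 ^ l) ^ 4 = (16::real) ^ l"
      using power_mult[of "2::real" l 4] power_mult[of "2::real" 4 l] by (simp add: mult.commute)
    finally show ?thesis
      by (simp add: Suc power_one_over field_simps)
  qed
  with m show "\<exists>n. cp_kernel u \<le> 32 * (1/16) ^ n \<and> cmod u \<le> 2 ^ n"
    by blast
qed (auto simp: cp_kernel_nonneg)

lemma cp_const_pos: "0 < cp_const"
proof -
  have "0 < measure lborel (cball (0::complex) 1) * (1/2)"
    using content_cball_pos[of 1 "0::complex"] by simp
  also have "\<dots> = (\<integral>u. indicator (cball (0::complex) 1) u * (1/2) \<partial>lborel)"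
    by simp
  also have "\<dots> \<le> cp_const"
    unfolding cp_const_def
  proof (intro integral_mono cp_kernel_integrable)
    show "integrable lborel (\<lambda>u. indicator (cball (0::complex) 1) u * (1/2::real))"
      by (intro integrable_mult_left integrable_cball)
    fix u :: complex
    show "indicator (cball 0 1) u * (1/2) \<le> cp_kernel u"
    proof (cases "cmod u \<le> 1")
      case True
      have "(1 + (cmod u)\<^sup>2)\<^sup>2 \<le> (1 + 1\<^sup>2)\<^sup>2"
        using True by (intro power_mono add_mono) auto
      then have "2 / 4 \<le> cp_kernel u"
        unfolding cp_kernel_def by (intro divide_left_mono) (auto simp: add_nonneg_eq_0_iff)
      then show ?thesis
        using True by simp
    qed (simp add: cp_kernel_nonneg)
  qed
  finally show ?thesis .
qed

text \<open>With the pole smoothed out, \<phi> times the kernel is differentiable with compact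
  support, so each partial derivative integrates to 0. Adding \<i> times the second relation to the
  first leaves only the antiholomorphic derivatives of \<phi> and of the kernel.\<close>

lemma cauchy_pompeiu_regularized:
  assumes \<eta>: "0 < (\<eta>::real)"
    and d: "has_dir_deriv 1 \<phi> \<phi>1" "has_dir_deriv \<i> \<phi> \<phi>2"
    and c: "continuous_on UNIV \<phi>" "continuous_on UNIV \<phi>1" "continuous_on UNIV \<phi>2"
    and M: "\<And>z. M < cmod z \<Longrightarrow> \<phi> z = 0" "\<And>z. M < cmod z \<Longrightarrow> \<phi>1 z = 0" "\<And>z. M < cmod z \<Longrightarrow> \<phi>2 z = 0"
  shows "(\<integral>z. (\<phi>1 z + \<i> * \<phi>2 z) * (cnj (z - 1) / of_real ((cmod (z - 1))\<^sup>2 + \<eta>\<^sup>2)) \<partial>lborel)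
     = - (\<integral>z. \<phi> z * of_real (2 * \<eta>\<^sup>2 / ((cmod (z - 1))\<^sup>2 + \<eta>\<^sup>2)\<^sup>2) \<partial>lborel)"
proof -
  define N where "N z = (cmod (z - 1))\<^sup>2 + \<eta>\<^sup>2" for z :: complex
  define K where "K z = cnj (z - 1) * of_real (inverse (N z))" for z
  define K' where "K' e z = cnj e * of_real (inverse (N z)) - cnj (z - 1) * of_real (2 * Re (e * cnj (z - 1)) * inverse (N z) * inverse (N z))" for e z
  have N: "0 < N z" for z
    unfolding N_def using \<eta> by (intro add_nonneg_pos) auto
  have dK: "has_dir_deriv e K (K' e)" for e
    unfolding has_dir_deriv_def
  proof
    fix z :: complex
    define w where "w = z - 1"
    have Nt: "N (z + of_real t * e) = (Re w + t * Re e)\<^sup>2 + (Im w + t * Im e)\<^sup>2 + \<eta>\<^sup>2" for t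
      by (simp add: N_def w_def cmod_power2 algebra_simps)
    have dN: "((\<lambda>t. N (z + of_real t * e)) has_real_derivative 2 * Re (e * cnj w)) (at 0)"
      unfolding Nt by (auto intro!: derivative_eq_intros simp: algebra_simps)
    have "((\<lambda>t. inverse (N (z + of_real t * e))) has_real_derivative - (inverse (N z) * (2 * Re (e * cnj w)) * inverse (N z))) (at 0)"
      using DERIV_inverse'[OF dN] N[of z] by simp
    then have 1: "((\<lambda>t. complex_of_real (inverse (N (z + of_real t * e)))) has_vector_derivative
        of_real (- (inverse (N z) * (2 * Re (e * cnj w)) * inverse (N z)))) (at 0)"
      by (rule has_vector_derivative_of_real)
    have 2: "((\<lambda>t. cnj (z + of_real t * e - 1)) has_vector_derivative cnj e) (at 0)"
    proof -
      have "((\<lambda>t. cnj w + t *\<^sub>R cnj e) has_vector_derivative cnj e) (at 0)"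
        by (auto intro!: derivative_eq_intros)
      then show ?thesis
        by (simp add: w_def scaleR_conv_of_real algebra_simps)
    qed
    show "((\<lambda>t. K (z + of_real t * e)) has_vector_derivative K' e z) (at 0)"
      unfolding K_def using has_vector_derivative_mult[OF 2 1]
      by (rule has_vector_derivative_eq_rhs) (simp add: K'_def w_def algebra_simps)
  qed
  have Nc: "continuous_on UNIV N"
    unfolding N_def by (intro continuous_intros)
  have N0: "N z \<noteq> 0" for z
    using N[of z] by simp
  have Kc: "continuous_on UNIV K"
    unfolding K_def by (intro continuous_intros Nc ballI N0)
  have K'c: "continuous_on UNIV (K' e)" for e
    unfolding K'_def by (intro continuous_intros Nc ballI N0)
  have "has_dir_deriv e (\<lambda>z. \<phi> z * K z) (\<lambda>z. \<phi> z * K' e z + \<phi>' z * K z)" if "has_dir_deriv e \<phi> \<phi>'" for e \<phi>'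
    unfolding has_dir_deriv_def
  proof
    fix z
    show "((\<lambda>t. \<phi> (z + of_real t * e) * K (z + of_real t * e)) has_vector_derivative \<phi> z * K' e z + \<phi>' z * K z) (at 0)"
      using has_vector_derivative_mult[OF that[unfolded has_dir_deriv_def, rule_format, of z]
          dK[unfolded has_dir_deriv_def, rule_format, of z e]] by simp
  qed
  then have z1: "(\<integral>z. \<phi> z * K' 1 z + \<phi>1 z * K z \<partial>lborel) = 0" and z2: "(\<integral>z. \<phi> z * K' \<i> z + \<phi>2 z * K z \<partial>lborel) = 0"
    using d c M by (auto intro!: integral_dir_deriv_zero[where M = M] continuous_intros Kc K'c)
  have i1: "integrable lborel (\<lambda>z. \<phi> z * K' e z)" for e
    by (rule integrable_compact_support[where M = M]) (auto intro!: continuous_intros c K'c simp: M)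
  have i2: "integrable lborel (\<lambda>z. \<phi>1 z * K z)" "integrable lborel (\<lambda>z. \<phi>2 z * K z)"
    by (rule integrable_compact_support[where M = M]; auto intro!: continuous_intros c Kc simp: M)+
  \<comment> \<open>Twice the antiholomorphic derivative of the kernel is 2 / N - 2 |w|^2 / N^2, and
    N - |w|^2 = \<eta>^2.\<close>
  have KK: "K' 1 z + \<i> * K' \<i> z = of_real (2 * \<eta>\<^sup>2 / (N z)\<^sup>2)" for z
  proof -
    define w where "w = z - 1"
    have w2: "cnj w * (of_real (Re w) + \<i> * of_real (Im w)) = of_real ((cmod w)\<^sup>2)"
      using complex_norm_square[of w] complex_eq[of w] by (simp add: mult.commute)
    have "K' 1 z + \<i> * K' \<i> z = 2 * of_real (inverse (N z)) - 2 * (cnj w * (of_real (Re w) + \<i> * of_real (Im w))) * of_real (inverse (N z) * inverse (N z))"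
      unfolding K'_def w_def[symmetric] by (simp add: algebra_simps)
    also have "\<dots> = of_real (2 * inverse (N z) - 2 * (cmod w)\<^sup>2 * (inverse (N z) * inverse (N z)))"
      unfolding w2 by simp
    also have "2 * inverse (N z) - 2 * (cmod w)\<^sup>2 * (inverse (N z) * inverse (N z)) = 2 * \<eta>\<^sup>2 / (N z)\<^sup>2"
    proof -
      have "(cmod w)\<^sup>2 = N z - \<eta>\<^sup>2"
        by (simp add: N_def w_def)
      then show ?thesis
        using N[of z] by (simp add: field_simps power2_eq_square)
    qed
    finally show ?thesis .
  qed
  have "0 = (\<integral>z. \<phi> z * K' 1 z + \<phi>1 z * K z \<partial>lborel) + \<i> * (\<integral>z. \<phi> z * K' \<i> z + \<phi>2 z * K z \<partial>lborel)"
    using z1 z2 by simp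
  also have "\<dots> = (\<integral>z. (\<phi> z * K' 1 z + \<phi>1 z * K z) + \<i> * (\<phi> z * K' \<i> z + \<phi>2 z * K z) \<partial>lborel)"
    using i1 i2 by simp
  also have "\<dots> = (\<integral>z. (\<phi>1 z * K z + \<i> * (\<phi>2 z * K z)) + (\<phi> z * K' 1 z + \<i> * (\<phi> z * K' \<i> z)) \<partial>lborel)"
    by (simp add: algebra_simps)
  also have "\<dots> = (\<integral>z. \<phi>1 z * K z + \<i> * (\<phi>2 z * K z) \<partial>lborel) + (\<integral>z. \<phi> z * K' 1 z + \<i> * (\<phi> z * K' \<i> z) \<partial>lborel)"
    using i1 i2 by (intro Bochner_Integration.integral_add) auto
  also have "(\<lambda>z. \<phi>1 z * K z + \<i> * (\<phi>2 z * K z)) = (\<lambda>z. (\<phi>1 z + \<i> * \<phi>2 z) * (cnj (z - 1) / of_real ((cmod (z - 1))\<^sup>2 + \<eta>\<^sup>2)))"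
    by (auto simp: fun_eq_iff K_def N_def divide_inverse algebra_simps)
  also have "(\<lambda>z. \<phi> z * K' 1 z + \<i> * (\<phi> z * K' \<i> z)) = (\<lambda>z. \<phi> z * (K' 1 z + \<i> * K' \<i> z))"
    by (simp add: algebra_simps)
  finally show ?thesis
    unfolding KK N_def by (simp add: eq_neg_iff_add_eq_0)
qed

text \<open>As \<eta> tends to 0 the left kernels converge to 1 / (z - 1) under the locally
  integrable majorant 1 / |z - 1|. On the right the substitution z = 1 + \<eta> u turns the kernel
  into the fixed \<open>cp_kernel\<close>, and \<phi>(1 + \<eta> u) tends to \<phi>(1).\<close>

lemma cauchy_pompeiu:
  assumes d: "has_dir_deriv 1 \<phi> \<phi>1" "has_dir_deriv \<i> \<phi> \<phi>2"
    and c: "continuous_on UNIV \<phi>" "continuous_on UNIV \<phi>1" "continuous_on UNIV \<phi>2"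
    and M: "\<And>z. M < cmod z \<Longrightarrow> \<phi> z = 0" "\<And>z. M < cmod z \<Longrightarrow> \<phi>1 z = 0" "\<And>z. M < cmod z \<Longrightarrow> \<phi>2 z = 0"
  shows "(\<integral>z. (\<phi>1 z + \<i> * \<phi>2 z) / (z - 1) \<partial>lborel) = - of_real cp_const * \<phi> 1"
proof -
  define h where "h n = 1 / real (Suc n)" for n
  have h: "h \<longlonglongrightarrow> 0" "\<And>n. h n \<noteq> 0" "\<And>n. 0 < h n"
    unfolding h_def using LIMSEQ_Suc[OF lim_1_over_n] by auto
  have [measurable]: "\<phi> \<in> borel_measurable borel" "\<phi>1 \<in> borel_measurable borel" "\<phi>2 \<in> borel_measurable borel"
    using c by (auto intro: borel_measurable_continuous_onI)
  have [measurable]: "cnj \<in> borel_measurable borel"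
    by (intro borel_measurable_continuous_onI continuous_intros)
  obtain B where B: "0 \<le> B" "\<And>z. cmod (\<phi> z) \<le> B"
    using continuous_compact_support_bounded[OF c(1) M(1)] by metis
  have "continuous_on UNIV (\<lambda>z. \<phi>1 z + \<i> * \<phi>2 z)"
    by (intro continuous_intros c)
  then obtain B' where B': "0 \<le> B'" "\<And>z. cmod (\<phi>1 z + \<i> * \<phi>2 z) \<le> B'"
    using continuous_compact_support_bounded[of "\<lambda>z. \<phi>1 z + \<i> * \<phi>2 z" M] M by auto
  have L: "(\<lambda>n. \<integral>z. (\<phi>1 z + \<i> * \<phi>2 z) * (cnj (z - 1) / of_real ((cmod (z - 1))\<^sup>2 + (h n)\<^sup>2)) \<partial>lborel)
      \<longlonglongrightarrow> (\<integral>z. (\<phi>1 z + \<i> * \<phi>2 z) / (z - 1) \<partial>lborel)"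
  proof (rule integral_dominated_convergence[where w = "\<lambda>z. B' * (indicator (cball 0 M) z * inverse (cmod (z - 1)))"])
    show "integrable lborel (\<lambda>z. B' * (indicator (cball 0 M) z * inverse (cmod (z - 1))))"
      by (intro integrable_mult_right integrable_cauchy_kernel)
    show "AE z in lborel. (\<lambda>n. (\<phi>1 z + \<i> * \<phi>2 z) * (cnj (z - 1) / of_real ((cmod (z - 1))\<^sup>2 + (h n)\<^sup>2)))
        \<longlonglongrightarrow> (\<phi>1 z + \<i> * \<phi>2 z) / (z - 1)"
    proof (rule AE_I2)
      fix z
      show "(\<lambda>n. (\<phi>1 z + \<i> * \<phi>2 z) * (cnj (z - 1) / of_real ((cmod (z - 1))\<^sup>2 + (h n)\<^sup>2)))
        \<longlonglongrightarrow> (\<phi>1 z + \<i> * \<phi>2 z) / (z - 1)"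
      proof (cases "z = 1")
        case False
        have "(\<lambda>n. (\<phi>1 z + \<i> * \<phi>2 z) * (cnj (z - 1) / of_real ((cmod (z - 1))\<^sup>2 + (h n)\<^sup>2)))
          \<longlonglongrightarrow> (\<phi>1 z + \<i> * \<phi>2 z) * (cnj (z - 1) / of_real ((cmod (z - 1))\<^sup>2 + 0\<^sup>2))"
          using False by (intro tendsto_intros h) auto
        also have "cnj (z - 1) / of_real ((cmod (z - 1))\<^sup>2 + 0\<^sup>2) = 1 / (z - 1)"
          using False by (simp add: complex_norm_square field_simps del: of_real_power complex_cnj_diff)
        finally show ?thesis by simp
      qed simp
    qed
    show "AE z in lborel. norm ((\<phi>1 z + \<i> * \<phi>2 z) * (cnj (z - 1) / of_real ((cmod (z - 1))\<^sup>2 + (h n)\<^sup>2)))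
        \<le> B' * (indicator (cball 0 M) z * inverse (cmod (z - 1)))" for n
    proof (rule AE_I2)
      fix z
      have K: "cmod (cnj (z - 1) / of_real ((cmod (z - 1))\<^sup>2 + (h n)\<^sup>2)) \<le> inverse (cmod (z - 1))"
      proof (cases "z = 1")
        case False
        have "cmod (cnj (z - 1) / of_real ((cmod (z - 1))\<^sup>2 + (h n)\<^sup>2)) = cmod (z - 1) / ((cmod (z - 1))\<^sup>2 + (h n)\<^sup>2)"
          by (simp only: norm_divide complex_mod_cnj norm_of_real) (simp add: abs_of_nonneg)
        also have "\<dots> \<le> cmod (z - 1) / (cmod (z - 1))\<^sup>2"
          using False by (intro divide_left_mono) (auto intro!: mult_pos_pos add_pos_nonneg)
        finally show ?thesis
          using False by (simp add: power2_eq_square field_simps)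
      qed simp
      show "norm ((\<phi>1 z + \<i> * \<phi>2 z) * (cnj (z - 1) / of_real ((cmod (z - 1))\<^sup>2 + (h n)\<^sup>2)))
        \<le> B' * (indicator (cball 0 M) z * inverse (cmod (z - 1)))"
      proof (cases "cmod z \<le> M")
        case True
        then show ?thesis
          unfolding norm_mult using mult_mono[OF B'(2)[of z] K] B'(1) by simp
      qed (simp add: M)
    qed
  qed measurable
  have R: "(\<lambda>n. \<integral>z. \<phi> z * of_real (2 * (h n)\<^sup>2 / ((cmod (z - 1))\<^sup>2 + (h n)\<^sup>2)\<^sup>2) \<partial>lborel) \<longlonglongrightarrow> \<phi> 1 * of_real cp_const"
  proof -
    have eq: "(\<integral>z. \<phi> z * of_real (2 * (h n)\<^sup>2 / ((cmod (z - 1))\<^sup>2 + (h n)\<^sup>2)\<^sup>2) \<partial>lborel)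
      = (\<integral>u. \<phi> (1 + h n *\<^sub>R u) * of_real (cp_kernel u) \<partial>lborel)" for n
    proof -
      have k: "(h n)\<^sup>2 * (2 * (h n)\<^sup>2 / ((cmod (1 + h n *\<^sub>R u - 1))\<^sup>2 + (h n)\<^sup>2)\<^sup>2) = cp_kernel u" for u
      proof -
        have "(cmod (1 + h n *\<^sub>R u - 1))\<^sup>2 + (h n)\<^sup>2 = (h n)\<^sup>2 * (1 + (cmod u)\<^sup>2)"
          by (simp add: power_mult_distrib algebra_simps)
        then have "(h n)\<^sup>2 * (2 * (h n)\<^sup>2 / ((cmod (1 + h n *\<^sub>R u - 1))\<^sup>2 + (h n)\<^sup>2)\<^sup>2)
            = (((h n)\<^sup>2)\<^sup>2 * 2) / (((h n)\<^sup>2)\<^sup>2 * (1 + (cmod u)\<^sup>2)\<^sup>2)"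
          by (simp add: power_mult_distrib power2_eq_square[of "(h n)\<^sup>2"] mult_ac)
        then show ?thesis
          using h(2)[of n] by (simp add: cp_kernel_def)
      qed
      have "(\<integral>z. \<phi> z * of_real (2 * (h n)\<^sup>2 / ((cmod (z - 1))\<^sup>2 + (h n)\<^sup>2)\<^sup>2) \<partial>lborel)
        = (\<integral>u. (h n)\<^sup>2 *\<^sub>R (\<phi> (1 + h n *\<^sub>R u) * of_real (2 * (h n)\<^sup>2 / ((cmod (1 + h n *\<^sub>R u - 1))\<^sup>2 + (h n)\<^sup>2)\<^sup>2)) \<partial>lborel)"
        by (rule lborel_integral_affine[OF h(2)]) measurable
      also have "\<dots> = (\<integral>u. \<phi> (1 + h n *\<^sub>R u) * of_real (cp_kernel u) \<partial>lborel)"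
        unfolding k[symmetric] by (intro Bochner_Integration.integral_cong) (auto simp: scaleR_conv_of_real)
      finally show ?thesis .
    qed
    have "(\<lambda>n. \<integral>u. \<phi> (1 + h n *\<^sub>R u) * of_real (cp_kernel u) \<partial>lborel) \<longlonglongrightarrow> (\<integral>u. \<phi> 1 * of_real (cp_kernel u) \<partial>lborel)"
    proof (rule integral_dominated_convergence[where w = "\<lambda>u. B * cp_kernel u"])
      show "integrable lborel (\<lambda>u. B * cp_kernel u)"
        by (intro integrable_mult_right cp_kernel_integrable)
      show "AE u in lborel. (\<lambda>n. \<phi> (1 + h n *\<^sub>R u) * of_real (cp_kernel u)) \<longlonglongrightarrow> \<phi> 1 * of_real (cp_kernel u)"
      proof (rule AE_I2)
        fix u :: complex
        have "(\<lambda>n. 1 + h n *\<^sub>R u) \<longlonglongrightarrow> 1 + 0 *\<^sub>R u"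
          by (intro tendsto_intros h)
        then have "(\<lambda>n. \<phi> (1 + h n *\<^sub>R u)) \<longlonglongrightarrow> \<phi> 1"
          using continuous_on_tendsto_compose[OF c(1)] by simp
        then show "(\<lambda>n. \<phi> (1 + h n *\<^sub>R u) * of_real (cp_kernel u)) \<longlonglongrightarrow> \<phi> 1 * of_real (cp_kernel u)"
          by (intro tendsto_intros)
      qed
      show "AE u in lborel. norm (\<phi> (1 + h n *\<^sub>R u) * of_real (cp_kernel u)) \<le> B * cp_kernel u" for n
        using B(2) cp_kernel_nonneg by (intro AE_I2) (auto simp: norm_mult intro!: mult_right_mono)
    qed measurable
    then show ?thesis
      unfolding eq cp_const_def by simp
  qed
  have "(\<lambda>n. \<integral>z. (\<phi>1 z + \<i> * \<phi>2 z) * (cnj (z - 1) / of_real ((cmod (z - 1))\<^sup>2 + (h n)\<^sup>2)) \<partial>lborel)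
      \<longlonglongrightarrow> - (\<phi> 1 * of_real cp_const)"
  proof -
    have eq: "(\<integral>z. (\<phi>1 z + \<i> * \<phi>2 z) * (cnj (z - 1) / of_real ((cmod (z - 1))\<^sup>2 + (h n)\<^sup>2)) \<partial>lborel)
       = - (\<integral>z. \<phi> z * of_real (2 * (h n)\<^sup>2 / ((cmod (z - 1))\<^sup>2 + (h n)\<^sup>2)\<^sup>2) \<partial>lborel)" for n
      by (rule cauchy_pompeiu_regularized[OF h(3) d c M])
    show ?thesis
      unfolding eq by (intro tendsto_minus R)
  qed
  from LIMSEQ_unique[OF L this] show ?thesis
    by (simp add: mult.commute)
qed

text \<open>A derivative at 0 can be tested on steps bounded by 1, and for those the families below
  have uniform bounds.\<close>

lemma has_dir_derivI:
  assumes "\<And>z h. h \<longlonglongrightarrow> 0 \<Longrightarrow> (\<And>n. h n \<noteq> 0) \<Longrightarrow> (\<And>n. \<bar>h n\<bar> \<le> 1) \<Longrightarrow>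
      (\<lambda>n. (g (z + of_real (h n) * e) - g z) / of_real (h n)) \<longlonglongrightarrow> g' z"
  shows "has_dir_deriv e g g'"
  unfolding has_dir_deriv_def
proof
  fix z
  have "((\<lambda>t. (g (z + of_real t * e) - g z) / of_real t) \<longlongrightarrow> g' z) (at 0 within {-1..1})"
    unfolding tendsto_at_iff_sequentially
    using assms by (auto simp: o_def abs_le_iff)
  moreover have "at (0::real) within {-1..1} = at 0"
    by (rule at_within_interior) (simp add: interior_atLeastAtMost_real)
  ultimately have "((\<lambda>t. (g (z + of_real t * e) - g z) / of_real t) \<longlongrightarrow> g' z) (at 0)"
    by simp
  then have "((\<lambda>t. norm ((g (z + of_real t * e) - g z) / of_real t - g' z)) \<longlongrightarrow> 0) (at 0)"
    by (simp only: tendsto_norm_zero_iff LIM_zero_iff)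
  then have "((\<lambda>t. norm (g (z + of_real t * e) - g z - t *\<^sub>R g' z) / norm t) \<longlongrightarrow> 0) (at 0)"
  proof (rule Lim_transform_within[of _ _ _ _ 1])
    fix t :: real assume "0 < dist t 0"
    then have "(g (z + of_real t * e) - g z) / of_real t - g' z = (g (z + of_real t * e) - g z - t *\<^sub>R g' z) / of_real t"
      by (simp add: diff_divide_distrib scaleR_conv_of_real)
    then show "norm ((g (z + of_real t * e) - g z) / of_real t - g' z) = norm (g (z + of_real t * e) - g z - t *\<^sub>R g' z) / norm t"
      by (simp add: norm_divide)
  qed simp
  then show "((\<lambda>t. g (z + of_real t * e)) has_vector_derivative g' z) (at 0)"
    unfolding has_vector_derivative_def has_derivative_at by (simp add: bounded_linear_scaleR_left)
qed

lemma has_dir_deriv_bound_abs: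
  assumes d: "has_dir_deriv e g g'" and B: "\<And>s. \<bar>s\<bar> \<le> \<bar>h\<bar> \<Longrightarrow> cmod (g' (z + of_real s * e)) \<le> B"
  shows "cmod (g (z + of_real h * e) - g z) \<le> B * \<bar>h\<bar>"
proof (cases "0 \<le> h")
  case True
  then show ?thesis
    using has_dir_deriv_bound[OF d, of h z B] B by simp
next
  case False
  have "cmod (g (z + of_real h * e + of_real (-h) * e) - g (z + of_real h * e)) \<le> B * (- h)"
  proof (rule has_dir_deriv_bound[OF d])
    fix s assume "0 \<le> s" "s \<le> - h"
    then show "cmod (g' (z + of_real h * e + of_real s * e)) \<le> B"
      using B[of "h + s"] False by (simp add: algebra_simps)
  qed (use False in auto)
  then show ?thesis
    using False by (simp add: norm_minus_commute)
qed

lemma has_dir_deriv_vanish: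
  assumes d: "has_dir_deriv e g g'" and 0: "\<And>z. M < cmod z \<Longrightarrow> g z = 0" and z: "M < cmod z"
  shows "g' z = 0"
proof -
  \<comment> \<open>Steps up to c move z by less than |z| - M, so every difference quotient is 0;
    the added 1 covers e = 0.\<close>
  define c where "c = (cmod z - M) / (cmod e + 1)"
  have c: "0 < c"
    using z by (auto simp: c_def intro!: divide_pos_pos add_nonneg_pos)
  define h where "h n = c * (1 / real (Suc n))" for n
  have h0: "h \<longlonglongrightarrow> 0"
    unfolding h_def by (rule tendsto_mult_right_zero[OF LIMSEQ_Suc[OF lim_1_over_n]])
  have h: "0 < h n" "h n \<le> c" for n
    unfolding h_def using c by (auto simp: mult_le_cancel_left1 divide_le_eq)
  have "g (z + of_real (h n) * e) = 0" for n
  proof (rule 0)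
    have "cmod (of_real (h n) * e) = h n * cmod e"
      using h[of n] by (simp add: norm_mult)
    also have "\<dots> \<le> c * cmod e"
      using h[of n] by (intro mult_right_mono) auto
    also have "\<dots> < c * (cmod e + 1)"
      using c by simp
    also have "\<dots> = cmod z - M"
      using add_nonneg_pos[of "cmod e" 1] by (simp add: c_def)
    finally show "M < cmod (z + of_real (h n) * e)"
      using norm_diff_ineq[of z "of_real (h n) * e"] by linarith
  qed
  then have "(\<lambda>n. (0::complex)) \<longlonglongrightarrow> g' z"
    using has_dir_deriv_quot[OF d h0, of z] h(1) 0[OF z] by (simp add: less_imp_neq[THEN not_sym])
  from LIMSEQ_unique[OF this tendsto_const] show ?thesis .
qed

section \<open>Families of Lipschitz functions\<close>

text \<open>Continuity of T asks for common Lipschitz constants along a convergent sequence of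
  parameters, hence the local uniformity in z. Boundedness puts every member into
  \<open>Lipb\<close>, where T alternates.\<close>

definition cont_fam :: "(complex \<Rightarrow> 'a::real_normed_vector \<Rightarrow> complex) \<Rightarrow> bool" where
  "cont_fam P \<longleftrightarrow> (\<forall>x. continuous_on UNIV (\<lambda>z. P z x)) \<and>
     (\<forall>M. \<exists>C. \<forall>z. cmod z \<le> M \<longrightarrow> C-lipschitz_on UNIV (P z) \<and> (\<forall>x. cmod (P z x) \<le> C))"

definition dir_deriv :: "complex \<Rightarrow> (complex \<Rightarrow> 'a \<Rightarrow> complex) \<Rightarrow> complex \<Rightarrow> 'a \<Rightarrow> complex" where
  "dir_deriv e P z x = vector_derivative (\<lambda>t. P (z + of_real t * e) x) (at 0)"

text \<open>This is twice the Wirtinger derivative with respect to the conjugate of the parameter.\<close>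
definition dbar :: "(complex \<Rightarrow> 'a \<Rightarrow> complex) \<Rightarrow> complex \<Rightarrow> 'a \<Rightarrow> complex" where
  "dbar P z x = dir_deriv 1 P z x + \<i> * dir_deriv \<i> P z x"

text \<open>The derivatives have to be continuous families because they become arguments of T in
  turn.\<close>

definition diff_fam :: "(complex \<Rightarrow> 'a::real_normed_vector \<Rightarrow> complex) \<Rightarrow> bool" where
  "diff_fam P \<longleftrightarrow> cont_fam P \<and> (\<forall>e\<in>{1, \<i>}. cont_fam (dir_deriv e P) \<and> (\<forall>x. has_dir_deriv e (\<lambda>z. P z x) (\<lambda>z. dir_deriv e P z x)))"

lemma cont_fam_Lipb: "cont_fam P \<Longrightarrow> P z \<in> Lipb"
  unfolding cont_fam_def Lipb_iff Lip_def by (metis (mono_tags, lifting) mem_Collect_eq order_refl)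

lemma cont_fam_continuous: "cont_fam P \<Longrightarrow> continuous_on S (\<lambda>z. P z x)"
  unfolding cont_fam_def using continuous_on_subset by blast

lemma cont_fam_bound:
  assumes "cont_fam P"
  obtains C where "0 \<le> C" "\<And>z. cmod z \<le> M \<Longrightarrow> C-lipschitz_on UNIV (P z)" "\<And>z x. cmod z \<le> M \<Longrightarrow> cmod (P z x) \<le> C"
proof -
  obtain C where C: "\<forall>z. cmod z \<le> M \<longrightarrow> C-lipschitz_on UNIV (P z) \<and> (\<forall>x. cmod (P z x) \<le> C)"
    using assms unfolding cont_fam_def by blast
  show ?thesis
  proof (rule that[of "max 0 C"])
    show "(max 0 C)-lipschitz_on UNIV (P z)" if "cmod z \<le> M" for z
      using C that by (auto intro: lipschitz_on_le)
    show "cmod (P z x) \<le> max 0 C" if "cmod z \<le> M" for z x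
      using C that by (auto simp: le_max_iff_disj)
  qed simp
qed

lemma cont_famI:
  assumes "\<And>x. continuous_on UNIV (\<lambda>z. P z x)"
    and "\<And>M. \<exists>C B. \<forall>z. cmod z \<le> M \<longrightarrow> C-lipschitz_on UNIV (P z) \<and> (\<forall>x. cmod (P z x) \<le> B)"
  shows "cont_fam P"
  unfolding cont_fam_def
proof (intro conjI allI)
  fix M
  obtain C B where CB: "\<forall>z. cmod z \<le> M \<longrightarrow> C-lipschitz_on UNIV (P z) \<and> (\<forall>x. cmod (P z x) \<le> B)"
    using assms(2)[of M] by blast
  then have "\<forall>z. cmod z \<le> M \<longrightarrow> (max C B)-lipschitz_on UNIV (P z) \<and> (\<forall>x. cmod (P z x) \<le> max C B)"
    by (auto intro: lipschitz_on_le simp: le_max_iff_disj)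
  then show "\<exists>C. \<forall>z. cmod z \<le> M \<longrightarrow> C-lipschitz_on UNIV (P z) \<and> (\<forall>x. cmod (P z x) \<le> C)"
    by blast
qed (use assms in auto)

lemma cont_fam_const: "cont_fam (\<lambda>z x. c)"
  by (rule cont_famI) (auto intro!: exI[where x = 0 and P = "\<lambda>C. \<exists>B. contraction C B" for contraction] lipschitz_on_constant)

lemma cont_fam_add:
  assumes "cont_fam P" "cont_fam P'"
  shows "cont_fam (\<lambda>z x. P z x + P' z x)"
proof (rule cont_famI)
  show "continuous_on UNIV (\<lambda>z. P z x + P' z x)" for x
    using assms by (intro continuous_intros cont_fam_continuous)
  fix M
  obtain C where C: "\<And>z. cmod z \<le> M \<Longrightarrow> C-lipschitz_on UNIV (P z)" "\<And>z x. cmod z \<le> M \<Longrightarrow> cmod (P z x) \<le> C"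
    using cont_fam_bound[OF assms(1), of M] by metis
  obtain C' where C': "\<And>z. cmod z \<le> M \<Longrightarrow> C'-lipschitz_on UNIV (P' z)" "\<And>z x. cmod z \<le> M \<Longrightarrow> cmod (P' z x) \<le> C'"
    using cont_fam_bound[OF assms(2), of M] by metis
  show "\<exists>C B. \<forall>z. cmod z \<le> M \<longrightarrow> C-lipschitz_on UNIV (\<lambda>x. P z x + P' z x) \<and> (\<forall>x. cmod (P z x + P' z x) \<le> B)"
    using C C' by (intro exI[of _ "C + C'"]) (auto intro!: lipschitz_on_add norm_triangle_mono)
qed

lemma cont_fam_mult:
  assumes "cont_fam P" "cont_fam P'"
  shows "cont_fam (\<lambda>z x. P z x * P' z x)"
proof (rule cont_famI)
  show "continuous_on UNIV (\<lambda>z. P z x * P' z x)" for x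
    using assms by (intro continuous_intros cont_fam_continuous)
  fix M
  obtain C where C: "0 \<le> C" "\<And>z. cmod z \<le> M \<Longrightarrow> C-lipschitz_on UNIV (P z)" "\<And>z x. cmod z \<le> M \<Longrightarrow> cmod (P z x) \<le> C"
    using cont_fam_bound[OF assms(1), of M] by metis
  obtain C' where C': "0 \<le> C'" "\<And>z. cmod z \<le> M \<Longrightarrow> C'-lipschitz_on UNIV (P' z)" "\<And>z x. cmod z \<le> M \<Longrightarrow> cmod (P' z x) \<le> C'"
    using cont_fam_bound[OF assms(2), of M] by metis
  show "\<exists>C B. \<forall>z. cmod z \<le> M \<longrightarrow> C-lipschitz_on UNIV (\<lambda>x. P z x * P' z x) \<and> (\<forall>x. cmod (P z x * P' z x) \<le> B)"
  proof (intro exI allI impI conjI)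
    fix z assume z: "cmod z \<le> M"
    show "(C * C' + C * C')-lipschitz_on UNIV (\<lambda>x. P z x * P' z x)"
      using z by (intro lipschitz_on_mult_bounded C C')
    show "cmod (P z x * P' z x) \<le> C * C'" for x
      unfolding norm_mult using C C' z by (intro mult_mono) auto
  qed
qed

lemma cont_fam_cmult: "cont_fam P \<Longrightarrow> cont_fam (\<lambda>z x. c * P z x)"
  by (rule cont_fam_mult[OF cont_fam_const])

lemma cont_fam_diff: "cont_fam P \<Longrightarrow> cont_fam P' \<Longrightarrow> cont_fam (\<lambda>z x. P z x - P' z x)"
  using cont_fam_add[OF _ cont_fam_cmult[of P' "-1"], of P] by simp

lemma cont_fam_list_bound:
  assumes "\<forall>P\<in>set Ps. cont_fam P"
  obtains C where "0 \<le> C" "\<And>P z. P \<in> set Ps \<Longrightarrow> cmod z \<le> M \<Longrightarrow> C-lipschitz_on UNIV (P z)"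
    "\<And>P z x. P \<in> set Ps \<Longrightarrow> cmod z \<le> M \<Longrightarrow> cmod (P z x) \<le> C"
proof -
  have "\<exists>C\<ge>0. \<forall>P\<in>set Ps. \<forall>z. cmod z \<le> M \<longrightarrow> C-lipschitz_on UNIV (P z) \<and> (\<forall>x. cmod (P z x) \<le> C)"
    using assms
  proof (induction Ps)
    case (Cons P Ps)
    then obtain C where C: "C \<ge> 0" "\<forall>P\<in>set Ps. \<forall>z. cmod z \<le> M \<longrightarrow> C-lipschitz_on UNIV (P z) \<and> (\<forall>x. cmod (P z x) \<le> C)"
      by auto
    obtain C' where C': "0 \<le> C'" "\<And>z. cmod z \<le> M \<Longrightarrow> C'-lipschitz_on UNIV (P z)" "\<And>z x. cmod z \<le> M \<Longrightarrow> cmod (P z x) \<le> C'"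
      using cont_fam_bound[of P M] Cons.prems by auto
    show ?case
      using C C' by (intro exI[of _ "max C C'"])
        (auto intro: lipschitz_on_le[OF _ max.cobounded1] lipschitz_on_le[OF _ max.cobounded2] simp: le_max_iff_disj)
  qed auto
  then show ?thesis
    using that by blast
qed

lemma dir_deriv_eqI:
  assumes "\<And>x. has_dir_deriv e (\<lambda>z. P z x) (\<lambda>z. P' z x)"
  shows "dir_deriv e P = P'"
proof (intro ext)
  fix z x
  show "dir_deriv e P z x = P' z x"
    using assms[of x] unfolding dir_deriv_def has_dir_deriv_def by (auto intro: vector_derivative_at)
qed

lemma diff_famI:
  assumes "cont_fam P" "cont_fam P1" "cont_fam P2"
    and "\<And>x. has_dir_deriv 1 (\<lambda>z. P z x) (\<lambda>z. P1 z x)" "\<And>x. has_dir_deriv \<i> (\<lambda>z. P z x) (\<lambda>z. P2 z x)"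
  shows "diff_fam P" "dir_deriv 1 P = P1" "dir_deriv \<i> P = P2"
proof -
  show 1: "dir_deriv 1 P = P1" "dir_deriv \<i> P = P2"
    using assms dir_deriv_eqI by blast+
  show "diff_fam P"
    unfolding diff_fam_def using assms by (auto simp: 1)
qed

lemma diff_fam_cont_fam: "diff_fam P \<Longrightarrow> cont_fam P"
  by (simp add: diff_fam_def)

lemma diff_fam_cont_fam_dir_deriv: "diff_fam P \<Longrightarrow> e \<in> {1, \<i>} \<Longrightarrow> cont_fam (dir_deriv e P)"
  by (auto simp: diff_fam_def)

lemma diff_fam_deriv: "diff_fam P \<Longrightarrow> e \<in> {1, \<i>} \<Longrightarrow> has_dir_deriv e (\<lambda>z. P z x) (\<lambda>z. dir_deriv e P z x)"
  by (auto simp: diff_fam_def)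

lemma diff_fam_cont_fam_dbar: "diff_fam P \<Longrightarrow> cont_fam (dbar P)"
  unfolding dbar_def[abs_def] by (intro cont_fam_add cont_fam_cmult diff_fam_cont_fam_dir_deriv) auto

section \<open>Algebra of differentiable families\<close>

lemma has_dir_deriv_lin:
  assumes "has_dir_deriv e f f'" "has_dir_deriv e g g'"
  shows "has_dir_deriv e (\<lambda>z. c * f z + g z) (\<lambda>z. c * f' z + g' z)"
  using assms unfolding has_dir_deriv_def
  by (auto intro!: has_vector_derivative_add has_vector_derivative_mult_right)

lemma has_dir_deriv_mult:
  assumes "has_dir_deriv e f f'" "has_dir_deriv e g g'"
  shows "has_dir_deriv e (\<lambda>z. f z * g z) (\<lambda>z. f z * g' z + f' z * g z)"
  unfolding has_dir_deriv_def
proof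
  fix z
  show "((\<lambda>t. f (z + of_real t * e) * g (z + of_real t * e)) has_vector_derivative f z * g' z + f' z * g z) (at 0)"
    using has_vector_derivative_mult[OF assms(1)[unfolded has_dir_deriv_def, rule_format, of z]
        assms(2)[unfolded has_dir_deriv_def, rule_format, of z]] by simp
qed

lemma diff_fam_lin:
  assumes "diff_fam P" "diff_fam P'"
  shows "diff_fam (\<lambda>z x. c * P z x + P' z x)" "dbar (\<lambda>z x. c * P z x + P' z x) = (\<lambda>z x. c * dbar P z x + dbar P' z x)"
proof -
  have *: "has_dir_deriv e (\<lambda>z. c * P z x + P' z x) (\<lambda>z. c * dir_deriv e P z x + dir_deriv e P' z x)" if "e \<in> {1, \<i>}" for e x
    using assms that by (intro has_dir_deriv_lin diff_fam_deriv)
  note ** = diff_famI[OF cont_fam_add[OF cont_fam_cmult[OF diff_fam_cont_fam[OF assms(1)]] diff_fam_cont_fam[OF assms(2)]]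
      cont_fam_add[OF cont_fam_cmult[OF diff_fam_cont_fam_dir_deriv[OF assms(1), of 1]] diff_fam_cont_fam_dir_deriv[OF assms(2), of 1]]
      cont_fam_add[OF cont_fam_cmult[OF diff_fam_cont_fam_dir_deriv[OF assms(1), of \<i>]] diff_fam_cont_fam_dir_deriv[OF assms(2), of \<i>]], of c c c]
  show "diff_fam (\<lambda>z x. c * P z x + P' z x)"
    using **(1) * by simp
  show "dbar (\<lambda>z x. c * P z x + P' z x) = (\<lambda>z x. c * dbar P z x + dbar P' z x)"
    unfolding dbar_def[abs_def] using **(2,3) * by (simp add: algebra_simps)
qed

lemma diff_fam_mult:
  assumes "diff_fam P" "diff_fam P'"
  shows "diff_fam (\<lambda>z x. P z x * P' z x)" "dbar (\<lambda>z x. P z x * P' z x) = (\<lambda>z x. P z x * dbar P' z x + P' z x * dbar P z x)"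
proof -
  have *: "has_dir_deriv e (\<lambda>z. P z x * P' z x) (\<lambda>z. P z x * dir_deriv e P' z x + dir_deriv e P z x * P' z x)" if "e \<in> {1, \<i>}" for e x
    using assms that by (intro has_dir_deriv_mult diff_fam_deriv)
  have c: "cont_fam (\<lambda>z x. P z x * dir_deriv e P' z x + dir_deriv e P z x * P' z x)" if "e \<in> {1, \<i>}" for e
    using assms that by (intro cont_fam_add cont_fam_mult diff_fam_cont_fam diff_fam_cont_fam_dir_deriv)
  note ** = diff_famI[OF cont_fam_mult[OF diff_fam_cont_fam[OF assms(1)] diff_fam_cont_fam[OF assms(2)]] c[of 1] c[of \<i>]]
  show "diff_fam (\<lambda>z x. P z x * P' z x)"
    using **(1) * by simp
  show "dbar (\<lambda>z x. P z x * P' z x) = (\<lambda>z x. P z x * dbar P' z x + P' z x * dbar P z x)"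
    unfolding dbar_def[abs_def] using **(2,3) * by (simp add: algebra_simps)
qed

lemma diff_fam_diff:
  assumes "diff_fam P" "diff_fam P'"
  shows "diff_fam (\<lambda>z x. P z x - P' z x)" "dbar (\<lambda>z x. P z x - P' z x) = (\<lambda>z x. dbar P z x - dbar P' z x)"
  using diff_fam_lin[OF assms(2,1), of "-1"] by auto

text \<open>The mean value inequality is used for z \<mapsto> P z x and again for z \<mapsto> P z x
  - P z y. The second use bounds the Lipschitz constants of the difference quotients in x, as
  \<open>T_tendsto\<close> requires.\<close>

lemma diff_fam_quot:
  assumes P: "diff_fam P" and e: "e \<in> {1, \<i>}"
  obtains C where "0 \<le> C"
    "\<And>z h. cmod z \<le> M \<Longrightarrow> h \<noteq> 0 \<Longrightarrow> \<bar>h\<bar> \<le> 1 \<Longrightarrow> C-lipschitz_on UNIV (\<lambda>x. (P (z + of_real h * e) x - P z x) / of_real h)"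
    "\<And>z h x. cmod z \<le> M \<Longrightarrow> h \<noteq> 0 \<Longrightarrow> \<bar>h\<bar> \<le> 1 \<Longrightarrow> cmod ((P (z + of_real h * e) x - P z x) / of_real h) \<le> C"
proof -
  have ne: "cmod e = 1"
    using e by auto
  obtain C where C: "0 \<le> C" "\<And>z. cmod z \<le> M + 1 \<Longrightarrow> C-lipschitz_on UNIV (dir_deriv e P z)"
    "\<And>z x. cmod z \<le> M + 1 \<Longrightarrow> cmod (dir_deriv e P z x) \<le> C"
    using cont_fam_bound[OF diff_fam_cont_fam_dir_deriv[OF P e], of "M + 1"] by metis
  have in_M: "cmod (z + of_real s * e) \<le> M + 1" if "cmod z \<le> M" "\<bar>s\<bar> \<le> \<bar>h\<bar>" "\<bar>h\<bar> \<le> 1" for z and s h :: real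
    using that norm_triangle_ineq[of z "of_real s * e"] by (simp add: norm_mult ne)
  show ?thesis
  proof (rule that[OF C(1)])
    fix z and h :: real assume zh: "cmod z \<le> M" "h \<noteq> 0" "\<bar>h\<bar> \<le> 1"
    show "cmod ((P (z + of_real h * e) x - P z x) / of_real h) \<le> C" for x
    proof -
      have "cmod (P (z + of_real h * e) x - P z x) \<le> C * \<bar>h\<bar>"
        using in_M zh C(3) by (intro has_dir_deriv_bound_abs[OF diff_fam_deriv[OF P e]]) blast
      then show ?thesis
        using zh by (simp add: norm_divide divide_le_eq)
    qed
    show "C-lipschitz_on UNIV (\<lambda>x. (P (z + of_real h * e) x - P z x) / of_real h)"
    proof (rule lipschitz_onI)
      fix x y
      have "cmod (((-1) * P (z + of_real h * e) y + P (z + of_real h * e) x) - ((-1) * P z y + P z x)) \<le> (C * dist x y) * \<bar>h\<bar>"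
      proof (rule has_dir_deriv_bound_abs[OF has_dir_deriv_lin[OF diff_fam_deriv[OF P e] diff_fam_deriv[OF P e]]])
        fix s assume "\<bar>s\<bar> \<le> \<bar>h\<bar>"
        then have "C-lipschitz_on UNIV (dir_deriv e P (z + of_real s * e))"
          using in_M zh C(2) by blast
        then show "cmod ((-1) * dir_deriv e P (z + of_real s * e) y + dir_deriv e P (z + of_real s * e) x) \<le> C * dist x y"
          by (auto dest!: lipschitz_onD[of _ _ _ x y] simp: dist_norm)
      qed
      moreover have "dist ((P (z + of_real h * e) x - P z x) / of_real h) ((P (z + of_real h * e) y - P z y) / of_real h)
          = cmod (((-1) * P (z + of_real h * e) y + P (z + of_real h * e) x) - ((-1) * P z y + P z x)) / \<bar>h\<bar>"
        by (simp add: dist_norm norm_divide algebra_simps flip: diff_divide_distrib)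
      ultimately show "dist ((P (z + of_real h * e) x - P z x) / of_real h) ((P (z + of_real h * e) y - P z y) / of_real h) \<le> C * dist x y"
        using zh by (simp add: divide_le_eq)
    qed (rule C(1))
  qed
qed

section \<open>The current evaluated along families\<close>

definition eval_fams :: "complex \<Rightarrow> (complex \<Rightarrow> 'a \<Rightarrow> complex) list \<Rightarrow> ('a \<Rightarrow> complex) list" where
  "eval_fams z Ps = map (\<lambda>P. P z) Ps"

lemma length_eval_fams [simp]: "length (eval_fams z Ps) = length Ps"
  by (simp add: eval_fams_def)

lemma nth_eval_fams [simp]: "j < length Ps \<Longrightarrow> eval_fams z Ps ! j = (Ps ! j) z"
  by (simp add: eval_fams_def)

lemma eval_fams_update: "eval_fams z (Ps[j := P]) = (eval_fams z Ps)[j := P z]"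
  by (simp add: eval_fams_def map_update)

lemma eval_fams_args: "\<forall>P\<in>set Ps. cont_fam P \<Longrightarrow> length Ps = k \<Longrightarrow> eval_fams z Ps \<in> args Lipb k"
  by (auto simp: eval_fams_def args_def cont_fam_Lipb)

context annulus_current
begin

lemma T_cont_fam_continuous:
  assumes F: "cont_fam F" and Ps: "\<forall>P\<in>set Ps. cont_fam P" "length Ps = k"
  shows "continuous_on UNIV (\<lambda>z. T (F z) (eval_fams z Ps))"
  unfolding continuous_on_sequentially
proof (intro allI ballI impI, elim conjE)
  fix zs z assume zs: "\<forall>n. zs n \<in> (UNIV::complex set)" "zs \<longlonglongrightarrow> z"
  obtain M where M: "\<And>n. cmod (zs n) \<le> M"
    using convergent_imp_Bseq[of zs] zs(2) by (auto simp: Bseq_def convergent_def)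
  obtain C where C: "\<And>z x. cmod z \<le> M \<Longrightarrow> cmod (F z x) \<le> C"
    using cont_fam_bound[OF F, of M] by metis
  obtain C' where C': "\<And>P z. P \<in> set Ps \<Longrightarrow> cmod z \<le> M \<Longrightarrow> C'-lipschitz_on UNIV (P z)"
    using cont_fam_list_bound[OF Ps(1), of M] by metis
  have lim: "(\<lambda>n. P (zs n) x) \<longlonglongrightarrow> P z x" if "cont_fam P" for P and x :: 'a
    using continuous_on_tendsto_compose[OF cont_fam_continuous[OF that, of UNIV x] zs(2)] by simp
  have "(\<lambda>n. T (F (zs n)) (eval_fams (zs n) Ps)) \<longlonglongrightarrow> T (F z) (eval_fams z Ps)"
  proof (rule T_tendsto[where B = C and C = C'])
    show "cmod (F (zs n) x) \<le> C" for n x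
      using C M by blast
    show "C'-lipschitz_on UNIV (eval_fams (zs n) Ps ! j)" if "j < k" for n j
      using C' M that Ps by simp
    show "(\<lambda>n. (eval_fams (zs n) Ps ! j) x) \<longlonglongrightarrow> (eval_fams z Ps ! j) x" if "j < k" for j x
      using that Ps by (simp add: lim)
  qed (use F Ps in \<open>simp_all add: args_Lip eval_fams_args lim cont_fam_Lipb\<close>)
  then show "((\<lambda>z. T (F z) (eval_fams z Ps)) \<circ> zs) \<longlonglongrightarrow> T (F z) (eval_fams z Ps)"
    by (simp add: o_def)
qed

text \<open>The difference quotient telescopes: the first argument changes while the entries stay at
  the moved parameter, then the entries change one at a time through \<open>hybrid\<close>. Each
  summand converges by the continuity of T.\<close>

lemma T_dir_deriv:
  assumes F: "diff_fam F" and Ps: "\<forall>P\<in>set Ps. diff_fam P" "length Ps = k" and e: "e \<in> {1, \<i>}"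
  shows "has_dir_deriv e (\<lambda>z. T (F z) (eval_fams z Ps))
     (\<lambda>z. T (dir_deriv e F z) (eval_fams z Ps) + (\<Sum>j<k. T (F z) ((eval_fams z Ps)[j := dir_deriv e (Ps ! j) z])))"
proof (rule has_dir_derivI)
  fix z and h :: "nat \<Rightarrow> real"
  assume h: "h \<longlonglongrightarrow> 0" "\<And>n. h n \<noteq> 0" "\<And>n. \<bar>h n\<bar> \<le> 1"
  have Pc: "\<forall>P\<in>set Ps. cont_fam P"
    using Ps diff_fam_cont_fam by blast
  define zs where "zs n = z + of_real (h n) * e" for n
  have ne: "cmod e = 1"
    using e by auto
  have zsM: "cmod (zs n) \<le> cmod z + 1" for n
    unfolding zs_def using norm_triangle_ineq[of z "of_real (h n) * e"] h(3)[of n] by (simp add: norm_mult ne)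
  have "zs \<longlonglongrightarrow> z + of_real 0 * e"
    unfolding zs_def by (intro tendsto_intros h)
  then have zs: "zs \<longlonglongrightarrow> z"
    by simp
  have lim: "(\<lambda>n. P (zs n) x) \<longlonglongrightarrow> P z x" if "cont_fam P" for P and x :: 'a
    using continuous_on_tendsto_compose[OF cont_fam_continuous[OF that, of UNIV x] zs] by simp
  define q where "q P n x = (P (zs n) x - P z x) / of_real (h n)" for P :: "complex \<Rightarrow> 'a \<Rightarrow> complex" and n and x :: 'a
  have q_lim: "(\<lambda>n. q P n x) \<longlonglongrightarrow> dir_deriv e P z x" if "diff_fam P" for P x
    unfolding q_def zs_def by (rule has_dir_deriv_quot[OF diff_fam_deriv[OF that e] h(1,2)])
  have q_Lipb: "q P n \<in> Lipb" if "cont_fam P" for P n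
  proof -
    have "(\<lambda>x. inverse (of_real (h n)) * (P (zs n) x - P z x)) \<in> Lipb"
      using that by (intro Lipb_cmult Lipb_diff cont_fam_Lipb)
    then show ?thesis
      by (simp add: q_def[abs_def] divide_inverse mult.commute)
  qed
  obtain C' where C': "0 \<le> C'" "\<And>P z'. P \<in> set Ps \<Longrightarrow> cmod z' \<le> cmod z + 1 \<Longrightarrow> C'-lipschitz_on UNIV (P z')"
    using cont_fam_list_bound[OF Pc, of "cmod z + 1"] by metis
  obtain C where C: "\<And>n x. cmod (q F n x) \<le> C"
    using diff_fam_quot[OF F e, of "cmod z"] h unfolding q_def zs_def by (metis order_refl)
  have 1: "(\<lambda>n. T (q F n) (eval_fams (zs n) Ps)) \<longlonglongrightarrow> T (dir_deriv e F z) (eval_fams z Ps)"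
  proof (rule T_tendsto[where B = C and C = C'])
    show "C'-lipschitz_on UNIV (eval_fams (zs n) Ps ! j)" if "j < k" for n j
      using C' zsM that Ps by simp
    show "(\<lambda>n. (eval_fams (zs n) Ps ! j) x) \<longlonglongrightarrow> (eval_fams z Ps ! j) x" if "j < k" for j x
      using that Ps Pc by (simp add: lim)
  qed (use F Pc Ps C e in \<open>simp_all add: args_Lip eval_fams_args q_lim q_Lipb diff_fam_cont_fam cont_fam_Lipb diff_fam_cont_fam_dir_deriv\<close>)
  let ?hy = "\<lambda>i n. hybrid i (eval_fams (zs n) Ps) (eval_fams z Ps)"
  have hyL: "?hy i n \<in> args Lip k" for i n
    using Pc Ps by (intro hybrid_args args_Lip eval_fams_args) auto
  obtain BF where BF: "\<And>x. cmod (F z x) \<le> BF"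
    using LipbE[OF cont_fam_Lipb[OF diff_fam_cont_fam[OF F], of z]] by metis
  have 2: "(\<lambda>n. T (F z) ((?hy i n)[i := q (Ps ! i) n])) \<longlonglongrightarrow> T (F z) ((eval_fams z Ps)[i := dir_deriv e (Ps ! i) z])" if i: "i < k" for i
  proof -
    have Pi: "diff_fam (Ps ! i)"
      using Ps i by simp
    obtain C1 where C1': "\<And>z' h'. cmod z' \<le> cmod z \<Longrightarrow> h' \<noteq> 0 \<Longrightarrow> \<bar>h'\<bar> \<le> 1 \<Longrightarrow>
        C1-lipschitz_on UNIV (\<lambda>x. ((Ps ! i) (z' + of_real h' * e) x - (Ps ! i) z' x) / of_real h')"
      by (rule diff_fam_quot[OF Pi e, of "cmod z"]) (rule that)
    have C1: "C1-lipschitz_on UNIV (q (Ps ! i) n)" for n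
      unfolding q_def[abs_def] zs_def by (rule C1'[OF order_refl h(2,3)])
    have zz: "cmod z \<le> cmod z + 1" by simp
    show ?thesis
    proof (rule T_tendsto[where B = BF and C = "max C' C1"])
      show "cmod (F z x) \<le> BF" for x
        by (rule BF)
      show "(max C' C1)-lipschitz_on UNIV ((?hy i n)[i := q (Ps ! i) n] ! j)" if j: "j < k" for n j
      proof (cases "i = j")
        case True
        then show ?thesis
          using C1[of n] j Ps by (auto intro: lipschitz_on_le)
      next
        case False
        have "C'-lipschitz_on UNIV ((Ps ! j) z)" "C'-lipschitz_on UNIV ((Ps ! j) (zs n))"
          using C'(2) zsM zz j Ps by auto
        then show ?thesis
          using j Ps False by (auto simp: nth_hybrid intro: lipschitz_on_le)
      qed
      show "(\<lambda>n. ((?hy i n)[i := q (Ps ! i) n] ! j) x) \<longlonglongrightarrow> ((eval_fams z Ps)[i := dir_deriv e (Ps ! i) z] ! j) x" if j: "j < k" for j x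
      proof (cases "i = j")
        case True
        then show ?thesis
          using j Ps q_lim[OF Pi] by simp
      next
        case False
        have "cont_fam (Ps ! j)"
          using j Ps Pc by simp
        then show ?thesis
          using j Ps False lim[of "Ps ! j" x] by (cases "j < i") (auto simp: nth_hybrid)
      qed
      show "(eval_fams z Ps)[i := dir_deriv e (Ps ! i) z] \<in> args Lip k"
        using Pc Ps Pi e by (intro args_update args_Lip eval_fams_args) (auto intro!: Lipb_Lip cont_fam_Lipb diff_fam_cont_fam_dir_deriv)
      show "(?hy i n)[i := q (Ps ! i) n] \<in> args Lip k" for n
        using hyL Pi by (intro args_update) (auto intro!: Lipb_Lip q_Lipb diff_fam_cont_fam)
    qed (use F in \<open>auto intro!: cont_fam_Lipb diff_fam_cont_fam\<close>)
  qed
  have eq: "(T (F (zs n)) (eval_fams (zs n) Ps) - T (F z) (eval_fams z Ps)) / of_real (h n)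
      = T (q F n) (eval_fams (zs n) Ps) + (\<Sum>i<k. T (F z) ((?hy i n)[i := q (Ps ! i) n]))" for n
  proof -
    have a: "eval_fams (zs n) Ps \<in> args Lip k" "eval_fams z Ps \<in> args Lip k"
      using args_Lip[OF eval_fams_args[OF Pc Ps(2)]] by simp_all
    note Fz = cont_fam_Lipb[OF diff_fam_cont_fam[OF F]]
    have "T (q F n) (eval_fams (zs n) Ps) = T (\<lambda>x. inverse (of_real (h n)) * (F (zs n) x - F z x)) (eval_fams (zs n) Ps)"
      by (simp add: q_def[abs_def] divide_inverse mult.commute)
    also have "\<dots> = inverse (of_real (h n)) * (T (F (zs n)) (eval_fams (zs n) Ps) - T (F z) (eval_fams (zs n) Ps))"
      using a Fz by (simp add: T_scale T_diff Lipb_diff)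
    finally have q1: "T (q F n) (eval_fams (zs n) Ps) = inverse (of_real (h n)) * (T (F (zs n)) (eval_fams (zs n) Ps) - T (F z) (eval_fams (zs n) Ps))" .
    have q2: "T (F z) ((?hy i n)[i := q (Ps ! i) n])
        = inverse (of_real (h n)) * (T (F z) ((?hy i n)[i := eval_fams (zs n) Ps ! i]) - T (F z) ((?hy i n)[i := eval_fams z Ps ! i]))"
      if i: "i < k" for i
    proof -
      have L: "(Ps ! i) z \<in> Lip" "(Ps ! i) (zs n) \<in> Lip"
        using Pc Ps i by (auto intro!: Lipb_Lip cont_fam_Lipb)
      have "q (Ps ! i) n = (\<lambda>x. inverse (of_real (h n)) * ((Ps ! i) (zs n) x - (Ps ! i) z x) + 0)"
        by (auto simp: q_def[abs_def] fun_eq_iff divide_inverse mult.commute)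
      then have "T (F z) ((?hy i n)[i := q (Ps ! i) n])
          = T (F z) ((?hy i n)[i := \<lambda>x. inverse (of_real (h n)) * ((Ps ! i) (zs n) x - (Ps ! i) z x) + 0])"
        by (rule arg_cong[where f = "\<lambda>p. T (F z) ((?hy i n)[i := p])"])
      also have "\<dots> = inverse (of_real (h n)) * T (F z) ((?hy i n)[i := \<lambda>x. (Ps ! i) (zs n) x - (Ps ! i) z x]) + T (F z) ((?hy i n)[i := \<lambda>x. 0])"
        by (rule T_lin_arg[OF Fz hyL Lip_diff[OF L(2,1)] Lip_const i])
      also have "T (F z) ((?hy i n)[i := \<lambda>x. 0]) = 0"
        by (rule T_const_arg[OF Fz hyL i Lip_const, of UNIV]) auto
      also have "T (F z) ((?hy i n)[i := \<lambda>x. (Ps ! i) (zs n) x - (Ps ! i) z x])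
          = T (F z) ((?hy i n)[i := (Ps ! i) (zs n)]) - T (F z) ((?hy i n)[i := (Ps ! i) z])"
        by (rule T_diff_arg[OF Fz hyL L(2,1) i])
      finally show ?thesis
        using i Ps by (simp add: algebra_simps)
    qed
    have "T (F z) (eval_fams (zs n) Ps) - T (F z) (eval_fams z Ps)
        = (\<Sum>i<k. T (F z) ((?hy i n)[i := eval_fams (zs n) Ps ! i]) - T (F z) ((?hy i n)[i := eval_fams z Ps ! i]))"
      using Ps by (intro sum_hybrid) auto
    then have "(\<Sum>i<k. T (F z) ((?hy i n)[i := q (Ps ! i) n])) = inverse (of_real (h n)) * (T (F z) (eval_fams (zs n) Ps) - T (F z) (eval_fams z Ps))"
      by (simp add: q2 sum_distrib_left)
    then show ?thesis
      unfolding q1 by (simp add: divide_inverse algebra_simps)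
  qed
  show "(\<lambda>n. (T (F (z + of_real (h n) * e)) (eval_fams (z + of_real (h n) * e) Ps) - T (F z) (eval_fams z Ps)) / of_real (h n))
     \<longlonglongrightarrow> T (dir_deriv e F z) (eval_fams z Ps) + (\<Sum>j<k. T (F z) ((eval_fams z Ps)[j := dir_deriv e (Ps ! j) z]))"
    unfolding zs_def[symmetric] eq by (intro tendsto_add 1 tendsto_sum 2) auto
qed

end

section \<open>The product with the Cauchy kernel\<close>

text \<open>The total variation of the Cauchy kernel times Lebesgue measure on the disc of radius M;
  the bounds on the primitive are integrals against it.\<close>

definition kernel_measure :: "real \<Rightarrow> complex measure" where
  "kernel_measure M = density lborel (\<lambda>z. ennreal (indicator (cball 0 M) z * inverse (cmod (z - 1))))"

lemma kern_measurable [measurable]: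
  "(\<lambda>z::complex. indicator (cball 0 M) z * inverse (cmod (z - 1)) :: real) \<in> borel_measurable borel"
  by measurable

lemma sets_kernel_measure [simp, measurable_cong]: "sets (kernel_measure M) = sets borel"
  by (simp add: kernel_measure_def)

lemma space_kernel_measure [simp]: "space (kernel_measure M) = UNIV"
  by (simp add: kernel_measure_def)

lemma finite_kernel_measure: "finite_measure (kernel_measure M)"
proof (rule finite_measureI)
  have "emeasure (kernel_measure M) (space (kernel_measure M)) = (\<integral>\<^sup>+z. ennreal (indicator (cball 0 M) z * inverse (cmod (z - 1))) \<partial>lborel)"
    unfolding kernel_measure_def by (simp add: emeasure_density)
  also have "\<dots> < \<infinity>"
    using integrable_cauchy_kernel[of M] unfolding integrable_iff_bounded by (simp add: abs_mult)
  finally show "emeasure (kernel_measure M) (space (kernel_measure M)) \<noteq> \<infinity>"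
    by simp
qed

lemma integral_kernel_measure:
  fixes g :: "complex \<Rightarrow> real"
  assumes [measurable]: "g \<in> borel_measurable borel"
  shows "(\<integral>z. g z \<partial>kernel_measure M) = (\<integral>z. (indicator (cball 0 M) z * inverse (cmod (z - 1))) * g z \<partial>lborel)"
    and "integrable (kernel_measure M) g \<longleftrightarrow> integrable lborel (\<lambda>z. (indicator (cball 0 M) z * inverse (cmod (z - 1))) * g z)"
  unfolding kernel_measure_def by (subst integral_density integrable_density; simp)+

lemma AE_kernel_measure: "AE z in kernel_measure M. cmod z \<le> M"
  unfolding kernel_measure_def by (subst AE_density) (auto intro!: AE_I2 simp: indicator_def ennreal_mult)

lemma kernel_measure_integrable_bounded:
  assumes [measurable]: "g \<in> borel_measurable borel" and B: "\<And>z. cmod z \<le> M \<Longrightarrow> \<bar>g z\<bar> \<le> B"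
  shows "integrable (kernel_measure M) (g :: complex \<Rightarrow> real)"
proof -
  interpret finite_measure "kernel_measure M" by (rule finite_kernel_measure)
  show ?thesis
    by (rule integrable_const_bound[of _ B]) (use AE_kernel_measure[of M] B in \<open>auto elim!: eventually_mono\<close>)
qed

lemma kernel_integrable:
  assumes q: "continuous_on UNIV q" "\<And>z. M < cmod z \<Longrightarrow> q z = 0"
  shows "integrable lborel (\<lambda>z. q z / (z - 1))"
proof -
  obtain B where B: "0 \<le> B" "\<And>z. cmod (q z) \<le> B"
    using continuous_compact_support_bounded[OF q] by metis
  have [measurable]: "q \<in> borel_measurable borel"
    using q by (auto intro: borel_measurable_continuous_onI)
  show ?thesis
  proof (rule Bochner_Integration.integrable_bound)
    show "integrable lborel (\<lambda>z. B * (indicator (cball (0::complex) M) z * inverse (cmod (z - 1))))"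
      by (intro integrable_mult_right integrable_cauchy_kernel)
    show "AE z in lborel. norm (q z / (z - 1)) \<le> norm (B * (indicator (cball 0 M) z * inverse (cmod (z - 1))))"
    proof (rule AE_I2)
      fix z
      show "norm (q z / (z - 1)) \<le> norm (B * (indicator (cball 0 M) z * inverse (cmod (z - 1))))"
      proof (cases "cmod z \<le> M")
        case True
        then show ?thesis
          using B mult_right_mono[OF B(2)[of z], of "inverse (cmod (z - 1))"] by (simp add: norm_mult norm_inverse divide_inverse abs_mult)
      qed (use q(2)[of z] in simp)
    qed
  qed measurable
qed

lemma kernel_integral_le:
  assumes q: "continuous_on UNIV q" "\<And>z. M < cmod z \<Longrightarrow> q z = 0"
    and [measurable]: "g \<in> borel_measurable borel" and g: "integrable (kernel_measure M) g"
    and le: "\<And>z. cmod z \<le> M \<Longrightarrow> cmod (q z) \<le> g z"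
  shows "cmod (\<integral>z. q z / (z - 1) \<partial>lborel) \<le> (\<integral>z. g z \<partial>kernel_measure M)"
proof -
  have "cmod (\<integral>z. q z / (z - 1) \<partial>lborel) \<le> (\<integral>z. norm (q z / (z - 1)) \<partial>lborel)"
    by (rule integral_norm_bound)
  also have "\<dots> \<le> (\<integral>z. (indicator (cball 0 M) z * inverse (cmod (z - 1))) * g z \<partial>lborel)"
  proof (rule integral_mono)
    show "integrable lborel (\<lambda>z. norm (q z / (z - 1)))"
      by (intro integrable_norm kernel_integrable[OF q])
    show "integrable lborel (\<lambda>z. (indicator (cball 0 M) z * inverse (cmod (z - 1))) * g z)"
      using g integral_kernel_measure(2)[of g M] by simp
    fix z
    show "norm (q z / (z - 1)) \<le> (indicator (cball 0 M) z * inverse (cmod (z - 1))) * g z"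
    proof (cases "cmod z \<le> M")
      case True
      then show ?thesis
        using mult_right_mono[OF le[OF True], of "inverse (cmod (z - 1))"] by (simp add: norm_mult norm_inverse divide_inverse mult.commute)
    qed (use q(2)[of z] in simp)
  qed
  also have "\<dots> = (\<integral>z. g z \<partial>kernel_measure M)"
    by (simp add: integral_kernel_measure(1))
  finally show ?thesis .
qed

text \<open>Lipschitz families: \<open>P z\<close> comes from \<open>x \<mapsto> p (z x)\<close>, so its constant in \<open>x\<close> grows linearly in \<open>z\<close>.\<close>
definition lip_fam :: "real \<Rightarrow> (complex \<Rightarrow> 'a::real_normed_vector \<Rightarrow> complex) \<Rightarrow> bool" where
  "lip_fam L P \<longleftrightarrow> 0 \<le> L \<and> (\<forall>z z' x. cmod (P z x - P z' x) \<le> L * cmod (z - z')) \<and>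
     (\<forall>z x x'. cmod (P z x - P z x') \<le> L * (1 + cmod z) * norm (x - x'))"

lemma lip_fam_nonneg: "lip_fam L P \<Longrightarrow> 0 \<le> L"
  by (simp add: lip_fam_def)

lemma lip_fam_lipschitz: "lip_fam L P \<Longrightarrow> (L * (1 + cmod z))-lipschitz_on UNIV (P z)"
  by (auto simp: lip_fam_def dist_norm intro!: lipschitz_onI)

lemma lip_fam_dir_deriv_bound:
  assumes L: "lip_fam L P" and P: "diff_fam P" and e: "e \<in> {1, \<i>}"
  shows "cmod (dir_deriv e P z x) \<le> L"
proof -
  define h where "h n = 1 / real (Suc n)" for n
  have h: "h \<longlonglongrightarrow> 0" "\<And>n. h n \<noteq> 0" "\<And>n. 0 < h n"
    unfolding h_def using LIMSEQ_Suc[OF lim_1_over_n] by auto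
  have lim: "(\<lambda>n. cmod ((P (z + of_real (h n) * e) x - P z x) / of_real (h n))) \<longlonglongrightarrow> cmod (dir_deriv e P z x)"
    by (intro tendsto_norm has_dir_deriv_quot[OF diff_fam_deriv[OF P e]] h)
  have "cmod ((P (z + of_real (h n) * e) x - P z x) / of_real (h n)) \<le> L" for n
  proof -
    have "cmod (P (z + of_real (h n) * e) x - P z x) \<le> L * cmod (z + of_real (h n) * e - z)"
      using L unfolding lip_fam_def by blast
    also have "\<dots> = L * h n"
      using e h(3)[of n] by (auto simp: norm_mult)
    finally show ?thesis
      using h(3)[of n] by (simp add: norm_divide divide_le_eq)
  qed
  then show ?thesis
    by (intro LIMSEQ_le_const2[OF lim]) auto
qed

lemma lip_fam_dbar_bound:
  assumes "lip_fam L P" "diff_fam P"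
  shows "cmod (dbar P z x) \<le> 2 * L"
proof -
  have "cmod (dbar P z x) \<le> cmod (dir_deriv 1 P z x) + cmod (\<i> * dir_deriv \<i> P z x)"
    unfolding dbar_def by (rule norm_triangle_ineq)
  then show ?thesis
    using lip_fam_dir_deriv_bound[OF assms, of 1 z x] lip_fam_dir_deriv_bound[OF assms, of \<i> z x] by (simp add: norm_mult)
qed

context annulus_current
begin

text \<open>Vanishing can only be asked for away from the origin, near which z x stays in a given
  ball even for large z. The annulus is all that T sees of its first argument.\<close>

definition vanishing :: "real \<Rightarrow> (complex \<Rightarrow> 'a \<Rightarrow> complex) \<Rightarrow> bool" where
  "vanishing M F \<longleftrightarrow> (\<forall>z x. M < cmod z \<longrightarrow> r \<le> norm x \<longrightarrow> norm x \<le> R0 \<longrightarrow> F z x = 0)"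

definition diff_fams :: "(complex \<Rightarrow> 'a \<Rightarrow> complex) list \<Rightarrow> bool" where
  "diff_fams Ps \<longleftrightarrow> (\<forall>P\<in>set Ps. diff_fam P) \<and> length Ps = k"

definition fiber_mass :: "(complex \<Rightarrow> 'a \<Rightarrow> complex) \<Rightarrow> complex \<Rightarrow> real" where
  "fiber_mass P z = (\<integral>x. cmod (P z x) \<partial>\<nu>)"

definition weighted_mass :: "real \<Rightarrow> (complex \<Rightarrow> 'a \<Rightarrow> complex) \<Rightarrow> real" where
  "weighted_mass M P = (\<integral>z. fiber_mass P z \<partial>kernel_measure M)"

text \<open>The contraction of \<open>T\<close> with the conjugate differential of the parameter, applied to the arguments \<open>G # Ps\<close>.
  Putting \<open>G\<close> in the place of the differentiated \<open>Ps ! j\<close> absorbs the alternating signs.\<close>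
definition contraction :: "(complex \<Rightarrow> 'a \<Rightarrow> complex) \<Rightarrow> (complex \<Rightarrow> 'a \<Rightarrow> complex) \<Rightarrow> (complex \<Rightarrow> 'a \<Rightarrow> complex) list \<Rightarrow> complex \<Rightarrow> complex" where
  "contraction F G Ps z = T (\<lambda>x. F z x * dbar G z x) (eval_fams z Ps)
     - (\<Sum>j<k. T (\<lambda>x. F z x * dbar (Ps ! j) z x) (eval_fams z (Ps[j := G])))"

text \<open>The factor -1 / \<open>cp_const\<close> is the normalisation of
  \<open>cauchy_pompeiu\<close>; since \<open>dbar\<close> is twice the Wirtinger derivative there
  as well, no further factor arises.\<close>

definition slot_primitive :: "(complex \<Rightarrow> 'a \<Rightarrow> complex) \<Rightarrow> (complex \<Rightarrow> 'a \<Rightarrow> complex) \<Rightarrow> (complex \<Rightarrow> 'a \<Rightarrow> complex) list \<Rightarrow> complex" where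
  "slot_primitive F G Ps = - (1 / of_real cp_const) * (\<integral>z. contraction F G Ps z / (z - 1) \<partial>lborel)"

section \<open>Integration by parts and antisymmetry\<close>

lemma diff_fams_length: "diff_fams Ps \<Longrightarrow> length Ps = k"
  by (simp add: diff_fams_def)

lemma diff_fams_nth: "diff_fams Ps \<Longrightarrow> j < k \<Longrightarrow> diff_fam (Ps ! j)"
  by (auto simp: diff_fams_def)

lemma diff_fams_update: "diff_fams Ps \<Longrightarrow> diff_fam G \<Longrightarrow> diff_fams (Ps[j := G])"
  by (auto simp: diff_fams_def dest!: set_update_subset_insert[THEN subsetD])

lemma diff_fams_cont_fam: "diff_fams Ps \<Longrightarrow> \<forall>P\<in>set Ps. cont_fam P"
  by (auto simp: diff_fams_def diff_fam_cont_fam)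

lemma diff_fams_args: "diff_fams Ps \<Longrightarrow> eval_fams z Ps \<in> args Lipb k"
  by (intro eval_fams_args diff_fams_cont_fam diff_fams_length)

lemma diff_fams_args': "diff_fams Ps \<Longrightarrow> eval_fams z Ps \<in> args Lip k"
  by (intro args_Lip diff_fams_args)

lemma diff_fam_Lipb: "diff_fam P \<Longrightarrow> P z \<in> Lipb"
  by (intro cont_fam_Lipb diff_fam_cont_fam)

lemma diff_fam_dbar_Lipb: "diff_fam P \<Longrightarrow> dbar P z \<in> Lipb"
  by (intro cont_fam_Lipb diff_fam_cont_fam_dbar)

lemma FDD_Lipb: "diff_fam F \<Longrightarrow> diff_fam G \<Longrightarrow> (\<lambda>x. F z x * dbar G z x) \<in> Lipb"
  by (intro Lipb_mult diff_fam_Lipb diff_fam_dbar_Lipb)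

lemma contraction_continuous:
  assumes "diff_fam F" "diff_fam G" "diff_fams Ps"
  shows "continuous_on UNIV (contraction F G Ps)"
proof -
  have 1: "continuous_on UNIV (\<lambda>z. T (\<lambda>x. F z x * dbar G z x) (eval_fams z Ps))"
    using assms by (intro T_cont_fam_continuous[of "\<lambda>z x. F z x * dbar G z x"] cont_fam_mult diff_fam_cont_fam diff_fam_cont_fam_dbar diff_fams_cont_fam diff_fams_length)
  have 2: "continuous_on UNIV (\<lambda>z. T (\<lambda>x. F z x * dbar (Ps ! j) z x) (eval_fams z (Ps[j := G])))" if "j < k" for j
    using assms that
    by (intro T_cont_fam_continuous[of "\<lambda>z x. F z x * dbar (Ps ! j) z x"] cont_fam_mult diff_fam_cont_fam diff_fam_cont_fam_dbar diff_fams_cont_fam diff_fams_length diff_fams_update diff_fams_nth)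
  show ?thesis
    unfolding contraction_def[abs_def] by (intro continuous_intros 1 2) auto
qed

lemma T_vanish:
  assumes "f \<in> Lipb" "\<pi> \<in> args Lip k" "\<And>x. r \<le> norm x \<Longrightarrow> norm x \<le> R0 \<Longrightarrow> f x = 0"
  shows "T f \<pi> = 0"
  using T_cong_first[of f "\<lambda>x. 0" \<pi>] assms T_zero by simp

lemma vanishing_dir_deriv:
  assumes "vanishing M F" "diff_fam F" "e \<in> {1, \<i>}"
  shows "vanishing M (dir_deriv e F)"
  unfolding vanishing_def using assms has_dir_deriv_vanish[OF diff_fam_deriv[OF assms(2,3)], of M] by (simp add: vanishing_def)

lemma vanishing_dbar: "vanishing M F \<Longrightarrow> diff_fam F \<Longrightarrow> vanishing M (dbar F)"
  using vanishing_dir_deriv[of M F 1] vanishing_dir_deriv[of M F \<i>] by (auto simp: vanishing_def dbar_def)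

lemma contraction_vanish_first:
  assumes "vanishing M F" "diff_fam F" "diff_fam G" "diff_fams Ps" "M < cmod z"
  shows "contraction F G Ps z = 0"
proof -
  have "T (\<lambda>x. F z x * dbar G z x) (eval_fams z Ps) = 0"
    using assms by (intro T_vanish FDD_Lipb diff_fams_args') (auto simp: vanishing_def)
  moreover have "T (\<lambda>x. F z x * dbar (Ps ! j) z x) (eval_fams z (Ps[j := G])) = 0" if "j < k" for j
    using assms that by (intro T_vanish FDD_Lipb diff_fams_args' diff_fams_update diff_fams_nth) (auto simp: vanishing_def)
  ultimately show ?thesis
    by (simp add: contraction_def)
qed

text \<open>F now sits in an entry, where vanishing on the annulus alone does not make T vanish.
  \<open>T_swap_first\<close> brings it to the first argument, where it does.\<close>

lemma contraction_vanish_second: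
  assumes "vanishing M F" "diff_fam F" "diff_fam G" "diff_fams Ps" "M < cmod z"
  shows "contraction G F Ps z = 0"
proof -
  have "T (\<lambda>x. G z x * dbar F z x) (eval_fams z Ps) = 0"
    using assms vanishing_dbar[of M F] by (intro T_vanish FDD_Lipb diff_fams_args') (auto simp: vanishing_def)
  moreover have "T (\<lambda>x. G z x * dbar (Ps ! j) z x) (eval_fams z (Ps[j := F])) = 0" if "j < k" for j
  proof -
    have "T (\<lambda>x. G z x * dbar (Ps ! j) z x) ((eval_fams z Ps)[j := F z]) = - T (F z) ((eval_fams z Ps)[j := \<lambda>x. G z x * dbar (Ps ! j) z x])"
      using assms that by (intro T_swap_first FDD_Lipb diff_fams_nth diff_fam_Lipb diff_fams_args)
    also have "T (F z) ((eval_fams z Ps)[j := \<lambda>x. G z x * dbar (Ps ! j) z x]) = 0"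
      using assms that
      by (intro T_vanish diff_fam_Lipb args_update diff_fams_args' Lipb_Lip FDD_Lipb diff_fams_nth) (auto simp: vanishing_def)
    finally show ?thesis
      by (simp add: eval_fams_update)
  qed
  ultimately show ?thesis
    by (simp add: contraction_def)
qed

text \<open>The right side is the antiholomorphic derivative of z \<mapsto> T(F G, Ps) expanded by
  the product rule. In slot j, \<open>T_product\<close> merges the two terms into a single entry F
  G, and a swap moves F G to the first argument, which produces the sign.\<close>

lemma contraction_leibniz:
  assumes F: "diff_fam F" and G: "diff_fam G" and Ps: "diff_fams Ps"
  shows "contraction F G Ps z + contraction G F Ps z = T (dbar (\<lambda>z x. F z x * G z x) z) (eval_fams z Ps)
     + (\<Sum>j<k. T (\<lambda>x. F z x * G z x) ((eval_fams z Ps)[j := dbar (Ps ! j) z]))"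
proof -
  note L = FDD_Lipb diff_fam_Lipb diff_fam_dbar_Lipb diff_fams_args diff_fams_args' diff_fams_nth Lipb_mult
  have "T (dbar (\<lambda>z x. F z x * G z x) z) (eval_fams z Ps) = T (\<lambda>x. F z x * dbar G z x + G z x * dbar F z x) (eval_fams z Ps)"
    by (simp add: diff_fam_mult(2)[OF F G])
  also have "\<dots> = T (\<lambda>x. F z x * dbar G z x) (eval_fams z Ps) + T (\<lambda>x. G z x * dbar F z x) (eval_fams z Ps)"
    using F G Ps by (intro T_add L)
  finally have 1: "T (dbar (\<lambda>z x. F z x * G z x) z) (eval_fams z Ps) = T (\<lambda>x. F z x * dbar G z x) (eval_fams z Ps) + T (\<lambda>x. G z x * dbar F z x) (eval_fams z Ps)" .
  have 2: "T (\<lambda>x. F z x * dbar (Ps ! j) z x) ((eval_fams z Ps)[j := G z]) + T (\<lambda>x. G z x * dbar (Ps ! j) z x) ((eval_fams z Ps)[j := F z])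
      = - T (\<lambda>x. F z x * G z x) ((eval_fams z Ps)[j := dbar (Ps ! j) z])" if j: "j < k" for j
  proof -
    have P: "diff_fam (Ps ! j)"
      using Ps j by (rule diff_fams_nth)
    have "T (\<lambda>x. F z x * dbar (Ps ! j) z x) ((eval_fams z Ps)[j := G z]) + T (\<lambda>x. G z x * dbar (Ps ! j) z x) ((eval_fams z Ps)[j := F z])
       = T (dbar (Ps ! j) z) ((eval_fams z Ps)[j := \<lambda>x. F z x * G z x])"
      using T_product[of "dbar (Ps ! j) z" "F z" "G z" "eval_fams z Ps" j] F G Ps P j by (simp add: L mult.commute)
    also have "\<dots> = - T (\<lambda>x. F z x * G z x) ((eval_fams z Ps)[j := dbar (Ps ! j) z])"
      using F G Ps P j by (intro T_swap_first L)
    finally show ?thesis .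
  qed
  have "contraction F G Ps z + contraction G F Ps z = (T (\<lambda>x. F z x * dbar G z x) (eval_fams z Ps) + T (\<lambda>x. G z x * dbar F z x) (eval_fams z Ps))
      - (\<Sum>j<k. T (\<lambda>x. F z x * dbar (Ps ! j) z x) ((eval_fams z Ps)[j := G z]) + T (\<lambda>x. G z x * dbar (Ps ! j) z x) ((eval_fams z Ps)[j := F z]))"
    unfolding contraction_def eval_fams_update sum.distrib by simp
  also have "\<dots> = T (dbar (\<lambda>z x. F z x * G z x) z) (eval_fams z Ps) + (\<Sum>j<k. T (\<lambda>x. F z x * G z x) ((eval_fams z Ps)[j := dbar (Ps ! j) z]))"
    unfolding 1 by (simp add: 2 sum_negf)
  finally show ?thesis .
qed

lemma slot_primitive_leibniz:
  assumes F: "diff_fam F" and G: "diff_fam G" and Ps: "diff_fams Ps" and M: "vanishing M F"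
  shows "slot_primitive F G Ps + slot_primitive G F Ps = T (\<lambda>x. F 1 x * G 1 x) (eval_fams 1 Ps)"
proof -
  let ?H = "\<lambda>z x. F z x * G z x"
  let ?\<phi> = "\<lambda>z. T (?H z) (eval_fams z Ps)"
  let ?\<phi>' = "\<lambda>e z. T (dir_deriv e ?H z) (eval_fams z Ps) + (\<Sum>j<k. T (?H z) ((eval_fams z Ps)[j := dir_deriv e (Ps ! j) z]))"
  note H = diff_fam_mult(1)[OF F G]
  have d: "has_dir_deriv e ?\<phi> (?\<phi>' e)" if "e \<in> {1, \<i>}" for e
    using T_dir_deriv[OF H _ _ that, of Ps] Ps by (simp add: diff_fams_def)
  have \<phi>0: "?\<phi> z = 0" if "M < cmod z" for z
    using that M F G Ps by (intro T_vanish Lipb_mult diff_fam_Lipb diff_fams_args') (auto simp: vanishing_def)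
  have c: "continuous_on UNIV ?\<phi>"
    using H Ps by (intro T_cont_fam_continuous diff_fam_cont_fam diff_fams_cont_fam diff_fams_length)
  have c': "continuous_on UNIV (?\<phi>' e)" if e: "e \<in> {1, \<i>}" for e
  proof (intro continuous_on_add continuous_on_sum)
    show "continuous_on UNIV (\<lambda>z. T (dir_deriv e ?H z) (eval_fams z Ps))"
      using H Ps e by (intro T_cont_fam_continuous diff_fam_cont_fam_dir_deriv diff_fams_cont_fam diff_fams_length)
    fix j assume "j \<in> {..<k}"
    then have "\<forall>P\<in>set (Ps[j := dir_deriv e (Ps ! j)]). cont_fam P" "length (Ps[j := dir_deriv e (Ps ! j)]) = k"
      using Ps e diff_fams_nth[OF Ps, of j]
      by (auto simp: diff_fams_length diff_fam_cont_fam_dir_deriv dest!: set_update_subset_insert[THEN subsetD] dest: diff_fams_cont_fam)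
    then show "continuous_on UNIV (\<lambda>z. T (?H z) ((eval_fams z Ps)[j := dir_deriv e (Ps ! j) z]))"
      using T_cont_fam_continuous[OF diff_fam_cont_fam[OF H], of "Ps[j := dir_deriv e (Ps ! j)]"] by (simp add: eval_fams_update)
  qed
  have \<phi>'0: "?\<phi>' e z = 0" if "M < cmod z" "e \<in> {1, \<i>}" for z e
    using has_dir_deriv_vanish[OF d[OF that(2)] \<phi>0 that(1)] .
  \<comment> \<open>T is complex linear in every argument, so \<i> times the second partial
    derivative moves inside and the two partial derivatives combine to \<open>dbar\<close>.\<close>
  have eq: "?\<phi>' 1 z + \<i> * ?\<phi>' \<i> z = contraction F G Ps z + contraction G F Ps z" for z
  proof -
    have "T (dbar ?H z) (eval_fams z Ps) = T (\<lambda>x. \<i> * dir_deriv \<i> ?H z x + dir_deriv 1 ?H z x) (eval_fams z Ps)"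
      unfolding dbar_def[abs_def] by (simp add: add.commute)
    also have "\<dots> = \<i> * T (dir_deriv \<i> ?H z) (eval_fams z Ps) + T (dir_deriv 1 ?H z) (eval_fams z Ps)"
      using H Ps by (intro T_lin) (auto intro!: cont_fam_Lipb diff_fam_cont_fam_dir_deriv diff_fams_args')
    finally have 1: "T (dbar ?H z) (eval_fams z Ps) = \<i> * T (dir_deriv \<i> ?H z) (eval_fams z Ps) + T (dir_deriv 1 ?H z) (eval_fams z Ps)" .
    have 2: "T (?H z) ((eval_fams z Ps)[j := dbar (Ps ! j) z]) = \<i> * T (?H z) ((eval_fams z Ps)[j := dir_deriv \<i> (Ps ! j) z]) + T (?H z) ((eval_fams z Ps)[j := dir_deriv 1 (Ps ! j) z])"
      if j: "j < k" for j
    proof -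
      have "T (?H z) ((eval_fams z Ps)[j := dbar (Ps ! j) z]) = T (?H z) ((eval_fams z Ps)[j := \<lambda>x. \<i> * dir_deriv \<i> (Ps ! j) z x + dir_deriv 1 (Ps ! j) z x])"
        unfolding dbar_def[abs_def] by (simp add: add.commute)
      also have "\<dots> = \<i> * T (?H z) ((eval_fams z Ps)[j := dir_deriv \<i> (Ps ! j) z]) + T (?H z) ((eval_fams z Ps)[j := dir_deriv 1 (Ps ! j) z])"
        using diff_fam_Lipb[OF H] diff_fams_args'[OF Ps] diff_fams_nth[OF Ps j] j
        by (intro T_lin_arg) (auto intro!: Lipb_Lip cont_fam_Lipb diff_fam_cont_fam_dir_deriv)
      finally show ?thesis .
    qed
    show ?thesis
      unfolding contraction_leibniz[OF F G Ps] 1 by (simp add: 2 sum.distrib sum_distrib_left algebra_simps)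
  qed
  have i1: "integrable lborel (\<lambda>z. contraction F G Ps z / (z - 1))"
    by (rule kernel_integrable[OF contraction_continuous[OF F G Ps] contraction_vanish_first[OF M F G Ps]])
  have i2: "integrable lborel (\<lambda>z. contraction G F Ps z / (z - 1))"
    by (rule kernel_integrable[OF contraction_continuous[OF G F Ps] contraction_vanish_second[OF M F G Ps]])
  have "(\<integral>z. contraction F G Ps z / (z - 1) \<partial>lborel) + (\<integral>z. contraction G F Ps z / (z - 1) \<partial>lborel)
      = (\<integral>z. (?\<phi>' 1 z + \<i> * ?\<phi>' \<i> z) / (z - 1) \<partial>lborel)"
    unfolding eq add_divide_distrib by (rule Bochner_Integration.integral_add[OF i1 i2, symmetric])
  also have "\<dots> = - of_real cp_const * ?\<phi> 1"
    by (rule cauchy_pompeiu[where M = M]) (auto intro!: d c c' \<phi>0 \<phi>'0 simp del: add_eq_0_iff)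
  finally have "(\<integral>z. contraction F G Ps z / (z - 1) \<partial>lborel) + (\<integral>z. contraction G F Ps z / (z - 1) \<partial>lborel) = - of_real cp_const * ?\<phi> 1" .
  then have "slot_primitive F G Ps + slot_primitive G F Ps = - (1 / of_real cp_const) * (- of_real cp_const * ?\<phi> 1)"
    unfolding slot_primitive_def distrib_left[symmetric] by simp
  then show ?thesis
    using cp_const_pos by simp
qed

text \<open>Exchanging G with the entry in slot i exchanges the leading term of the contraction with
  its summand for i, and these carry opposite signs; every other summand changes sign by
  \<open>T_antisym\<close>.\<close>

lemma contraction_antisym:
  assumes F: "diff_fam F" and G: "diff_fam G" and Ps: "diff_fams Ps" and i: "i < k"
  shows "contraction F (Ps ! i) (Ps[i := G]) z = - contraction F G Ps z"
proof -
  note len = diff_fams_length[OF Ps]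
  have ne: "T (\<lambda>x. F z x * dbar (Ps ! j) z x) (eval_fams z (Ps[i := G, j := Ps ! i])) = - T (\<lambda>x. F z x * dbar (Ps ! j) z x) (eval_fams z (Ps[j := G]))"
    if j: "j < k" "j \<noteq> i" for j
  proof -
    have "T (\<lambda>x. F z x * dbar (Ps ! j) z x) ((eval_fams z Ps)[i := G z, j := (Ps ! i) z])
       = - T (\<lambda>x. F z x * dbar (Ps ! j) z x) ((eval_fams z Ps)[i := (Ps ! i) z, j := G z])"
      using F G Ps i j by (intro T_antisym FDD_Lipb diff_fam_Lipb diff_fams_nth diff_fams_args) auto
    also have "(eval_fams z Ps)[i := (Ps ! i) z] = eval_fams z Ps"
      using i len by (simp add: list_update_same_conv)
    finally show ?thesis
      by (simp add: eval_fams_update)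
  qed
  have "(\<Sum>j<k. T (\<lambda>x. F z x * dbar (Ps[i := G] ! j) z x) (eval_fams z (Ps[i := G, j := Ps ! i])))
     = T (\<lambda>x. F z x * dbar G z x) (eval_fams z Ps) + (\<Sum>j\<in>{..<k} - {i}. T (\<lambda>x. F z x * dbar (Ps ! j) z x) (eval_fams z (Ps[i := G, j := Ps ! i])))"
    using i len by (subst sum.remove[of _ i]) auto
  also have "\<dots> = T (\<lambda>x. F z x * dbar G z x) (eval_fams z Ps) - (\<Sum>j\<in>{..<k} - {i}. T (\<lambda>x. F z x * dbar (Ps ! j) z x) (eval_fams z (Ps[j := G])))"
    by (simp add: ne sum_negf)
  finally have 1: "(\<Sum>j<k. T (\<lambda>x. F z x * dbar (Ps[i := G] ! j) z x) (eval_fams z (Ps[i := G, j := Ps ! i])))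
     = T (\<lambda>x. F z x * dbar G z x) (eval_fams z Ps) - (\<Sum>j\<in>{..<k} - {i}. T (\<lambda>x. F z x * dbar (Ps ! j) z x) (eval_fams z (Ps[j := G])))" .
  have 2: "(\<Sum>j<k. T (\<lambda>x. F z x * dbar (Ps ! j) z x) (eval_fams z (Ps[j := G])))
     = T (\<lambda>x. F z x * dbar (Ps ! i) z x) (eval_fams z (Ps[i := G])) + (\<Sum>j\<in>{..<k} - {i}. T (\<lambda>x. F z x * dbar (Ps ! j) z x) (eval_fams z (Ps[j := G])))"
    using i by (subst sum.remove[of _ i]) auto
  show ?thesis
    unfolding contraction_def 1 2 by simp
qed

lemma slot_primitive_antisym:
  assumes "diff_fam F" "diff_fam G" "diff_fams Ps" "i < k"
  shows "slot_primitive F (Ps ! i) (Ps[i := G]) = - slot_primitive F G Ps"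
  unfolding slot_primitive_def contraction_antisym[OF assms] by simp

section \<open>Mass estimates\<close>

lemma fiber_mass_nonneg: "0 \<le> fiber_mass P z"
  by (simp add: fiber_mass_def)

text \<open>Continuity in z supplies measurability and, on the compact disc, boundedness; both are
  needed to integrate against the kernel measure.\<close>

lemma fiber_mass_continuous:
  assumes P: "cont_fam P"
  shows "continuous_on UNIV (fiber_mass P)"
  unfolding continuous_on_sequentially
proof (intro allI ballI impI, elim conjE)
  fix zs z assume zs: "\<forall>n. zs n \<in> (UNIV::complex set)" "zs \<longlonglongrightarrow> z"
  obtain M where M: "\<And>n. cmod (zs n) \<le> M"
    using convergent_imp_Bseq[of zs] zs(2) by (auto simp: Bseq_def convergent_def)
  obtain C where C: "\<And>z x. cmod z \<le> M \<Longrightarrow> cmod (P z x) \<le> C"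
    using cont_fam_bound[OF P, of M] by metis
  have [measurable]: "P z \<in> borel_measurable borel" for z
    using P by (intro Lip_measurable Lipb_Lip cont_fam_Lipb)
  have "(\<lambda>n. \<integral>x. cmod (P (zs n) x) \<partial>\<nu>) \<longlonglongrightarrow> (\<integral>x. cmod (P z x) \<partial>\<nu>)"
  proof (rule integral_dominated_convergence[where w = "\<lambda>_. C"])
    show "AE x in \<nu>. (\<lambda>n. cmod (P (zs n) x)) \<longlonglongrightarrow> cmod (P z x)"
      by (intro AE_I2 tendsto_norm continuous_on_tendsto_compose[OF cont_fam_continuous[OF P, of UNIV] zs(2)]) auto
    show "AE x in \<nu>. norm (cmod (P (zs n) x)) \<le> C" for n
      using C[OF M[of n]] by simp
  qed auto
  then show "(fiber_mass P \<circ> zs) \<longlonglongrightarrow> fiber_mass P z"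
    by (simp add: o_def fiber_mass_def)
qed

lemma fiber_mass_measurable: "cont_fam P \<Longrightarrow> fiber_mass P \<in> borel_measurable borel"
  by (intro borel_measurable_continuous_onI fiber_mass_continuous)

lemma fiber_mass_integrable:
  assumes P: "cont_fam P"
  shows "integrable (kernel_measure M) (fiber_mass P)"
proof -
  have "compact (fiber_mass P ` cball 0 M)"
    using fiber_mass_continuous[OF P] by (intro compact_continuous_image) (auto intro: continuous_on_subset)
  then obtain B where "\<forall>z\<in>cball 0 M. \<bar>fiber_mass P z\<bar> \<le> B"
    by (auto dest!: compact_imp_bounded simp: bounded_iff)
  then show ?thesis
    by (intro kernel_measure_integrable_bounded[of _ _ B] fiber_mass_measurable[OF P]) auto
qed

lemma fiber_mass_mult_le:
  assumes F: "F z \<in> Lipb" and u: "u \<in> Lipb" "\<And>x. cmod (u x) \<le> c"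
  shows "(\<integral>x. cmod (F z x * u x) \<partial>\<nu>) \<le> c * fiber_mass F z"
proof -
  have "(\<integral>x. cmod (F z x * u x) \<partial>\<nu>) \<le> (\<integral>x. c * cmod (F z x) \<partial>\<nu>)"
    using F u by (intro integral_mono int_nu Lipb_mult integrable_mult_right) (auto simp: norm_mult mult.commute intro!: mult_right_mono)
  then show ?thesis
    by (simp add: fiber_mass_def)
qed

text \<open>Each of the k + 1 terms has one differentiated family, with \<open>dbar\<close> at most
  twice its constant, and k undifferentiated ones, whose Lipschitz constants carry the factor 1 +
  |z|. F enters only through its absolute value.\<close>

lemma contraction_bound:
  assumes F: "diff_fam F" and G: "diff_fam G" "lip_fam (Ls 0) G" and Ps: "diff_fams Ps" "\<And>j. j < k \<Longrightarrow> lip_fam (Ls (Suc j)) (Ps ! j)"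
  shows "cmod (contraction F G Ps z) \<le> 2 * (real k + 1) * (1 + cmod z) ^ k * (\<Prod>i<Suc k. Ls i) * fiber_mass F z"
proof -
  let ?m = "1 + cmod z"
  let ?R = "2 * ?m ^ k * (\<Prod>i<Suc k. Ls i) * fiber_mass F z"
  have L0: "0 \<le> Ls i" if "i < Suc k" for i
    using G(2) Ps(2) lip_fam_nonneg that by (cases i) auto
  have split: "(\<Prod>i<Suc k. Ls i) = Ls 0 * (\<Prod>j<k. Ls (Suc j))"
    by (rule prod.lessThan_Suc_shift)
  have P0: "0 \<le> (\<Prod>j<k. Ls (Suc j))"
    using L0 by (intro prod_nonneg) auto
  have len: "length Ps = k"
    using Ps diff_fams_length by blast
  have t0: "cmod (T (\<lambda>x. F z x * dbar G z x) (eval_fams z Ps)) \<le> ?R"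
  proof -
    have "cmod (T (\<lambda>x. F z x * dbar G z x) (eval_fams z Ps)) \<le> (\<Prod>j<k. Ls (Suc j) * ?m) * (\<integral>x. cmod (F z x * dbar G z x) \<partial>\<nu>)"
      using F G Ps len by (intro T_bound FDD_Lipb diff_fams_args') (auto intro!: lip_fam_lipschitz)
    also have "\<dots> \<le> (\<Prod>j<k. Ls (Suc j) * ?m) * (2 * Ls 0 * fiber_mass F z)"
      using F G L0 by (intro mult_left_mono fiber_mass_mult_le diff_fam_Lipb diff_fam_dbar_Lipb lip_fam_dbar_bound prod_nonneg) auto
    also have "\<dots> = ?R"
      unfolding split by (simp add: prod.distrib mult_ac)
    finally show ?thesis .
  qed
  have tj: "cmod (T (\<lambda>x. F z x * dbar (Ps ! j) z x) (eval_fams z (Ps[j := G]))) \<le> ?R" if j: "j < k" for j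
  proof -
    have "cmod (T (\<lambda>x. F z x * dbar (Ps ! j) z x) (eval_fams z (Ps[j := G])))
        \<le> (\<Prod>i<k. (if i = j then Ls 0 else Ls (Suc i)) * ?m) * (\<integral>x. cmod (F z x * dbar (Ps ! j) z x) \<partial>\<nu>)"
      using F G Ps len j
      by (intro T_bound FDD_Lipb diff_fams_args' diff_fams_update diff_fams_nth) (auto intro!: lip_fam_lipschitz simp: nth_list_update)
    also have "\<dots> \<le> (\<Prod>i<k. (if i = j then Ls 0 else Ls (Suc i)) * ?m) * (2 * Ls (Suc j) * fiber_mass F z)"
      using F G Ps j L0
      by (intro mult_left_mono fiber_mass_mult_le diff_fam_Lipb diff_fam_dbar_Lipb lip_fam_dbar_bound prod_nonneg diff_fams_nth) auto
    also have "(\<Prod>i<k. (if i = j then Ls 0 else Ls (Suc i)) * ?m) = Ls 0 * (\<Prod>i\<in>{..<k} - {j}. Ls (Suc i)) * ?m ^ k"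
    proof -
      have "(\<Prod>i<k. if i = j then Ls 0 else Ls (Suc i)) = Ls 0 * (\<Prod>i\<in>{..<k} - {j}. if i = j then Ls 0 else Ls (Suc i))"
        using j by (subst prod.remove[of _ j]) auto
      also have "(\<Prod>i\<in>{..<k} - {j}. if i = j then Ls 0 else Ls (Suc i)) = (\<Prod>i\<in>{..<k} - {j}. Ls (Suc i))"
        by (intro prod.cong) auto
      finally show ?thesis
        by (simp add: prod.distrib)
    qed
    also have "Ls 0 * (\<Prod>i\<in>{..<k} - {j}. Ls (Suc i)) * ?m ^ k * (2 * Ls (Suc j) * fiber_mass F z) = ?R"
      unfolding split using j by (simp add: prod.remove[of "{..<k}" j "\<lambda>i. Ls (Suc i)"] mult_ac)
    finally show ?thesis .
  qed
  have "cmod (contraction F G Ps z) \<le> cmod (T (\<lambda>x. F z x * dbar G z x) (eval_fams z Ps)) + cmod (\<Sum>j<k. T (\<lambda>x. F z x * dbar (Ps ! j) z x) (eval_fams z (Ps[j := G])))"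
    unfolding contraction_def by (rule norm_triangle_ineq4)
  also have "\<dots> \<le> ?R + (\<Sum>j<k. ?R)"
    by (intro add_mono t0 order_trans[OF norm_sum] sum_mono tj) auto
  also have "\<dots> = 2 * (real k + 1) * ?m ^ k * (\<Prod>i<Suc k. Ls i) * fiber_mass F z"
    by (simp add: algebra_simps)
  finally show ?thesis .
qed

definition mass_const :: "real \<Rightarrow> real" where
  "mass_const M = 2 * (real k + 1) * (1 + M) ^ k / cp_const"

lemma mass_const_nonneg: "0 \<le> M \<Longrightarrow> 0 \<le> mass_const M"
  using cp_const_pos by (auto simp: mass_const_def intro!: divide_nonneg_nonneg mult_nonneg_nonneg)

text \<open>Vanishing outside the disc is asked of the contraction itself, so that the estimate
  serves both when the vanishing family is the first argument and when it is the leading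
  entry.\<close>

lemma slot_primitive_bound_gen:
  assumes F: "diff_fam F" and G: "diff_fam G" "lip_fam (Ls 0) G" and Ps: "diff_fams Ps" "\<And>j. j < k \<Longrightarrow> lip_fam (Ls (Suc j)) (Ps ! j)"
    and M: "0 \<le> M" "\<And>z. M < cmod z \<Longrightarrow> contraction F G Ps z = 0"
  shows "cmod (slot_primitive F G Ps) \<le> mass_const M * (\<Prod>i<Suc k. Ls i) * weighted_mass M F"
proof -
  let ?c = "2 * (real k + 1) * (1 + M) ^ k * (\<Prod>i<Suc k. Ls i)"
  have L0: "0 \<le> Ls i" if "i < Suc k" for i
    using G(2) Ps(2) lip_fam_nonneg that by (cases i) auto
  have P0: "0 \<le> (\<Prod>i<Suc k. Ls i)"
    using L0 by (intro prod_nonneg) auto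
  have "cmod (\<integral>z. contraction F G Ps z / (z - 1) \<partial>lborel) \<le> (\<integral>z. ?c * fiber_mass F z \<partial>kernel_measure M)"
  proof (rule kernel_integral_le[OF contraction_continuous[OF F G(1) Ps(1)] M(2)])
    show "(\<lambda>z. ?c * fiber_mass F z) \<in> borel_measurable borel"
      using fiber_mass_measurable[OF diff_fam_cont_fam[OF F]] by measurable
    show "integrable (kernel_measure M) (\<lambda>z. ?c * fiber_mass F z)"
      by (intro integrable_mult_right fiber_mass_integrable diff_fam_cont_fam F)
    fix z assume z: "cmod z \<le> M"
    have "cmod (contraction F G Ps z) \<le> 2 * (real k + 1) * (1 + cmod z) ^ k * (\<Prod>i<Suc k. Ls i) * fiber_mass F z"
      by (rule contraction_bound[OF F G Ps])
    also have "\<dots> \<le> ?c * fiber_mass F z"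
      using z P0 fiber_mass_nonneg by (intro mult_right_mono mult_left_mono power_mono) auto
    finally show "cmod (contraction F G Ps z) \<le> ?c * fiber_mass F z" .
  qed
  also have "\<dots> = ?c * weighted_mass M F"
    by (simp add: weighted_mass_def)
  finally have "cmod (slot_primitive F G Ps) \<le> (1 / cp_const) * (?c * weighted_mass M F)"
    unfolding slot_primitive_def norm_mult using cp_const_pos by (simp add: norm_divide divide_right_mono)
  then show ?thesis
    by (simp add: mass_const_def)
qed

lemma slot_primitive_bound:
  assumes "diff_fam F" "diff_fam G" "lip_fam (Ls 0) G" "diff_fams Ps" "\<And>j. j < k \<Longrightarrow> lip_fam (Ls (Suc j)) (Ps ! j)" "0 \<le> M" "vanishing M F"
  shows "cmod (slot_primitive F G Ps) \<le> mass_const M * (\<Prod>i<Suc k. Ls i) * weighted_mass M F"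
  using assms contraction_vanish_first by (intro slot_primitive_bound_gen) auto

lemma weighted_mass_nonneg: "0 \<le> weighted_mass M P"
  unfolding weighted_mass_def by (intro integral_nonneg_AE AE_I2 fiber_mass_nonneg)

text \<open>This estimate carries the convergence: after the swap by
  \<open>slot_primitive_leibniz\<close>, G occurs only through its absolute values, although the
  contraction differentiates it. The constant 2 L is the Lipschitz constant of the entries at z =
  1.\<close>

lemma slot_primitive_bound_second:
  assumes F: "diff_fam F" "lip_fam L F" "vanishing M F" and G: "diff_fam G" and Ps: "diff_fams Ps" "\<And>j. j < k \<Longrightarrow> lip_fam L (Ps ! j)" and M: "0 \<le> M"
  shows "cmod (slot_primitive F G Ps) \<le> (2 * L) ^ k * (\<integral>x. cmod (F 1 x * G 1 x) \<partial>\<nu>) + mass_const M * L ^ Suc k * weighted_mass M G"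
proof -
  have "slot_primitive F G Ps = T (\<lambda>x. F 1 x * G 1 x) (eval_fams 1 Ps) - slot_primitive G F Ps"
    using slot_primitive_leibniz[OF F(1) G Ps(1) F(3)] by (simp add: algebra_simps)
  then have "cmod (slot_primitive F G Ps) \<le> cmod (T (\<lambda>x. F 1 x * G 1 x) (eval_fams 1 Ps)) + cmod (slot_primitive G F Ps)"
    by (simp add: norm_triangle_ineq4)
  moreover have "cmod (T (\<lambda>x. F 1 x * G 1 x) (eval_fams 1 Ps)) \<le> (\<Prod>j<k. 2 * L) * (\<integral>x. cmod (F 1 x * G 1 x) \<partial>\<nu>)"
    using F G Ps diff_fams_length[OF Ps(1)] lip_fam_lipschitz[OF Ps(2), of _ 1]
    by (intro T_bound Lipb_mult diff_fam_Lipb diff_fams_args') (auto simp: mult.commute)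
  moreover have "cmod (slot_primitive G F Ps) \<le> mass_const M * (\<Prod>i<Suc k. L) * weighted_mass M G"
    using F G Ps M contraction_vanish_second[OF F(3,1) G Ps(1)] by (intro slot_primitive_bound_gen) auto
  ultimately show ?thesis
    by simp
qed

section \<open>Linearity and reduction to the leading entry\<close>

lemma contraction_lin_first:
  assumes F: "diff_fam F" "diff_fam F'" and G: "diff_fam G" and Ps: "diff_fams Ps"
  shows "contraction (\<lambda>z x. c * F z x + F' z x) G Ps z = c * contraction F G Ps z + contraction F' G Ps z"
proof -
  have *: "T (\<lambda>x. (c * F z x + F' z x) * dbar P z x) \<pi> = c * T (\<lambda>x. F z x * dbar P z x) \<pi> + T (\<lambda>x. F' z x * dbar P z x) \<pi>"
    if "diff_fam P" "\<pi> \<in> args Lip k" for P \<pi>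
  proof -
    have "(\<lambda>x. (c * F z x + F' z x) * dbar P z x) = (\<lambda>x. c * (F z x * dbar P z x) + F' z x * dbar P z x)"
      by (simp add: algebra_simps)
    then show ?thesis
      using T_lin[of "\<lambda>x. F z x * dbar P z x" "\<lambda>x. F' z x * dbar P z x" \<pi> c] F that by (simp add: FDD_Lipb)
  qed
  have 1: "T (\<lambda>x. (c * F z x + F' z x) * dbar G z x) (eval_fams z Ps)
      = c * T (\<lambda>x. F z x * dbar G z x) (eval_fams z Ps) + T (\<lambda>x. F' z x * dbar G z x) (eval_fams z Ps)"
    using G Ps by (intro * diff_fams_args')
  have 2: "(\<Sum>j<k. T (\<lambda>x. (c * F z x + F' z x) * dbar (Ps ! j) z x) (eval_fams z (Ps[j := G])))
      = c * (\<Sum>j<k. T (\<lambda>x. F z x * dbar (Ps ! j) z x) (eval_fams z (Ps[j := G]))) + (\<Sum>j<k. T (\<lambda>x. F' z x * dbar (Ps ! j) z x) (eval_fams z (Ps[j := G])))"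
    using G Ps by (simp add: * diff_fams_args' diff_fams_update diff_fams_nth sum.distrib sum_distrib_left)
  show ?thesis
    unfolding contraction_def 1 2 by (simp add: right_diff_distrib)
qed

lemma kernel_integral_lin:
  assumes "integrable lborel (\<lambda>z. q z / (z - 1))" "integrable lborel (\<lambda>z. q' z / (z - 1))"
  shows "(\<integral>z. (c * q z + q' z) / (z - 1) \<partial>lborel) = c * (\<integral>z. q z / (z - 1) \<partial>lborel) + (\<integral>z. q' z / (z - (1::complex)) \<partial>lborel)"
proof -
  have "(\<integral>z. (c * q z + q' z) / (z - 1) \<partial>lborel) = (\<integral>z. c * (q z / (z - 1)) + q' z / (z - 1) \<partial>lborel)"
    by (simp add: add_divide_distrib)
  also have "\<dots> = (\<integral>z. c * (q z / (z - 1)) \<partial>lborel) + (\<integral>z. q' z / (z - 1) \<partial>lborel)"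
    using assms by (intro Bochner_Integration.integral_add integrable_mult_right)
  finally show ?thesis
    by (simp only: integral_mult_right_zero)
qed

lemma slot_primitive_lin_first:
  assumes F: "diff_fam F" "diff_fam F'" and G: "diff_fam G" and Ps: "diff_fams Ps" and M: "vanishing M F" "vanishing M F'"
  shows "slot_primitive (\<lambda>z x. c * F z x + F' z x) G Ps = c * slot_primitive F G Ps + slot_primitive F' G Ps"
proof -
  have i1: "integrable lborel (\<lambda>z. contraction F G Ps z / (z - 1))"
    by (rule kernel_integrable[OF contraction_continuous[OF F(1) G Ps] contraction_vanish_first[OF M(1) F(1) G Ps]])
  have i2: "integrable lborel (\<lambda>z. contraction F' G Ps z / (z - 1))"
    by (rule kernel_integrable[OF contraction_continuous[OF F(2) G Ps] contraction_vanish_first[OF M(2) F(2) G Ps]])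
  show ?thesis
    unfolding slot_primitive_def contraction_lin_first[OF F G Ps] kernel_integral_lin[OF i1 i2] by (simp add: ring_distribs)
qed

text \<open>\<open>slot_primitive_leibniz\<close> turns linearity in the leading entry into
  linearity in the first argument, both of T and of the swapped primitive.\<close>

lemma slot_primitive_lin_second:
  assumes F: "diff_fam F" and G: "diff_fam G" "diff_fam G'" and Ps: "diff_fams Ps" and M: "vanishing M F"
  shows "slot_primitive F (\<lambda>z x. c * G z x + G' z x) Ps = c * slot_primitive F G Ps + slot_primitive F G' Ps"
proof -
  have "(\<lambda>x. F 1 x * (c * G 1 x + G' 1 x)) = (\<lambda>x. c * (F 1 x * G 1 x) + F 1 x * G' 1 x)"
    by (simp add: algebra_simps)
  then have 1: "T (\<lambda>x. F 1 x * (c * G 1 x + G' 1 x)) (eval_fams 1 Ps) = c * T (\<lambda>x. F 1 x * G 1 x) (eval_fams 1 Ps) + T (\<lambda>x. F 1 x * G' 1 x) (eval_fams 1 Ps)"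
    using F G Ps by (simp add: T_lin Lipb_mult diff_fam_Lipb diff_fams_args')
  have i1: "integrable lborel (\<lambda>z. contraction G F Ps z / (z - 1))"
    by (rule kernel_integrable[OF contraction_continuous[OF G(1) F Ps] contraction_vanish_second[OF M F G(1) Ps]])
  have i2: "integrable lborel (\<lambda>z. contraction G' F Ps z / (z - 1))"
    by (rule kernel_integrable[OF contraction_continuous[OF G(2) F Ps] contraction_vanish_second[OF M F G(2) Ps]])
  have 2: "slot_primitive (\<lambda>z x. c * G z x + G' z x) F Ps = c * slot_primitive G F Ps + slot_primitive G' F Ps"
    unfolding slot_primitive_def contraction_lin_first[OF G F Ps] kernel_integral_lin[OF i1 i2] by (simp add: ring_distribs)
  have e: "slot_primitive F H Ps = T (\<lambda>x. F 1 x * H 1 x) (eval_fams 1 Ps) - slot_primitive H F Ps" if "diff_fam H" for H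
    using slot_primitive_leibniz[OF F that Ps M] by (simp add: eq_diff_eq)
  show ?thesis
    unfolding e[OF diff_fam_lin(1)[OF G, of c]] e[OF G(1)] e[OF G(2)] 1 2 by (simp add: ring_distribs)
qed

definition fam_primitive :: "(complex \<Rightarrow> 'a \<Rightarrow> complex) \<Rightarrow> (complex \<Rightarrow> 'a \<Rightarrow> complex) list \<Rightarrow> complex" where
  "fam_primitive F Ps = slot_primitive F (hd Ps) (tl Ps)"

text \<open>Antisymmetry makes any entry the leading one at the cost of a sign. The sign and the
  remaining list do not depend on the entry inserted, so linearity and bounds for the leading entry
  transfer to every slot.\<close>

lemma fam_primitive_slot:
  assumes F: "diff_fam F" and Ps: "\<forall>P\<in>set Ps. diff_fam P" "length Ps = Suc k" and G: "diff_fam G" and i: "i < Suc k"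
  obtains s Qs where "s \<in> {1, -1}" "diff_fams Qs" "\<And>G. diff_fam G \<Longrightarrow> fam_primitive F (Ps[i := G]) = s * slot_primitive F G Qs"
    "\<And>j. j < k \<Longrightarrow> \<exists>l<Suc k. l \<noteq> i \<and> Qs ! j = Ps ! l"
proof -
  obtain P Ps' where P: "Ps = P # Ps'" "diff_fam P" and diff_fams: "diff_fams Ps'"
    using Ps by (cases Ps) (auto simp: diff_fams_def)
  show ?thesis
  proof (cases i)
    case 0
    show ?thesis
      by (rule that[of 1 Ps']) (use P diff_fams 0 in \<open>auto simp: fam_primitive_def\<close>)
  next
    case (Suc l)
    then have l: "l < k"
      using i by simp
    show ?thesis
    proof (rule that[of "-1" "Ps'[l := P]"])
      show "diff_fams (Ps'[l := P])"
        using diff_fams P by (intro diff_fams_update)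
      show "fam_primitive F (Ps[i := G]) = - 1 * slot_primitive F G (Ps'[l := P])" if G: "diff_fam G" for G
      proof -
        have "slot_primitive F ((Ps'[l := G]) ! l) ((Ps'[l := G])[l := P]) = - slot_primitive F P (Ps'[l := G])"
          by (rule slot_primitive_antisym[OF F P(2) diff_fams_update[OF diff_fams G] l])
        then show ?thesis
          using P Suc l diff_fams_length[OF diff_fams] by (simp add: fam_primitive_def)
      qed
      fix j assume j: "j < k"
      show "\<exists>l'<Suc k. l' \<noteq> i \<and> Ps'[l := P] ! j = Ps ! l'"
      proof (cases "j = l")
        case True
        then show ?thesis
          using P Suc l diff_fams_length[OF diff_fams] by (intro exI[of _ 0]) auto
      next
        case False
        then show ?thesis
          using P Suc j by (intro exI[of _ "Suc j"]) auto
      qed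
    qed simp
  qed
qed

lemma fam_primitive_lin:
  assumes F: "diff_fam F" "vanishing M F" and Ps: "\<forall>P\<in>set Ps. diff_fam P" "length Ps = Suc k" and G: "diff_fam G" "diff_fam G'" and i: "i < Suc k"
  shows "fam_primitive F (Ps[i := \<lambda>z x. c * G z x + G' z x]) = c * fam_primitive F (Ps[i := G]) + fam_primitive F (Ps[i := G'])"
proof -
  obtain s Qs where s: "diff_fams Qs" "\<And>G. diff_fam G \<Longrightarrow> fam_primitive F (Ps[i := G]) = s * slot_primitive F G Qs"
    using fam_primitive_slot[OF F(1) Ps G(1) i] by metis
  show ?thesis
    unfolding s(2)[OF diff_fam_lin(1)[OF G]] s(2)[OF G(1)] s(2)[OF G(2)] slot_primitive_lin_second[OF F(1) G s(1) F(2)] by (simp add: ring_distribs)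
qed

definition slot_const :: "real \<Rightarrow> real \<Rightarrow> real" where
  "slot_const M L = (2 * L) ^ k + mass_const M * L ^ Suc k"

lemma fam_primitive_bound_slot:
  assumes F: "diff_fam F" "lip_fam L F" "vanishing M F" and Ps: "\<forall>P\<in>set Ps. diff_fam P" "length Ps = Suc k" and G: "diff_fam G" and i: "i < Suc k"
    and L: "\<And>j. j < Suc k \<Longrightarrow> j \<noteq> i \<Longrightarrow> lip_fam L (Ps ! j)" and M: "0 \<le> M"
  shows "cmod (fam_primitive F (Ps[i := G])) \<le> slot_const M L * ((\<integral>x. cmod (F 1 x * G 1 x) \<partial>\<nu>) + weighted_mass M G)"
proof -
  obtain s Qs where s: "s \<in> {1, -1}" "diff_fams Qs" "\<And>G. diff_fam G \<Longrightarrow> fam_primitive F (Ps[i := G]) = s * slot_primitive F G Qs"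
    "\<And>j. j < k \<Longrightarrow> \<exists>l<Suc k. l \<noteq> i \<and> Qs ! j = Ps ! l"
    using fam_primitive_slot[OF F(1) Ps G i] by metis
  have QL: "lip_fam L (Qs ! j)" if "j < k" for j
    using s(4)[OF that] L by auto
  have L0: "0 \<le> L"
    using F(2) by (rule lip_fam_nonneg)
  have "cmod (fam_primitive F (Ps[i := G])) = cmod (slot_primitive F G Qs)"
    using s(1) s(3)[OF G] by (auto simp: norm_mult)
  also have "\<dots> \<le> (2 * L) ^ k * (\<integral>x. cmod (F 1 x * G 1 x) \<partial>\<nu>) + mass_const M * L ^ Suc k * weighted_mass M G"
    by (rule slot_primitive_bound_second[OF F G s(2) QL M])
  also have "\<dots> \<le> slot_const M L * (\<integral>x. cmod (F 1 x * G 1 x) \<partial>\<nu>) + slot_const M L * weighted_mass M G"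
    unfolding slot_const_def using L0 mass_const_nonneg[OF M] weighted_mass_nonneg
    by (intro add_mono mult_right_mono) (auto intro!: mult_nonneg_nonneg)
  finally show ?thesis
    by (simp add: algebra_simps)
qed

lemma fam_primitive_bound:
  assumes F: "diff_fam F" "vanishing M F" and Ps: "\<forall>P\<in>set Ps. diff_fam P" "length Ps = Suc k"
    and L: "\<And>j. j < Suc k \<Longrightarrow> lip_fam (Ls j) (Ps ! j)" and M: "0 \<le> M"
  shows "cmod (fam_primitive F Ps) \<le> mass_const M * (\<Prod>i<Suc k. Ls i) * weighted_mass M F"
proof -
  obtain P Ps' where P: "Ps = P # Ps'" "diff_fam P" and diff_fams: "diff_fams Ps'"
    using Ps by (cases Ps) (auto simp: diff_fams_def)
  show ?thesis
    unfolding fam_primitive_def using P L[of 0] L[of "Suc _"] slot_primitive_bound[OF F(1) P(2) _ diff_fams _ M F(2), of Ls]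
    by (simp del: prod.lessThan_Suc)
qed

text \<open>Changing one slot at a time, each difference is estimated by its values. Uniformly close
  entries with a common constant L thus give close results, however their derivatives
  differ.\<close>

lemma fam_primitive_diff_bound:
  assumes F: "diff_fam F" "lip_fam L F" "vanishing M F" and Ps: "\<forall>P\<in>set Ps. diff_fam P" "length Ps = Suc k" "\<And>j. j < Suc k \<Longrightarrow> lip_fam L (Ps ! j)"
    and Ps': "\<forall>P\<in>set Ps'. diff_fam P" "length Ps' = Suc k" "\<And>j. j < Suc k \<Longrightarrow> lip_fam L (Ps' ! j)" and M: "0 \<le> M"
  shows "cmod (fam_primitive F Ps - fam_primitive F Ps') \<le> slot_const M L * (\<Sum>i<Suc k. (\<integral>x. cmod (F 1 x * ((Ps ! i) 1 x - (Ps' ! i) 1 x)) \<partial>\<nu>)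
     + weighted_mass M (\<lambda>z x. (Ps ! i) z x - (Ps' ! i) z x))"
proof -
  let ?h = "\<lambda>i. hybrid i Ps Ps'"
  let ?D = "\<lambda>i z x. (Ps ! i) z x - (Ps' ! i) z x"
  have hd: "\<forall>P\<in>set (?h i). diff_fam P" "length (?h i) = Suc k" for i
    using Ps Ps' by (auto simp: hybrid_def dest!: in_set_takeD in_set_dropD)
  have hL: "lip_fam L (?h i ! j)" if "j < Suc k" for i j
    using that Ps Ps' by (simp add: nth_hybrid)
  have dP: "diff_fam (Ps ! i)" "diff_fam (Ps' ! i)" if "i < Suc k" for i
    using Ps Ps' that by auto
  have "fam_primitive F Ps - fam_primitive F Ps' = (\<Sum>i<Suc k. fam_primitive F ((?h i)[i := Ps ! i]) - fam_primitive F ((?h i)[i := Ps' ! i]))"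
    using Ps Ps' by (intro sum_hybrid) auto
  also have "\<dots> = (\<Sum>i<Suc k. fam_primitive F ((?h i)[i := ?D i]))"
  proof (rule sum.cong)
    fix i assume "i \<in> {..<Suc k}"
    then have i: "i < Suc k" by simp
    show "fam_primitive F ((?h i)[i := Ps ! i]) - fam_primitive F ((?h i)[i := Ps' ! i]) = fam_primitive F ((?h i)[i := ?D i])"
      using fam_primitive_lin[OF F(1,3) hd[of i] dP(2)[OF i] dP(1)[OF i] i, of "-1"] by simp
  qed simp
  also have "cmod \<dots> \<le> (\<Sum>i<Suc k. slot_const M L * ((\<integral>x. cmod (F 1 x * ?D i 1 x) \<partial>\<nu>) + weighted_mass M (?D i)))"
    using dP by (intro order_trans[OF norm_sum] sum_mono fam_primitive_bound_slot[OF F hd _ _ hL M] diff_fam_diff(1)) auto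
  finally show ?thesis
    by (simp only: sum_distrib_left)
qed

end

section \<open>Mollification in the parameter\<close>

definition line_average :: "complex \<Rightarrow> real \<Rightarrow> (complex \<Rightarrow> complex) \<Rightarrow> complex \<Rightarrow> complex" where
  "line_average e \<epsilon> g z = integral {0..1} (\<lambda>s. g (z + of_real (\<epsilon> * s) * e))"

lemma line_average_integrable:
  fixes g :: "complex \<Rightarrow> complex"
  assumes "continuous_on UNIV g"
  shows "(\<lambda>s. g (z + of_real (\<epsilon> * s) * e)) integrable_on {0..1}"
  by (intro integrable_continuous_real continuous_on_compose2[OF assms]) (auto intro!: continuous_intros)

lemma line_average_bound:
  assumes "continuous_on UNIV g" "\<And>s. 0 \<le> s \<Longrightarrow> s \<le> 1 \<Longrightarrow> cmod (g (z + of_real (\<epsilon> * s) * e)) \<le> B"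
  shows "cmod (line_average e \<epsilon> g z) \<le> B"
proof -
  have "cmod (line_average e \<epsilon> g z) \<le> B * (1 - 0)"
    unfolding line_average_def using assms
    by (intro integral_bound continuous_on_compose2[OF assms(1)]) (auto intro!: continuous_intros)
  then show ?thesis by simp
qed

lemma line_average_lin:
  assumes "continuous_on UNIV f" "continuous_on UNIV g"
  shows "line_average e \<epsilon> (\<lambda>z. c * f z + g z) z = c * line_average e \<epsilon> f z + line_average e \<epsilon> g z"
proof -
  have "integral {0..1} (\<lambda>s. c * f (z + of_real (\<epsilon> * s) * e) + g (z + of_real (\<epsilon> * s) * e))
      = integral {0..1} (\<lambda>s. c * f (z + of_real (\<epsilon> * s) * e)) + integral {0..1} (\<lambda>s. g (z + of_real (\<epsilon> * s) * e))"
    by (intro integral_add integrable_on_mult_right line_average_integrable assms)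
  then show ?thesis
    unfolding line_average_def by (simp only: integral_mult_right)
qed

lemma line_average_diff:
  assumes "continuous_on UNIV f" "continuous_on UNIV g"
  shows "line_average e \<epsilon> (\<lambda>z. f z - g z) z = line_average e \<epsilon> f z - line_average e \<epsilon> g z"
  using line_average_lin[OF assms(2,1), of e \<epsilon> "-1" z] by simp

lemma line_average_shift: "line_average e \<epsilon> (\<lambda>w. g (w + c)) z = line_average e \<epsilon> g (z + c)"
  by (simp add: line_average_def algebra_simps)

lemma line_average_const [simp]: "line_average e \<epsilon> (\<lambda>_. c) z = c"
  by (simp add: line_average_def)

lemma line_average_lipschitz:
  assumes "continuous_on UNIV g" "\<And>z z'. cmod (g z - g z') \<le> L * cmod (z - z')"
  shows "cmod (line_average e \<epsilon> g z - line_average e \<epsilon> g z') \<le> L * cmod (z - z')"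
proof -
  have c: "continuous_on UNIV (\<lambda>w. g (w + (z' - z)))"
    by (intro continuous_on_compose2[OF assms(1)]) (auto intro!: continuous_intros)
  have "line_average e \<epsilon> g z - line_average e \<epsilon> g z' = line_average e \<epsilon> (\<lambda>w. g w - g (w + (z' - z))) z"
    unfolding line_average_diff[OF assms(1) c] line_average_shift by simp
  also have "cmod \<dots> \<le> L * cmod (z - z')"
  proof (rule line_average_bound)
    show "continuous_on UNIV (\<lambda>w. g w - g (w + (z' - z)))"
      by (intro continuous_intros assms(1) c)
    show "cmod (g (z + of_real (\<epsilon> * s) * e) - g (z + of_real (\<epsilon> * s) * e + (z' - z))) \<le> L * cmod (z - z')" for s
      using assms(2)[of "z + of_real (\<epsilon> * s) * e" "z + of_real (\<epsilon> * s) * e + (z' - z)"] by (simp add: norm_minus_commute)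
  qed
  finally show ?thesis .
qed

lemma lipschitz_continuous:
  fixes g :: "complex \<Rightarrow> complex"
  assumes "0 \<le> L" "\<And>z z'. cmod (g z - g z') \<le> L * cmod (z - z')"
  shows "continuous_on UNIV g"
  by (rule lipschitz_on_continuous_on[of L]) (use assms in \<open>auto intro!: lipschitz_onI simp: dist_norm\<close>)

lemma line_average_near:
  assumes "0 \<le> L" and L: "\<And>z z'. cmod (g z - g z') \<le> L * cmod (z - z')" and \<epsilon>: "0 \<le> \<epsilon>" and e: "cmod e = 1"
  shows "cmod (line_average e \<epsilon> g z - g z) \<le> L * \<epsilon>"
proof -
  have c: "continuous_on UNIV g"
    using assms(1,2) by (rule lipschitz_continuous)
  have "line_average e \<epsilon> g z - g z = line_average e \<epsilon> (\<lambda>w. g w - g z) z"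
    using line_average_diff[OF c, of "\<lambda>_. g z" e \<epsilon> z] by simp
  also have "cmod \<dots> \<le> L * \<epsilon>"
  proof (rule line_average_bound)
    fix s :: real assume s: "0 \<le> s" "s \<le> 1"
    have "cmod (g (z + of_real (\<epsilon> * s) * e) - g z) \<le> L * cmod (of_real (\<epsilon> * s) * e)"
      using L[of "z + of_real (\<epsilon> * s) * e" z] by simp
    also have "cmod (of_real (\<epsilon> * s) * e) = \<epsilon> * s"
      using s \<epsilon> e by (simp add: norm_mult)
    also have "L * (\<epsilon> * s) \<le> L * \<epsilon>"
      using s \<epsilon> assms(1) by (intro mult_left_mono) (auto simp: mult_left_le)
    finally show "cmod (g (z + of_real (\<epsilon> * s) * e) - g z) \<le> L * \<epsilon>" .
  qed (intro continuous_intros c)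
  finally show ?thesis .
qed

text \<open>Along the line the average is an increment of an antiderivative divided by \<epsilon>,
  so its derivative is a difference quotient of g.\<close>

lemma line_average_dir_deriv:
  assumes c: "continuous_on UNIV g" and \<epsilon>: "0 < \<epsilon>"
  shows "has_dir_deriv e (line_average e \<epsilon> g) (\<lambda>z. (g (z + of_real \<epsilon> * e) - g z) / of_real \<epsilon>)"
  unfolding has_dir_deriv_def
proof
  fix z
  define G where "G u = g (z + of_real u * e)" for u :: real
  have Gc: "continuous_on S G" for S
    unfolding G_def by (intro continuous_on_compose2[OF c]) (auto intro!: continuous_intros)
  \<comment> \<open>The margin of 1 on both sides makes 0 and \<epsilon> interior points, so that
    two-sided derivatives are available there.\<close>
  obtain \<Phi> where \<Phi>': "\<And>u. u \<in> {-1..\<epsilon>+1} \<Longrightarrow> (\<Phi> has_vector_derivative G u) (at u within {-1..\<epsilon>+1})"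
    using antiderivative_continuous[of "-1" "\<epsilon>+1" G] Gc by blast
  have \<Phi>: "(\<Phi> has_vector_derivative G u) (at u)" if "-1 < u" "u < \<epsilon> + 1" for u
    using \<Phi>'[of u] that at_within_interior[of u "{-1..\<epsilon>+1}"] by (simp add: interior_atLeastAtMost_real)
  have eq: "line_average e \<epsilon> g (z + of_real h * e) = (\<Phi> (h + \<epsilon>) - \<Phi> h) / of_real \<epsilon>" if h: "-1 < h" "h < 1" for h
  proof -
    have "((\<lambda>s. G (h + \<epsilon> * s)) has_integral (\<Phi> (h + \<epsilon> * 1) / of_real \<epsilon> - \<Phi> (h + \<epsilon> * 0) / of_real \<epsilon>)) {0..1}"
    proof (rule fundamental_theorem_of_calculus)
      fix s :: real assume s: "s \<in> {0..1}"
      have "-1 < h + \<epsilon> * s"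
        using h s \<epsilon> by (smt (verit) atLeastAtMost_iff mult_nonneg_nonneg)
      moreover have "h + \<epsilon> * s < \<epsilon> + 1"
        using h s \<epsilon> by (smt (verit) atLeastAtMost_iff mult_left_le)
      ultimately have d: "(\<Phi> has_vector_derivative G (h + \<epsilon> * s)) (at (h + \<epsilon> * s))"
        by (rule \<Phi>)
      have "((\<lambda>s. h + \<epsilon> * s) has_vector_derivative \<epsilon>) (at s)"
        by (auto intro!: derivative_eq_intros)
      from vector_diff_chain_at[OF this d]
      have "((\<lambda>s. \<Phi> (h + \<epsilon> * s)) has_vector_derivative \<epsilon> *\<^sub>R G (h + \<epsilon> * s)) (at s)"
        by (simp add: o_def)
      then have "((\<lambda>s. \<Phi> (h + \<epsilon> * s) / of_real \<epsilon>) has_vector_derivative (\<epsilon> *\<^sub>R G (h + \<epsilon> * s)) / of_real \<epsilon>) (at s)"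
        by (rule has_vector_derivative_divide)
      then show "((\<lambda>s. \<Phi> (h + \<epsilon> * s) / of_real \<epsilon>) has_vector_derivative G (h + \<epsilon> * s)) (at s within {0..1})"
        using \<epsilon> by (auto simp: scaleR_conv_of_real intro: has_vector_derivative_at_within)
    qed simp
    then have "integral {0..1} (\<lambda>s. G (h + \<epsilon> * s)) = (\<Phi> (h + \<epsilon>) - \<Phi> h) / of_real \<epsilon>"
      by (simp add: integral_unique diff_divide_distrib)
    moreover have "(\<lambda>s. G (h + \<epsilon> * s)) = (\<lambda>s. g (z + of_real h * e + of_real (\<epsilon> * s) * e))"
      by (simp add: G_def fun_eq_iff algebra_simps)
    ultimately show ?thesis
      by (simp add: line_average_def)
  qed
  have d1: "(\<Phi> has_vector_derivative G 0) (at 0)"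
    using \<epsilon> by (intro \<Phi>) auto
  have d2: "((\<lambda>h. \<Phi> (h + \<epsilon>)) has_vector_derivative G \<epsilon>) (at 0)"
  proof -
    have "((\<lambda>h. h + \<epsilon>) has_vector_derivative 1) (at 0)"
      by (auto intro!: derivative_eq_intros)
    moreover have "(\<Phi> has_vector_derivative G \<epsilon>) (at (0 + \<epsilon>))"
      using \<epsilon> \<Phi>[of \<epsilon>] by simp
    ultimately show ?thesis
      using vector_diff_chain_at[of "\<lambda>h. h + \<epsilon>" 1 0 \<Phi> "G \<epsilon>"] by (simp add: o_def)
  qed
  have "((\<lambda>h. (\<Phi> (h + \<epsilon>) - \<Phi> h) / of_real \<epsilon>) has_vector_derivative (G \<epsilon> - G 0) / of_real \<epsilon>) (at 0)"
    by (intro has_vector_derivative_divide has_vector_derivative_diff d1 d2)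
  then have "((\<lambda>h. line_average e \<epsilon> g (z + of_real h * e)) has_vector_derivative (G \<epsilon> - G 0) / of_real \<epsilon>) (at 0)"
    by (rule has_vector_derivative_transform_within_open[of _ _ _ "{-1<..<1}"]) (auto simp: eq)
  then show "((\<lambda>h. line_average e \<epsilon> g (z + of_real h * e)) has_vector_derivative (g (z + of_real \<epsilon> * e) - g z) / of_real \<epsilon>) (at 0)"
    by (simp add: G_def)
qed

lemma line_average_commute:
  assumes "continuous_on UNIV g"
  shows "line_average e \<epsilon> (line_average e' \<epsilon> g) z = line_average e' \<epsilon> (line_average e \<epsilon> g) z"
proof -
  have "integral (cbox 0 1) (\<lambda>s. integral (cbox 0 1) (\<lambda>t. g (z + of_real (\<epsilon> * s) * e + of_real (\<epsilon> * t) * e')))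
      = integral (cbox 0 1) (\<lambda>t. integral (cbox 0 1) (\<lambda>s. g (z + of_real (\<epsilon> * s) * e + of_real (\<epsilon> * t) * e')))"
    by (rule integral_swap_continuous)
       (auto intro!: continuous_on_compose2[OF assms] continuous_intros simp: case_prod_unfold)
  then show ?thesis
    by (simp add: line_average_def add.assoc add.commute add.left_commute)
qed

section \<open>Averaged families\<close>

definition fam_average :: "complex \<Rightarrow> real \<Rightarrow> (complex \<Rightarrow> 'a \<Rightarrow> complex) \<Rightarrow> complex \<Rightarrow> 'a \<Rightarrow> complex" where
  "fam_average e \<epsilon> P z x = line_average e \<epsilon> (\<lambda>w. P w x) z"

definition mollify :: "real \<Rightarrow> (complex \<Rightarrow> 'a \<Rightarrow> complex) \<Rightarrow> complex \<Rightarrow> 'a \<Rightarrow> complex" where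
  "mollify \<epsilon> P = fam_average 1 \<epsilon> (fam_average \<i> \<epsilon> P)"

definition loc_bdd_lip_fam :: "real \<Rightarrow> (complex \<Rightarrow> 'a::real_normed_vector \<Rightarrow> complex) \<Rightarrow> bool" where
  "loc_bdd_lip_fam L P \<longleftrightarrow> lip_fam L P \<and> (\<forall>M. \<exists>B. \<forall>z x. cmod z \<le> M \<longrightarrow> cmod (P z x) \<le> B)"

lemma loc_bdd_lip_fam_lip_fam: "loc_bdd_lip_fam L P \<Longrightarrow> lip_fam L P"
  by (simp add: loc_bdd_lip_fam_def)

lemma lip_fam_continuous: "lip_fam L P \<Longrightarrow> continuous_on UNIV (\<lambda>z. P z x)"
  unfolding lip_fam_def by (blast intro: lipschitz_continuous[of L])

lemma loc_bdd_lip_fam_cont_fam: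
  assumes "loc_bdd_lip_fam L P"
  shows "cont_fam P"
proof (rule cont_famI)
  show "continuous_on UNIV (\<lambda>z. P z x)" for x
    using lip_fam_continuous[OF loc_bdd_lip_fam_lip_fam[OF assms]] .
  fix M
  obtain B where B: "\<forall>z x. cmod z \<le> M \<longrightarrow> cmod (P z x) \<le> B"
    using assms unfolding loc_bdd_lip_fam_def by blast
  have L: "0 \<le> L"
    using assms by (auto simp: loc_bdd_lip_fam_def lip_fam_def)
  have "(L * (1 + M))-lipschitz_on UNIV (P z)" if "cmod z \<le> M" for z
    using lip_fam_lipschitz[OF loc_bdd_lip_fam_lip_fam[OF assms], of z] that L by (rule_tac lipschitz_on_le) (auto intro: mult_left_mono)
  with B show "\<exists>C B. \<forall>z. cmod z \<le> M \<longrightarrow> C-lipschitz_on UNIV (P z) \<and> (\<forall>x. cmod (P z x) \<le> B)"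
    by blast
qed

text \<open>The constant doubles because the weight 1 + |z| is evaluated at points up to distance 1
  from z, and 2 + |z| \<le> 2 (1 + |z|).\<close>

lemma loc_bdd_lip_fam_fam_average:
  assumes P: "loc_bdd_lip_fam L P" and \<epsilon>: "0 < \<epsilon>" "\<epsilon> \<le> 1" and e: "cmod e = 1"
  shows "loc_bdd_lip_fam (2 * L) (fam_average e \<epsilon> P)"
proof -
  have L: "0 \<le> L" "\<And>z z' x. cmod (P z x - P z' x) \<le> L * cmod (z - z')"
    "\<And>z x x'. cmod (P z x - P z x') \<le> L * (1 + cmod z) * norm (x - x')"
    using P by (auto simp: loc_bdd_lip_fam_def lip_fam_def)
  have c: "continuous_on UNIV (\<lambda>z. P z x)" for x
    by (rule lip_fam_continuous[OF loc_bdd_lip_fam_lip_fam[OF P]])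
  have near: "cmod (z + of_real (\<epsilon> * s) * e) \<le> cmod z + 1" if "0 \<le> s" "s \<le> 1" for z s
    using norm_triangle_ineq[of z "of_real (\<epsilon> * s) * e"] that \<epsilon> mult_le_one[of \<epsilon> s] by (simp add: norm_mult e abs_mult)
  show ?thesis
    unfolding loc_bdd_lip_fam_def lip_fam_def
  proof (intro conjI allI)
    show "0 \<le> 2 * L"
      using L by simp
    fix z z' x
    have "cmod (fam_average e \<epsilon> P z x - fam_average e \<epsilon> P z' x) \<le> L * cmod (z - z')"
      unfolding fam_average_def by (rule line_average_lipschitz[OF c L(2)])
    also have "\<dots> \<le> 2 * L * cmod (z - z')"
      using L by (intro mult_right_mono) auto
    finally show "cmod (fam_average e \<epsilon> P z x - fam_average e \<epsilon> P z' x) \<le> 2 * L * cmod (z - z')" .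
  next
    fix z and x x' :: 'a
    have "fam_average e \<epsilon> P z x - fam_average e \<epsilon> P z x' = line_average e \<epsilon> (\<lambda>w. P w x - P w x') z"
      unfolding fam_average_def by (rule line_average_diff[symmetric, OF c c])
    also have "cmod \<dots> \<le> 2 * L * (1 + cmod z) * norm (x - x')"
    proof (rule line_average_bound)
      show "continuous_on UNIV (\<lambda>w. P w x - P w x')"
        by (intro continuous_intros c)
      fix s :: real assume s: "0 \<le> s" "s \<le> 1"
      have "cmod (P (z + of_real (\<epsilon> * s) * e) x - P (z + of_real (\<epsilon> * s) * e) x') \<le> L * (1 + cmod (z + of_real (\<epsilon> * s) * e)) * norm (x - x')"
        by (rule L(3))
      also have "\<dots> \<le> L * (2 * (1 + cmod z)) * norm (x - x')"
      proof (intro mult_right_mono mult_left_mono)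
        show "1 + cmod (z + of_real (\<epsilon> * s) * e) \<le> 2 * (1 + cmod z)"
          using add_left_mono[OF near[OF s, of z], of 1] by (rule order_trans) simp
      qed (use L in auto)
      finally show "cmod (P (z + of_real (\<epsilon> * s) * e) x - P (z + of_real (\<epsilon> * s) * e) x') \<le> 2 * L * (1 + cmod z) * norm (x - x')"
        by (simp add: mult_ac)
    qed
    finally show "cmod (fam_average e \<epsilon> P z x - fam_average e \<epsilon> P z x') \<le> 2 * L * (1 + cmod z) * norm (x - x')" .
  next
    fix M
    obtain B where B: "\<forall>z x. cmod z \<le> M + 1 \<longrightarrow> cmod (P z x) \<le> B"
      using P unfolding loc_bdd_lip_fam_def by blast
    have "cmod (fam_average e \<epsilon> P z x) \<le> B" if "cmod z \<le> M" for z x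
      unfolding fam_average_def by (rule line_average_bound[OF c]) (use B near[of _ z] that in force)
    then show "\<exists>B. \<forall>z x. cmod z \<le> M \<longrightarrow> cmod (fam_average e \<epsilon> P z x) \<le> B"
      by blast
  qed
qed

lemma loc_bdd_lip_fam_mollify:
  assumes "loc_bdd_lip_fam L P" "0 < \<epsilon>" "\<epsilon> \<le> 1"
  shows "loc_bdd_lip_fam (4 * L) (mollify \<epsilon> P)"
  unfolding mollify_def using loc_bdd_lip_fam_fam_average[OF loc_bdd_lip_fam_fam_average[OF assms, of \<i>] assms(2,3), of 1] by simp

lemma cont_fam_shift:
  assumes "cont_fam P"
  shows "cont_fam (\<lambda>z. P (z + c))"
proof (rule cont_famI)
  show "continuous_on UNIV (\<lambda>z. P (z + c) x)" for x
    by (rule continuous_on_compose2[OF cont_fam_continuous[OF assms, of UNIV x]]) (auto intro!: continuous_intros)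
  fix M
  obtain C where C: "\<And>z. cmod z \<le> M + cmod c \<Longrightarrow> C-lipschitz_on UNIV (P z)" "\<And>z x. cmod z \<le> M + cmod c \<Longrightarrow> cmod (P z x) \<le> C"
    using cont_fam_bound[OF assms, of "M + cmod c"] by metis
  have "cmod (z + c) \<le> M + cmod c" if "cmod z \<le> M" for z
    using norm_triangle_ineq[of z c] that by simp
  then show "\<exists>C B. \<forall>z. cmod z \<le> M \<longrightarrow> C-lipschitz_on UNIV (P (z + c)) \<and> (\<forall>x. cmod (P (z + c) x) \<le> B)"
    using C by blast
qed

text \<open>Each average makes a family differentiable in its own direction. The two averages
  commute, so the one belonging to the required derivative can be put outermost.\<close>

lemma mollify_diff_fam:
  assumes P: "loc_bdd_lip_fam L P" and \<epsilon>: "0 < \<epsilon>" "\<epsilon> \<le> 1"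
  shows "diff_fam (mollify \<epsilon> P)"
    and "dbar (mollify \<epsilon> P) z x = ((fam_average \<i> \<epsilon> P (z + of_real \<epsilon>) x - fam_average \<i> \<epsilon> P z x)
       + \<i> * (fam_average 1 \<epsilon> P (z + of_real \<epsilon> * \<i>) x - fam_average 1 \<epsilon> P z x)) / of_real \<epsilon>"
proof -
  have r: "loc_bdd_lip_fam (2 * L) (fam_average \<i> \<epsilon> P)" "loc_bdd_lip_fam (2 * L) (fam_average 1 \<epsilon> P)"
    using loc_bdd_lip_fam_fam_average[OF P \<epsilon>] by auto
  let ?D = "\<lambda>e P z x. inverse (of_real \<epsilon>) * (P (z + of_real \<epsilon> * e) x - P z x)"
  have cD: "cont_fam (?D e P)" if "cont_fam P" for e and P :: "complex \<Rightarrow> 'a \<Rightarrow> complex"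
    by (intro cont_fam_cmult cont_fam_diff cont_fam_shift that)
  have d: "has_dir_deriv e (\<lambda>z. fam_average e \<epsilon> P' z x) (\<lambda>z. ?D e P' z x)" if "loc_bdd_lip_fam L' P'" for e x P' L'
    unfolding fam_average_def using line_average_dir_deriv[OF lip_fam_continuous[OF loc_bdd_lip_fam_lip_fam[OF that]] \<epsilon>(1), of e x]
    by (simp add: divide_inverse mult.commute)
  have comm: "mollify \<epsilon> P = fam_average \<i> \<epsilon> (fam_average 1 \<epsilon> P)"
    unfolding mollify_def fam_average_def[abs_def] by (intro ext) (rule line_average_commute[OF lip_fam_continuous[OF loc_bdd_lip_fam_lip_fam[OF P]]])
  have d1: "has_dir_deriv 1 (\<lambda>z. mollify \<epsilon> P z x) (\<lambda>z. ?D 1 (fam_average \<i> \<epsilon> P) z x)" for x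
    unfolding mollify_def by (rule d[OF r(1)])
  have d2: "has_dir_deriv \<i> (\<lambda>z. mollify \<epsilon> P z x) (\<lambda>z. ?D \<i> (fam_average 1 \<epsilon> P) z x)" for x
    unfolding comm by (rule d[OF r(2)])
  note * = diff_famI[OF loc_bdd_lip_fam_cont_fam[OF loc_bdd_lip_fam_mollify[OF P \<epsilon>]] cD[OF loc_bdd_lip_fam_cont_fam[OF r(1)]] cD[OF loc_bdd_lip_fam_cont_fam[OF r(2)]] d1 d2]
  show "diff_fam (mollify \<epsilon> P)"
    by (rule *)
  show "dbar (mollify \<epsilon> P) z x = ((fam_average \<i> \<epsilon> P (z + of_real \<epsilon>) x - fam_average \<i> \<epsilon> P z x)
       + \<i> * (fam_average 1 \<epsilon> P (z + of_real \<epsilon> * \<i>) x - fam_average 1 \<epsilon> P z x)) / of_real \<epsilon>"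
    unfolding dbar_def *(2,3) by (simp add: divide_inverse algebra_simps)
qed

lemma mollify_near:
  assumes P: "loc_bdd_lip_fam L P" and \<epsilon>: "0 < \<epsilon>" "\<epsilon> \<le> 1"
  shows "cmod (mollify \<epsilon> P z x - P z x) \<le> 3 * L * \<epsilon>"
proof -
  have L: "0 \<le> L" "\<And>z z' x. cmod (P z x - P z' x) \<le> L * cmod (z - z')"
    using P by (auto simp: loc_bdd_lip_fam_def lip_fam_def)
  have L': "\<And>z z' x. cmod (fam_average \<i> \<epsilon> P z x - fam_average \<i> \<epsilon> P z' x) \<le> (2 * L) * cmod (z - z')"
    using loc_bdd_lip_fam_fam_average[OF P \<epsilon>, of \<i>] by (auto simp: loc_bdd_lip_fam_def lip_fam_def)
  \<comment> \<open>The outer average acts on a family with constant 2 L, the inner one on a family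
    with constant L; together this is 3 L \<epsilon>.\<close>
  have "cmod (mollify \<epsilon> P z x - fam_average \<i> \<epsilon> P z x) \<le> (2 * L) * \<epsilon>"
    unfolding mollify_def fam_average_def[of 1] using L(1) L' \<epsilon> by (intro line_average_near) auto
  moreover have "cmod (fam_average \<i> \<epsilon> P z x - P z x) \<le> L * \<epsilon>"
    unfolding fam_average_def using L \<epsilon> by (intro line_average_near) auto
  ultimately show ?thesis
    using norm_triangle_ineq[of "mollify \<epsilon> P z x - fam_average \<i> \<epsilon> P z x" "fam_average \<i> \<epsilon> P z x - P z x"] by simp
qed

lemma mollify_lin:
  assumes P: "loc_bdd_lip_fam L P" and P': "loc_bdd_lip_fam L' P'" and \<epsilon>: "0 < \<epsilon>" "\<epsilon> \<le> 1"
  shows "mollify \<epsilon> (\<lambda>z x. c * P z x + P' z x) = (\<lambda>z x. c * mollify \<epsilon> P z x + mollify \<epsilon> P' z x)"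
proof -
  have "fam_average \<i> \<epsilon> (\<lambda>z x. c * P z x + P' z x) = (\<lambda>z x. c * fam_average \<i> \<epsilon> P z x + fam_average \<i> \<epsilon> P' z x)"
    unfolding fam_average_def[abs_def] using line_average_lin[OF lip_fam_continuous[OF loc_bdd_lip_fam_lip_fam[OF P]] lip_fam_continuous[OF loc_bdd_lip_fam_lip_fam[OF P']]] by blast
  moreover have "fam_average 1 \<epsilon> (\<lambda>z x. c * fam_average \<i> \<epsilon> P z x + fam_average \<i> \<epsilon> P' z x) = (\<lambda>z x. c * mollify \<epsilon> P z x + mollify \<epsilon> P' z x)"
    unfolding fam_average_def[of 1, abs_def] mollify_def
    using line_average_lin[OF lip_fam_continuous[OF loc_bdd_lip_fam_lip_fam[OF loc_bdd_lip_fam_fam_average[OF P \<epsilon>, of \<i>]]] lip_fam_continuous[OF loc_bdd_lip_fam_lip_fam[OF loc_bdd_lip_fam_fam_average[OF P' \<epsilon>, of \<i>]]]] by simp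
  ultimately show ?thesis
    by (simp add: mollify_def)
qed

lemma mollify_bound:
  assumes P: "loc_bdd_lip_fam L P" and \<epsilon>: "0 < \<epsilon>" "\<epsilon> \<le> 1"
    and B: "\<And>s t. 0 \<le> s \<Longrightarrow> s \<le> 1 \<Longrightarrow> 0 \<le> t \<Longrightarrow> t \<le> 1 \<Longrightarrow> cmod (P (z + of_real (\<epsilon> * s) + of_real (\<epsilon> * t) * \<i>) x) \<le> B"
  shows "cmod (mollify \<epsilon> P z x) \<le> B"
proof -
  have c: "continuous_on UNIV (\<lambda>w. fam_average \<i> \<epsilon> P w x)" for x
    by (rule lip_fam_continuous[OF loc_bdd_lip_fam_lip_fam[OF loc_bdd_lip_fam_fam_average[OF P \<epsilon>]]]) simp
  show ?thesis
    unfolding mollify_def fam_average_def[of 1]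
  proof (rule line_average_bound[OF c])
    fix s :: real assume s: "0 \<le> s" "s \<le> 1"
    show "cmod (fam_average \<i> \<epsilon> P (z + of_real (\<epsilon> * s) * 1) x) \<le> B"
      unfolding fam_average_def by (rule line_average_bound[OF lip_fam_continuous[OF loc_bdd_lip_fam_lip_fam[OF P]]]) (use B s in simp)
  qed
qed

lemma mollify_nonzero:
  assumes P: "loc_bdd_lip_fam L P" and \<epsilon>: "0 < \<epsilon>" "\<epsilon> \<le> 1" and nz: "mollify \<epsilon> P z x \<noteq> 0"
  obtains w where "cmod w \<le> 2 * \<epsilon>" "P (z + w) x \<noteq> 0"
proof (rule ccontr)
  assume neg: "\<not> thesis"
  have "cmod (mollify \<epsilon> P z x) \<le> 0"
  proof (rule mollify_bound[OF P \<epsilon>])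
    fix s t :: real assume st: "0 \<le> s" "s \<le> 1" "0 \<le> t" "t \<le> 1"
    have "cmod (of_real (\<epsilon> * s) + of_real (\<epsilon> * t) * \<i>) \<le> cmod (of_real (\<epsilon> * s)) + cmod (of_real (\<epsilon> * t) * \<i>)"
      by (rule norm_triangle_ineq)
    also have "\<dots> = \<epsilon> * s + \<epsilon> * t"
      using \<epsilon> st by (simp add: norm_mult)
    also have "\<dots> \<le> 2 * \<epsilon>"
      using \<epsilon> mult_left_le[OF st(2), of \<epsilon>] mult_left_le[OF st(4), of \<epsilon>] by linarith
    finally have "P (z + (of_real (\<epsilon> * s) + of_real (\<epsilon> * t) * \<i>)) x = 0"
      using neg that by blast
    then show "cmod (P (z + of_real (\<epsilon> * s) + of_real (\<epsilon> * t) * \<i>) x) \<le> 0"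
      by (simp add: add.assoc)
  qed
  with nz show False by simp
qed

text \<open>The square of averaging lies within 2 \<epsilon> \<le> 2 of z, whence M + 2.\<close>

lemma (in annulus_current) vanishing_mollify:
  assumes P: "loc_bdd_lip_fam L P" and \<epsilon>: "0 < \<epsilon>" "\<epsilon> \<le> 1" and "vanishing M P"
  shows "vanishing (M + 2) (mollify \<epsilon> P)"
  unfolding vanishing_def
proof (intro allI impI)
  fix z and x :: 'a assume z: "M + 2 < cmod z" and x: "r \<le> norm x" "norm x \<le> R0"
  show "mollify \<epsilon> P z x = 0"
  proof (rule ccontr)
    assume "mollify \<epsilon> P z x \<noteq> 0"
    then obtain w where "cmod w \<le> 2 * \<epsilon>" "P (z + w) x \<noteq> 0"
      using mollify_nonzero[OF P \<epsilon>] by blast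
    moreover have "M < cmod (z + w)"
      using z \<open>cmod w \<le> 2 * \<epsilon>\<close> \<epsilon> norm_diff_ineq[of z w] by linarith
    ultimately show False
      using assms(4) x by (auto simp: vanishing_def)
  qed
qed

section \<open>The pushforward under scaling\<close>

lemma scaleC_diff_right: "scaleC a (x - y) = scaleC a x - scaleC a (y::'a::complex_normed_vector)"
  by (metis add_diff_cancel diff_add_cancel scaleC_add_right)

lemma scaleC_diff_left: "scaleC (a - b) x = scaleC a x - scaleC b (x::'a::complex_normed_vector)"
  by (metis add_diff_cancel diff_add_cancel scaleC_add_left)

lemma scaleC_zero_left [simp]: "scaleC 0 x = (0::'a::complex_normed_vector)"
  using norm_scaleC[of 0 x] by simp

lemma EqlocE:
  assumes "f \<in> Eqloc"
  obtains C R where "0 \<le> C" "C-lipschitz_on UNIV f" "0 < R" "fsupp f \<subseteq> ball 0 R"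
proof -
  obtain C where C: "C-lipschitz_on UNIV f" and b: "bounded (fsupp f)"
    using assms by (auto simp: Eqloc_def)
  obtain B where B: "\<forall>x\<in>fsupp f. norm x \<le> B"
    using b by (auto simp: bounded_iff)
  have "fsupp f \<subseteq> ball 0 (max 0 B + 1)"
  proof
    fix x assume "x \<in> fsupp f"
    then have "norm x \<le> B"
      using B by blast
    then show "x \<in> ball 0 (max 0 B + 1)"
      by simp
  qed
  then show ?thesis
    using that[of C "max 0 B + 1"] C lipschitz_on_nonneg[OF C] by auto
qed

lemma fsupp_zero: "x \<notin> fsupp f \<Longrightarrow> f x = 0"
  using closure_subset[of "{x. f x \<noteq> 0}"] by (auto simp: fsupp_def)

lemma Eqloc_Lipb:
  assumes "f \<in> Eqloc"
  shows "f \<in> Lipb"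
proof -
  obtain C R where C: "0 \<le> C" "C-lipschitz_on UNIV f" and R: "0 < R" "fsupp f \<subseteq> ball 0 R"
    by (rule EqlocE[OF assms])
  have "cmod (f x) \<le> cmod (f 0) + C * R" for x
  proof (cases "x \<in> ball 0 R")
    case True
    have "cmod (f x) \<le> cmod (f 0) + cmod (f x - f 0)"
      using norm_triangle_ineq[of "f 0" "f x - f 0"] by simp
    also have "cmod (f x - f 0) \<le> C * norm x"
      using lipschitz_onD[OF C(2), of x 0] by (simp add: dist_norm)
    also have "C * norm x \<le> C * R"
      using True C by (intro mult_left_mono) auto
    finally show ?thesis by simp
  next
    case False
    then have "f x = 0"
      using R fsupp_zero by blast
    then show ?thesis
      using C R by simp
  qed
  then show ?thesis
    using C(2) by (rule LipbI[rotated])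
qed

context annulus_current
begin

text \<open>The retraction only serves to make the family bounded; it is the identity where \<open>\<nu>\<close> lives.\<close>
definition scale_fam :: "('a \<Rightarrow> complex) \<Rightarrow> complex \<Rightarrow> 'a \<Rightarrow> complex" where
  "scale_fam p z x = p (scaleC z (ball_retract (R0 + 1) x))"

text \<open>R0 + 3 serves two estimates: the retraction has norm at most R0 + 1, which bounds the
  variation in z, and Lipschitz constant 2, which bounds the variation in x.\<close>

lemma scale_fam_loc_bdd_lip_fam:
  assumes C: "C-lipschitz_on UNIV p"
  shows "loc_bdd_lip_fam (C * (R0 + 3)) (scale_fam p)"
  unfolding loc_bdd_lip_fam_def lip_fam_def
proof (intro conjI allI)
  have C0: "0 \<le> C"
    using C by (rule lipschitz_on_nonneg)
  have R: "0 \<le> R0 + 1"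
    using R0_nonneg by simp
  show "0 \<le> C * (R0 + 3)"
    using C0 R0_nonneg by simp
  have Cp: "cmod (p x - p y) \<le> C * norm (x - y)" for x y
    using lipschitz_onD[OF C, of x y] by (simp add: dist_norm)
  show "cmod (scale_fam p z x - scale_fam p z' x) \<le> C * (R0 + 3) * cmod (z - z')" for z z' x
  proof -
    have "cmod (scale_fam p z x - scale_fam p z' x) \<le> C * (cmod (z - z') * norm (ball_retract (R0 + 1) x))"
      unfolding scale_fam_def using Cp[of "scaleC z (ball_retract (R0 + 1) x)" "scaleC z' (ball_retract (R0 + 1) x)"]
      by (simp add: norm_scaleC flip: scaleC_diff_left)
    also have "\<dots> \<le> C * (cmod (z - z') * (R0 + 3))"
      using C0 norm_ball_retract_le[OF R, of x] by (intro mult_left_mono) auto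
    finally show ?thesis
      by (simp add: mult_ac)
  qed
  show "cmod (scale_fam p z x - scale_fam p z x') \<le> C * (R0 + 3) * (1 + cmod z) * norm (x - x')" for z x x'
  proof -
    have "cmod (scale_fam p z x - scale_fam p z x') \<le> C * (cmod z * norm (ball_retract (R0 + 1) x - ball_retract (R0 + 1) x'))"
      unfolding scale_fam_def using Cp[of "scaleC z (ball_retract (R0 + 1) x)" "scaleC z (ball_retract (R0 + 1) x')"]
      by (simp add: norm_scaleC flip: scaleC_diff_right)
    also have "\<dots> \<le> C * ((1 + cmod z) * ((R0 + 3) * norm (x - x')))"
    proof (intro mult_left_mono mult_mono)
      have "norm (ball_retract (R0 + 1) x - ball_retract (R0 + 1) x') \<le> 2 * norm (x - x')"
        using lipschitz_onD[OF ball_retract_lipschitz[OF R], of x x'] by (simp add: dist_norm)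
      also have "\<dots> \<le> (R0 + 3) * norm (x - x')"
        using R0_nonneg by (intro mult_right_mono) auto
      finally show "norm (ball_retract (R0 + 1) x - ball_retract (R0 + 1) x') \<le> (R0 + 3) * norm (x - x')" .
    qed (use C0 in auto)
    finally show ?thesis
      by (simp add: mult_ac)
  qed
  show "\<exists>B. \<forall>z x. cmod z \<le> M \<longrightarrow> cmod (scale_fam p z x) \<le> B" for M
  proof (intro exI allI impI)
    fix z x assume z: "cmod z \<le> M"
    have "cmod (scale_fam p z x) \<le> cmod (p 0) + cmod (scale_fam p z x - p 0)"
      using norm_triangle_ineq[of "p 0" "scale_fam p z x - p 0"] by simp
    also have "cmod (scale_fam p z x - p 0) \<le> C * (cmod z * norm (ball_retract (R0 + 1) x))"
      unfolding scale_fam_def using Cp[of "scaleC z (ball_retract (R0 + 1) x)" 0] by (simp add: norm_scaleC)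
    also have "\<dots> \<le> C * (M * (R0 + 1))"
      using C0 norm_ball_retract_le[OF R, of x] z order_trans[OF norm_ge_zero z] by (intro mult_left_mono mult_mono) auto
    finally show "cmod (scale_fam p z x) \<le> cmod (p 0) + C * (M * (R0 + 1))"
      by simp
  qed
qed

lemma scale_fam_vanishing:
  assumes R: "fsupp f \<subseteq> ball 0 R"
  shows "vanishing (R / r) (scale_fam f)"
  unfolding vanishing_def
proof (intro allI impI)
  fix z and x :: 'a assume z: "R / r < cmod z" and x: "r \<le> norm x" "norm x \<le> R0"
  have "R < cmod z * r"
    using z r_pos by (simp add: divide_less_eq)
  also have "\<dots> \<le> cmod z * norm x"
    using x by (intro mult_left_mono) auto
  finally have "scaleC z x \<notin> ball 0 R"
    by (simp add: norm_scaleC)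
  then have "f (scaleC z x) = 0"
    using R by (intro fsupp_zero[of _ f]) auto
  then show "scale_fam f z x = 0"
    unfolding scale_fam_def using x by (simp add: ball_retract_id)
qed

section \<open>Mollified primitives and their limit\<close>

definition eps :: "nat \<Rightarrow> real" where
  "eps n = 1 / real (Suc n)"

lemma eps: "0 < eps n" "eps n \<le> 1" "eps \<longlonglongrightarrow> 0"
  unfolding eps_def[abs_def] using LIMSEQ_Suc[OF lim_1_over_n] by auto

definition mol_fam :: "nat \<Rightarrow> ('a \<Rightarrow> complex) \<Rightarrow> complex \<Rightarrow> 'a \<Rightarrow> complex" where
  "mol_fam n p = mollify (eps n) (scale_fam p)"

definition mol_primitive :: "nat \<Rightarrow> ('a \<Rightarrow> complex) \<Rightarrow> ('a \<Rightarrow> complex) list \<Rightarrow> complex" where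
  "mol_primitive n f \<pi> = fam_primitive (mol_fam n f) (map (mol_fam n) \<pi>)"

definition primitive :: "('a \<Rightarrow> complex) \<Rightarrow> ('a \<Rightarrow> complex) list \<Rightarrow> complex" where
  "primitive f \<pi> = lim (\<lambda>n. mol_primitive n f \<pi>)"

text \<open>The factor 4 comes from the two averages and R0 + 3 from \<open>scale_fam\<close>. It
  converts a Lipschitz constant of p into one for \<open>mol_fam n p\<close> that is the same for
  all n.\<close>

definition fam_const :: real where "fam_const = 4 * (R0 + 3)"

lemma fam_const_pos: "0 < fam_const"
  using R0_nonneg by (simp add: fam_const_def)

lemma mol_fam_diff_fam: "p \<in> Lip \<Longrightarrow> diff_fam (mol_fam n p)"
  unfolding mol_fam_def by (elim LipE) (rule mollify_diff_fam(1)[OF scale_fam_loc_bdd_lip_fam eps(1,2)])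

lemma mol_fam_lip_fam: "C-lipschitz_on UNIV p \<Longrightarrow> lip_fam (fam_const * C) (mol_fam n p)"
  unfolding mol_fam_def fam_const_def using loc_bdd_lip_fam_lip_fam[OF loc_bdd_lip_fam_mollify[OF scale_fam_loc_bdd_lip_fam[of C p] eps(1,2)[of n]]] by (simp add: mult_ac)

lemma mol_fam_near:
  assumes "C-lipschitz_on UNIV p"
  shows "cmod (mol_fam n p z x - scale_fam p z x) \<le> fam_const * C * eps n"
proof -
  have "cmod (mol_fam n p z x - scale_fam p z x) \<le> 3 * (C * (R0 + 3)) * eps n"
    unfolding mol_fam_def by (rule mollify_near[OF scale_fam_loc_bdd_lip_fam[OF assms] eps(1,2)])
  also have "\<dots> \<le> 4 * (C * (R0 + 3)) * eps n"
    using lipschitz_on_nonneg[OF assms] R0_nonneg eps(1)[of n] by (intro mult_right_mono) auto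
  also have "\<dots> = fam_const * C * eps n"
    by (simp add: fam_const_def)
  finally show ?thesis .
qed

lemma mol_fam_tendsto:
  assumes "p \<in> Lip"
  shows "(\<lambda>n. mol_fam n p z x) \<longlonglongrightarrow> scale_fam p z x"
proof -
  obtain C where C: "C-lipschitz_on UNIV p"
    using assms by (auto simp: Lip_def)
  have "(\<lambda>n. mol_fam n p z x - scale_fam p z x) \<longlonglongrightarrow> 0"
  proof (rule Lim_null_comparison)
    show "\<forall>\<^sub>F n in sequentially. norm (mol_fam n p z x - scale_fam p z x) \<le> fam_const * C * eps n"
      using mol_fam_near[OF C] by simp
    show "(\<lambda>n. fam_const * C * eps n) \<longlonglongrightarrow> 0"
      by (intro tendsto_mult_right_zero eps)
  qed
  then show ?thesis
    by (simp only: LIM_zero_iff)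
qed

lemma mol_fam_vanishing: "f \<in> Lip \<Longrightarrow> fsupp f \<subseteq> ball 0 R \<Longrightarrow> vanishing (R / r + 2) (mol_fam n f)"
  unfolding mol_fam_def by (elim LipE) (rule vanishing_mollify[OF scale_fam_loc_bdd_lip_fam eps(1,2) scale_fam_vanishing])

lemma scale_fam_lin: "scale_fam (\<lambda>x. c * f x + g x) = (\<lambda>z x. c * scale_fam f z x + scale_fam g z x)"
  by (simp add: scale_fam_def[abs_def])

lemma mol_fam_lin:
  assumes "f \<in> Lip" "g \<in> Lip"
  shows "mol_fam n (\<lambda>x. c * f x + g x) = (\<lambda>z x. c * mol_fam n f z x + mol_fam n g z x)"
proof -
  obtain C C' where "C-lipschitz_on UNIV f" "C'-lipschitz_on UNIV g"
    using assms by (auto simp: Lip_def)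
  then show ?thesis
    unfolding mol_fam_def scale_fam_lin by (rule mollify_lin[OF scale_fam_loc_bdd_lip_fam scale_fam_loc_bdd_lip_fam eps(1,2)])
qed

lemma mol_fam_bound:
  assumes "f \<in> Lip" "\<And>x. cmod (f x) \<le> A"
  shows "cmod (mol_fam n f z x) \<le> A"
proof -
  obtain C where C: "C-lipschitz_on UNIV f"
    using assms by (auto simp: Lip_def)
  show ?thesis
    unfolding mol_fam_def by (rule mollify_bound[OF scale_fam_loc_bdd_lip_fam[OF C] eps(1,2)]) (auto simp: scale_fam_def assms)
qed

lemma scale_fam_cont_fam: "p \<in> Lip \<Longrightarrow> cont_fam (scale_fam p)"
  by (elim LipE) (rule loc_bdd_lip_fam_cont_fam[OF scale_fam_loc_bdd_lip_fam])

lemma weighted_mass_near: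
  assumes P: "cont_fam P" "cont_fam P'" and b: "\<And>z x. cmod (P z x - P' z x) \<le> b"
  shows "\<bar>weighted_mass M P - weighted_mass M P'\<bar> \<le> b * (measure \<nu> UNIV * measure (kernel_measure M) UNIV)"
proof -
  interpret l: finite_measure "kernel_measure M" by (rule finite_kernel_measure)
  have L: "P z \<in> Lipb" "P' z \<in> Lipb" for z
    using P cont_fam_Lipb by auto
  have "\<bar>fiber_mass P z - fiber_mass P' z\<bar> \<le> b * measure \<nu> UNIV" for z
  proof -
    have "fiber_mass P z - fiber_mass P' z = (\<integral>x. cmod (P z x) - cmod (P' z x) \<partial>\<nu>)"
      unfolding fiber_mass_def using L by (intro Bochner_Integration.integral_diff[symmetric] int_nu)
    also have "\<bar>\<dots>\<bar> \<le> (\<integral>x. \<bar>cmod (P z x) - cmod (P' z x)\<bar> \<partial>\<nu>)"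
      using integral_norm_bound[of \<nu> "\<lambda>x. cmod (P z x) - cmod (P' z x)"] by simp
    also have "\<dots> \<le> (\<integral>x. b \<partial>\<nu>)"
      using L by (intro integral_mono integrable_abs Bochner_Integration.integrable_diff int_nu)
        (auto intro: order_trans[OF norm_triangle_ineq3 b])
    finally show ?thesis
      by (simp add: mult.commute)
  qed
  note d = this
  have "weighted_mass M P - weighted_mass M P' = (\<integral>z. fiber_mass P z - fiber_mass P' z \<partial>kernel_measure M)"
    unfolding weighted_mass_def using P by (intro Bochner_Integration.integral_diff[symmetric] fiber_mass_integrable)
  also have "\<bar>\<dots>\<bar> \<le> (\<integral>z. \<bar>fiber_mass P z - fiber_mass P' z\<bar> \<partial>kernel_measure M)"
    using integral_norm_bound[of "kernel_measure M" "\<lambda>z. fiber_mass P z - fiber_mass P' z"] by simp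
  also have "\<dots> \<le> (\<integral>z. b * measure \<nu> UNIV \<partial>kernel_measure M)"
    using P d by (intro integral_mono integrable_abs Bochner_Integration.integrable_diff fiber_mass_integrable) auto
  finally show ?thesis
    by (simp add: mult_ac)
qed

lemma weighted_mass_le:
  assumes P: "cont_fam P" and b: "\<And>z x. cmod (P z x) \<le> b"
  shows "weighted_mass M P \<le> b * (measure \<nu> UNIV * measure (kernel_measure M) UNIV)"
  using weighted_mass_near[OF P cont_fam_const[of 0], of b M] b by (simp add: weighted_mass_def fiber_mass_def)

lemma weighted_mass_mol_fam_tendsto:
  assumes "p \<in> Lip"
  shows "(\<lambda>n. weighted_mass M (mol_fam n p)) \<longlonglongrightarrow> weighted_mass M (scale_fam p)"
proof -
  obtain C where C: "C-lipschitz_on UNIV p"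
    using assms by (auto simp: Lip_def)
  have "(\<lambda>n. weighted_mass M (mol_fam n p) - weighted_mass M (scale_fam p)) \<longlonglongrightarrow> 0"
  proof (rule Lim_null_comparison)
    show "\<forall>\<^sub>F n in sequentially. norm (weighted_mass M (mol_fam n p) - weighted_mass M (scale_fam p)) \<le> fam_const * C * eps n * (measure \<nu> UNIV * measure (kernel_measure M) UNIV)"
      using weighted_mass_near[OF diff_fam_cont_fam[OF mol_fam_diff_fam[OF assms]] scale_fam_cont_fam[OF assms] mol_fam_near[OF C]] by simp
    show "(\<lambda>n. fam_const * C * eps n * (measure \<nu> UNIV * measure (kernel_measure M) UNIV)) \<longlonglongrightarrow> 0"
      by (intro tendsto_mult_left_zero tendsto_mult_right_zero eps)
  qed
  then show ?thesis
    by (simp only: LIM_zero_iff)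
qed

lemma fam_primitive_lin_first:
  assumes "diff_fam F" "diff_fam F'" "\<forall>P\<in>set Ps. diff_fam P" "length Ps = Suc k" "vanishing M F" "vanishing M F'"
  shows "fam_primitive (\<lambda>z x. c * F z x + F' z x) Ps = c * fam_primitive F Ps + fam_primitive F' Ps"
proof -
  obtain P Ps' where "Ps = P # Ps'" "diff_fam P" "diff_fams Ps'"
    using assms by (cases Ps) (auto simp: diff_fams_def)
  then show ?thesis
    using assms by (simp add: fam_primitive_def slot_primitive_lin_first)
qed

lemma map_mol_fam:
  assumes "\<pi> \<in> args Lip (Suc k)"
  shows "\<forall>P\<in>set (map (mol_fam n) \<pi>). diff_fam P" "length (map (mol_fam n) \<pi>) = Suc k"
  using assms by (auto simp: args_def intro!: mol_fam_diff_fam)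

lemma vanishing_mono: "vanishing M F \<Longrightarrow> M \<le> M' \<Longrightarrow> vanishing M' F"
  by (auto simp: vanishing_def)

lemma vanishing_diff: "vanishing M F \<Longrightarrow> vanishing M F' \<Longrightarrow> vanishing M (\<lambda>z x. F z x - F' z x)"
  by (auto simp: vanishing_def)

lemma args_common_lipschitz:
  assumes "\<pi> \<in> args Lip n"
  obtains C where "0 \<le> C" "\<And>j. j < n \<Longrightarrow> C-lipschitz_on UNIV (\<pi> ! j)"
proof -
  have "\<exists>C. C-lipschitz_on UNIV (\<pi> ! j)" if "j < n" for j
    using args_nth[OF assms that] by (auto simp: Lip_def)
  then obtain c where c: "\<And>j. j < n \<Longrightarrow> (c j)-lipschitz_on UNIV (\<pi> ! j)"
    by metis
  have "(\<Sum>i<n. c i)-lipschitz_on UNIV (\<pi> ! j)" if "j < n" for j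
    using c that lipschitz_on_nonneg[OF c]
    by (intro lipschitz_on_le[OF c[OF that]] member_le_sum) auto
  moreover have "0 \<le> (\<Sum>i<n. c i)"
    using lipschitz_on_nonneg[OF c] by (intro sum_nonneg) auto
  ultimately show ?thesis
    using that by blast
qed

text \<open>The families for n and m differ uniformly by a multiple of \<open>eps n + eps m\<close>,
  while their Lipschitz constants do not depend on n and m. Replacing f is paid for by the mass
  bound, replacing the entries by \<open>fam_primitive_diff_bound\<close>; K collects both
  constants.\<close>

lemma mol_primitive_diff:
  assumes f: "f \<in> Lip" "C-lipschitz_on UNIV f" "\<And>x. cmod (f x) \<le> A" "fsupp f \<subseteq> ball 0 R" "0 < R"
    and \<pi>: "\<pi> \<in> args Lip (Suc k)" "\<And>j. j < Suc k \<Longrightarrow> C-lipschitz_on UNIV (\<pi> ! j)"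
  obtains K where "0 \<le> K" "\<And>n m. cmod (mol_primitive n f \<pi> - mol_primitive m f \<pi>) \<le> K * (eps n + eps m)"
proof -
  define M where "M = R / r + 2"
  define N where "N = measure \<nu> UNIV * measure (kernel_measure M) UNIV"
  define b where "b n m = fam_const * C * (eps n + eps m)" for n m
  have M: "0 \<le> M"
    using f(5) r_pos by (simp add: M_def)
  have C: "0 \<le> C"
    using f(2) by (rule lipschitz_on_nonneg)
  have A: "0 \<le> A"
    using order_trans[OF norm_ge_zero f(3)] .
  have N: "0 \<le> N"
    by (simp add: N_def)
  have L: "0 \<le> fam_const * C"
    using C fam_const_pos by simp
  have near: "cmod (mol_fam n p z x - mol_fam m p z x) \<le> b n m" if "C-lipschitz_on UNIV p" for n m p z x
    using norm_triangle_ineq4[of "mol_fam n p z x - scale_fam p z x" "mol_fam m p z x - scale_fam p z x"] mol_fam_near[OF that, of n z x] mol_fam_near[OF that, of m z x]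
    by (simp add: b_def algebra_simps)
  have vanishing: "vanishing M (mol_fam n f)" for n
    unfolding M_def by (rule mol_fam_vanishing[OF f(1,4)])
  have LP: "lip_fam (fam_const * C) (map (mol_fam n) \<pi> ! j)" if "j < Suc k" for n j
    using that \<pi> args_length[OF \<pi>(1)] by (simp add: mol_fam_lip_fam)
  have pL: "\<pi> ! j \<in> Lip" if "j < Suc k" for j
    using args_nth[OF \<pi>(1) that] .
  define K where "K = (mass_const M * (fam_const * C) ^ Suc k * N + slot_const M (fam_const * C) * (real (Suc k) * (A * measure \<nu> UNIV + N))) * (fam_const * C)"
  have K0: "0 \<le> slot_const M (fam_const * C)"
    unfolding slot_const_def using L C fam_const_pos mass_const_nonneg[OF M] by (intro add_nonneg_nonneg mult_nonneg_nonneg zero_le_power) auto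
  show ?thesis
  proof (rule that[of K])
    show "0 \<le> K"
      unfolding K_def using L C fam_const_pos mass_const_nonneg[OF M] N K0 A
      by (intro mult_nonneg_nonneg add_nonneg_nonneg zero_le_power) auto
    fix n m
    have b0: "0 \<le> b n m"
      unfolding b_def using L eps(1)[of n] eps(1)[of m] by simp
    have 1: "cmod (fam_primitive (mol_fam n f) (map (mol_fam n) \<pi>) - fam_primitive (mol_fam m f) (map (mol_fam n) \<pi>)) \<le> mass_const M * (fam_const * C) ^ Suc k * (b n m * N)"
    proof -
      have "fam_primitive (\<lambda>z x. mol_fam n f z x - mol_fam m f z x) (map (mol_fam n) \<pi>) = fam_primitive (mol_fam n f) (map (mol_fam n) \<pi>) - fam_primitive (mol_fam m f) (map (mol_fam n) \<pi>)"
        using fam_primitive_lin_first[OF mol_fam_diff_fam[OF f(1)] mol_fam_diff_fam[OF f(1)] map_mol_fam[OF \<pi>(1)] vanishing vanishing, of "-1" m n n] by simp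
      moreover have "cmod (fam_primitive (\<lambda>z x. mol_fam n f z x - mol_fam m f z x) (map (mol_fam n) \<pi>))
          \<le> mass_const M * (\<Prod>i<Suc k. fam_const * C) * weighted_mass M (\<lambda>z x. mol_fam n f z x - mol_fam m f z x)"
        by (intro fam_primitive_bound diff_fam_diff(1) mol_fam_diff_fam f(1) vanishing_diff vanishing map_mol_fam[OF \<pi>(1)] LP M)
      moreover have "weighted_mass M (\<lambda>z x. mol_fam n f z x - mol_fam m f z x) \<le> b n m * N"
        unfolding N_def by (intro weighted_mass_le cont_fam_diff diff_fam_cont_fam mol_fam_diff_fam f(1) near f(2))
      ultimately show ?thesis
        using mult_left_mono[of "weighted_mass M (\<lambda>z x. mol_fam n f z x - mol_fam m f z x)" "b n m * N" "mass_const M * (\<Prod>i<Suc k. fam_const * C)"] mass_const_nonneg[OF M] L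
        by (simp add: mult_nonneg_nonneg)
    qed
    have 2: "cmod (fam_primitive (mol_fam m f) (map (mol_fam n) \<pi>) - fam_primitive (mol_fam m f) (map (mol_fam m) \<pi>)) \<le> slot_const M (fam_const * C) * (real (Suc k) * (A * measure \<nu> UNIV + N) * b n m)"
    proof -
      have "cmod (fam_primitive (mol_fam m f) (map (mol_fam n) \<pi>) - fam_primitive (mol_fam m f) (map (mol_fam m) \<pi>))
         \<le> slot_const M (fam_const * C) * (\<Sum>i<Suc k. (\<integral>x. cmod (mol_fam m f 1 x * ((map (mol_fam n) \<pi> ! i) 1 x - (map (mol_fam m) \<pi> ! i) 1 x)) \<partial>\<nu>)
           + weighted_mass M (\<lambda>z x. (map (mol_fam n) \<pi> ! i) z x - (map (mol_fam m) \<pi> ! i) z x))"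
        by (intro fam_primitive_diff_bound mol_fam_diff_fam f(1) mol_fam_lip_fam f(2) vanishing map_mol_fam[OF \<pi>(1)] LP M)
      also have "\<dots> \<le> slot_const M (fam_const * C) * (\<Sum>i<Suc k. A * b n m * measure \<nu> UNIV + b n m * N)"
      proof (intro mult_left_mono[OF _ K0] sum_mono add_mono)
        fix i assume "i \<in> {..<Suc k}"
        then have i: "i < Suc k" by simp
        have mp: "map (mol_fam n) \<pi> ! i = mol_fam n (\<pi> ! i)" for n
          using i args_length[OF \<pi>(1)] by simp
        show "weighted_mass M (\<lambda>z x. (map (mol_fam n) \<pi> ! i) z x - (map (mol_fam m) \<pi> ! i) z x) \<le> b n m * N"
          unfolding N_def mp by (intro weighted_mass_le cont_fam_diff diff_fam_cont_fam mol_fam_diff_fam pL[OF i] near \<pi>(2)[OF i])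
        have "(\<integral>x. cmod (mol_fam m f 1 x * (mol_fam n (\<pi> ! i) 1 x - mol_fam m (\<pi> ! i) 1 x)) \<partial>\<nu>) \<le> (\<integral>x. A * b n m \<partial>\<nu>)"
          using mol_fam_bound[OF f(1,3), of m 1] near[OF \<pi>(2)[OF i], of n 1 _ m] A
          by (intro integral_mono int_nu Lipb_mult Lipb_diff diff_fam_Lipb mol_fam_diff_fam f(1) pL[OF i])
             (auto simp: norm_mult intro!: mult_mono)
        then show "(\<integral>x. cmod (mol_fam m f 1 x * ((map (mol_fam n) \<pi> ! i) 1 x - (map (mol_fam m) \<pi> ! i) 1 x)) \<partial>\<nu>) \<le> A * b n m * measure \<nu> UNIV"
          unfolding mp by (simp add: mult_ac)
      qed
      also have "\<dots> = slot_const M (fam_const * C) * (real (Suc k) * (A * measure \<nu> UNIV + N) * b n m)"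
        by (simp add: algebra_simps)
      finally show ?thesis .
    qed
    have "cmod (mol_primitive n f \<pi> - mol_primitive m f \<pi>) \<le> cmod (fam_primitive (mol_fam n f) (map (mol_fam n) \<pi>) - fam_primitive (mol_fam m f) (map (mol_fam n) \<pi>))
        + cmod (fam_primitive (mol_fam m f) (map (mol_fam n) \<pi>) - fam_primitive (mol_fam m f) (map (mol_fam m) \<pi>))"
      unfolding mol_primitive_def using norm_triangle_ineq[of "fam_primitive (mol_fam n f) (map (mol_fam n) \<pi>) - fam_primitive (mol_fam m f) (map (mol_fam n) \<pi>)"
          "fam_primitive (mol_fam m f) (map (mol_fam n) \<pi>) - fam_primitive (mol_fam m f) (map (mol_fam m) \<pi>)"] by simp
    also have "\<dots> \<le> mass_const M * (fam_const * C) ^ Suc k * (b n m * N) + slot_const M (fam_const * C) * (real (Suc k) * (A * measure \<nu> UNIV + N) * b n m)"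
      by (rule add_mono[OF 1 2])
    also have "\<dots> = K * (eps n + eps m)"
      unfolding K_def b_def by (simp only: ring_distribs mult_ac)
    finally show "cmod (mol_primitive n f \<pi> - mol_primitive m f \<pi>) \<le> K * (eps n + eps m)" .
  qed
qed

lemma primitive_tendsto:
  assumes f: "f \<in> Eqloc" and \<pi>: "\<pi> \<in> args Lip (Suc k)"
  shows "(\<lambda>n. mol_primitive n f \<pi>) \<longlonglongrightarrow> primitive f \<pi>"
proof -
  obtain C1 R where C1: "0 \<le> C1" "C1-lipschitz_on UNIV f" and R: "0 < R" "fsupp f \<subseteq> ball 0 R"
    by (rule EqlocE[OF f])
  obtain A where A: "\<And>x. cmod (f x) \<le> A"
    using LipbE[OF Eqloc_Lipb[OF f]] by metis
  obtain C2 where C2: "0 \<le> C2" "\<And>j. j < Suc k \<Longrightarrow> C2-lipschitz_on UNIV (\<pi> ! j)"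
    using args_common_lipschitz[OF \<pi>] by metis
  have "(max C1 C2)-lipschitz_on UNIV f" "\<And>j. j < Suc k \<Longrightarrow> (max C1 C2)-lipschitz_on UNIV (\<pi> ! j)"
    using lipschitz_on_le[OF C1(2) max.cobounded1] lipschitz_on_le[OF C2(2) max.cobounded2] by auto
  then obtain K where K: "0 \<le> K" "\<And>n m. cmod (mol_primitive n f \<pi> - mol_primitive m f \<pi>) \<le> K * (eps n + eps m)"
    using mol_primitive_diff[OF LipI[OF C1(2)] _ A R(2,1) \<pi>, of "max C1 C2"] by metis
  have "Cauchy (\<lambda>n. mol_primitive n f \<pi>)"
  proof (rule metric_CauchyI)
    fix e :: real assume e: "0 < e"
    have "(\<lambda>n. K * eps n) \<longlonglongrightarrow> 0"
      by (intro tendsto_mult_right_zero eps)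
    then obtain n0 where n0: "\<And>n. n \<ge> n0 \<Longrightarrow> \<bar>K * eps n\<bar> < e / 2"
      using e LIMSEQ_D[of "\<lambda>n. K * eps n" 0 "e / 2"] by auto
    show "\<exists>N. \<forall>m\<ge>N. \<forall>n\<ge>N. dist (mol_primitive m f \<pi>) (mol_primitive n f \<pi>) < e"
    proof (intro exI[of _ n0] allI impI)
      fix m n assume "n0 \<le> m" "n0 \<le> n"
      then have "\<bar>K * eps m\<bar> < e / 2" "\<bar>K * eps n\<bar> < e / 2"
        using n0 by auto
      then show "dist (mol_primitive m f \<pi>) (mol_primitive n f \<pi>) < e"
        using K(2)[of m n] by (simp add: dist_norm distrib_left)
    qed
  qed
  then show ?thesis
    unfolding primitive_def by (simp add: Cauchy_convergent_iff convergent_LIMSEQ_iff)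
qed

section \<open>Linearity, bounds and the Leibniz identity in the limit\<close>

lemma Eqloc_Lip: "f \<in> Eqloc \<Longrightarrow> f \<in> Lip"
  by (intro Lipb_Lip Eqloc_Lipb)

lemma Eqloc_lin:
  assumes "f \<in> Eqloc" "g \<in> Eqloc"
  shows "(\<lambda>x. c * f x + g x) \<in> Eqloc"
proof -
  have "(\<lambda>x. c * f x + g x) \<in> Lip"
    using assms by (intro Lip_add Lip_cmult Eqloc_Lip)
  moreover have "fsupp (\<lambda>x. c * f x + g x) \<subseteq> fsupp f \<union> fsupp g"
    unfolding fsupp_def closure_Un[symmetric] by (intro closure_mono) auto
  then have "bounded (fsupp (\<lambda>x. c * f x + g x))"
    using assms bounded_subset[OF bounded_Un[THEN iffD2]] by (auto simp: Eqloc_def)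
  ultimately show ?thesis
    by (auto simp: Eqloc_def Lip_def)
qed

lemma primitive_lin_first:
  assumes f: "f \<in> Eqloc" "g \<in> Eqloc" and \<pi>: "\<pi> \<in> args Lip (Suc k)"
  shows "primitive (\<lambda>x. c * f x + g x) \<pi> = c * primitive f \<pi> + primitive g \<pi>"
proof -
  obtain R1 where R1: "fsupp f \<subseteq> ball 0 R1"
    using EqlocE[OF f(1)] by metis
  obtain R2 where R2: "fsupp g \<subseteq> ball 0 R2"
    using EqlocE[OF f(2)] by metis
  let ?M = "max (R1 / r + 2) (R2 / r + 2)"
  have "mol_primitive n (\<lambda>x. c * f x + g x) \<pi> = c * mol_primitive n f \<pi> + mol_primitive n g \<pi>" for n
    unfolding mol_primitive_def mol_fam_lin[OF Eqloc_Lip[OF f(1)] Eqloc_Lip[OF f(2)]]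
    using f R1 R2 by (intro fam_primitive_lin_first[of _ _ _ ?M] mol_fam_diff_fam Eqloc_Lip map_mol_fam[OF \<pi>]
        vanishing_mono[OF mol_fam_vanishing max.cobounded1] vanishing_mono[OF mol_fam_vanishing max.cobounded2])
  then have "(\<lambda>n. mol_primitive n (\<lambda>x. c * f x + g x) \<pi>) \<longlonglongrightarrow> c * primitive f \<pi> + primitive g \<pi>"
    using primitive_tendsto[OF f(1) \<pi>] primitive_tendsto[OF f(2) \<pi>] by (auto intro!: tendsto_intros)
  from LIMSEQ_unique[OF primitive_tendsto[OF Eqloc_lin[OF f] \<pi>] this] show ?thesis .
qed

lemma primitive_lin_arg:
  assumes f: "f \<in> Eqloc" and \<pi>: "\<pi> \<in> args Lip (Suc k)" and g: "g \<in> Lip" "h \<in> Lip" and i: "i < Suc k"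
  shows "primitive f (\<pi>[i := \<lambda>x. c * g x + h x]) = c * primitive f (\<pi>[i := g]) + primitive f (\<pi>[i := h])"
proof -
  obtain R where R: "fsupp f \<subseteq> ball 0 R"
    using EqlocE[OF f] by metis
  have "mol_primitive n f (\<pi>[i := \<lambda>x. c * g x + h x]) = c * mol_primitive n f (\<pi>[i := g]) + mol_primitive n f (\<pi>[i := h])" for n
    unfolding mol_primitive_def map_update mol_fam_lin[OF g]
    by (rule fam_primitive_lin[OF mol_fam_diff_fam[OF Eqloc_Lip[OF f]] mol_fam_vanishing[OF Eqloc_Lip[OF f] R] map_mol_fam[OF \<pi>] mol_fam_diff_fam[OF g(1)] mol_fam_diff_fam[OF g(2)] i])
  then have "(\<lambda>n. mol_primitive n f (\<pi>[i := \<lambda>x. c * g x + h x])) \<longlonglongrightarrow> c * primitive f (\<pi>[i := g]) + primitive f (\<pi>[i := h])"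
    using primitive_tendsto[OF f args_update[OF \<pi> g(1)]] primitive_tendsto[OF f args_update[OF \<pi> g(2)]] by (auto intro!: tendsto_intros)
  from LIMSEQ_unique[OF primitive_tendsto[OF f args_update[OF \<pi> Lip_add[OF Lip_cmult[OF g(1)] g(2)]]] this] show ?thesis .
qed

lemma primitive_bound:
  assumes f: "f \<in> Eqloc" and R: "0 < R" "fsupp f \<subseteq> ball 0 R" and \<pi>: "\<pi> \<in> args Lip (Suc k)"
    and L: "\<And>j. j < Suc k \<Longrightarrow> (L j)-lipschitz_on UNIV (\<pi> ! j)"
  shows "cmod (primitive f \<pi>) \<le> mass_const (R / r + 2) * fam_const ^ Suc k * (\<Prod>j<Suc k. L j) * weighted_mass (R / r + 2) (scale_fam f)"
proof (rule LIMSEQ_le)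
  let ?M = "R / r + 2"
  have M: "0 \<le> ?M"
    using R r_pos by simp
  show "(\<lambda>n. cmod (mol_primitive n f \<pi>)) \<longlonglongrightarrow> cmod (primitive f \<pi>)"
    by (intro tendsto_norm primitive_tendsto f \<pi>)
  show "(\<lambda>n. mass_const ?M * fam_const ^ Suc k * (\<Prod>j<Suc k. L j) * weighted_mass ?M (mol_fam n f)) \<longlonglongrightarrow> mass_const ?M * fam_const ^ Suc k * (\<Prod>j<Suc k. L j) * weighted_mass ?M (scale_fam f)"
    by (intro tendsto_intros weighted_mass_mol_fam_tendsto Eqloc_Lip f)
  show "\<exists>N. \<forall>n\<ge>N. cmod (mol_primitive n f \<pi>) \<le> mass_const ?M * fam_const ^ Suc k * (\<Prod>j<Suc k. L j) * weighted_mass ?M (mol_fam n f)"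
  proof (intro exI allI impI)
    fix n
    have "cmod (mol_primitive n f \<pi>) \<le> mass_const ?M * (\<Prod>j<Suc k. fam_const * L j) * weighted_mass ?M (mol_fam n f)"
      unfolding mol_primitive_def
    proof (rule fam_primitive_bound[OF mol_fam_diff_fam[OF Eqloc_Lip[OF f]] mol_fam_vanishing[OF Eqloc_Lip[OF f] R(2)] map_mol_fam[OF \<pi>] _ M])
      show "lip_fam (fam_const * L j) (map (mol_fam n) \<pi> ! j)" if "j < Suc k" for j
        using mol_fam_lip_fam[OF L[OF that]] that args_length[OF \<pi>] by simp
    qed
    then show "cmod (mol_primitive n f \<pi>) \<le> mass_const ?M * fam_const ^ Suc k * (\<Prod>j<Suc k. L j) * weighted_mass ?M (mol_fam n f)"
      by (simp only: prod.distrib prod_constant card_lessThan mult.assoc)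
  qed
qed

text \<open>Only the values of the entry g appear in the bound, so it tends to 0 under bounded
  pointwise convergence of g to 0. This is the source of continuity in the entries.\<close>

lemma primitive_bound_slot:
  assumes f: "f \<in> Eqloc" "C-lipschitz_on UNIV f" and R: "0 < R" "fsupp f \<subseteq> ball 0 R" and \<pi>: "\<pi> \<in> args Lip (Suc k)"
    and L: "\<And>j. j < Suc k \<Longrightarrow> j \<noteq> i \<Longrightarrow> C-lipschitz_on UNIV (\<pi> ! j)" and i: "i < Suc k" and g: "g \<in> Lip"
  shows "cmod (primitive f (\<pi>[i := g])) \<le> slot_const (R / r + 2) (fam_const * C) * ((\<integral>x. cmod (scale_fam f 1 x * scale_fam g 1 x) \<partial>\<nu>) + weighted_mass (R / r + 2) (scale_fam g))"
proof (rule LIMSEQ_le)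
  let ?M = "R / r + 2"
  have M: "0 \<le> ?M"
    using R r_pos by simp
  show "(\<lambda>n. cmod (mol_primitive n f (\<pi>[i := g]))) \<longlonglongrightarrow> cmod (primitive f (\<pi>[i := g]))"
    by (intro tendsto_norm primitive_tendsto f args_update \<pi> g)
  obtain Cg where Cg: "0 \<le> Cg" "Cg-lipschitz_on UNIV g"
    using LipE[OF g] by metis
  obtain A where A: "0 \<le> A" "\<And>x. cmod (f x) \<le> A"
    using LipbE[OF Eqloc_Lipb[OF f(1)]] by metis
  obtain B where B: "0 \<le> B" "\<And>x. cmod (scale_fam g 1 x) \<le> B"
    using LipbE[OF cont_fam_Lipb[OF scale_fam_cont_fam[OF g], of 1]] by metis
  have "(\<lambda>n. \<integral>x. cmod (mol_fam n f 1 x * mol_fam n g 1 x) \<partial>\<nu>) \<longlonglongrightarrow> (\<integral>x. cmod (scale_fam f 1 x * scale_fam g 1 x) \<partial>\<nu>)"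
  proof (rule integral_dominated_convergence[where w = "\<lambda>_. A * (B + fam_const * Cg)"])
    have "mol_fam n p 1 \<in> borel_measurable borel" "scale_fam p 1 \<in> borel_measurable borel" if "p \<in> Lip" for n p
      using Lip_measurable[OF Lipb_Lip[OF diff_fam_Lipb[OF mol_fam_diff_fam[OF that]]]] Lip_measurable[OF Lipb_Lip[OF cont_fam_Lipb[OF scale_fam_cont_fam[OF that]]]] by auto
    then have [measurable]: "mol_fam n f 1 \<in> borel_measurable borel" "scale_fam f 1 \<in> borel_measurable borel"
        "mol_fam n g 1 \<in> borel_measurable borel" "scale_fam g 1 \<in> borel_measurable borel" for n
      using g Eqloc_Lip[OF f(1)] by auto
    show "(\<lambda>x. cmod (scale_fam f 1 x * scale_fam g 1 x)) \<in> borel_measurable \<nu>" "\<And>n. (\<lambda>x. cmod (mol_fam n f 1 x * mol_fam n g 1 x)) \<in> borel_measurable \<nu>"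
      by measurable
    show "AE x in \<nu>. (\<lambda>n. cmod (mol_fam n f 1 x * mol_fam n g 1 x)) \<longlonglongrightarrow> cmod (scale_fam f 1 x * scale_fam g 1 x)"
      by (intro AE_I2 tendsto_intros mol_fam_tendsto Eqloc_Lip f g)
    show "AE x in \<nu>. norm (cmod (mol_fam n f 1 x * mol_fam n g 1 x)) \<le> A * (B + fam_const * Cg)" for n
    proof (rule AE_I2)
      fix x
      have "cmod (mol_fam n g 1 x) \<le> cmod (scale_fam g 1 x) + cmod (mol_fam n g 1 x - scale_fam g 1 x)"
        using norm_triangle_ineq[of "scale_fam g 1 x" "mol_fam n g 1 x - scale_fam g 1 x"] by simp
      also have "\<dots> \<le> B + fam_const * Cg * eps n"
        by (intro add_mono B mol_fam_near Cg)
      also have "\<dots> \<le> B + fam_const * Cg"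
        using eps(2)[of n] Cg fam_const_pos by (simp add: mult_left_le)
      finally show "norm (cmod (mol_fam n f 1 x * mol_fam n g 1 x)) \<le> A * (B + fam_const * Cg)"
        using mol_fam_bound[OF Eqloc_Lip[OF f(1)] A(2), of n 1 x] A by (simp add: norm_mult mult_mono)
    qed
  qed auto
  then show "(\<lambda>n. slot_const ?M (fam_const * C) * ((\<integral>x. cmod (mol_fam n f 1 x * mol_fam n g 1 x) \<partial>\<nu>) + weighted_mass ?M (mol_fam n g)))
      \<longlonglongrightarrow> slot_const ?M (fam_const * C) * ((\<integral>x. cmod (scale_fam f 1 x * scale_fam g 1 x) \<partial>\<nu>) + weighted_mass ?M (scale_fam g))"
    by (intro tendsto_intros weighted_mass_mol_fam_tendsto g)
  show "\<exists>N. \<forall>n\<ge>N. cmod (mol_primitive n f (\<pi>[i := g])) \<le> slot_const ?M (fam_const * C) * ((\<integral>x. cmod (mol_fam n f 1 x * mol_fam n g 1 x) \<partial>\<nu>) + weighted_mass ?M (mol_fam n g))"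
  proof (intro exI allI impI)
    fix n
    show "cmod (mol_primitive n f (\<pi>[i := g])) \<le> slot_const ?M (fam_const * C) * ((\<integral>x. cmod (mol_fam n f 1 x * mol_fam n g 1 x) \<partial>\<nu>) + weighted_mass ?M (mol_fam n g))"
      unfolding mol_primitive_def map_update
    proof (rule fam_primitive_bound_slot[OF mol_fam_diff_fam[OF Eqloc_Lip[OF f(1)]] mol_fam_lip_fam[OF f(2)] mol_fam_vanishing[OF Eqloc_Lip[OF f(1)] R(2)] map_mol_fam[OF \<pi>] mol_fam_diff_fam[OF g] i _ M])
      show "lip_fam (fam_const * C) (map (mol_fam n) \<pi> ! j)" if "j < Suc k" "j \<noteq> i" for j
        using mol_fam_lip_fam[OF L[OF that]] that args_length[OF \<pi>] by simp
    qed
  qed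
qed

text \<open>Cutting the first argument off beyond radius R0 does not change T, and its support then
  lies in the open ball of radius R0 + 1, so by locality the entries matter only there.\<close>

lemma T_localize:
  assumes h: "h \<in> Lipb" and \<pi>: "\<pi> \<in> args Lip k" "\<pi>' \<in> args Lip k"
    and eq: "\<And>j x. j < k \<Longrightarrow> norm x < R0 + 1 \<Longrightarrow> (\<pi> ! j) x = (\<pi>' ! j) x"
  shows "T h \<pi> = T h \<pi>'"
proof -
  obtain \<theta> :: "'a \<Rightarrow> complex" where \<theta>: "\<theta> \<in> Lipb" "\<And>x. norm x \<le> R0 \<Longrightarrow> \<theta> x = 1" "fsupp \<theta> \<subseteq> cball 0 (R0 + 1/2)"
    using norm_cutoff[where R = R0] by metis
  then have \<theta>': "fsupp \<theta> \<subseteq> ball 0 (R0 + 1)"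
    by fastforce
  have "T h \<pi>'' = T (\<lambda>x. \<theta> x * h x) \<pi>''" if "\<pi>'' \<in> args Lip k" for \<pi>''
    using h \<theta> that by (intro T_cong_first Lipb_mult) auto
  moreover have "T (\<lambda>x. \<theta> x * h x) \<pi> = T (\<lambda>x. \<theta> x * h x) \<pi>'"
    using h \<theta> \<theta>' \<pi> eq fsupp_mult_subset[of \<theta> h]
    by (intro T_cong_args[where V = "ball 0 (R0 + 1)"] Lipb_mult) auto
  ultimately show ?thesis
    using \<pi> by simp
qed

text \<open>At z = 1 \<open>scale_fam\<close> returns the original functions on the ball of radius
  R0 + 1. The first argument needs this only on the annulus, the entries on a neighbourhood of it;
  this is why the retraction is at R0 + 1 and not at R0.\<close>

lemma primitive_leibniz:
  assumes f: "f \<in> Eqloc" and g: "g \<in> Eqloc" and \<pi>: "\<pi> \<in> args Lip k"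
  shows "primitive f (g # \<pi>) + primitive g (f # \<pi>) = T (\<lambda>x. f x * g x) \<pi>"
proof -
  obtain R where R: "fsupp f \<subseteq> ball 0 R"
    using EqlocE[OF f] by metis
  note fL = Eqloc_Lip[OF f] and gL = Eqloc_Lip[OF g]
  have \<pi>1: "g # \<pi> \<in> args Lip (Suc k)" "f # \<pi> \<in> args Lip (Suc k)"
    using \<pi> fL gL by (auto simp: args_def)
  have diff_fams: "diff_fams (map (mol_fam n) \<pi>)" for n
    using \<pi> by (auto simp: diff_fams_def args_def intro!: mol_fam_diff_fam)
  have eq: "mol_primitive n f (g # \<pi>) + mol_primitive n g (f # \<pi>) = T (\<lambda>x. mol_fam n f 1 x * mol_fam n g 1 x) (eval_fams 1 (map (mol_fam n) \<pi>))" for n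
    unfolding mol_primitive_def fam_primitive_def
    using slot_primitive_leibniz[OF mol_fam_diff_fam[OF fL] mol_fam_diff_fam[OF gL] diff_fams mol_fam_vanishing[OF fL R], of n] by simp
  obtain C where C: "0 \<le> C" "\<And>j. j < k \<Longrightarrow> C-lipschitz_on UNIV (\<pi> ! j)"
    using args_common_lipschitz[OF \<pi>] by metis
  obtain A where A: "0 \<le> A" "\<And>x. cmod (f x) \<le> A"
    using LipbE[OF Eqloc_Lipb[OF f]] by metis
  obtain A' where A': "0 \<le> A'" "\<And>x. cmod (g x) \<le> A'"
    using LipbE[OF Eqloc_Lipb[OF g]] by metis
  let ?\<pi> = "map (\<lambda>p. scale_fam p 1) \<pi>"
  have \<pi>': "?\<pi> \<in> args Lip k"
    using \<pi> by (auto simp: args_def intro!: Lipb_Lip[OF cont_fam_Lipb[OF scale_fam_cont_fam]])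
  have "(\<lambda>n. T (\<lambda>x. mol_fam n f 1 x * mol_fam n g 1 x) (eval_fams 1 (map (mol_fam n) \<pi>))) \<longlonglongrightarrow> T (\<lambda>x. scale_fam f 1 x * scale_fam g 1 x) ?\<pi>"
  proof (rule T_tendsto[where B = "A * A'" and C = "fam_const * C * 2"])
    show "(\<lambda>n. mol_fam n f 1 x * mol_fam n g 1 x) \<longlonglongrightarrow> scale_fam f 1 x * scale_fam g 1 x" for x
      by (intro tendsto_intros mol_fam_tendsto fL gL)
    show "cmod (mol_fam n f 1 x * mol_fam n g 1 x) \<le> A * A'" for n x
      using mol_fam_bound[OF fL A(2), of n 1 x] mol_fam_bound[OF gL A'(2), of n 1 x] A A' by (simp add: norm_mult mult_mono)
    fix j assume j: "j < k"
    have pj: "\<pi> ! j \<in> Lip"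
      using args_nth[OF \<pi> j] .
    have len: "length \<pi> = k"
      using \<pi> by (rule args_length)
    show "(\<lambda>n. (eval_fams 1 (map (mol_fam n) \<pi>) ! j) x) \<longlonglongrightarrow> (?\<pi> ! j) x" for x
      using j len mol_fam_tendsto[OF pj] by simp
    show "(fam_const * C * 2)-lipschitz_on UNIV (eval_fams 1 (map (mol_fam n) \<pi>) ! j)" for n
      using lip_fam_lipschitz[OF mol_fam_lip_fam[OF C(2)[OF j], of n], of 1] j len by simp
  next
    show "(\<lambda>x. scale_fam f 1 x * scale_fam g 1 x) \<in> Lipb"
      by (intro Lipb_mult cont_fam_Lipb scale_fam_cont_fam fL gL)
    show "(\<lambda>x. mol_fam n f 1 x * mol_fam n g 1 x) \<in> Lipb" for n
      by (intro Lipb_mult diff_fam_Lipb mol_fam_diff_fam fL gL)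
  qed (use diff_fams_args'[OF diff_fams] \<pi>' in auto)
  then have "(\<lambda>n. mol_primitive n f (g # \<pi>) + mol_primitive n g (f # \<pi>)) \<longlonglongrightarrow> T (\<lambda>x. scale_fam f 1 x * scale_fam g 1 x) ?\<pi>"
    by (simp add: eq)
  moreover have "(\<lambda>n. mol_primitive n f (g # \<pi>) + mol_primitive n g (f # \<pi>)) \<longlonglongrightarrow> primitive f (g # \<pi>) + primitive g (f # \<pi>)"
    by (intro tendsto_add primitive_tendsto f g \<pi>1)
  ultimately have "primitive f (g # \<pi>) + primitive g (f # \<pi>) = T (\<lambda>x. scale_fam f 1 x * scale_fam g 1 x) ?\<pi>"
    using LIMSEQ_unique by blast
  also have "\<dots> = T (\<lambda>x. f x * g x) ?\<pi>"
    using f g \<pi>' by (intro T_cong_first Lipb_mult cont_fam_Lipb scale_fam_cont_fam fL gL Eqloc_Lipb) (auto simp: scale_fam_def ball_retract_id scaleC_one)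
  also have "\<dots> = T (\<lambda>x. f x * g x) \<pi>"
    using \<pi> \<pi>' args_length[OF \<pi>]
    by (intro T_localize Lipb_mult Eqloc_Lipb f g) (auto simp: scale_fam_def ball_retract_id scaleC_one)
  finally show ?thesis .
qed

end

section \<open>Bidimension\<close>

lemma bounded_linear_scaleC_left: "bounded_linear (\<lambda>w. scaleC w (x::'a::complex_normed_vector))"
proof (rule bounded_linear_intro[where K = "norm x"])
  show "scaleC (c *\<^sub>R w) x = c *\<^sub>R scaleC w x" for c w
    by (simp add: scaleR_scaleC[of c "scaleC w x"] scaleC_scaleC scaleR_conv_of_real)
qed (auto simp: scaleC_add_left norm_scaleC mult.commute)

lemma bounded_linear_scaleC_right: "bounded_linear (\<lambda>x::'a::complex_normed_vector. scaleC w x)"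
proof (rule bounded_linear_intro[where K = "cmod w"])
  show "scaleC w (c *\<^sub>R x) = c *\<^sub>R scaleC w x" for c and x :: 'a
    by (simp add: scaleR_scaleC scaleC_scaleC mult.commute)
qed (auto simp: scaleC_add_right norm_scaleC mult.commute)

text \<open>A derivative L that commutes with complex scaling becomes, along w \<mapsto> w y,
  multiplication by the number L y.\<close>

lemma holo_on_line:
  assumes "holo_on V g" "scaleC \<zeta> y \<in> V"
  shows "(\<lambda>w. g (scaleC w y)) field_differentiable at \<zeta>"
proof -
  obtain L where L: "(g has_derivative L) (at (scaleC \<zeta> y))" "\<And>c v. L (scaleC c v) = c * L v"
    using assms by (auto simp: holo_on_def)
  have "((\<lambda>w. g (scaleC w y)) has_derivative (\<lambda>w. L (scaleC w y))) (at \<zeta>)"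
    by (rule has_derivative_compose[OF bounded_linear.has_derivative[OF bounded_linear_scaleC_left has_derivative_ident] L(1)])
  moreover have "(\<lambda>w. L (scaleC w y)) = (*) (L y)"
    by (rule ext) (simp add: L(2) mult.commute)
  ultimately have "((\<lambda>w. g (scaleC w y)) has_field_derivative L y) (at \<zeta>)"
    unfolding has_field_derivative_def by simp
  then show ?thesis
    by (auto simp: field_differentiable_def)
qed

lemma holo_on_scale:
  assumes g: "holo_on V g" and W: "open W" "\<And>x. x \<in> W \<Longrightarrow> scaleC \<zeta> x \<in> V \<and> p x = g (scaleC \<zeta> x)"
  shows "holo_on W p"
  unfolding holo_on_def
proof
  fix x assume x: "x \<in> W"
  then obtain L where L: "(g has_derivative L) (at (scaleC \<zeta> x))" "\<And>c v. L (scaleC c v) = c * L v"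
    using g W(2)[OF x] unfolding holo_on_def by blast
  have "((\<lambda>x. g (scaleC \<zeta> x)) has_derivative (\<lambda>v. L (scaleC \<zeta> v))) (at x)"
    by (rule has_derivative_compose[OF bounded_linear.has_derivative[OF bounded_linear_scaleC_right has_derivative_ident] L(1)])
  then have "(p has_derivative (\<lambda>v. L (scaleC \<zeta> v))) (at x)"
    by (rule has_derivative_transform_within_open[OF _ W(1) x]) (simp add: W(2))
  moreover have "L (scaleC \<zeta> (scaleC c v)) = c * L (scaleC \<zeta> v)" for c v
    by (simp add: L(2) scaleC_scaleC)
  ultimately show "\<exists>L. (p has_derivative L) (at x) \<and> (\<forall>c v. L (scaleC c v) = c * L v)"
    by blast
qed

lemma line_average_primitive:
  assumes \<Phi>: "\<And>s. 0 \<le> s \<Longrightarrow> s \<le> 1 \<Longrightarrow> (\<Phi> has_field_derivative \<phi> (z + of_real (\<epsilon> * s) * e)) (at (z + of_real (\<epsilon> * s) * e))"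
    and \<epsilon>: "\<epsilon> \<noteq> 0" and e: "e \<noteq> 0"
  shows "line_average e \<epsilon> \<phi> z = (\<Phi> (z + of_real \<epsilon> * e) - \<Phi> z) / (of_real \<epsilon> * e)"
proof -
  let ?c = "of_real \<epsilon> * e"
  have "((\<lambda>s. \<phi> (z + of_real (\<epsilon> * s) * e)) has_integral (\<Phi> (z + of_real (\<epsilon> * 1) * e) / ?c - \<Phi> (z + of_real (\<epsilon> * 0) * e) / ?c)) {0..1}"
  proof (rule fundamental_theorem_of_calculus)
    fix s :: real assume "s \<in> {0..1}"
    then have "(\<Phi> has_field_derivative \<phi> (z + of_real (\<epsilon> * s) * e)) (at (z + of_real (\<epsilon> * s) * e))"
      using \<Phi> by simp
    moreover have "((\<lambda>s. z + of_real (\<epsilon> * s) * e) has_vector_derivative ?c) (at s within {0..1})"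
      by (auto intro!: derivative_eq_intros simp: scaleR_conv_of_real)
    ultimately have "((\<Phi> \<circ> (\<lambda>s. z + of_real (\<epsilon> * s) * e)) has_vector_derivative ?c * \<phi> (z + of_real (\<epsilon> * s) * e)) (at s within {0..1})"
      by (intro field_vector_diff_chain_within) (auto intro: has_field_derivative_at_within)
    then have "((\<lambda>s. \<Phi> (z + of_real (\<epsilon> * s) * e) / ?c) has_vector_derivative (?c * \<phi> (z + of_real (\<epsilon> * s) * e)) / ?c) (at s within {0..1})"
      unfolding o_def by (rule has_vector_derivative_divide)
    then show "((\<lambda>s. \<Phi> (z + of_real (\<epsilon> * s) * e) / ?c) has_vector_derivative \<phi> (z + of_real (\<epsilon> * s) * e)) (at s within {0..1})"
      using \<epsilon> e by simp
  qed simp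
  then show ?thesis
    unfolding line_average_def by (simp add: integral_unique diff_divide_distrib)
qed

text \<open>On each of the n cells the Lipschitz condition costs at most L / n^2.\<close>

lemma riemann_sum_bound:
  fixes g :: "real \<Rightarrow> complex"
  assumes L: "\<And>s t. cmod (g s - g t) \<le> L * \<bar>s - t\<bar>" and n: "0 < n"
  shows "cmod ((\<Sum>i<n. g (real i / real n) / of_nat n) - integral {0..1} g) \<le> L / real n"
proof -
  have L0: "0 \<le> L"
    using order_trans[OF norm_ge_zero L[of 1 0]] by simp
  have c: "continuous_on S g" for S
    by (rule continuous_on_subset[OF lipschitz_on_continuous_on[of L UNIV]])
       (use L L0 in \<open>auto intro!: lipschitz_onI simp: dist_norm\<close>)
  have "cmod ((\<Sum>i<m. g (real i / real n) / of_nat n) - integral {0..real m / real n} g) \<le> real m * (L / real n / real n)" if "m \<le> n" for m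
    using that
  proof (induction m)
    case (Suc m)
    let ?a = "real m / real n" and ?b = "real (Suc m) / real n"
    have ab: "0 \<le> ?a" "?a \<le> ?b" "?b - ?a = 1 / real n"
      using n by (auto simp: field_simps)
    have split: "integral {0..?b} g = integral {0..?a} g + integral {?a..?b} g"
      using ab by (intro Henstock_Kurzweil_Integration.integral_combine[symmetric] integrable_continuous_real c) auto
    have "g ?a / of_nat n - integral {?a..?b} g = - integral {?a..?b} (\<lambda>s. g s - g ?a)"
    proof -
      have "integral {?a..?b} (\<lambda>s. g s - g ?a) = integral {?a..?b} g - integral {?a..?b} (\<lambda>s. g ?a)"
        by (intro integral_diff integrable_continuous_real c) auto
      also have "integral {?a..?b} (\<lambda>s. g ?a) = g ?a / of_nat n"
        using ab n by (simp add: content_real scaleR_conv_of_real divide_inverse mult.commute)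
      finally show ?thesis by simp
    qed
    moreover have "cmod (integral {?a..?b} (\<lambda>s. g s - g ?a)) \<le> (L / real n) * (?b - ?a)"
    proof (rule integral_bound[OF ab(2)])
      show "continuous_on {?a..?b} (\<lambda>s. g s - g ?a)"
        by (intro continuous_intros c)
      fix s assume s: "s \<in> {?a..?b}"
      have "cmod (g s - g ?a) \<le> L * \<bar>s - ?a\<bar>"
        by (rule L)
      also have "\<dots> \<le> L * (1 / real n)"
        using s ab L0 by (intro mult_left_mono) auto
      finally show "cmod (g s - g ?a) \<le> L / real n" by simp
    qed
    ultimately have "cmod (g ?a / of_nat n - integral {?a..?b} g) \<le> L / real n / real n"
      using ab(3) by simp
    moreover have "(\<Sum>i<Suc m. g (real i / real n) / of_nat n) - integral {0..?b} g
        = ((\<Sum>i<m. g (real i / real n) / of_nat n) - integral {0..?a} g) + (g ?a / of_nat n - integral {?a..?b} g)"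
      unfolding split by simp
    moreover have "cmod ((\<Sum>i<m. g (real i / real n) / of_nat n) - integral {0..?a} g) \<le> real m * (L / real n / real n)"
      using Suc by simp
    ultimately have "cmod ((\<Sum>i<Suc m. g (real i / real n) / of_nat n) - integral {0..?b} g) \<le> real m * (L / real n / real n) + L / real n / real n"
      by (simp only: norm_triangle_mono)
    also have "\<dots> = real (Suc m) * (L / real n / real n)"
      by (simp add: distrib_right add_divide_distrib)
    finally show ?case .
  qed simp
  from this[of n] show ?thesis
    using n by simp
qed

context annulus_current
begin

section \<open>Holomorphic entries\<close>

lemma T_holo_arg:
  assumes "h \<in> Lipb" "\<pi> \<in> args Lip k" "j < k" "p \<in> Lip" "open W" "fsupp h \<subseteq> W" "holo_on W p"
  shows "T h (\<pi>[j := p]) = 0"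
proof -
  have "\<pi>[j := p] ! j = p"
    using assms args_length by fastforce
  moreover have "\<pi>[j := p] \<in> args Lip k"
    using assms by (intro args_update)
  ultimately show ?thesis
    using bidim assms(1,3,5,6,7) unfolding bidim_def
    by (auto intro!: exI[of _ "{j}"] exI[of _ W] dest!: spec[of _ h] spec[of _ "\<pi>[j := p]"])
qed

lemma T_sum_arg:
  fixes n :: nat
  assumes h: "h \<in> Lipb" and \<pi>: "\<pi> \<in> args Lip k" and j: "j < k" and p: "\<And>i. i < n \<Longrightarrow> p i \<in> Lip"
    and zero: "\<And>i. i < n \<Longrightarrow> T h (\<pi>[j := p i]) = 0"
  shows "(\<lambda>x. \<Sum>i<n. c * p i x) \<in> Lip \<and> T h (\<pi>[j := \<lambda>x. \<Sum>i<n. c * p i x]) = 0"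
  using p zero
proof (induction n)
  case 0
  show ?case
    using T_const_arg[OF h \<pi> j Lip_const, of UNIV] by simp
next
  case (Suc n)
  then have IH: "(\<lambda>x. \<Sum>i<n. c * p i x) \<in> Lip" "T h (\<pi>[j := \<lambda>x. \<Sum>i<n. c * p i x]) = 0" and pn: "p n \<in> Lip" "T h (\<pi>[j := p n]) = 0"
    by auto
  have eq: "(\<lambda>x. \<Sum>i<Suc n. c * p i x) = (\<lambda>x. c * p n x + (\<Sum>i<n. c * p i x))"
    by (simp add: add.commute)
  show ?case
    unfolding eq using T_lin_arg[OF h \<pi> pn(1) IH(1) j, of c] IH pn Lip_add[OF Lip_cmult[OF pn(1)] IH(1), of c] by simp
qed

text \<open>Multilinearity moves T only through finite sums, so the integral in the entry is
  replaced by Riemann sums. They keep the common Lipschitz constant and converge pointwise, so the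
  continuity of T carries the zero over to the integral.\<close>

lemma T_average_arg:
  fixes p :: "real \<Rightarrow> 'a \<Rightarrow> complex"
  assumes h: "h \<in> Lipb" and \<pi>: "\<pi> \<in> args Lip k" and j: "j < k"
    and p: "\<And>s. s \<in> {0..1} \<Longrightarrow> C-lipschitz_on UNIV (p s)" and L: "\<And>x s t. cmod (p s x - p t x) \<le> L * \<bar>s - t\<bar>"
    and 0: "\<And>s. s \<in> {0..1} \<Longrightarrow> T h (\<pi>[j := p s]) = 0" and line_average: "(\<lambda>x. integral {0..1} (\<lambda>s. p s x)) \<in> Lip"
  shows "T h (\<pi>[j := \<lambda>x. integral {0..1} (\<lambda>s. p s x)]) = 0"
proof -
  define q where "q n x = (\<Sum>i<Suc n. inverse (of_nat (Suc n)) * p (real i / real (Suc n)) x)" for n x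
  have in01: "real i / real (Suc n) \<in> {0..1}" if "i < Suc n" for i n
    using that by (auto simp: divide_le_eq)
  have q: "q n \<in> Lip" "T h (\<pi>[j := q n]) = 0" for n
    using T_sum_arg[OF h \<pi> j, of "Suc n" "\<lambda>i. p (real i / real (Suc n))" "inverse (of_nat (Suc n))"] LipI[OF p[OF in01]] 0[OF in01]
    unfolding q_def[abs_def] by blast+
  have C0: "0 \<le> C"
    using lipschitz_on_nonneg[OF p[of 0]] by simp
  have qC: "C-lipschitz_on UNIV (q n)" for n
  proof (rule lipschitz_onI)
    fix x y
    have "q n x - q n y = (\<Sum>i<Suc n. inverse (of_nat (Suc n)) * (p (real i / real (Suc n)) x - p (real i / real (Suc n)) y))"
      unfolding q_def by (simp only: sum_subtractf[symmetric] right_diff_distrib)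
    also have "cmod \<dots> \<le> (\<Sum>i<Suc n. inverse (real (Suc n)) * (C * dist x y))"
    proof (intro order_trans[OF norm_sum] sum_mono)
      fix i assume "i \<in> {..<Suc n}"
      then have "dist (p (real i / real (Suc n)) x) (p (real i / real (Suc n)) y) \<le> C * dist x y"
        using p[OF in01[of i n]] by (intro lipschitz_onD) auto
      then show "cmod (inverse (of_nat (Suc n)) * (p (real i / real (Suc n)) x - p (real i / real (Suc n)) y)) \<le> inverse (real (Suc n)) * (C * dist x y)"
        unfolding norm_mult norm_inverse norm_of_nat dist_norm by (intro mult_left_mono) auto
    qed
    also have "\<dots> = C * dist x y"
      by (simp del: of_nat_Suc)
    finally show "dist (q n x) (q n y) \<le> C * dist x y"
      by (simp add: dist_norm)
  qed (rule C0)
  have lim: "(\<lambda>n. q n x) \<longlonglongrightarrow> integral {0..1} (\<lambda>s. p s x)" for x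
  proof -
    have "(\<lambda>n. q n x - integral {0..1} (\<lambda>s. p s x)) \<longlonglongrightarrow> 0"
    proof (rule Lim_null_comparison)
      show "\<forall>\<^sub>F n in sequentially. norm (q n x - integral {0..1} (\<lambda>s. p s x)) \<le> L * (1 / real (Suc n))"
      proof (intro always_eventually allI)
        fix n
        have "q n x = (\<Sum>i<Suc n. p (real i / real (Suc n)) x / of_nat (Suc n))"
          unfolding q_def by (simp only: divide_inverse mult.commute)
        then show "norm (q n x - integral {0..1} (\<lambda>s. p s x)) \<le> L * (1 / real (Suc n))"
          using riemann_sum_bound[of "\<lambda>s. p s x" L "Suc n", OF L] by simp
      qed
      show "(\<lambda>n. L * (1 / real (Suc n))) \<longlonglongrightarrow> 0"
        by (rule tendsto_mult_right_zero[OF LIMSEQ_Suc[OF lim_1_over_n]])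
    qed
    then show ?thesis
      by (simp only: LIM_zero_iff)
  qed
  obtain C' where C': "\<And>i. i < k \<Longrightarrow> C'-lipschitz_on UNIV (\<pi> ! i)"
    using args_common_lipschitz[OF \<pi>] by metis
  obtain B where B: "\<And>x. cmod (h x) \<le> B"
    using LipbE[OF h] by metis
  have "(\<lambda>n. T h (\<pi>[j := q n])) \<longlonglongrightarrow> T h (\<pi>[j := \<lambda>x. integral {0..1} (\<lambda>s. p s x)])"
  proof (rule T_tendsto[where B = B and C = "max C C'"])
    fix i assume i: "i < k"
    have len: "length \<pi> = k"
      using \<pi> by (rule args_length)
    show "(\<lambda>n. (\<pi>[j := q n] ! i) x) \<longlonglongrightarrow> (\<pi>[j := \<lambda>x. integral {0..1} (\<lambda>s. p s x)] ! i) x" for x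
      using i j len lim by (cases "i = j") auto
    show "(max C C')-lipschitz_on UNIV (\<pi>[j := q n] ! i)" for n
      using i j len lipschitz_on_le[OF qC max.cobounded1] lipschitz_on_le[OF C' max.cobounded2] by (cases "i = j") auto
  qed (use h \<pi> q(1) line_average B in \<open>auto intro!: args_update\<close>)
  then have "(\<lambda>n. 0::complex) \<longlonglongrightarrow> T h (\<pi>[j := \<lambda>x. integral {0..1} (\<lambda>s. p s x)])"
    by (simp only: q(2))
  from LIMSEQ_unique[OF this tendsto_const] show ?thesis .
qed

text \<open>\<delta> is a uniform margin of V around the points where f is nonzero, and the averages
  move points by less than that. So \<open>dbar\<close> of the averaged entry vanishes wherever F
  does not, and in the remaining terms the entry is an average of functions holomorphic near the
  support of the first argument.\<close>

lemma mol_primitive_zero_of_holo: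
  assumes f: "f \<in> Eqloc" and \<pi>: "\<pi> \<in> args Lip (Suc k)" and i: "i < Suc k" and g: "holo_on V (\<pi> ! i)"
    and \<delta>: "0 < \<delta>" "\<And>y y'. f y \<noteq> 0 \<Longrightarrow> norm (y' - y) < \<delta> \<Longrightarrow> y' \<in> V"
    and n: "8 * eps n * (R0 + 1) < \<delta>"
  shows "mol_primitive n f \<pi> = 0"
proof -
  define g where "g = \<pi> ! i"
  define \<epsilon> where "\<epsilon> = eps n"
  define F where "F = mol_fam n f"
  define G where "G = mol_fam n g"
  have \<epsilon>: "0 < \<epsilon>" "\<epsilon> \<le> 1"
    using eps by (auto simp: \<epsilon>_def)
  have gV: "holo_on V g"
    using assms(4) by (simp add: g_def)
  have gL: "g \<in> Lip"
    unfolding g_def using args_nth[OF \<pi> i] .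
  obtain C where C: "0 \<le> C" "C-lipschitz_on UNIV g"
    using LipE[OF gL] by metis
  obtain Cf where Cf: "Cf-lipschitz_on UNIV f"
    using Eqloc_Lip[OF f] by (auto simp: Lip_def)
  note rf = scale_fam_loc_bdd_lip_fam[OF Cf] and rg = scale_fam_loc_bdd_lip_fam[OF C(2)]
  have F: "diff_fam F" and G: "diff_fam G"
    unfolding F_def G_def using f gL by (auto intro!: mol_fam_diff_fam Eqloc_Lip)
  have R1: "0 \<le> R0 + 1"
    using R0_nonneg by simp
  have F_nz: "\<exists>w. cmod w \<le> 2 * \<epsilon> \<and> f (scaleC (z + w) (ball_retract (R0 + 1) x)) \<noteq> 0" if "F z x \<noteq> 0" for z x
  proof -
    have "mollify \<epsilon> (scale_fam f) z x \<noteq> 0"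
      using that by (simp add: F_def mol_fam_def \<epsilon>_def)
    then obtain w where "cmod w \<le> 2 * \<epsilon>" "scale_fam f (z + w) x \<noteq> 0"
      by (rule mollify_nonzero[OF rf \<epsilon>])
    then show ?thesis
      by (auto simp: scale_fam_def)
  qed
  have DG: "dbar G z x = 0" if nz: "F z x \<noteq> 0" for z x
  proof -
    define y where "y = ball_retract (R0 + 1) x"
    have y: "norm y \<le> R0 + 1"
      unfolding y_def by (rule norm_ball_retract_le[OF R1])
    obtain w where w: "cmod w \<le> 2 * \<epsilon>" "f (scaleC (z + w) y) \<noteq> 0"
      using F_nz[OF nz] by (auto simp: y_def)
    \<comment> \<open>Where F is nonzero, some z + w with |w| \<le> 2 \<epsilon> scales y to a point
      where f is nonzero; any \<zeta> within 2 \<epsilon> of z is within 4 \<epsilon> of z +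
      w.\<close>
    have inV: "scaleC \<zeta> y \<in> V" if "cmod (\<zeta> - z) < 2 * \<epsilon>" for \<zeta>
    proof (rule \<delta>(2)[OF w(2)])
      have "norm (scaleC \<zeta> y - scaleC (z + w) y) = cmod ((\<zeta> - z) - w) * norm y"
        by (simp add: norm_scaleC algebra_simps flip: scaleC_diff_left)
      also have "\<dots> \<le> (4 * \<epsilon>) * (R0 + 1)"
        using w(1) that y norm_triangle_ineq4[of "\<zeta> - z" w] \<epsilon> by (intro mult_mono) auto
      also have "\<dots> \<le> 8 * \<epsilon> * (R0 + 1)"
        using \<epsilon> R1 by (intro mult_right_mono) auto
      finally show "norm (scaleC \<zeta> y - scaleC (z + w) y) < \<delta>"
        using n by (simp add: \<epsilon>_def)
    qed
    define \<phi> where "\<phi> \<zeta> = g (scaleC \<zeta> y)" for \<zeta>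
    have "\<phi> holomorphic_on ball z (2 * \<epsilon>)"
      unfolding holomorphic_on_open[OF open_ball] \<phi>_def
      using holo_on_line[OF gV inV] by (auto simp: field_differentiable_def dist_norm norm_minus_commute)
    then obtain \<Phi> where \<Phi>': "\<And>\<zeta>. \<zeta> \<in> ball z (2 * \<epsilon>) \<Longrightarrow> (\<Phi> has_field_derivative \<phi> \<zeta>) (at \<zeta> within ball z (2 * \<epsilon>))"
      using holomorphic_convex_primitive'[OF convex_ball open_ball] by metis
    have \<Phi>: "(\<Phi> has_field_derivative \<phi> \<zeta>) (at \<zeta>)" if "\<zeta> \<in> ball z (2 * \<epsilon>)" for \<zeta>
      using \<Phi>'[OF that] at_within_open[OF that open_ball] by simp
    \<comment> \<open>The square of side \<epsilon> has diagonal sqrt 2 times \<epsilon>, so it fits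
      into the disc of radius 2 \<epsilon> where the holomorphic primitive \<Phi> is
      available.\<close>
    have box: "z + of_real a + of_real b * \<i> \<in> ball z (2 * \<epsilon>)" if "0 \<le> a" "a \<le> \<epsilon>" "0 \<le> b" "b \<le> \<epsilon>" for a b
    proof -
      have "(cmod (of_real a + of_real b * \<i>))\<^sup>2 = a\<^sup>2 + b\<^sup>2"
        by (simp add: cmod_power2)
      also have "\<dots> \<le> \<epsilon>\<^sup>2 + \<epsilon>\<^sup>2"
        using that by (intro add_mono power_mono) auto
      also have "\<dots> < (2 * \<epsilon>)\<^sup>2"
        using \<epsilon> by (simp add: power2_eq_square)
      finally have "cmod (of_real a + of_real b * \<i>) < 2 * \<epsilon>"
        by (rule power2_less_imp_less) (use \<epsilon> in simp)
      moreover have "dist z (z + of_real a + of_real b * \<i>) = cmod (of_real a + of_real b * \<i>)"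
        using norm_minus_cancel[of "of_real a + of_real b * \<i>"] by (simp add: dist_norm algebra_simps)
      ultimately show ?thesis
        by simp
    qed
    have es: "0 \<le> \<epsilon> * s" "\<epsilon> * s \<le> \<epsilon>" if "0 \<le> s" "s \<le> 1" for s
      using that \<epsilon> by (auto simp: mult_left_le)
    have A1: "fam_average \<i> \<epsilon> (scale_fam g) (z + of_real a) x = (\<Phi> (z + of_real a + of_real \<epsilon> * \<i>) - \<Phi> (z + of_real a)) / (of_real \<epsilon> * \<i>)"
      if "a \<in> {0, \<epsilon>}" for a
      unfolding fam_average_def scale_fam_def y_def[symmetric] \<phi>_def[symmetric] using \<epsilon> that es
      by (intro line_average_primitive \<Phi> box) auto
    have A2: "fam_average 1 \<epsilon> (scale_fam g) (z + of_real b * \<i>) x = (\<Phi> (z + of_real b * \<i> + of_real \<epsilon> * 1) - \<Phi> (z + of_real b * \<i>)) / (of_real \<epsilon> * 1)"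
      if b: "b \<in> {0, \<epsilon>}" for b
      unfolding fam_average_def scale_fam_def y_def[symmetric] \<phi>_def[symmetric]
    proof (intro line_average_primitive \<Phi>)
      fix s :: real assume "0 \<le> s" "s \<le> 1"
      then show "z + of_real b * \<i> + of_real (\<epsilon> * s) * 1 \<in> ball z (2 * \<epsilon>)"
        using box[of "\<epsilon> * s" b] es[of s] b \<epsilon> by (auto simp: add_ac)
    qed (use \<epsilon> in auto)
    \<comment> \<open>Both brackets contain the same alternating sum of \<Phi> over the four corners
      of the square, with factors 1 / \<i> and \<i>, which cancel.\<close>
    have "dbar G z x = ((fam_average \<i> \<epsilon> (scale_fam g) (z + of_real \<epsilon>) x - fam_average \<i> \<epsilon> (scale_fam g) (z + of_real 0) x)
       + \<i> * (fam_average 1 \<epsilon> (scale_fam g) (z + of_real \<epsilon> * \<i>) x - fam_average 1 \<epsilon> (scale_fam g) (z + of_real 0 * \<i>) x)) / of_real \<epsilon>"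
      unfolding G_def mol_fam_def \<epsilon>_def[symmetric] using mollify_diff_fam(2)[OF rg \<epsilon>, of z x] by simp
    also have "\<dots> = 0"
      unfolding A1[of \<epsilon>, simplified] A1[of 0, simplified] A2[of \<epsilon>, simplified] A2[of 0, simplified]
      using \<epsilon> by (simp add: A1[of 0, simplified] A2[of 0, simplified] field_simps)
    finally show ?thesis .
  qed
  \<comment> \<open>F may be nonzero beyond radius R0 + 1, where the retraction spoils holomorphy in
    x. A cutoff to radius R0 + 1/2 leaves the value of T unchanged and keeps the support of the
    first argument inside.\<close>
  have tj: "T (\<lambda>x. F z x * dbar P z x) ((eval_fams z Qs)[j := G z]) = 0" if P: "diff_fam P" and Qs: "diff_fams Qs" and j: "j < k" for P Qs z j
  proof -
    obtain \<theta> :: "'a \<Rightarrow> complex" where \<theta>: "\<theta> \<in> Lipb" "\<And>x. norm x \<le> R0 \<Longrightarrow> \<theta> x = 1" "\<And>x. \<theta> x \<noteq> 0 \<Longrightarrow> norm x \<le> R0 + 1/2"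
      using norm_cutoff[where R = R0] by metis
    let ?h = "\<lambda>x. \<theta> x * (F z x * dbar P z x)"
    have hL: "?h \<in> Lipb"
      by (intro Lipb_mult \<theta> FDD_Lipb F P)
    have a: "eval_fams z Qs \<in> args Lip k"
      by (rule diff_fams_args'[OF Qs])
    \<comment> \<open>An open set around the support of the cut first argument on which \<zeta> x
      lies in V whenever |\<zeta> - z| \<le> 2 \<epsilon>. The margin \<delta> is halved: one half
      pays for taking the closure, the other for the change of parameter, which is where the factor
      8 in the hypothesis is used.\<close>
    define W where "W = ball 0 (R0 + 1) \<inter> (\<Union>w\<in>cball 0 (2 * \<epsilon>). \<Union>y\<in>{y. f y \<noteq> 0}. {x. norm (scaleC (z + w) x - y) < \<delta> / 2})"
    have cs: "continuous_on UNIV (\<lambda>x::'a. scaleC c x)" for c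
      using bounded_linear_scaleC_right by (rule linear_continuous_on)
    have W: "open W"
      unfolding W_def by (intro open_Int open_ball open_UN ballI open_Collect_less continuous_intros cs)
    have WV: "scaleC \<zeta> x \<in> V" if x: "x \<in> W" and \<zeta>: "cmod (\<zeta> - z) \<le> 2 * \<epsilon>" for x \<zeta>
    proof -
      obtain w y where w: "cmod w \<le> 2 * \<epsilon>" "f y \<noteq> 0" "norm (scaleC (z + w) x - y) < \<delta> / 2" and nx: "norm x < R0 + 1"
        using x by (auto simp: W_def)
      have "norm (scaleC \<zeta> x - scaleC (z + w) x) = cmod ((\<zeta> - z) - w) * norm x"
        by (simp add: norm_scaleC algebra_simps flip: scaleC_diff_left)
      also have "\<dots> \<le> (4 * \<epsilon>) * (R0 + 1)"
        using w(1) \<zeta> nx norm_triangle_ineq4[of "\<zeta> - z" w] \<epsilon> by (intro mult_mono) auto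
      also have "\<dots> < \<delta> / 2"
        using n by (simp add: \<epsilon>_def)
      finally have "norm (scaleC \<zeta> x - y) < \<delta>"
        using norm_triangle_ineq[of "scaleC \<zeta> x - scaleC (z + w) x" "scaleC (z + w) x - y"] w(3) by simp
      then show ?thesis
        by (rule \<delta>(2)[OF w(2)])
    qed
    have supp: "fsupp ?h \<subseteq> W"
    proof
      fix x assume x: "x \<in> fsupp ?h"
      have "fsupp ?h \<subseteq> cball 0 (R0 + 1/2)"
        by (rule fsupp_subset_closed) (use \<theta>(3) in auto)
      then have nx: "norm x \<le> R0 + 1/2"
        using x by auto
      \<comment> \<open>|z + w| is at most |z| + 2, so moving x by less than \<eta> moves its image
        by less than \<delta> / 2.\<close>
      define \<eta> where "\<eta> = \<delta> / 2 / (cmod z + 3)"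
      have \<eta>: "0 < \<eta>" "(cmod z + 3) * \<eta> = \<delta> / 2"
      proof -
        have nz: "0 < cmod z + 3"
          by (rule add_nonneg_pos) auto
        then show "0 < \<eta>"
          using \<delta>(1) by (simp add: \<eta>_def)
        show "(cmod z + 3) * \<eta> = \<delta> / 2"
          unfolding \<eta>_def using nz by (metis less_irrefl nonzero_mult_div_cancel_left times_divide_eq_right)
      qed
      obtain x' where x': "?h x' \<noteq> 0" "dist x' x < \<eta>"
        using x \<eta>(1) unfolding fsupp_def closure_approachable by blast
      then have "F z x' \<noteq> 0" "norm x' \<le> R0 + 1/2"
        using \<theta>(3) by auto
      moreover from this have "ball_retract (R0 + 1) x' = x'"
        by (intro ball_retract_id) auto
      ultimately obtain w where w: "cmod w \<le> 2 * \<epsilon>" "f (scaleC (z + w) x') \<noteq> 0"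
        using F_nz by fastforce
      have "norm (scaleC (z + w) x - scaleC (z + w) x') = cmod (z + w) * dist x' x"
        by (simp add: norm_scaleC dist_norm norm_minus_commute flip: scaleC_diff_right)
      also have "\<dots> \<le> (cmod z + 3) * dist x' x"
        using w(1) \<epsilon> norm_triangle_ineq[of z w] by (intro mult_right_mono) auto
      also have "\<dots> < (cmod z + 3) * \<eta>"
        using x'(2) by (intro mult_strict_left_mono) (auto intro: add_nonneg_pos)
      finally have "norm (scaleC (z + w) x - scaleC (z + w) x') < \<delta> / 2"
        using \<eta>(2) by simp
      then show "x \<in> W"
        unfolding W_def using w nx by auto
    qed
    have fm0: "T ?h ((eval_fams z Qs)[j := scale_fam g \<zeta>]) = 0" if "cmod (\<zeta> - z) \<le> 2 * \<epsilon>" for \<zeta>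
    proof (rule T_holo_arg[OF hL a j _ W supp])
      show "scale_fam g \<zeta> \<in> Lip"
        by (intro Lipb_Lip cont_fam_Lipb scale_fam_cont_fam gL)
      show "holo_on W (scale_fam g \<zeta>)"
      proof (rule holo_on_scale[OF gV W, of \<zeta>])
        fix x assume x: "x \<in> W"
        then have "norm x \<le> R0 + 1"
          by (auto simp: W_def)
        then show "scaleC \<zeta> x \<in> V \<and> scale_fam g \<zeta> x = g (scaleC \<zeta> x)"
          using WV[OF x that] by (simp add: scale_fam_def ball_retract_id)
      qed
    qed
    define Lg where "Lg = C * (R0 + 3)"
    have Lg: "lip_fam Lg (scale_fam g)" "lip_fam (2 * Lg) (fam_average \<i> \<epsilon> (scale_fam g))"
      unfolding Lg_def using loc_bdd_lip_fam_lip_fam[OF rg] loc_bdd_lip_fam_lip_fam[OF loc_bdd_lip_fam_fam_average[OF rg \<epsilon>, of \<i>]] by auto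
    have near: "cmod (\<zeta> - z) \<le> 2 * \<epsilon>" if "\<zeta> = z + of_real (\<epsilon> * s) + of_real (\<epsilon> * t) * \<i>" "s \<in> {0..1}" "t \<in> {0..1}" for \<zeta> s t
    proof -
      have "cmod (\<zeta> - z) \<le> cmod (of_real (\<epsilon> * s)) + cmod (of_real (\<epsilon> * t) * \<i>)"
        unfolding that(1) using norm_triangle_ineq[of "of_real (\<epsilon> * s)" "of_real (\<epsilon> * t) * \<i>"] by (simp add: add.assoc)
      also have "\<dots> = \<epsilon> * s + \<epsilon> * t"
        using that \<epsilon> by (simp add: norm_mult)
      also have "\<dots> \<le> 2 * \<epsilon>"
      proof -
        have "\<epsilon> * s \<le> \<epsilon>" "\<epsilon> * t \<le> \<epsilon>"
          using that(2,3) \<epsilon> by (simp_all add: mult_left_le)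
        then show ?thesis by linarith
      qed
      finally show ?thesis .
    qed
    have zz: "cmod (z + of_real (\<epsilon> * s)) \<le> cmod z + 1" if "s \<in> {0..1}" for s
      using that \<epsilon> norm_triangle_ineq[of z "of_real (\<epsilon> * s)"] mult_le_one[of \<epsilon> s] by (simp add: norm_mult)
    have zz2: "cmod (z + of_real (\<epsilon> * s) + of_real (\<epsilon> * t) * \<i>) \<le> cmod z + 2" if "s \<in> {0..1}" "t \<in> {0..1}" for s t
      using that zz[OF that(1)] \<epsilon> norm_triangle_ineq[of "z + of_real (\<epsilon> * s)" "of_real (\<epsilon> * t) * \<i>"] mult_le_one[of \<epsilon> t] by (simp add: norm_mult)
    have Lg0: "0 \<le> Lg"
      using Lg(1) by (rule lip_fam_nonneg)
    \<comment> \<open>The square average consists of two line averages, so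
      \<open>T_average_arg\<close> is applied twice: here to the inner one in direction \<i>, below
      to the outer one.\<close>
    have av0: "T ?h ((eval_fams z Qs)[j := fam_average \<i> \<epsilon> (scale_fam g) (z + of_real (\<epsilon> * s))]) = 0" if s: "s \<in> {0..1}" for s
    proof -
      have eq: "fam_average \<i> \<epsilon> (scale_fam g) (z + of_real (\<epsilon> * s)) = (\<lambda>x. integral {0..1} (\<lambda>t. scale_fam g (z + of_real (\<epsilon> * s) + of_real (\<epsilon> * t) * \<i>) x))"
        by (simp add: fam_average_def[abs_def] line_average_def)
      show ?thesis
        unfolding eq
      proof (rule T_average_arg[OF hL a j, where C = "Lg * (3 + cmod z)" and L = Lg])
        fix t :: real assume t: "t \<in> {0..1}"
        show "T ?h ((eval_fams z Qs)[j := scale_fam g (z + of_real (\<epsilon> * s) + of_real (\<epsilon> * t) * \<i>)]) = 0"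
          by (rule fm0[OF near[OF refl s t]])
        show "(Lg * (3 + cmod z))-lipschitz_on UNIV (scale_fam g (z + of_real (\<epsilon> * s) + of_real (\<epsilon> * t) * \<i>))"
          using zz2[OF s t] Lg0 by (intro lipschitz_on_le[OF lip_fam_lipschitz[OF Lg(1)]] mult_left_mono) auto
      next
        fix x and t t' :: real
        have "cmod (scale_fam g (z + of_real (\<epsilon> * s) + of_real (\<epsilon> * t) * \<i>) x - scale_fam g (z + of_real (\<epsilon> * s) + of_real (\<epsilon> * t') * \<i>) x)
          \<le> Lg * cmod ((z + of_real (\<epsilon> * s) + of_real (\<epsilon> * t) * \<i>) - (z + of_real (\<epsilon> * s) + of_real (\<epsilon> * t') * \<i>))"
          using Lg(1) unfolding lip_fam_def by blast
        also have "(z + of_real (\<epsilon> * s) + of_real (\<epsilon> * t) * \<i>) - (z + of_real (\<epsilon> * s) + of_real (\<epsilon> * t') * \<i>) = of_real (\<epsilon> * (t - t')) * \<i>"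
          by (simp add: algebra_simps)
        also have "cmod (of_real (\<epsilon> * (t - t')) * \<i>) = \<epsilon> * \<bar>t - t'\<bar>"
          unfolding norm_mult norm_of_real norm_ii using \<epsilon> by (simp add: abs_mult)
        also have "Lg * (\<epsilon> * \<bar>t - t'\<bar>) \<le> Lg * \<bar>t - t'\<bar>"
          using \<epsilon> Lg0 by (intro mult_left_mono) (auto simp: mult_left_le_one_le)
        finally show "cmod (scale_fam g (z + of_real (\<epsilon> * s) + of_real (\<epsilon> * t) * \<i>) x - scale_fam g (z + of_real (\<epsilon> * s) + of_real (\<epsilon> * t') * \<i>) x) \<le> Lg * \<bar>t - t'\<bar>" .
      next
        show "(\<lambda>x. integral {0..1} (\<lambda>t. scale_fam g (z + of_real (\<epsilon> * s) + of_real (\<epsilon> * t) * \<i>) x)) \<in> Lip"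
          unfolding eq[symmetric] using LipI[OF lip_fam_lipschitz[OF Lg(2)]] .
      qed
    qed
    have eqG: "G z = (\<lambda>x. integral {0..1} (\<lambda>s. fam_average \<i> \<epsilon> (scale_fam g) (z + of_real (\<epsilon> * s)) x))"
      by (simp add: G_def mol_fam_def mollify_def \<epsilon>_def[symmetric] fam_average_def[of 1, abs_def] line_average_def)
    have hG: "T ?h ((eval_fams z Qs)[j := G z]) = 0"
      unfolding eqG
    proof (rule T_average_arg[OF hL a j, where C = "2 * Lg * (2 + cmod z)" and L = "2 * Lg"])
      fix s :: real assume s: "s \<in> {0..1}"
      show "T ?h ((eval_fams z Qs)[j := fam_average \<i> \<epsilon> (scale_fam g) (z + of_real (\<epsilon> * s))]) = 0"
        by (rule av0[OF s])
      show "(2 * Lg * (2 + cmod z))-lipschitz_on UNIV (fam_average \<i> \<epsilon> (scale_fam g) (z + of_real (\<epsilon> * s)))"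
        using zz[OF s] Lg0 by (intro lipschitz_on_le[OF lip_fam_lipschitz[OF Lg(2)]] mult_left_mono) auto
    next
      fix x and t t' :: real
      have "cmod (fam_average \<i> \<epsilon> (scale_fam g) (z + of_real (\<epsilon> * t)) x - fam_average \<i> \<epsilon> (scale_fam g) (z + of_real (\<epsilon> * t')) x)
        \<le> 2 * Lg * cmod ((z + of_real (\<epsilon> * t)) - (z + of_real (\<epsilon> * t')))"
        using Lg(2) unfolding lip_fam_def by blast
      also have "(z + of_real (\<epsilon> * t)) - (z + of_real (\<epsilon> * t')) = of_real (\<epsilon> * (t - t'))"
        by (simp add: algebra_simps)
      also have "cmod (of_real (\<epsilon> * (t - t'))) = \<epsilon> * \<bar>t - t'\<bar>"
        unfolding norm_of_real using \<epsilon> by (simp add: abs_mult)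
      also have "2 * Lg * (\<epsilon> * \<bar>t - t'\<bar>) \<le> 2 * Lg * \<bar>t - t'\<bar>"
        using \<epsilon> Lg0 by (intro mult_left_mono) (auto simp: mult_left_le_one_le)
      finally show "cmod (fam_average \<i> \<epsilon> (scale_fam g) (z + of_real (\<epsilon> * t)) x - fam_average \<i> \<epsilon> (scale_fam g) (z + of_real (\<epsilon> * t')) x) \<le> 2 * Lg * \<bar>t - t'\<bar>" .
    next
      show "(\<lambda>x. integral {0..1} (\<lambda>s. fam_average \<i> \<epsilon> (scale_fam g) (z + of_real (\<epsilon> * s)) x)) \<in> Lip"
        unfolding eqG[symmetric] by (intro Lipb_Lip diff_fam_Lipb G)
    qed
    have "T (\<lambda>x. F z x * dbar P z x) ((eval_fams z Qs)[j := G z]) = T ?h ((eval_fams z Qs)[j := G z])"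
      using \<theta> F P a G by (intro T_cong_first FDD_Lipb hL args_update Lipb_Lip diff_fam_Lipb) auto
    then show ?thesis
      by (simp add: hG)
  qed
  obtain s Qs where s: "diff_fams Qs" "\<And>G. diff_fam G \<Longrightarrow> fam_primitive F ((map (mol_fam n) \<pi>)[i := G]) = s * slot_primitive F G Qs"
    using fam_primitive_slot[OF F map_mol_fam[OF \<pi>] G i] by metis
  have "contraction F G Qs z = 0" for z
  proof -
    have "(\<lambda>x. F z x * dbar G z x) = (\<lambda>x. 0)"
      using DG by (metis mult_eq_0_iff)
    then have "T (\<lambda>x. F z x * dbar G z x) (eval_fams z Qs) = 0"
      using T_zero[OF diff_fams_args'[OF s(1)]] by simp
    then show ?thesis
      unfolding contraction_def eval_fams_update using tj s(1) by (simp add: diff_fams_nth)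
  qed
  then have "slot_primitive F G Qs = 0"
    by (simp add: slot_primitive_def)
  moreover have "(map (mol_fam n) \<pi>)[i := G] = map (mol_fam n) \<pi>"
    using i args_length[OF \<pi>] by (simp add: G_def g_def list_update_same_conv)
  ultimately show ?thesis
    using s(2)[OF G] by (simp add: mol_primitive_def F_def)
qed

lemma primitive_zero_of_holo_uniform:
  assumes f: "f \<in> Eqloc" and \<pi>: "\<pi> \<in> args Lip (Suc k)" and i: "i < Suc k" and g: "holo_on V (\<pi> ! i)"
    and \<delta>: "0 < \<delta>" "\<And>y y'. f y \<noteq> 0 \<Longrightarrow> norm (y' - y) < \<delta> \<Longrightarrow> y' \<in> V"
  shows "primitive f \<pi> = 0"
proof -
  have "(\<lambda>n. 8 * eps n * (R0 + 1)) \<longlonglongrightarrow> 0"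
    by (intro tendsto_mult_left_zero tendsto_mult_right_zero eps)
  then have "\<forall>\<^sub>F n in sequentially. 8 * eps n * (R0 + 1) < \<delta>"
    using \<delta>(1) by (rule order_tendstoD)
  then have "\<forall>\<^sub>F n in sequentially. mol_primitive n f \<pi> = 0"
    by eventually_elim (rule mol_primitive_zero_of_holo[OF f \<pi> i g \<delta>])
  then have "(\<lambda>n. mol_primitive n f \<pi>) \<longlonglongrightarrow> 0"
    by (rule tendsto_eventually)
  from LIMSEQ_unique[OF primitive_tendsto[OF f \<pi>] this] show ?thesis .
qed

lemma weighted_mass_tendsto_zero:
  assumes P: "\<And>n. cont_fam (P n)" and A: "\<And>n z x. cmod (P n z x) \<le> A" and lim: "\<And>z x. (\<lambda>n. P n z x) \<longlonglongrightarrow> 0"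
  shows "(\<lambda>n. weighted_mass M (P n)) \<longlonglongrightarrow> 0"
proof -
  interpret l: finite_measure "kernel_measure M" by (rule finite_kernel_measure)
  have fiber_mass0: "(\<lambda>n. fiber_mass (P n) z) \<longlonglongrightarrow> 0" for z
  proof -
    have [measurable]: "P n z \<in> borel_measurable borel" for n
      using P by (intro Lip_measurable Lipb_Lip cont_fam_Lipb)
    have "(\<lambda>n. \<integral>x. cmod (P n z x) \<partial>\<nu>) \<longlonglongrightarrow> (\<integral>x. 0 \<partial>\<nu>)"
      by (rule integral_dominated_convergence[where w = "\<lambda>_. A"])
         (use A lim in \<open>auto intro!: AE_I2 tendsto_norm_zero\<close>)
    then show ?thesis
      by (simp add: fiber_mass_def)
  qed
  have nnA: "\<bar>fiber_mass (P n) z\<bar> \<le> A * measure \<nu> UNIV" for n z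
  proof -
    have "fiber_mass (P n) z \<le> (\<integral>x. A \<partial>\<nu>)"
      unfolding fiber_mass_def using P A by (intro integral_mono int_nu cont_fam_Lipb) auto
    then show ?thesis
      using fiber_mass_nonneg[of "P n" z] by (simp add: mult.commute)
  qed
  have [measurable]: "fiber_mass (P n) \<in> borel_measurable borel" for n
    using P by (intro fiber_mass_measurable)
  have "(\<lambda>n. \<integral>z. fiber_mass (P n) z \<partial>kernel_measure M) \<longlonglongrightarrow> (\<integral>z. 0 \<partial>kernel_measure M)"
    by (rule integral_dominated_convergence[where w = "\<lambda>_. A * measure \<nu> UNIV"])
       (use nnA fiber_mass0 in \<open>auto intro!: AE_I2\<close>)
  then show ?thesis
    by (simp add: weighted_mass_def)
qed

lemma Eqloc_mult:
  assumes "f \<in> Eqloc" "g \<in> Lipb"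
  shows "(\<lambda>x. f x * g x) \<in> Eqloc"
proof -
  have "(\<lambda>x. f x * g x) \<in> Lip"
    by (intro Lipb_Lip Lipb_mult Eqloc_Lipb assms)
  moreover have "bounded (fsupp (\<lambda>x. f x * g x))"
    using assms(1) by (auto simp: Eqloc_def intro: bounded_subset[OF _ fsupp_mult_subset])
  ultimately show ?thesis
    by (auto simp: Eqloc_def Lip_def)
qed

text \<open>The closed support of f may come arbitrarily close to the complement of V. The cutoffs
  \<open>c m\<close> keep it at distance 1 / m, where the uniform version applies; the remainders
  are bounded and tend to 0 pointwise, so the mass bound sends their contribution to 0.\<close>

lemma primitive_zero_of_holo:
  assumes f: "f \<in> Eqloc" and \<pi>: "\<pi> \<in> args Lip (Suc k)" and i: "i < Suc k"
    and V: "open V" "fsupp f \<subseteq> V" and g: "holo_on V (\<pi> ! i)"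
  shows "primitive f \<pi> = 0"
\<comment> \<open>\<open>infdist\<close> to the empty set is 0, so for an empty complement the
  cutoffs below would all vanish.\<close>
proof (cases "V = UNIV")
  case True
  then show ?thesis
    using primitive_zero_of_holo_uniform[OF f \<pi> i g, of 1] by simp
next
  case False
  define c where "c m x = complex_of_real (max 0 (min 1 (real m * infdist x (- V) - 1)))" for m and x :: 'a
  have fam_const: "c m \<in> Lipb" for m
    unfolding c_def
  proof (rule Lipb_of_real[of "real m" _ 1])
    show "(real m)-lipschitz_on UNIV (\<lambda>x. max 0 (min 1 (real m * infdist x (- V) - 1)))"
    proof (rule lipschitz_onI)
      fix x y :: 'a
      have "dist (max 0 (min 1 (real m * infdist x (- V) - 1))) (max 0 (min 1 (real m * infdist y (- V) - 1)))
          \<le> \<bar>real m * infdist x (- V) - real m * infdist y (- V)\<bar>"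
        unfolding dist_real_def by linarith
      also have "\<dots> = real m * \<bar>infdist x (- V) - infdist y (- V)\<bar>"
        by (simp add: abs_mult flip: right_diff_distrib)
      also have "\<dots> \<le> real m * dist x y"
        by (intro mult_left_mono infdist_triangle_abs) auto
      finally show "dist (max 0 (min 1 (real m * infdist x (- V) - 1))) (max 0 (min 1 (real m * infdist y (- V) - 1))) \<le> real m * dist x y" .
    qed simp
  qed auto
  have c1: "cmod (c m x) \<le> 1" "cmod (c m x - 1) \<le> 1" for m x
  proof -
    let ?t = "max 0 (min 1 (real m * infdist x (- V) - 1))"
    have "cmod (complex_of_real ?t) = \<bar>?t\<bar>" "cmod (complex_of_real (?t - 1)) = \<bar>?t - 1\<bar>"
      by (rule norm_of_real)+
    then show "cmod (c m x) \<le> 1" "cmod (c m x - 1) \<le> 1"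
      unfolding c_def by auto
  qed
  have zero: "primitive (\<lambda>x. f x * c m x) \<pi> = 0" for m
  proof (cases "m = 0")
    case True
    then show ?thesis
      by (intro primitive_zero_of_holo_uniform[OF Eqloc_mult[OF f fam_const] \<pi> i g, of 1]) (auto simp: c_def)
  next
    case False
    show ?thesis
    proof (rule primitive_zero_of_holo_uniform[OF Eqloc_mult[OF f fam_const] \<pi> i g, of "1 / real m"])
      fix y y' :: 'a assume y: "f y * c m y \<noteq> 0" and y': "norm (y' - y) < 1 / real m"
      from y have "1 / real m < infdist y (- V)"
        using False by (auto simp: c_def max_def min_def field_simps split: if_splits)
      show "y' \<in> V"
      proof (rule ccontr)
        assume "y' \<notin> V"
        then have "infdist y (- V) \<le> dist y y'"
          by (intro infdist_le) auto
        with y' \<open>1 / real m < infdist y (- V)\<close> show False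
          by (simp add: dist_norm norm_minus_commute)
      qed
    qed (use False in simp)
  qed
  obtain C R where R: "0 < R" "fsupp f \<subseteq> ball 0 R"
    using EqlocE[OF f] by metis
  obtain A where A: "0 \<le> A" "\<And>x. cmod (f x) \<le> A"
    using LipbE[OF Eqloc_Lipb[OF f]] by metis
  obtain L where L: "\<And>j. j < Suc k \<Longrightarrow> L-lipschitz_on UNIV (\<pi> ! j)"
    using args_common_lipschitz[OF \<pi>] by metis
  define h where "h m x = f x * (c m x - 1)" for m x
  have hE: "h m \<in> Eqloc" for m
    unfolding h_def by (intro Eqloc_mult f Lipb_diff fam_const Lipb_const)
  have eq: "primitive f \<pi> = - primitive (h m) \<pi>" for m
  proof -
    have "(\<lambda>x. f x * c m x) = (\<lambda>x. 1 * h m x + f x)"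
      by (simp add: h_def algebra_simps)
    then have "primitive (\<lambda>x. f x * c m x) \<pi> = primitive (h m) \<pi> + primitive f \<pi>"
      using primitive_lin_first[OF hE f \<pi>, of 1 m] by simp
    then show ?thesis
      using zero[of m] by (simp add: eq_neg_iff_add_eq_0 add.commute)
  qed
  let ?M = "R / r + 2"
  have II0: "(\<lambda>m. weighted_mass ?M (scale_fam (h m))) \<longlonglongrightarrow> 0"
  proof (rule weighted_mass_tendsto_zero)
    show "cont_fam (scale_fam (h m))" for m
      by (intro scale_fam_cont_fam Eqloc_Lip hE)
    show "cmod (scale_fam (h m) z x) \<le> A" for m z x
      unfolding scale_fam_def h_def norm_mult using A(2)[of "scaleC z (ball_retract (R0 + 1) x)"] c1(2)[of m "scaleC z (ball_retract (R0 + 1) x)"] A(1)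
      by (metis mult.right_neutral mult_mono norm_ge_zero)
    have "(\<lambda>m. h m y) \<longlonglongrightarrow> 0" for y
    proof (cases "y \<in> V")
      case False
      then have "f y = 0"
        using V(2) by (intro fsupp_zero) auto
      then show ?thesis
        by (simp add: h_def)
    next
      case True
      then have d: "0 < infdist y (- V)"
        using V(1) \<open>V \<noteq> UNIV\<close> by (intro infdist_pos_not_in_closed) auto
      have "\<forall>\<^sub>F m in sequentially. 2 / infdist y (- V) \<le> real m"
        by (metis eventually_at_top_linorder filterlim_at_top filterlim_real_sequentially)
      then have "\<forall>\<^sub>F m in sequentially. h m y = 0"
      proof eventually_elim
        case (elim m)
        then have "2 \<le> real m * infdist y (- V)"
          using d by (simp add: divide_le_eq)
        then show ?case
          by (simp add: h_def c_def min_def max_def)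
      qed
      then show ?thesis
        by (rule tendsto_eventually)
    qed
    then show "(\<lambda>m. scale_fam (h m) z x) \<longlonglongrightarrow> 0" for z x
      by (simp add: scale_fam_def)
  qed
  have "cmod (primitive f \<pi>) \<le> mass_const ?M * fam_const ^ Suc k * (\<Prod>j<Suc k. L) * weighted_mass ?M (scale_fam (h m))" for m
    unfolding eq[of m] norm_minus_cancel
    by (rule primitive_bound[OF hE R(1) _ \<pi> L]) (use R(2) fsupp_mult_subset[of f "\<lambda>x. c m x - 1"] in \<open>auto simp: h_def[abs_def]\<close>)
  moreover have "(\<lambda>m. mass_const ?M * fam_const ^ Suc k * (\<Prod>j<Suc k. L) * weighted_mass ?M (scale_fam (h m))) \<longlonglongrightarrow> 0"
    by (rule tendsto_mult_right_zero[OF II0])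
  ultimately have "cmod (primitive f \<pi>) \<le> 0"
    by (intro LIMSEQ_le_const) auto
  then show ?thesis by simp
qed

end

section \<open>The quasi-local current\<close>

text \<open>In a metric space a proper open set is the increasing union of the closed sets of points
  at distance at least 1 / n from its complement. This starts an induction over the Borel
  sets.\<close>

lemma closed_open_regular:
  fixes M :: "'a::metric_space measure"
  assumes "finite_measure M" and s: "sets M = sets borel" and A: "A \<in> sets borel"
  shows "\<forall>e>0. \<exists>C U. closed C \<and> open U \<and> C \<subseteq> A \<and> A \<subseteq> U \<and> measure M (U - C) \<le> e"
proof -
  interpret finite_measure M by fact
  have "A \<in> sigma_sets UNIV {S. open S}"
    using A by (simp add: borel_def)
  then show ?thesis
  proof (induct rule: sigma_sets.induct)
    case (Basic a)
    then have a: "open a" by simp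
    show ?case
    proof (intro allI impI)
      fix e :: real assume e: "0 < e"
      show "\<exists>C U. closed C \<and> open U \<and> C \<subseteq> a \<and> a \<subseteq> U \<and> measure M (U - C) \<le> e"
      proof (cases "a = UNIV")
        case True
        then show ?thesis
          using e by (intro exI[of _ UNIV]) auto
      next
        case False
        define C where "C n = {x. 1 / real (Suc n) \<le> infdist x (- a)}" for n
        have cl: "closed (C n)" for n
          unfolding C_def by (intro closed_Collect_le continuous_intros)
        have sub: "C n \<subseteq> a" for n
        proof
          fix x assume "x \<in> C n"
          then have "0 < infdist x (- a)"
            unfolding C_def by (auto intro: less_le_trans[of 0 "1 / real (Suc n)"])
          then show "x \<in> a"
            by (metis ComplI infdist_zero less_irrefl)
        qed
        have "(\<lambda>n. measure M (a - C n)) \<longlonglongrightarrow> measure M (\<Inter>n. a - C n)"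
        proof (rule finite_Lim_measure_decseq)
          show "range (\<lambda>n. a - C n) \<subseteq> sets M"
            using a cl s by auto
          have "C m \<subseteq> C n" if "m \<le> n" for m n
          proof
            fix x assume "x \<in> C m"
            moreover have "1 / real (Suc n) \<le> 1 / real (Suc m)"
              using that by (intro divide_left_mono) auto
            ultimately show "x \<in> C n"
              by (auto simp: C_def)
          qed
          then show "decseq (\<lambda>n. a - C n)"
            by (auto simp: decseq_def)
        qed
        also have "(\<Inter>n. a - C n) = {}"
        proof -
          have "\<exists>n. x \<in> C n" if "x \<in> a" for x
          proof -
            have "0 < infdist x (- a)"
              using a that False by (intro infdist_pos_not_in_closed) auto
            then obtain n where "inverse (real (Suc n)) < infdist x (- a)"
              using reals_Archimedean by blast
            then show ?thesis
              by (auto simp: C_def inverse_eq_divide intro!: exI[of _ n])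
          qed
          then show ?thesis by auto
        qed
        finally have "(\<lambda>n. measure M (a - C n)) \<longlonglongrightarrow> 0"
          by simp
        then have "\<forall>\<^sub>F n in sequentially. measure M (a - C n) < e"
          using e by (rule order_tendstoD)
        then obtain n where "measure M (a - C n) < e"
          by (auto simp: eventually_sequentially)
        then show ?thesis
          using a cl sub by (intro exI[of _ "C n"] exI[of _ a]) auto
      qed
    qed
  next
    case Empty
    show ?case
      by (intro allI impI exI[of _ "{}"]) auto
  next
    case (Compl a)
    show ?case
    proof (intro allI impI)
      fix e :: real assume "0 < e"
      from Compl(2)[rule_format, OF this] obtain C U where "closed C" "open U" "C \<subseteq> a" "a \<subseteq> U" "measure M (U - C) \<le> e"
        by (elim exE conjE)
      moreover have "(UNIV - C) - (UNIV - U) = U - C"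
        by auto
      ultimately show "\<exists>C U. closed C \<and> open U \<and> C \<subseteq> UNIV - a \<and> UNIV - a \<subseteq> U \<and> measure M (U - C) \<le> e"
        by (intro exI[of _ "UNIV - U"] exI[of _ "UNIV - C"]) auto
    qed
  next
    case (Union a)
    show ?case
    proof (intro allI impI)
      fix e :: real assume e: "0 < e"
      \<comment> \<open>The errors add up to e / 2; the other half pays for truncating the union
        below.\<close>
      define d where "d i = e / 4 * (1/2) ^ i" for i :: nat
      have d: "0 < d i" for i
        using e by (simp add: d_def)
      have "\<exists>C U. closed C \<and> open U \<and> C \<subseteq> a i \<and> a i \<subseteq> U \<and> measure M (U - C) \<le> d i" for i
        by (rule Union(2)[rule_format, OF d])
      then obtain C U where CU: "\<And>i. closed (C i)" "\<And>i. open (U i)" "\<And>i. C i \<subseteq> a i" "\<And>i. a i \<subseteq> U i" "\<And>i. measure M (U i - C i) \<le> d i"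
        by metis
      have meas [simp]: "C i \<in> sets M" "U i \<in> sets M" for i
        using CU s by auto
      have "(\<lambda>i. e / 4 * (1/2) ^ i) sums (e / 4 * (1 / (1 - 1/2)))"
        by (intro sums_mult geometric_sums) simp
      then have "d sums (e / 2)"
        by (simp add: d_def[abs_def])
      then have sd: "summable d" "suminf d = e / 2"
        by (auto simp: sums_iff)
      have UN: "(\<Union>i. U i) \<in> sets M" "(\<Union>i. C i) \<in> sets M" "(\<Union>i\<le>n. C i) \<in> sets M" "(\<Union>i. U i - C i) \<in> sets M" for n :: nat
        by (intro sets.countable_UN sets.finite_UN finite_atMost sets.Diff image_subsetI meas)+
      have sm: "summable (\<lambda>i. measure M (U i - C i))"
        by (rule summable_comparison_test'[OF sd(1), of 0]) (use CU(5) in auto)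
      have "measure M ((\<Union>i. U i) - (\<Union>i. C i)) \<le> measure M (\<Union>i. U i - C i)"
        by (intro finite_measure_mono UN) auto
      also have "\<dots> \<le> (\<Sum>i. measure M (U i - C i))"
        by (intro finite_measure_subadditive_countably sm) auto
      also have "\<dots> \<le> suminf d"
        by (intro suminf_le CU(5) sm sd(1))
      finally have 1: "measure M ((\<Union>i. U i) - (\<Union>i. C i)) \<le> e / 2"
        by (simp add: sd)
      \<comment> \<open>A countable union of closed sets need not be closed, so the inner
        approximation stops at a finite stage.\<close>
      define D where "D n = (\<Union>i. C i) - (\<Union>i\<le>n. C i)" for n
      have "(\<lambda>n. measure M (D n)) \<longlonglongrightarrow> measure M (\<Inter>n. D n)"
      proof (rule finite_Lim_measure_decseq)
        show "range D \<subseteq> sets M"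
          unfolding D_def by (intro image_subsetI sets.Diff UN)
        show "decseq D"
          by (force simp: decseq_def D_def)
      qed
      also have "(\<Inter>n. D n) = {}"
        by (auto simp: D_def)
      finally have "(\<lambda>n. measure M (D n)) \<longlonglongrightarrow> 0"
        by simp
      then have "\<forall>\<^sub>F n in sequentially. measure M (D n) < e / 2"
        using e by (intro order_tendstoD) auto
      then obtain n where n: "measure M (D n) < e / 2"
        by (auto simp: eventually_sequentially)
      have "measure M ((\<Union>i. U i) - (\<Union>i\<le>n. C i)) \<le> measure M (((\<Union>i. U i) - (\<Union>i. C i)) \<union> D n)"
        unfolding D_def by (intro finite_measure_mono sets.Un sets.Diff UN) auto
      also have "\<dots> \<le> measure M ((\<Union>i. U i) - (\<Union>i. C i)) + measure M (D n)"
        unfolding D_def by (intro measure_Un_le sets.Diff UN)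
      also have "\<dots> \<le> e"
        using 1 n by simp
      finally have "measure M ((\<Union>i. U i) - (\<Union>i\<le>n. C i)) \<le> e" .
      moreover have "closed (\<Union>i\<le>n. C i)" "open (\<Union>i. U i)"
        using CU(1,2) by auto
      moreover have "(\<Union>i\<le>n. C i) \<subseteq> (\<Union>i. a i)" "(\<Union>i. a i) \<subseteq> (\<Union>i. U i)"
        using CU(3,4) by blast+
      ultimately show "\<exists>C U. closed C \<and> open U \<and> C \<subseteq> (\<Union>i. a i) \<and> (\<Union>i. a i) \<subseteq> U \<and> measure M (U - C) \<le> e"
        by blast
    qed
  qed
qed

text \<open>Closed inner approximations become compact by intersection with one compact set of
  nearly full measure. For an image measure it then remains to find such a set.\<close>

lemma finite_radon_of_tight:
  fixes M :: "'a::metric_space measure"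
  assumes fin: "finite_measure M" and s: "sets M = sets borel"
    and tight: "\<And>e. 0 < e \<Longrightarrow> \<exists>K. compact K \<and> measure M (UNIV - K) \<le> e"
  shows "finite_radon M"
proof (rule finite_radonI[OF s fin])
  interpret finite_measure M by fact
  fix A :: "'a set" and e :: real assume A: "A \<in> sets borel" and e: "0 < e"
  obtain C U where CU: "closed C" "open U" "C \<subseteq> A" "A \<subseteq> U" "measure M (U - C) \<le> e / 2"
    using closed_open_regular[OF fin s A] e by (meson half_gt_zero)
  obtain K where K: "compact K" "measure M (UNIV - K) \<le> e / 2"
    using tight[of "e / 2"] e by auto
  have T: "C \<in> sets M" "U \<in> sets M" "K \<in> sets M" "UNIV \<in> sets M"
    using CU K s by (auto intro: borel_closed compact_imp_closed)
  have "measure M (A - (C \<inter> K)) \<le> measure M ((U - C) \<union> (UNIV - K))"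
    using CU by (intro finite_measure_mono sets.Un sets.Diff T) auto
  also have "\<dots> \<le> measure M (U - C) + measure M (UNIV - K)"
    by (intro measure_Un_le sets.Diff T)
  also have "\<dots> \<le> e"
    using CU K by simp
  finally show "\<exists>K. compact K \<and> K \<subseteq> A \<and> measure M (A - K) \<le> e"
    using CU K by (intro exI[of _ "C \<inter> K"]) (auto intro: closed_Int_compact)
qed

section \<open>Scaling as a measurable map\<close>

lemma continuous_scaleC: "continuous_on UNIV (\<lambda>p. scaleC (fst p) (snd p :: 'a::complex_normed_vector))"
proof -
  have "bounded_bilinear (scaleC :: complex \<Rightarrow> 'a \<Rightarrow> 'a)"
  proof
    show "scaleC (r *\<^sub>R a) b = r *\<^sub>R scaleC a b" for r a and b :: 'a
      using bounded_linear.axioms(1)[OF bounded_linear_scaleC_left[of b]] by (rule linear_scale)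
    show "scaleC a (r *\<^sub>R b) = r *\<^sub>R scaleC a b" for r a and b :: 'a
      using bounded_linear.axioms(1)[OF bounded_linear_scaleC_right[of a]] by (rule linear_scale)
    show "\<exists>K. \<forall>a b. norm (scaleC a (b::'a)) \<le> norm a * norm b * K"
      by (intro exI[of _ 1]) (simp add: norm_scaleC)
  qed (auto simp: scaleC_add_left scaleC_add_right)
  then show ?thesis
    by (intro bounded_bilinear.continuous_on[of scaleC]) (auto intro!: continuous_intros)
qed

text \<open>The second factor need not be second countable, so the Borel sets of the product are not
  available; one second countable factor suffices to write an open set as a countable union of boxes.\<close>
lemma measurable_scaleC:
  "(\<lambda>p. scaleC (fst p) (snd p :: 'a::complex_normed_vector)) \<in> borel \<Otimes>\<^sub>M borel \<rightarrow>\<^sub>M borel"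
proof (rule borel_measurableI)
  fix S :: "'a set" assume "open S"
  define Z where "Z = (\<lambda>p. scaleC (fst p) (snd p :: 'a)) -` S"
  have Z: "open Z"
    unfolding Z_def using continuous_scaleC \<open>open S\<close> by (rule open_vimage[rotated])
  obtain B :: "complex set set" where B: "countable B" "topological_basis B"
    using ex_countable_basis by blast
  \<comment> \<open>The largest open set whose product with b lies in Z. Since b runs through a
    countable basis, the union of these boxes is countable.\<close>
  define W where "W b = \<Union>{V. open V \<and> b \<times> V \<subseteq> Z}" for b
  have W: "open (W b)" for b
    unfolding W_def by auto
  have "Z = (\<Union>b\<in>B. b \<times> W b)"
  proof
    show "(\<Union>b\<in>B. b \<times> W b) \<subseteq> Z"
      by (auto simp: W_def)
    show "Z \<subseteq> (\<Union>b\<in>B. b \<times> W b)"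
    proof
      fix p assume "p \<in> Z"
      with Z obtain a v where line_average: "open a" "open v" "p \<in> a \<times> v" "a \<times> v \<subseteq> Z"
        by (rule open_prod_elim)
      then obtain b where b: "b \<in> B" "fst p \<in> b" "b \<subseteq> a"
        using topological_basisE[OF B(2) line_average(1)] by (metis mem_Times_iff)
      have "snd p \<in> W b"
        unfolding W_def using line_average b by (intro UnionI[of v]) (auto simp: mem_Times_iff)
      then show "p \<in> (\<Union>b\<in>B. b \<times> W b)"
        using b by (auto simp: mem_Times_iff)
    qed
  qed
  moreover have "(\<Union>b\<in>B. b \<times> W b) \<in> sets (borel \<Otimes>\<^sub>M borel)"
    using B W topological_basis_open[OF B(2)] by (intro sets.countable_UN' pair_measureI) auto
  ultimately show "(\<lambda>p. scaleC (fst p) (snd p :: 'a)) -` S \<inter> space (borel \<Otimes>\<^sub>M borel) \<in> sets (borel \<Otimes>\<^sub>M borel)"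
    by (simp add: Z_def space_pair_measure)
qed

section \<open>From quasi-local functions to Lipschitz functions\<close>

definition ball_cut :: "real \<Rightarrow> ('a::real_normed_vector \<Rightarrow> complex) \<Rightarrow> 'a \<Rightarrow> complex" where
  "ball_cut R p x = p (ball_retract R x)"

lemma ball_cut_lipschitz:
  assumes p: "continuous_on UNIV p" "C-lipschitz_on (ball 0 R) p" and R: "0 < R"
  shows "(2 * C)-lipschitz_on UNIV (ball_cut R p)"
proof -
  \<comment> \<open>The retraction also takes values on the sphere, so the Lipschitz bound passes
    from the open ball to its closure by continuity.\<close>
  have "C-lipschitz_on (cball 0 R) p"
    using lipschitz_on_closure[OF p(2)] p(1) R by (simp add: continuous_on_subset)
  then have "C-lipschitz_on (ball_retract R ` UNIV) p"
    by (rule lipschitz_on_subset) (use norm_ball_retract_le[OF less_imp_le[OF R]] in auto)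
  from lipschitz_on_compose[OF ball_retract_lipschitz this] show ?thesis
    using R by (simp add: ball_cut_def[abs_def] o_def mult.commute)
qed

lemma Lipqloc_ball_cut_lipschitz:
  assumes "p \<in> Lipqloc" "0 < R"
  shows "(2 * lipc (ball 0 R) p)-lipschitz_on UNIV (ball_cut R p)"
proof -
  obtain C where "C-lipschitz_on (ball 0 R) p"
    using assms by (auto simp: Lipqloc_def)
  then show ?thesis
    using assms by (intro ball_cut_lipschitz lipschitz_on_lipc[of C]) (auto simp: Lipqloc_def)
qed

lemma ball_cut_Lip: "p \<in> Lipqloc \<Longrightarrow> 0 < R \<Longrightarrow> ball_cut R p \<in> Lip"
  by (rule LipI[OF Lipqloc_ball_cut_lipschitz])

lemma ball_cut_eq: "norm x \<le> R \<Longrightarrow> ball_cut R p x = p x"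
  by (simp add: ball_cut_def ball_retract_id)

lemma map_ball_cut_args: "\<pi> \<in> args Lipqloc n \<Longrightarrow> 0 < R \<Longrightarrow> map (ball_cut R) \<pi> \<in> args Lip n"
  by (rule args_map) (auto intro: ball_cut_Lip)

lemma Lip_subset_Lipqloc: "Lip \<subseteq> Lipqloc"
proof
  fix p :: "'a \<Rightarrow> complex" assume p: "p \<in> Lip"
  then obtain C where "C-lipschitz_on UNIV p"
    by (auto simp: Lip_def)
  then show "p \<in> Lipqloc"
    using Lip_continuous[OF p] by (auto simp: Lipqloc_def intro: lipschitz_on_subset)
qed

lemma holo_on_const: "(\<And>x. x \<in> V \<Longrightarrow> p x = c) \<Longrightarrow> open V \<Longrightarrow> holo_on V p"
  unfolding holo_on_def
  by (intro ballI exI[of _ "\<lambda>_. 0"] conjI has_derivative_transform_within_open[OF has_derivative_const[of c]]) auto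

lemma holo_on_cong: "holo_on V p \<Longrightarrow> open W \<Longrightarrow> W \<subseteq> V \<Longrightarrow> (\<And>x. x \<in> W \<Longrightarrow> q x = p x) \<Longrightarrow> holo_on W q"
  unfolding holo_on_def
proof
  fix x assume a: "\<forall>x\<in>V. \<exists>L. (p has_derivative L) (at x) \<and> (\<forall>c v. L (scaleC c v) = c * L v)"
    "open W" "W \<subseteq> V" "\<And>x. x \<in> W \<Longrightarrow> q x = p x" "x \<in> W"
  then obtain L where L: "(p has_derivative L) (at x)" "\<forall>c v. L (scaleC c v) = c * L v"
    by blast
  have "(q has_derivative L) (at x)"
    by (rule has_derivative_transform_within_open[OF L(1) a(2,5)]) (simp add: a(4))
  with L show "\<exists>L. (q has_derivative L) (at x) \<and> (\<forall>c v. L (scaleC c v) = c * L v)"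
    by blast
qed

lemma exists_cutoff_one:
  assumes "f \<in> Eqloc"
  shows "\<exists>\<sigma>::'a::real_normed_vector \<Rightarrow> complex. \<sigma> \<in> Eqloc \<and> (\<exists>V. open V \<and> fsupp f \<subseteq> V \<and> (\<forall>x\<in>V. \<sigma> x = 1))"
proof -
  obtain R where R: "0 < R" "fsupp f \<subseteq> ball 0 R"
    using EqlocE[OF assms] by metis
  obtain \<theta> :: "'a \<Rightarrow> complex" where \<theta>: "\<theta> \<in> Lipb" "\<And>x. norm x \<le> R \<Longrightarrow> \<theta> x = 1" "fsupp \<theta> \<subseteq> cball 0 (R + 1/2)"
    using norm_cutoff[where R = R] by metis
  then have "bounded (fsupp \<theta>)"
    using bounded_cball bounded_subset by blast
  then have "\<theta> \<in> Eqloc"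
    using \<theta>(1) by (auto simp: Eqloc_def Lipb_def)
  then show ?thesis
    using R \<theta>(2) by (intro exI[of _ \<theta>] conjI exI[of _ "ball 0 R"]) auto
qed

context annulus_current
begin

text \<open>The image of the weighted product measure under \<open>(z, x) \<mapsto> z x\<close> bounds the mass of the primitive.\<close>
definition image_measure :: "real \<Rightarrow> 'a measure" where
  "image_measure M = distr (kernel_measure M \<Otimes>\<^sub>M \<nu>) borel (\<lambda>p. scaleC (fst p) (snd p))"

lemma scaleC_measurable' [measurable]: "(\<lambda>p. scaleC (fst p) (snd p)) \<in> kernel_measure M \<Otimes>\<^sub>M \<nu> \<rightarrow>\<^sub>M borel"
  using measurable_scaleC by (simp cong: measurable_cong_sets)

lemma pair_finite: "pair_sigma_finite (kernel_measure M) \<nu>" "finite_measure (kernel_measure M \<Otimes>\<^sub>M \<nu>)"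
proof -
  interpret l: finite_measure "kernel_measure M" by (rule finite_kernel_measure)
  show "pair_sigma_finite (kernel_measure M) \<nu>"
    by (intro pair_sigma_finite.intro l.sigma_finite_measure_axioms nu.sigma_finite_measure_axioms)
  show "finite_measure (kernel_measure M \<Otimes>\<^sub>M \<nu>)"
    by (intro finite_measure_pair_measure l.finite_measure_axioms nu.finite_measure_axioms)
qed

lemma finite_image_measure: "finite_measure (image_measure M)"
  unfolding image_measure_def by (intro finite_measure.finite_measure_distr pair_finite scaleC_measurable')

lemma sets_image_measure [simp, measurable_cong]: "sets (image_measure M) = sets borel"
  by (simp add: image_measure_def)

text \<open>The product measure nearly lives on a disc times a compact set, and the image of that
  under scaling is compact; so the image measure is tight.\<close>

lemma image_measure_radon: "finite_radon (image_measure M)"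
proof (rule finite_radon_of_tight[OF finite_image_measure sets_image_measure])
  interpret l: finite_measure "kernel_measure M" by (rule finite_kernel_measure)
  interpret p: finite_measure "kernel_measure M \<Otimes>\<^sub>M \<nu>" by (rule pair_finite)
  fix e :: real assume e: "0 < e"
  \<comment> \<open>The added 1 avoids a division by 0 when the kernel measure is zero.\<close>
  define d where "d = e / (measure (kernel_measure M) UNIV + 1)"
  have d: "0 < d" "measure (kernel_measure M) UNIV * d \<le> e"
    using e measure_nonneg[of "kernel_measure M" UNIV] add_nonneg_pos[of "measure (kernel_measure M) UNIV" 1]
    by (auto simp: d_def field_simps)
  obtain K where K: "compact K" "measure \<nu> (UNIV - K) \<le> d"
    using finite_radon_compact[OF radon, of UNIV d] d by auto
  let ?f = "\<lambda>p. scaleC (fst p) (snd p :: 'a)"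
  have K': "compact (?f ` (cball 0 M \<times> K))"
    using K by (intro compact_continuous_image compact_Times continuous_on_subset[OF continuous_scaleC]) auto
  have [measurable]: "K \<in> sets borel"
    using K by (auto intro: borel_closed compact_imp_closed)
  have bK': "?f ` (cball 0 M \<times> K) \<in> sets borel"
    using K' by (auto intro: borel_closed compact_imp_closed)
  have l0: "measure (kernel_measure M) (UNIV - cball 0 M) = 0"
  proof -
    have "AE z in kernel_measure M. z \<notin> UNIV - cball 0 M"
      using AE_kernel_measure[of M] by eventually_elim auto
    then show ?thesis
      by (subst (asm) AE_iff_measurable[of "UNIV - cball 0 M"]) (auto simp: measure_def)
  qed
  have "measure (image_measure M) (UNIV - ?f ` (cball 0 M \<times> K)) = measure (kernel_measure M \<Otimes>\<^sub>M \<nu>) (?f -` (UNIV - ?f ` (cball 0 M \<times> K)) \<inter> space (kernel_measure M \<Otimes>\<^sub>M \<nu>))"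
    unfolding image_measure_def using bK' by (intro measure_distr) auto
  also have "\<dots> \<le> measure (kernel_measure M \<Otimes>\<^sub>M \<nu>) (((UNIV - cball 0 M) \<times> UNIV) \<union> (UNIV \<times> (UNIV - K)))"
    by (intro p.finite_measure_mono) auto
  also have "\<dots> \<le> measure (kernel_measure M \<Otimes>\<^sub>M \<nu>) ((UNIV - cball 0 M) \<times> UNIV) + measure (kernel_measure M \<Otimes>\<^sub>M \<nu>) (UNIV \<times> (UNIV - K))"
    by (intro measure_Un_le) auto
  also have "\<dots> = measure (kernel_measure M) UNIV * measure \<nu> (UNIV - K)"
    using l0 by (simp add: measure_def nu.emeasure_pair_measure_Times enn2real_mult)
  also have "\<dots> \<le> e"
    using K d mult_left_mono[OF K(2), of "measure (kernel_measure M) UNIV"] by simp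
  finally show "\<exists>K. compact K \<and> measure (image_measure M) (UNIV - K) \<le> e"
    using K' by blast
qed

text \<open>Fubini's theorem, after removing the retraction \<nu>-almost everywhere on each
  fibre.\<close>

lemma weighted_mass_eq_image_measure:
  assumes f: "f \<in> Lipb"
  shows "weighted_mass M (scale_fam f) = (\<integral>x. cmod (f x) \<partial>image_measure M)"
proof -
  interpret P: pair_sigma_finite "kernel_measure M" \<nu> by (rule pair_finite)
  interpret p: finite_measure "kernel_measure M \<Otimes>\<^sub>M \<nu>" by (rule pair_finite)
  obtain B where B: "\<And>x. cmod (f x) \<le> B"
    using LipbE[OF f] by metis
  have [measurable]: "f \<in> borel_measurable borel"
    using f by (intro Lip_measurable Lipb_Lip)
  have int: "integrable (kernel_measure M \<Otimes>\<^sub>M \<nu>) (\<lambda>p. cmod (f (scaleC (fst p) (snd p))))"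
    by (rule p.integrable_const_bound[of _ B]) (use B in auto)
  have "fiber_mass (scale_fam f) z = (\<integral>x. cmod (f (scaleC z x)) \<partial>\<nu>)" for z
    unfolding fiber_mass_def
  proof (rule integral_cong_AE)
    show "AE x in \<nu>. cmod (scale_fam f z x) = cmod (f (scaleC z x))"
      using concentrated by eventually_elim (simp add: scale_fam_def ball_retract_id)
    show "(\<lambda>x. cmod (scale_fam f z x)) \<in> borel_measurable \<nu>"
      using Lip_measurable[OF Lipb_Lip[OF cont_fam_Lipb[OF scale_fam_cont_fam[OF Lipb_Lip[OF f]], of z]]] by measurable
    have "(\<lambda>x. scaleC z x) \<in> borel_measurable borel"
      by (intro borel_measurable_continuous_onI linear_continuous_on bounded_linear_scaleC_right)
    then show "(\<lambda>x. cmod (f (scaleC z x))) \<in> borel_measurable \<nu>"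
      by measurable
  qed
  then have "weighted_mass M (scale_fam f) = (\<integral>z. (\<integral>x. cmod (f (scaleC (fst (z, x)) (snd (z, x)))) \<partial>\<nu>) \<partial>kernel_measure M)"
    by (simp add: weighted_mass_def)
  also have "\<dots> = (\<integral>p. cmod (f (scaleC (fst p) (snd p))) \<partial>(kernel_measure M \<Otimes>\<^sub>M \<nu>))"
    by (rule P.integral_fst'[OF int])
  also have "\<dots> = (\<integral>x. cmod (f x) \<partial>image_measure M)"
    unfolding image_measure_def by (subst integral_distr) auto
  finally show ?thesis .
qed

text \<open>Locality is a special case of bidimension: the difference of two entries that agree on V
  is constant there, hence holomorphic, so the primitive vanishes on it.\<close>

lemma primitive_cong:
  assumes f: "f \<in> Eqloc" and \<pi>: "\<pi> \<in> args Lip (Suc k)" "\<pi>' \<in> args Lip (Suc k)"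
    and V: "open V" "fsupp f \<subseteq> V" "\<And>x i. x \<in> V \<Longrightarrow> i < Suc k \<Longrightarrow> (\<pi> ! i) x = (\<pi>' ! i) x"
  shows "primitive f \<pi> = primitive f \<pi>'"
proof -
  have "primitive f \<pi> - primitive f \<pi>' = (\<Sum>i<Suc k. primitive f ((hybrid i \<pi> \<pi>')[i := \<pi> ! i]) - primitive f ((hybrid i \<pi> \<pi>')[i := \<pi>' ! i]))"
    using \<pi> by (intro sum_hybrid) (auto simp: args_def)
  also have "\<dots> = 0"
  proof (intro sum.neutral ballI)
    fix i assume "i \<in> {..<Suc k}"
    then have i: "i < Suc k" by simp
    note h = hybrid_args[OF \<pi>, of i]
    have L: "\<pi> ! i \<in> Lip" "\<pi>' ! i \<in> Lip"
      using args_nth[OF \<pi>(1) i] args_nth[OF \<pi>(2) i] by auto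
    let ?d = "\<lambda>x. (-1) * (\<pi>' ! i) x + (\<pi> ! i) x"
    have dL: "?d \<in> Lip"
      using L by (intro Lip_add Lip_cmult)
    have "holo_on V ?d"
      using V i by (intro holo_on_const[of _ _ 0]) auto
    then have "holo_on V ((hybrid i \<pi> \<pi>')[i := ?d] ! i)"
      using i args_length[OF h] by simp
    then have "primitive f ((hybrid i \<pi> \<pi>')[i := ?d]) = 0"
      by (rule primitive_zero_of_holo[OF f args_update[OF h dL] i V(1,2)])
    then show "primitive f ((hybrid i \<pi> \<pi>')[i := \<pi> ! i]) - primitive f ((hybrid i \<pi> \<pi>')[i := \<pi>' ! i]) = 0"
      using primitive_lin_arg[OF f h L(2,1) i, of "-1"] by simp
  qed
  finally show ?thesis by simp
qed

text \<open>By locality the choice of the radius does not affect \<open>qloc_primitive\<close>.\<close>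
definition supp_radius :: "('a \<Rightarrow> complex) \<Rightarrow> real" where
  "supp_radius f = (SOME R. 0 < R \<and> fsupp f \<subseteq> ball 0 R)"

definition qloc_primitive :: "('a \<Rightarrow> complex) \<Rightarrow> ('a \<Rightarrow> complex) list \<Rightarrow> complex" where
  "qloc_primitive f \<pi> = primitive f (map (ball_cut (supp_radius f)) \<pi>)"

lemma supp_radius: "f \<in> Eqloc \<Longrightarrow> 0 < supp_radius f \<and> fsupp f \<subseteq> ball 0 (supp_radius f)"
  unfolding supp_radius_def by (rule someI_ex) (metis EqlocE)

lemma qloc_primitive_eq:
  assumes f: "f \<in> Eqloc" and \<pi>: "\<pi> \<in> args Lipqloc (Suc k)" and R: "0 < R" "fsupp f \<subseteq> ball 0 R"
  shows "qloc_primitive f \<pi> = primitive f (map (ball_cut R) \<pi>)"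
  unfolding qloc_primitive_def
proof (rule primitive_cong[OF f map_ball_cut_args[OF \<pi>] map_ball_cut_args[OF \<pi>], of _ _ "ball 0 (min R (supp_radius f))"])
  show "(map (ball_cut (supp_radius f)) \<pi> ! i) x = (map (ball_cut R) \<pi> ! i) x" if "x \<in> ball 0 (min R (supp_radius f))" "i < Suc k" for x i
    using that args_length[OF \<pi>] by (simp add: ball_cut_eq)
  show "fsupp f \<subseteq> ball 0 (min R (supp_radius f))"
    using R supp_radius[OF f] by force
qed (use R supp_radius[OF f] in auto)

lemma qloc_primitive_eq_Lip:
  assumes f: "f \<in> Eqloc" and \<pi>: "\<pi> \<in> args Lip (Suc k)"
  shows "qloc_primitive f \<pi> = primitive f \<pi>"
proof -
  have \<pi>': "\<pi> \<in> args Lipqloc (Suc k)"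
    using \<pi> args_mono[OF Lip_subset_Lipqloc] by blast
  show ?thesis
    unfolding qloc_primitive_def
  proof (rule primitive_cong[OF f map_ball_cut_args[OF \<pi>'] \<pi>, of _ "ball 0 (supp_radius f)"])
    show "(map (ball_cut (supp_radius f)) \<pi> ! i) x = (\<pi> ! i) x" if "x \<in> ball 0 (supp_radius f)" "i < Suc k" for x i
      using that args_length[OF \<pi>] by (simp add: ball_cut_eq)
  qed (use supp_radius[OF f] in auto)
qed

section \<open>The axioms of a quasi-local current\<close>

lemma qloc_primitive_multilin: "multilin Eqloc Lipqloc (Suc k) qloc_primitive"
  unfolding multilin_def
proof (intro conjI allI impI)
  fix f g :: "'a \<Rightarrow> complex" and \<pi> :: "('a \<Rightarrow> complex) list" and c
  assume f: "f \<in> Eqloc" and g: "g \<in> Eqloc" and \<pi>: "\<pi> \<in> args Lipqloc (Suc k)"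
  define R where "R = max (supp_radius f) (max (supp_radius g) (supp_radius (\<lambda>x. c * f x + g x)))"
  note fg = Eqloc_lin[OF f g, of c]
  have R: "0 < R" "fsupp f \<subseteq> ball 0 R" "fsupp g \<subseteq> ball 0 R" "fsupp (\<lambda>x. c * f x + g x) \<subseteq> ball 0 R"
    using supp_radius[OF f] supp_radius[OF g] supp_radius[OF fg] by (force simp: R_def)+
  show "qloc_primitive (\<lambda>x. c * f x + g x) \<pi> = c * qloc_primitive f \<pi> + qloc_primitive g \<pi>"
    using qloc_primitive_eq[OF f \<pi> R(1,2)] qloc_primitive_eq[OF g \<pi> R(1,3)] qloc_primitive_eq[OF fg \<pi> R(1,4)] primitive_lin_first[OF f g map_ball_cut_args[OF \<pi> R(1)]]
    by simp
next
  fix f :: "'a \<Rightarrow> complex" and \<pi> :: "('a \<Rightarrow> complex) list" and g h :: "'a \<Rightarrow> complex" and c i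
  assume f: "f \<in> Eqloc" and \<pi>: "\<pi> \<in> args Lipqloc (Suc k)" and g: "g \<in> Lipqloc" "h \<in> Lipqloc" and i: "i < Suc k"
  have R: "0 < supp_radius f"
    using supp_radius[OF f] by simp
  have "ball_cut (supp_radius f) (\<lambda>x. c * g x + h x) = (\<lambda>x. c * ball_cut (supp_radius f) g x + ball_cut (supp_radius f) h x)"
    by (simp add: ball_cut_def[abs_def])
  then show "qloc_primitive f (\<pi>[i := \<lambda>x. c * g x + h x]) = c * qloc_primitive f (\<pi>[i := g]) + qloc_primitive f (\<pi>[i := h])"
    unfolding qloc_primitive_def map_update using primitive_lin_arg[OF f map_ball_cut_args[OF \<pi> R] ball_cut_Lip[OF g(1) R] ball_cut_Lip[OF g(2) R] i, of c] by simp
qed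

lemma qloc_primitive_bidim: "bidim 0 (Suc k) Eqloc Lipqloc (Suc k) qloc_primitive"
  unfolding bidim_def
proof (intro allI impI)
  fix f :: "'a \<Rightarrow> complex" and \<pi> :: "('a \<Rightarrow> complex) list"
  assume f: "f \<in> Eqloc" and \<pi>: "\<pi> \<in> args Lipqloc (Suc k)"
    and J: "(\<exists>J V. J \<subseteq> {..<Suc k} \<and> card J = 0 + 1 \<and> open V \<and> fsupp f \<subseteq> V \<and> (\<forall>j\<in>J. holo_on V (\<pi> ! j))) \<or>
      (\<exists>J V. J \<subseteq> {..<Suc k} \<and> card J = Suc k + 1 \<and> open V \<and> fsupp f \<subseteq> V \<and> (\<forall>j\<in>J. holo_on V (\<lambda>x. cnj ((\<pi> ! j) x))))"
  \<comment> \<open>k + 2 indices do not fit into k + 1 slots, so only the alternative with a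
    holomorphic entry remains.\<close>
  have "\<not> (J \<subseteq> {..<Suc k} \<and> card J = Suc k + 1)" for J
    using card_mono[of "{..<Suc k}" J] by auto
  with J obtain J V where J: "J \<subseteq> {..<Suc k}" "card J = 1" and V: "open V" "fsupp f \<subseteq> V" "\<forall>j\<in>J. holo_on V (\<pi> ! j)"
    by auto
  then obtain i where i: "i \<in> J"
    by (metis card_1_singletonE singletonI)
  then have ik: "i < Suc k"
    using J by auto
  have R: "0 < supp_radius f" "fsupp f \<subseteq> ball 0 (supp_radius f)"
    using supp_radius[OF f] by auto
  show "qloc_primitive f \<pi> = 0"
    unfolding qloc_primitive_def
  proof (rule primitive_zero_of_holo[OF f map_ball_cut_args[OF \<pi> R(1)] ik, of "V \<inter> ball 0 (supp_radius f)"])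
    show "holo_on (V \<inter> ball 0 (supp_radius f)) (map (ball_cut (supp_radius f)) \<pi> ! i)"
    proof (rule holo_on_cong[of V "\<pi> ! i"])
      show "(map (ball_cut (supp_radius f)) \<pi> ! i) x = (\<pi> ! i) x" if "x \<in> V \<inter> ball 0 (supp_radius f)" for x
        using that ik args_length[OF \<pi>] by (simp add: ball_cut_eq)
    qed (use V i in auto)
  qed (use V R in auto)
qed

lemma qloc_primitive_locality: "locality Eqloc Lipqloc (Suc k) qloc_primitive"
  unfolding locality_def
proof (intro allI impI, elim exE conjE)
  fix f :: "'a \<Rightarrow> complex" and \<pi> :: "('a \<Rightarrow> complex) list" and j V c
  assume f: "f \<in> Eqloc" and \<pi>: "\<pi> \<in> args Lipqloc (Suc k)" and j: "j < Suc k"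
    and V: "open V" "fsupp f \<subseteq> V" "\<forall>x\<in>V. (\<pi> ! j) x = c"
  have "holo_on V (\<pi> ! j)"
    using V by (intro holo_on_const[of _ _ c]) auto
  then show "qloc_primitive f \<pi> = 0"
    using j V by (intro qloc_primitive_bidim[unfolded bidim_def, rule_format, OF f \<pi>] disjI1 exI[of _ "{j}"] exI[of _ V]) auto
qed

lemma qloc_primitive_mass: "qloc_mass (Suc k) qloc_primitive"
  unfolding qloc_mass_def
proof (intro allI impI)
  fix R :: real assume R: "0 < R"
  define M where "M = R / r + 2"
  have M: "0 \<le> M"
    using R r_pos by (simp add: M_def)
  \<comment> \<open>2^(k+1) accounts for \<open>ball_cut\<close>, which doubles each Lipschitz
    constant; the other factors are those of \<open>primitive_bound\<close>.\<close>
  define c where "c = mass_const M * fam_const ^ Suc k * 2 ^ Suc k"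
  have c: "0 \<le> c"
    unfolding c_def using mass_const_nonneg[OF M] fam_const_pos by simp
  let ?\<mu> = "density (image_measure M) (\<lambda>_. ennreal c)"
  interpret m: finite_measure "image_measure M" by (rule finite_image_measure)
  have em: "emeasure ?\<mu> A = ennreal c * emeasure (image_measure M) A" if "A \<in> sets borel" for A
    using that by (simp add: emeasure_density nn_integral_cmult_indicator)
  have sp: "space (image_measure M) = UNIV"
    by (simp add: image_measure_def)
  have fin: "finite_measure ?\<mu>"
    by (rule finite_measureI) (simp add: em sp ennreal_mult_eq_top_iff)
  have me: "measure ?\<mu> A = c * measure (image_measure M) A" if "A \<in> sets borel" for A
    using em[OF that] c by (simp add: measure_def enn2real_mult)
  have radon: "finite_radon ?\<mu>"
  proof (rule finite_radon_of_tight[OF fin])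
    fix e :: real assume e: "0 < e"
    then have "0 < e / (c + 1)"
      using c by simp
    then obtain K where K: "compact K" "measure (image_measure M) (UNIV - K) \<le> e / (c + 1)"
      using finite_radon_compact[OF image_measure_radon, of UNIV "e / (c + 1)"] by auto
    have "measure ?\<mu> (UNIV - K) = c * measure (image_measure M) (UNIV - K)"
      using K by (intro me) (auto intro: borel_closed compact_imp_closed)
    also have "\<dots> \<le> c * (e / (c + 1))"
      using K c by (intro mult_left_mono)
    also have "\<dots> \<le> e"
      using c e by (simp add: field_simps)
    finally show "\<exists>K. compact K \<and> measure ?\<mu> (UNIV - K) \<le> e"
      using K by blast
  qed simp
  show "\<exists>\<mu>. finite_radon \<mu> \<and> (\<forall>f \<pi>. f \<in> Eqloc \<longrightarrow> \<pi> \<in> args Lipqloc (Suc k) \<longrightarrow> fsupp f \<subseteq> ball 0 R \<longrightarrow>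
      cmod (qloc_primitive f \<pi>) \<le> prod_list (map (lipc (ball 0 R)) \<pi>) * (LINT x:ball 0 R|\<mu>. cmod (f x)))"
  proof (intro exI[of _ ?\<mu>] conjI allI impI radon)
    fix f :: "'a \<Rightarrow> complex" and \<pi> :: "('a \<Rightarrow> complex) list"
    assume f: "f \<in> Eqloc" and \<pi>: "\<pi> \<in> args Lipqloc (Suc k)" and supp: "fsupp f \<subseteq> ball 0 R"
    have [measurable]: "f \<in> borel_measurable borel"
      using f by (intro Lip_measurable Eqloc_Lip)
    have len: "length \<pi> = Suc k"
      using \<pi> by (rule args_length)
    have f0: "f x = 0" if "x \<notin> ball 0 R" for x
      using supp that by (intro fsupp_zero) auto
    have "(LINT x:ball 0 R|?\<mu>. cmod (f x)) = (\<integral>x. cmod (f x) \<partial>?\<mu>)"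
      unfolding set_lebesgue_integral_def
      by (intro Bochner_Integration.integral_cong) (use f0 in \<open>auto simp: indicator_def\<close>)
    also have "\<dots> = c * (\<integral>x. cmod (f x) \<partial>image_measure M)"
      using c by (subst integral_density) auto
    finally have I: "(LINT x:ball 0 R|?\<mu>. cmod (f x)) = c * weighted_mass M (scale_fam f)"
      by (simp add: weighted_mass_eq_image_measure[OF Eqloc_Lipb[OF f]])
    have "cmod (qloc_primitive f \<pi>) = cmod (primitive f (map (ball_cut R) \<pi>))"
      using qloc_primitive_eq[OF f \<pi> R supp] by simp
    also have "\<dots> \<le> mass_const M * fam_const ^ Suc k * (\<Prod>j<Suc k. 2 * lipc (ball 0 R) (\<pi> ! j)) * weighted_mass M (scale_fam f)"
      unfolding M_def
    proof (rule primitive_bound[OF f R supp map_ball_cut_args[OF \<pi> R]])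
      show "(2 * lipc (ball 0 R) (\<pi> ! j))-lipschitz_on UNIV (map (ball_cut R) \<pi> ! j)" if "j < Suc k" for j
        using Lipqloc_ball_cut_lipschitz[OF args_nth[OF \<pi> that] R] that len by simp
    qed
    also have "(\<Prod>j<Suc k. 2 * lipc (ball 0 R) (\<pi> ! j)) = 2 ^ Suc k * prod_list (map (lipc (ball 0 R)) \<pi>)"
      unfolding prod_list_nth len prod.distrib by simp
    finally show "cmod (qloc_primitive f \<pi>) \<le> prod_list (map (lipc (ball 0 R)) \<pi>) * (LINT x:ball 0 R|?\<mu>. cmod (f x))"
      unfolding I unfolding c_def by (simp add: mult_ac)
  qed
qed

text \<open>All entries are first cut off at a common radius R. A change of the first argument is
  then bounded by mass, a change of an entry by \<open>primitive_bound_slot\<close>; both bounds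
  depend on values only, which converge pointwise and boundedly.\<close>

lemma qloc_primitive_continuous: "qloc_continuous (Suc k) qloc_primitive"
  unfolding qloc_continuous_def
proof (intro allI impI)
  fix f :: "'a \<Rightarrow> complex" and \<pi> :: "('a \<Rightarrow> complex) list" and fs ps
  assume f: "f \<in> Eqloc" and \<pi>: "\<pi> \<in> args Lipqloc (Suc k)"
    and fs: "\<forall>n. fs n \<in> Eqloc" and ps: "\<forall>n. ps n \<in> args Lipqloc (Suc k)"
    and fl: "\<forall>x. (\<lambda>n. fs n x) \<longlonglongrightarrow> f x"
    and pl: "\<forall>j<Suc k. \<forall>x. (\<lambda>n. (ps n ! j) x) \<longlonglongrightarrow> (\<pi> ! j) x"
    and "\<exists>R. \<forall>n. fsupp (fs n) \<subseteq> ball 0 R"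
    and fC: "\<exists>C. \<forall>n. C-lipschitz_on UNIV (fs n)"
    and pC: "\<forall>R>0. \<exists>C. \<forall>n. \<forall>j<Suc k. C-lipschitz_on (ball 0 R) (ps n ! j)"
  then obtain R0' where R0': "\<And>n. fsupp (fs n) \<subseteq> ball 0 R0'"
    by blast
  define R where "R = max R0' (supp_radius f)"
  have R: "0 < R" "fsupp f \<subseteq> ball 0 R" "\<And>n. fsupp (fs n) \<subseteq> ball 0 R"
    using supp_radius[OF f] R0' by (force simp: R_def)+
  define M where "M = R / r + 2"
  obtain C1 where C1: "\<And>n. C1-lipschitz_on UNIV (fs n)"
    using fC by blast
  obtain C2 where C2: "\<And>n j. j < Suc k \<Longrightarrow> C2-lipschitz_on (ball 0 R) (ps n ! j)"
    using pC R(1) by blast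
  define qs where "qs n = map (ball_cut R) (ps n)" for n
  define \<rho> where "\<rho> = map (ball_cut R) \<pi>"
  have len: "length (ps n) = Suc k" "length \<pi> = Suc k" for n
    using ps \<pi> by (auto simp: args_def)
  have qs: "qs n \<in> args Lip (Suc k)" for n
    unfolding qs_def using ps R by (intro map_ball_cut_args) auto
  have \<rho>: "\<rho> \<in> args Lip (Suc k)"
    unfolding \<rho>_def using \<pi> R by (intro map_ball_cut_args) auto
  have C2': "(2 * C2)-lipschitz_on UNIV (qs n ! j)" if "j < Suc k" for n j
    using ball_cut_lipschitz[OF _ C2[OF that] R(1), of n] args_nth[OF ps[rule_format] that, of n] that len
    by (simp add: qs_def Lipqloc_def)
  have pj: "(\<lambda>n. (qs n ! j) x) \<longlonglongrightarrow> (\<rho> ! j) x" if "j < Suc k" for j x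
    using pl that len by (simp add: qs_def \<rho>_def ball_cut_def)
  obtain C3 where C3: "0 \<le> C3" "\<And>j. j < Suc k \<Longrightarrow> C3-lipschitz_on UNIV (\<rho> ! j)"
    using args_common_lipschitz[OF \<rho>] by metis
  obtain Cf where Cf: "0 \<le> Cf" "Cf-lipschitz_on UNIV f"
    using EqlocE[OF f] by metis
  define C where "C = max Cf (max (2 * C2) C3)"
  have Cle: "Cf \<le> C" "2 * C2 \<le> C" "C3 \<le> C"
    by (simp_all add: C_def)
  have CL: "C-lipschitz_on UNIV f" "\<And>j n. j < Suc k \<Longrightarrow> C-lipschitz_on UNIV (qs n ! j)" "\<And>j. j < Suc k \<Longrightarrow> C-lipschitz_on UNIV (\<rho> ! j)"
    using lipschitz_on_le[OF Cf(2) Cle(1)] lipschitz_on_le[OF C2' Cle(2)] lipschitz_on_le[OF C3(2) Cle(3)] by auto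
  have bdd: "\<exists>B. \<forall>n. cmod (u n) \<le> B" if "u \<longlonglongrightarrow> l" for u and l :: complex
    using that convergent_imp_Bseq[of u] by (auto simp: Bseq_def convergent_def)

  have 1: "(\<lambda>n. primitive (\<lambda>x. (-1) * f x + fs n x) (qs n)) \<longlonglongrightarrow> 0"
  proof (rule Lim_null_comparison)
    let ?g = "\<lambda>n x. (-1) * f x + fs n x"
    have g: "?g n \<in> Eqloc" for n
      using f fs by (intro Eqloc_lin) auto
    have gs: "fsupp (?g n) \<subseteq> ball 0 R" for n
    proof -
      have "fsupp (?g n) \<subseteq> fsupp f \<union> fsupp (fs n)"
        unfolding fsupp_def closure_Un[symmetric] by (intro closure_mono) auto
      then show ?thesis
        using R(2) R(3)[of n] by blast
    qed
    show "\<forall>\<^sub>F n in sequentially. norm (primitive (?g n) (qs n)) \<le> mass_const M * fam_const ^ Suc k * (\<Prod>j<Suc k. C) * weighted_mass M (scale_fam (?g n))"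
      unfolding M_def by (intro always_eventually allI primitive_bound[OF g R(1) gs qs CL(2)])
    obtain B where B: "\<And>n. cmod (fs n 0) \<le> B"
      using bdd fl by metis
    have C10: "0 \<le> C1"
      using lipschitz_on_nonneg[OF C1[of 0]] .
    have fsB: "cmod (fs n x) \<le> B + C1 * R" for n x
    proof (cases "x \<in> ball 0 R")
      case True
      have "cmod (fs n x) \<le> cmod (fs n 0) + cmod (fs n x - fs n 0)"
        using norm_triangle_ineq[of "fs n 0" "fs n x - fs n 0"] by simp
      also have "cmod (fs n x - fs n 0) \<le> C1 * norm x"
        using lipschitz_onD[OF C1, of x 0 n] by (simp add: dist_norm)
      also have "C1 * norm x \<le> C1 * R"
        using True C10 by (intro mult_left_mono) auto
      finally show ?thesis
        using B[of n] by simp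
    next
      case False
      then have "fs n x = 0"
        using R(3)[of n] by (intro fsupp_zero) auto
      then show ?thesis
        using order_trans[OF norm_ge_zero B] C10 R(1) by simp
    qed
    obtain A where A: "\<And>x. cmod (f x) \<le> A"
      using LipbE[OF Eqloc_Lipb[OF f]] by metis
    have "(\<lambda>n. weighted_mass M (scale_fam (?g n))) \<longlonglongrightarrow> 0"
    proof (rule weighted_mass_tendsto_zero)
      show "cont_fam (scale_fam (?g n))" for n
        by (intro scale_fam_cont_fam Eqloc_Lip g)
      show "cmod (scale_fam (?g n) z x) \<le> A + (B + C1 * R)" for n z x
        unfolding scale_fam_def using norm_triangle_ineq4[of "fs n (scaleC z (ball_retract (R0 + 1) x))" "f (scaleC z (ball_retract (R0 + 1) x))"]
          fsB[of n "scaleC z (ball_retract (R0 + 1) x)"] A[of "scaleC z (ball_retract (R0 + 1) x)"] by simp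
      show "(\<lambda>n. scale_fam (?g n) z x) \<longlonglongrightarrow> 0" for z x
        unfolding scale_fam_def using tendsto_diff[OF fl[rule_format] tendsto_const, of "scaleC z (ball_retract (R0 + 1) x)" "f (scaleC z (ball_retract (R0 + 1) x))"] by simp
    qed
    then show "(\<lambda>n. mass_const M * fam_const ^ Suc k * (\<Prod>j<Suc k. C) * weighted_mass M (scale_fam (?g n))) \<longlonglongrightarrow> 0"
      by (rule tendsto_mult_right_zero)
  qed
  have 2: "(\<lambda>n. primitive f ((hybrid i (qs n) \<rho>)[i := \<lambda>x. (-1) * (\<rho> ! i) x + (qs n ! i) x])) \<longlonglongrightarrow> 0" if i: "i < Suc k" for i
  proof (rule Lim_null_comparison)
    let ?g = "\<lambda>n x. (-1) * (\<rho> ! i) x + (qs n ! i) x"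
    have gL: "?g n \<in> Lip" for n
      using args_nth[OF \<rho> i] args_nth[OF qs i] by (intro Lip_add Lip_cmult)
    have h: "hybrid i (qs n) \<rho> \<in> args Lip (Suc k)" for n
      by (rule hybrid_args[OF qs \<rho>])
    have hC: "C-lipschitz_on UNIV (hybrid i (qs n) \<rho> ! j)" if "j < Suc k" for j n
      using that CL args_length[OF qs] args_length[OF \<rho>] by (simp add: nth_hybrid)
    show "\<forall>\<^sub>F n in sequentially. norm (primitive f ((hybrid i (qs n) \<rho>)[i := ?g n]))
      \<le> slot_const M (fam_const * C) * ((\<integral>x. cmod (scale_fam f 1 x * scale_fam (?g n) 1 x) \<partial>\<nu>) + weighted_mass M (scale_fam (?g n)))"
      unfolding M_def by (intro always_eventually allI primitive_bound_slot[OF f CL(1) R(1,2) h hC i gL])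
    obtain B where B: "\<And>n. cmod ((ps n ! i) 0) \<le> B"
      using bdd pl i by metis
    have C20: "0 \<le> C2"
      using lipschitz_on_nonneg[OF C2[OF i]] .
    have cut0: "ball_cut R p 0 = p 0" for p
      using R(1) by (intro ball_cut_eq) simp
    have cutret: "ball_cut R p x = ball_cut R p (ball_retract R x)" for p x
      using norm_ball_retract_le[of R x] R(1) by (simp add: ball_cut_def ball_retract_id)
    \<comment> \<open>The bound holds on the whole space because \<open>ball_cut\<close> only sees
      the ball of radius R, where the Lipschitz estimate from the bounded values at 0
      applies.\<close>
    have qB: "cmod ((qs n ! i) x) \<le> B + 2 * C2 * R" for n x
    proof -
      have qi: "qs n ! i = ball_cut R (ps n ! i)"
        using i len by (simp add: qs_def)
      have "cmod ((qs n ! i) (ball_retract R x)) \<le> cmod ((qs n ! i) 0) + cmod ((qs n ! i) (ball_retract R x) - (qs n ! i) 0)"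
        using norm_triangle_ineq[of "(qs n ! i) 0" "(qs n ! i) (ball_retract R x) - (qs n ! i) 0"] by simp
      also have "cmod ((qs n ! i) (ball_retract R x) - (qs n ! i) 0) \<le> 2 * C2 * norm (ball_retract R x)"
        using lipschitz_onD[OF C2'[OF i], of "ball_retract R x" 0 n] by (simp add: dist_norm)
      also have "2 * C2 * norm (ball_retract R x) \<le> 2 * C2 * R"
        using C20 R(1) by (intro mult_left_mono norm_ball_retract_le) auto
      also have "cmod ((qs n ! i) 0) \<le> B"
        using B[of n] by (simp add: qi cut0)
      finally show ?thesis
        using cutret[of "ps n ! i" x] by (simp add: qi)
    qed
    have \<rho>B: "cmod ((\<rho> ! i) x) \<le> B + 2 * C2 * R" for x
      by (rule LIMSEQ_le_const2[OF tendsto_norm[OF pj[OF i]]]) (use qB in blast)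
    define A where "A = 2 * (B + 2 * C2 * R)"
    have gA: "cmod (?g n x) \<le> A" for n x
      using norm_triangle_ineq4[of "(qs n ! i) x" "(\<rho> ! i) x"] qB[of n x] \<rho>B[of x] by (simp add: A_def)
    have A0: "0 \<le> A"
      using order_trans[OF norm_ge_zero gA[of 0 0]] .
    have glim: "(\<lambda>n. scale_fam (?g n) z x) \<longlonglongrightarrow> 0" for z x
      unfolding scale_fam_def using tendsto_diff[OF pj[OF i] tendsto_const, of "scaleC z (ball_retract (R0 + 1) x)" "(\<rho> ! i) (scaleC z (ball_retract (R0 + 1) x))"] by simp
    have "(\<lambda>n. weighted_mass M (scale_fam (?g n))) \<longlonglongrightarrow> 0"
    proof (rule weighted_mass_tendsto_zero[OF _ _ glim])
      show "cont_fam (scale_fam (?g n))" for n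
        by (intro scale_fam_cont_fam gL)
      show "cmod (scale_fam (?g n) z x) \<le> A" for n z x
        unfolding scale_fam_def by (rule gA)
    qed
    moreover have "(\<lambda>n. \<integral>x. cmod (scale_fam f 1 x * scale_fam (?g n) 1 x) \<partial>\<nu>) \<longlonglongrightarrow> (\<integral>x. 0 \<partial>\<nu>)"
    proof -
      obtain Af where Af: "0 \<le> Af" "\<And>x. cmod (f x) \<le> Af"
        using LipbE[OF Eqloc_Lipb[OF f]] by metis
      have m: "scale_fam p 1 \<in> borel_measurable borel" if "p \<in> Lip" for p
        by (rule Lip_measurable[OF Lipb_Lip[OF cont_fam_Lipb[OF scale_fam_cont_fam[OF that]]]])
      note [measurable] = m[OF Eqloc_Lip[OF f]] m[OF gL]
      show ?thesis
      proof (rule integral_dominated_convergence[where w = "\<lambda>_. Af * A"])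
        show "AE x in \<nu>. (\<lambda>n. cmod (scale_fam f 1 x * scale_fam (?g n) 1 x)) \<longlonglongrightarrow> 0"
          by (intro AE_I2 tendsto_norm_zero tendsto_mult_right_zero glim)
        show "AE x in \<nu>. norm (cmod (scale_fam f 1 x * scale_fam (?g n) 1 x)) \<le> Af * A" for n
        proof (rule AE_I2)
          fix x
          have "cmod (scale_fam f 1 x) \<le> Af" "cmod (scale_fam (?g n) 1 x) \<le> A"
            unfolding scale_fam_def by (rule Af gA)+
          then show "norm (cmod (scale_fam f 1 x * scale_fam (?g n) 1 x)) \<le> Af * A"
            using Af(1) by (simp only: norm_mult real_norm_def abs_norm_cancel abs_mult) (intro mult_mono; simp)
        qed
      qed measurable
    qed
    ultimately have "(\<lambda>n. (\<integral>x. cmod (scale_fam f 1 x * scale_fam (?g n) 1 x) \<partial>\<nu>) + weighted_mass M (scale_fam (?g n))) \<longlonglongrightarrow> (\<integral>x. 0 \<partial>\<nu>) + 0"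
      by (intro tendsto_add)
    then show "(\<lambda>n. slot_const M (fam_const * C) * ((\<integral>x. cmod (scale_fam f 1 x * scale_fam (?g n) 1 x) \<partial>\<nu>) + weighted_mass M (scale_fam (?g n)))) \<longlonglongrightarrow> 0"
      by (intro tendsto_mult_right_zero) simp
  qed
  have eq: "qloc_primitive (fs n) (ps n) = primitive (\<lambda>x. (-1) * f x + fs n x) (qs n)
     + (\<Sum>i<Suc k. primitive f ((hybrid i (qs n) \<rho>)[i := \<lambda>x. (-1) * (\<rho> ! i) x + (qs n ! i) x])) + qloc_primitive f \<pi>" for n
  proof -
    have 1: "primitive (\<lambda>x. (-1) * f x + fs n x) (qs n) = (-1) * primitive f (qs n) + primitive (fs n) (qs n)"
      by (rule primitive_lin_first[OF f fs[rule_format] qs])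
    have "primitive f (qs n) - primitive f \<rho> = (\<Sum>i<Suc k. primitive f ((hybrid i (qs n) \<rho>)[i := qs n ! i]) - primitive f ((hybrid i (qs n) \<rho>)[i := \<rho> ! i]))"
      using args_length[OF qs] args_length[OF \<rho>] by (intro sum_hybrid)
    also have "\<dots> = (\<Sum>i<Suc k. primitive f ((hybrid i (qs n) \<rho>)[i := \<lambda>x. (-1) * (\<rho> ! i) x + (qs n ! i) x]))"
    proof (rule sum.cong)
      fix i assume "i \<in> {..<Suc k}"
      then have i: "i < Suc k" by simp
      show "primitive f ((hybrid i (qs n) \<rho>)[i := qs n ! i]) - primitive f ((hybrid i (qs n) \<rho>)[i := \<rho> ! i])
        = primitive f ((hybrid i (qs n) \<rho>)[i := \<lambda>x. (-1) * (\<rho> ! i) x + (qs n ! i) x])"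
        using primitive_lin_arg[OF f hybrid_args[OF qs[of n] \<rho>, of i] args_nth[OF \<rho> i] args_nth[OF qs[of n] i] i, of "-1"] by simp
    qed simp
    finally have 2: "(\<Sum>i<Suc k. primitive f ((hybrid i (qs n) \<rho>)[i := \<lambda>x. (-1) * (\<rho> ! i) x + (qs n ! i) x])) = primitive f (qs n) - primitive f \<rho>"
      by (rule sym)
    have 3: "qloc_primitive (fs n) (ps n) = primitive (fs n) (qs n)" "qloc_primitive f \<pi> = primitive f \<rho>"
      unfolding qs_def \<rho>_def using qloc_primitive_eq[OF fs[rule_format] ps[rule_format] R(1) R(3)] qloc_primitive_eq[OF f \<pi> R(1,2)] by auto
    show ?thesis
      unfolding 1 2 3 by simp
  qed
  have "(\<lambda>n. primitive (\<lambda>x. (-1) * f x + fs n x) (qs n)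
     + (\<Sum>i<Suc k. primitive f ((hybrid i (qs n) \<rho>)[i := \<lambda>x. (-1) * (\<rho> ! i) x + (qs n ! i) x])) + qloc_primitive f \<pi>) \<longlonglongrightarrow> 0 + (\<Sum>i<Suc k. 0) + qloc_primitive f \<pi>"
    by (intro tendsto_add tendsto_sum tendsto_const 1 2) auto
  then show "(\<lambda>n. qloc_primitive (fs n) (ps n)) \<longlonglongrightarrow> qloc_primitive f \<pi>"
    by (simp only: eq[symmetric]) simp
qed

lemma qloc_primitive_boundary:
  assumes f: "f \<in> Eqloc" and \<pi>: "\<pi> \<in> args Lip k"
  shows "qloc_bd qloc_primitive f \<pi> = T f \<pi>"
proof -
  \<comment> \<open>The very choice term of \<open>qloc_bd\<close>; all that is used of it is its
    specification.\<close>
  define \<sigma> where "\<sigma> = (SOME \<sigma>. \<sigma> \<in> Eqloc \<and> (\<exists>V. open V \<and> fsupp f \<subseteq> V \<and> (\<forall>x\<in>V. \<sigma> x = 1)))"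
  have "\<sigma> \<in> Eqloc \<and> (\<exists>V. open V \<and> fsupp f \<subseteq> V \<and> (\<forall>x\<in>V. \<sigma> x = 1))"
    unfolding \<sigma>_def by (rule someI_ex[OF exists_cutoff_one[OF f]])
  then obtain V where \<sigma>: "\<sigma> \<in> Eqloc" and V: "open V" "fsupp f \<subseteq> V" "\<And>x. x \<in> V \<Longrightarrow> \<sigma> x = 1"
    by blast
  have a: "f # \<pi> \<in> args Lip (Suc k)" "\<sigma> # \<pi> \<in> args Lip (Suc k)"
    using \<pi> Eqloc_Lip[OF f] Eqloc_Lip[OF \<sigma>] by (auto simp: args_def)
  have "qloc_bd qloc_primitive f \<pi> = primitive \<sigma> (f # \<pi>)"
    unfolding qloc_bd_def \<sigma>_def[symmetric] by (rule qloc_primitive_eq_Lip[OF \<sigma> a(1)])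
  also have "\<dots> = T (\<lambda>x. \<sigma> x * f x) \<pi> - primitive f (\<sigma> # \<pi>)"
    using primitive_leibniz[OF \<sigma> f \<pi>] by (simp add: eq_diff_eq)
  \<comment> \<open>\<sigma> is constant near the support of f, hence holomorphic there.\<close>
  also have "primitive f (\<sigma> # \<pi>) = 0"
    by (rule primitive_zero_of_holo[OF f a(2) _ V(1,2), of 0]) (auto intro!: holo_on_const[of _ _ 1] V)
  also have "(\<lambda>x. \<sigma> x * f x) = f"
  proof
    fix x
    show "\<sigma> x * f x = f x"
      using V(2,3) fsupp_zero[of x f] by (cases "x \<in> fsupp f") auto
  qed
  finally show ?thesis by simp
qed

end

theorem theorem7p5:
  fixes T :: "('a::complex_banach \<Rightarrow> complex) \<Rightarrow> ('a \<Rightarrow> complex) list \<Rightarrow> complex"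
    and k :: nat
  assumes "normal_current k T"
    and "bidim 0 k Lipb Lip k T"
    and "ak_bd_zero k T"
    and "bounded (current_supp k T)"
    and "\<exists>r>0. \<forall>x\<in>current_supp k T. r \<le> norm x"
  shows "\<exists>U. qloc_current (Suc k) U \<and> bidim 0 (Suc k) Eqloc Lipqloc (Suc k) U \<and>
           (\<forall>f \<pi>. f \<in> Eqloc \<longrightarrow> \<pi> \<in> args Lip k \<longrightarrow> qloc_bd U f \<pi> = T f \<pi>)"
proof -
  have ak: "ak_current k T"
    using assms(1) by (simp add: normal_current_def)
  let ?\<nu> = "mass_measure k T"
  have mass: "ak_mass_bound k T ?\<nu>"
    by (rule mass_measure_least[OF ak])
  then have sets_\<nu> [simp]: "sets ?\<nu> = sets borel" "space ?\<nu> = UNIV"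
    using finite_radonD by (auto simp: ak_mass_bound_def)
  obtain r where r: "0 < r" "\<And>x. x \<in> current_supp k T \<Longrightarrow> r \<le> norm x"
    using assms(5) by blast
  obtain B where B: "\<And>x. x \<in> current_supp k T \<Longrightarrow> norm x \<le> B"
    using assms(4) by (auto simp: bounded_iff)
  \<comment> \<open>The complement of the annulus is open and misses the support, hence is null.
    \<open>max 0 B\<close> keeps the outer radius nonnegative even when the support is
    empty.\<close>
  define W where "W = {x::'a. norm x < r} \<union> {x. max 0 B < norm x}"
  have W: "open W" "W \<inter> current_supp k T = {}"
  proof -
    show "open W"
      unfolding W_def by (intro open_Un open_Collect_less continuous_intros)
    show "W \<inter> current_supp k T = {}"
      using r(2) B by (force simp: W_def)
  qed
  have "W \<in> null_sets ?\<nu>"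
    using mass_measure_null_outside_supp[OF ak W] W(1) by (intro null_setsI) auto
  then have "AE x in ?\<nu>. x \<notin> W"
    by (rule AE_not_in)
  then have concentrated: "AE x in ?\<nu>. r \<le> norm x \<and> norm x \<le> max 0 B"
    by eventually_elim (auto simp: W_def)
  interpret annulus_current T k ?\<nu> r "max 0 B"
    using ak mass assms(2,3) r(1) concentrated by unfold_locales (auto simp: ak_current_def)
  show ?thesis
    using qloc_primitive_multilin qloc_primitive_continuous qloc_primitive_locality qloc_primitive_mass qloc_primitive_bidim qloc_primitive_boundary
    by (intro exI[of _ qloc_primitive]) (auto simp: qloc_current_def)
qed

end
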